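(* Given a string $s$ over a constant size alphabet $\Sigma$, the context adaptive transformation $BWT_*$ (i.e., the choice of the family of alphabet orderings $\{\pi_x\}$) minimizing the number of runs in $BWT_*(s)$ can be found in $\mathcal{O}(|s|)$ time.
   Context: $s$ is assumed primitive (all cyclic rotations distinct). A context adaptive BWT: for every string $x$ an ordering (permutation) $\pi_x$ of $\Sigma$ is chosen arbitrarily and independently; the matrix $M_*(s)$ has as rows all cyclic rotations of $s$, sorted so that, for two distinct rotations whose longest common prefix is $x$, the one whose $(|x|+1)$-st symbol is smaller according to $\pi_x$ comes first; $BWT_*(s)$ is the last column of $M_*(s)$. The minimization is over all such families of orderings. A run in a string is a maximal block of consecutive equal symbols; the number of runs is the number of such blocks. Computation model: word RAM. *)

theory Defs
  imports Main "HOL-Library.Sublist" "HOL-Combinatorics.Permutations"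
begin

unbundle bit_operations_syntax

section \<open>Context adaptive Burrows-Wheeler transformations\<close>

text \<open>The alphabet is \<open>{..<\<sigma>}\<close> and strings are lists over it.\<close>

definition primitive :: "nat list \<Rightarrow> bool" where
  "primitive s \<longleftrightarrow> s \<noteq> [] \<and> inj_on (\<lambda>i. rotate i s) {..<length s}"

definition rotations :: "nat list \<Rightarrow> nat list set" where
  "rotations s = (\<lambda>i. rotate i s) ` {..<length s}"

text \<open>The ordering attached to the context \<open>x\<close> is given by the permutation \<open>\<pi> x\<close> sending each
  symbol to its rank: \<open>a\<close> is smaller than \<open>b\<close> after \<open>x\<close> iff \<open>\<pi> x a < \<pi> x b\<close>.\<close>

type_synonym orderings = "nat list \<Rightarrow> nat \<Rightarrow> nat"

definition is_orderings :: "nat \<Rightarrow> orderings \<Rightarrow> bool" where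
  "is_orderings \<sigma> \<pi> \<longleftrightarrow> (\<forall>x\<in>lists {..<\<sigma>}. \<pi> x permutes {..<\<sigma>})"

definition ctx_less :: "orderings \<Rightarrow> nat list \<Rightarrow> nat list \<Rightarrow> bool" where
  "ctx_less \<pi> u v =
    (let x = longest_common_prefix u v in \<pi> x (u ! length x) < \<pi> x (v ! length x))"

text \<open>There is exactly one such list (lemma \<open>bwt_matrix\<close> below); for primitive \<open>s\<close> it has
  \<open>length s\<close> rows.\<close>

definition bwt_matrix :: "orderings \<Rightarrow> nat list \<Rightarrow> nat list list" where
  "bwt_matrix \<pi> s =
    (THE rows. distinct rows \<and> set rows = rotations s \<and> sorted_wrt (ctx_less \<pi>) rows)"

definition bwt :: "orderings \<Rightarrow> nat list \<Rightarrow> nat list" where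
  "bwt \<pi> s = map last (bwt_matrix \<pi> s)"

text \<open>A run is identified with the pair of its first and last positions.\<close>

definition runs :: "'a list \<Rightarrow> (nat \<times> nat) set" where
  "runs xs = {(i, j). i \<le> j \<and> j < length xs \<and> (\<forall>k\<in>{i..j}. xs ! k = xs ! i) \<and>
     (i = 0 \<or> xs ! (i - 1) \<noteq> xs ! i) \<and> (Suc j = length xs \<or> xs ! Suc j \<noteq> xs ! j)}"

definition num_runs :: "'a list \<Rightarrow> nat" where
  "num_runs xs = card (runs xs)"

definition optimal_orderings :: "nat \<Rightarrow> nat list \<Rightarrow> orderings \<Rightarrow> bool" where
  "optimal_orderings \<sigma> s \<pi> \<longleftrightarrow> is_orderings \<sigma> \<pi> \<and>
    (\<forall>\<pi>'. is_orderings \<sigma> \<pi>' \<longrightarrow> num_runs (bwt \<pi> s) \<le> num_runs (bwt \<pi>' s))"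

text \<open>A family of orderings is an infinite object, so an algorithm outputs a finite list of records.
  A record \<open>(i, l, p)\<close> says that the ordering for the context occurring in the circular string \<open>s\<close>
  at position \<open>i\<close> with length \<open>l\<close> has the rank table \<open>p\<close>. Contexts without a record get the
  identity ordering. (Two distinct rotations share a prefix of length less than \<open>length s\<close>, so other
  contexts are irrelevant for the transformation of \<open>s\<close>.) The records are written one after the other,
  each of them in \<open>\<sigma> + 2\<close> words.\<close>

definition encodes_orderings :: "nat \<Rightarrow> nat list \<Rightarrow> nat list \<Rightarrow> orderings \<Rightarrow> bool" where
  "encodes_orderings \<sigma> s ys \<pi> \<longleftrightarrow> (\<exists>rs.
     ys = concat (map (\<lambda>(i, l, p). i # l # p) rs) \<and>
     (\<forall>(i, l, p)\<in>set rs. i < length s \<and> l < length s \<and>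
        p = map (\<pi> (take l (rotate i s))) [0..<\<sigma>]) \<and>
     (\<forall>x\<in>lists {..<\<sigma>}. x \<notin> (\<lambda>(i, l, p). take l (rotate i s)) ` set rs \<longrightarrow> \<pi> x = id))"


section \<open>Word RAM\<close>

text \<open>A machine with word length \<open>w\<close>: registers and memory cells hold numbers below \<open>2 ^ w\<close>, memory is
  addressed by words, and every instruction costs one unit of time. Arithmetic is modulo
  \<open>2 ^ w\<close>, and division by zero yields \<open>x div 0 = 0\<close> and \<open>x mod 0 = x\<close> as in HOL.\<close>

datatype binop = Add | Sub | Mul | Div | Mod | And | Or | Xor | Shl | Shr | Eq | Less

fun binop_val :: "nat \<Rightarrow> binop \<Rightarrow> nat \<Rightarrow> nat \<Rightarrow> nat" where
  "binop_val w Add a b = (a + b) mod 2 ^ w"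
| "binop_val w Sub a b = (a + 2 ^ w - b) mod 2 ^ w"
| "binop_val w Mul a b = (a * b) mod 2 ^ w"
| "binop_val w Div a b = a div b"
| "binop_val w Mod a b = a mod b"
| "binop_val w And a b = a AND b"
| "binop_val w Or a b = a OR b"
| "binop_val w Xor a b = a XOR b"
| "binop_val w Shl a b = push_bit b a mod 2 ^ w"
| "binop_val w Shr a b = drop_bit b a"
| "binop_val w Eq a b = of_bool (a = b) mod 2 ^ w"
| "binop_val w Less a b = of_bool (a < b) mod 2 ^ w"

text \<open>\<open>Op f r a b\<close>, \<open>Const r c\<close> and \<open>Load r a\<close> assign to register \<open>r\<close>; \<open>Store a r\<close> writes register
  \<open>r\<close> into the cell whose address is in register \<open>a\<close>; jump targets are absolute.\<close>

datatype instr =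
    Const nat nat
  | Op binop nat nat nat
  | Load nat nat
  | Store nat nat
  | Jump nat
  | JumpIfZero nat nat

record ram_state =
  pc :: nat
  reg :: "nat \<Rightarrow> nat"
  mem :: "nat \<Rightarrow> nat"

fun exec :: "nat \<Rightarrow> instr \<Rightarrow> ram_state \<Rightarrow> ram_state" where
  "exec w (Const r c) st = st\<lparr>pc := Suc (pc st), reg := (reg st)(r := c mod 2 ^ w)\<rparr>"
| "exec w (Op f r a b) st =
     st\<lparr>pc := Suc (pc st), reg := (reg st)(r := binop_val w f (reg st a) (reg st b))\<rparr>"
| "exec w (Load r a) st = st\<lparr>pc := Suc (pc st), reg := (reg st)(r := mem st (reg st a))\<rparr>"
| "exec w (Store a r) st = st\<lparr>pc := Suc (pc st), mem := (mem st)(reg st a := reg st r)\<rparr>"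
| "exec w (Jump l) st = st\<lparr>pc := l\<rparr>"
| "exec w (JumpIfZero r l) st = st\<lparr>pc := (if reg st r = 0 then l else Suc (pc st))\<rparr>"

definition halted :: "instr list \<Rightarrow> ram_state \<Rightarrow> bool" where
  "halted P st \<longleftrightarrow> length P \<le> pc st"

definition step :: "nat \<Rightarrow> instr list \<Rightarrow> ram_state \<Rightarrow> ram_state" where
  "step w P st = (if halted P st then st else exec w (P ! pc st) st)"

text \<open>A list is stored in memory preceded by its length. The input starts at address 0, the remaining
  cells and all registers are initially 0. The output starts at the address held by register 0.\<close>

definition init_state :: "nat list \<Rightarrow> ram_state" where
  "init_state xs = \<lparr>pc = 0, reg = (\<lambda>_. 0),
     mem = (\<lambda>a. if a \<le> length xs then (length xs # xs) ! a else 0)\<rparr>"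

definition output_list :: "ram_state \<Rightarrow> nat list" where
  "output_list st = (let a = reg st 0 in map (mem st) [Suc a..<Suc a + mem st a])"

definition ram_computes ::
  "nat \<Rightarrow> instr list \<Rightarrow> nat list \<Rightarrow> nat \<Rightarrow> nat list \<Rightarrow> bool" where
  "ram_computes w P xs T ys \<longleftrightarrow>
    (\<exists>t\<le>T. let st = (step w P ^^ t) (init_state xs) in halted P st \<and> output_list st = ys)"


section \<open>The sorted matrix is well defined\<close>

lemma first_mismatch:
  assumes "length u = length v" "u \<noteq> v"
  obtains k where "k < length u" "take k u = take k v" "u ! k \<noteq> v ! k"
    "longest_common_prefix u v = take k u"
proof -
  let ?x = "longest_common_prefix u v"
  obtain a where a: "u = ?x @ a" using longest_common_prefix_prefix1 prefix_def by metis
  obtain b where b: "v = ?x @ b" using longest_common_prefix_prefix2 prefix_def by metis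
  have "length a = length b" using a b assms(1) by (metis add_left_cancel length_append)
  moreover have "a \<noteq> b" using a b assms(2) by metis
  ultimately obtain c a' d b' where ab: "a = c # a'" "b = d # b'"
    by (cases a; cases b) auto
  have "c \<noteq> d"
  proof
    assume "c = d"
    hence "prefix (?x @ [c]) u" "prefix (?x @ [c]) v"
      using a b ab by (metis append_Cons append_Nil append_assoc prefixI)+
    hence "prefix (?x @ [c]) ?x" by (rule longest_common_prefix_max_prefix)
    thus False using prefix_length_le by fastforce
  qed
  moreover have "u = ?x @ c # a'" "v = ?x @ d # b'" using a b ab by simp_all
  ultimately show thesis
    using that[of "length ?x"]
    by (smt (verit) append_eq_conv_conj length_append length_Cons less_add_same_cancel1
        nth_append_length zero_less_Suc)
qed

lemma ctx_less_altdef: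
  assumes "length u = length v" "u \<noteq> v"
  shows "ctx_less \<pi> u v \<longleftrightarrow> (\<exists>k<length u. take k u = take k v \<and> u ! k \<noteq> v ! k \<and>
           \<pi> (take k u) (u ! k) < \<pi> (take k u) (v ! k))" (is "_ \<longleftrightarrow> ?R")
proof -
  obtain k where k: "k < length u" "take k u = take k v" "u ! k \<noteq> v ! k"
    "longest_common_prefix u v = take k u"
    using first_mismatch[OF assms] .
  have uniq: "i = k" if "take i u = take i v" "u ! i \<noteq> v ! i" for i
    using k(2,3) that by (metis nth_take linorder_neqE_nat)
  have eq: "ctx_less \<pi> u v \<longleftrightarrow> \<pi> (take k u) (u ! k) < \<pi> (take k u) (v ! k)"
    using k(1) by (simp add: ctx_less_def Let_def k(4))
  show ?thesis
  proof
    assume "ctx_less \<pi> u v"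
    thus ?R using k eq by blast
  next
    assume ?R
    then obtain i where i: "take i u = take i v" "u ! i \<noteq> v ! i"
      "\<pi> (take i u) (u ! i) < \<pi> (take i u) (v ! i)" by blast
    thus "ctx_less \<pi> u v" using uniq[OF i(1,2)] eq by blast
  qed
qed

lemma longest_common_prefix_commute:
  "longest_common_prefix u v = longest_common_prefix v u"
  by (induction u v rule: longest_common_prefix.induct) auto

lemma ctx_less_total:
  assumes "is_orderings \<sigma> \<pi>" "u \<in> lists {..<\<sigma>}" "v \<in> lists {..<\<sigma>}"
    and "length u = length v" "u \<noteq> v"
  shows "ctx_less \<pi> u v \<longleftrightarrow> \<not> ctx_less \<pi> v u"
proof -
  obtain k where k: "k < length u" "take k u = take k v" "u ! k \<noteq> v ! k"
    "longest_common_prefix u v = take k u"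
    using first_mismatch[OF assms(4,5)] .
  have "take k u \<in> lists {..<\<sigma>}" using assms(2) by (auto dest: in_set_takeD)
  hence "inj (\<pi> (take k u))" using assms(1) permutes_inj by (auto simp: is_orderings_def)
  hence "\<pi> (take k u) (u ! k) \<noteq> \<pi> (take k u) (v ! k)" using k(3) by (auto dest: injD)
  thus ?thesis
    using k(1) by (auto simp: ctx_less_def Let_def longest_common_prefix_commute[of v u] k(4))
qed

lemma ctx_less_trans:
  assumes "length u = length v" "length v = length x" "u \<noteq> v" "v \<noteq> x" "u \<noteq> x"
    and "ctx_less \<pi> u v" "ctx_less \<pi> v x"
  shows "ctx_less \<pi> u x"
proof -
  obtain k where k: "k < length u" "take k u = take k v"
    "\<pi> (take k u) (u ! k) < \<pi> (take k u) (v ! k)"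
    using assms ctx_less_altdef by meson
  obtain m where m: "m < length v" "take m v = take m x"
    "\<pi> (take m v) (v ! m) < \<pi> (take m v) (x ! m)"
    using assms ctx_less_altdef by meson
  define j where "j = min k m"
  have "take j u = take j v" "take j v = take j x"
    using k m by (metis j_def min.commute take_take)+
  moreover have "\<pi> (take j u) (u ! j) < \<pi> (take j u) (x ! j)"
  proof (cases k m rule: linorder_cases)
    case less
    hence "x ! k = v ! k" using m by (metis nth_take)
    thus ?thesis using less k by (simp add: j_def)
  next
    case equal
    thus ?thesis using k m by (auto simp: j_def)
  next
    case greater
    hence "u ! m = v ! m" using k by (metis nth_take)
    moreover have "take m u = take m v" using greater k by (metis min.absorb1 less_imp_le take_take)
    ultimately show ?thesis using greater m by (simp add: j_def)
  qed
  ultimately have "j < length u \<and> take j u = take j x \<and> u ! j \<noteq> x ! j \<and>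
      \<pi> (take j u) (u ! j) < \<pi> (take j u) (x ! j)"
    using k(1) by (auto simp: j_def)
  moreover have "length u = length x" using assms by simp
  ultimately show ?thesis using ctx_less_altdef[of u x] assms(5) by blast
qed

lemma sorted_wrt_ex1:
  assumes "finite A"
    and "\<And>x y. x \<in> A \<Longrightarrow> y \<in> A \<Longrightarrow> x \<noteq> y \<Longrightarrow> R x y \<longleftrightarrow> \<not> R y x"
    and "\<And>x y z. x \<in> A \<Longrightarrow> y \<in> A \<Longrightarrow> z \<in> A \<Longrightarrow> x \<noteq> y \<Longrightarrow> y \<noteq> z \<Longrightarrow> x \<noteq> z \<Longrightarrow>
           R x y \<Longrightarrow> R y z \<Longrightarrow> R x z"
  shows "\<exists>!xs. distinct xs \<and> set xs = A \<and> sorted_wrt R xs"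
  using assms
proof (induction "card A" arbitrary: A)
  case 0
  have "A = {}" using "0.hyps" "0.prems"(1) by simp
  thus ?case by (auto intro!: ex1I[of _ "[]"])
next
  case (Suc n)
  have "\<exists>m\<in>B. \<forall>x\<in>B - {m}. R m x" if "finite B" "B \<noteq> {}" "B \<subseteq> A" for B
    using that
  proof (induction B rule: finite_ne_induct)
    case (singleton x)
    thus ?case by simp
  next
    case (insert x F)
    then obtain m where m: "m \<in> F" "\<forall>y\<in>F - {m}. R m y" by auto
    have "x \<noteq> m" "x \<in> A" "m \<in> A" using m insert by auto
    show ?case
    proof (cases "R m x")
      case True
      thus ?thesis using m by blast
    next
      case False
      hence "R x m" using Suc.prems(2)[of m x] \<open>x \<noteq> m\<close> \<open>x \<in> A\<close> \<open>m \<in> A\<close> by simp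
      moreover have "R x y" if "y \<in> F" "y \<noteq> m" for y
        using Suc.prems(3)[of x m y] calculation that m insert \<open>x \<noteq> m\<close> by auto
      ultimately show ?thesis by blast
    qed
  qed
  moreover have "A \<noteq> {}" using Suc.hyps(2) by auto
  ultimately obtain m where m: "m \<in> A" "\<forall>x\<in>A - {m}. R m x" using Suc.prems(1) by blast
  have "\<exists>!xs. distinct xs \<and> set xs = A - {m} \<and> sorted_wrt R xs"
  proof (rule Suc.hyps(1))
    show "n = card (A - {m})" using Suc.hyps(2) m(1) Suc.prems(1) by simp
    show "finite (A - {m})" using Suc.prems(1) by simp
    show "R x y \<longleftrightarrow> \<not> R y x" if "x \<in> A - {m}" "y \<in> A - {m}" "x \<noteq> y" for x y
      using that by (intro Suc.prems(2)) simp_all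
    show "R x z" if "x \<in> A - {m}" "y \<in> A - {m}" "z \<in> A - {m}" "x \<noteq> y" "y \<noteq> z" "x \<noteq> z"
      "R x y" "R y z" for x y z
      using that by (intro Suc.prems(3)[of x y z]) simp_all
  qed
  then obtain xs where xs0: "distinct xs \<and> set xs = A - {m} \<and> sorted_wrt R xs"
    and uniq0: "\<forall>ys. distinct ys \<and> set ys = A - {m} \<and> sorted_wrt R ys \<longrightarrow> ys = xs"
    by (rule ex1E) (rule that)
  have xs: "distinct xs" "set xs = A - {m}" "sorted_wrt R xs" using xs0 by simp_all
  have uniq: "ys = xs" if "distinct ys" "set ys = A - {m}" "sorted_wrt R ys" for ys
    using uniq0[rule_format, of ys] that by simp
  show ?case
  proof (rule ex1I[of _ "m # xs"])
    show "distinct (m # xs) \<and> set (m # xs) = A \<and> sorted_wrt R (m # xs)"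
      using xs m by auto
  next
    fix ys assume ys: "distinct ys \<and> set ys = A \<and> sorted_wrt R ys"
    then obtain y zs where yz: "ys = y # zs" using m(1) by (cases ys) auto
    have "y = m"
    proof (rule ccontr)
      assume "y \<noteq> m"
      hence "m \<in> set zs" "y \<in> A" using ys yz m by auto
      hence "R y m" "R m y" using ys yz m \<open>y \<noteq> m\<close> by auto
      thus False using Suc.prems(2)[of y m] \<open>y \<in> A\<close> \<open>y \<noteq> m\<close> m(1) by simp
    qed
    moreover have "zs = xs" using ys yz \<open>y = m\<close> by (intro uniq) auto
    ultimately show "ys = m # xs" using yz by simp
  qed
qed

lemma bwt_matrix:
  assumes "is_orderings \<sigma> \<pi>" "set s \<subseteq> {..<\<sigma>}"
  shows "distinct (bwt_matrix \<pi> s)" "set (bwt_matrix \<pi> s) = rotations s"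
    "sorted_wrt (ctx_less \<pi>) (bwt_matrix \<pi> s)"
proof -
  have len: "length u = length s" "u \<in> lists {..<\<sigma>}" if "u \<in> rotations s" for u
    using that assms(2) by (auto simp: rotations_def)
  have "\<exists>!rows. distinct rows \<and> set rows = rotations s \<and> sorted_wrt (ctx_less \<pi>) rows"
  proof (rule sorted_wrt_ex1)
    show "finite (rotations s)" by (simp add: rotations_def)
  next
    fix u v assume "u \<in> rotations s" "v \<in> rotations s" "u \<noteq> v"
    thus "ctx_less \<pi> u v \<longleftrightarrow> \<not> ctx_less \<pi> v u"
      using len by (intro ctx_less_total[OF assms(1)]) auto
  next
    fix u v x assume "u \<in> rotations s" "v \<in> rotations s" "x \<in> rotations s"
      "u \<noteq> v" "v \<noteq> x" "u \<noteq> x" "ctx_less \<pi> u v" "ctx_less \<pi> v x"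
    thus "ctx_less \<pi> u x" using len by (intro ctx_less_trans[of u v x]) auto
  qed
  from theI'[OF this] show "distinct (bwt_matrix \<pi> s)"
    "set (bwt_matrix \<pi> s) = rotations s" "sorted_wrt (ctx_less \<pi>) (bwt_matrix \<pi> s)"
    unfolding bwt_matrix_def by blast+
qed

lemma length_bwt:
  assumes "is_orderings \<sigma> \<pi>" "set s \<subseteq> {..<\<sigma>}" "primitive s"
  shows "length (bwt \<pi> s) = length s"
  using bwt_matrix[OF assms(1,2)] assms(3) distinct_card[of "bwt_matrix \<pi> s"]
  by (simp add: bwt_def rotations_def primitive_def card_image)

end

theory Submission
  imports Defs
begin

text \<open>
  Let \<open>s\<close> have length \<open>n\<close>. The rows of the matrix that start with a context \<open>x\<close> form a block, and \<open>\<pi>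
  x\<close> permutes the blocks of its extensions \<open>x @ [c]\<close>. Only branching contexts matter, and they are
  nodes of the suffix tree of \<open>s @ s\<close>, which has \<open>O(n)\<close> nodes. The changes inside the block of \<open>x\<close>
  are the changes inside the blocks of the children and those at the joints between consecutive
  blocks, and the latter depend only on the first and last symbols of the blocks. So dynamic
  programming over the tree works, with one table entry per pair of first and last symbols; all
  combinations of a permutation and of such pairs for the children are unrolled at compile time,
  since \<open>\<sigma>\<close> is constant. A top-down pass then emits an optimal ordering for every branching context.

  The tree is built by Weiner's algorithm, which prepends the letters from right to left. The nodes
  of the tree are the longest common prefixes of suffixes, and the transition of \<open>x\<close> with \<open>a\<close> leads
  to the least node that extends \<open>a # x\<close>; these are the data of the suffix automaton of the reversed
  text. The number of nodes that are prefixes of the whole text is the potential that makes the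
  construction linear.
\<close>

subsection \<open>Structured programs\<close>

text \<open>The claim is about a concrete machine, and two obstacles shape the proof. First, words
  are finite. Instead of bounding each value separately, sums of two run-time values are guarded by
  one linear bound \<open>bnd\<close>, while all other growth comes from literals and is thus at
  most proportional to the running time. A word length of a constant times log n then suffices, and
  the exponent in the theorem is this constant. Second, the text has no end marker. Rotations are
  the windows of length n of \<open>s @ s\<close>, so contexts shorter than n are factors of that
  text, and suffixes are counted as nodes even if they end inside an edge. A window of length n is a
  single row of the matrix; so nodes of length at least n serve as leaves, are cut to n letters, and
  end the recursion although the tree may go on below them. The constant factor hidden in the linear
  time is large: every short node tries all pairs of one of the \<sigma>! permutations and one of
  the (\<sigma>^2 + 1)^\<sigma> assignments of end symbols to the children. The best pair is not
  stored but found again in the top-down pass.\<close>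

datatype exp =
    Lit nat
  | Var nat
  | Ld exp
  | Inc exp nat
  | Bin binop exp exp

abbreviation "Pl \<equiv> Bin Add"
abbreviation "Mi \<equiv> Bin Sub"
abbreviation "Equ \<equiv> Bin Eq"
abbreviation "Les \<equiv> Bin Less"

fun ival :: "binop \<Rightarrow> nat \<Rightarrow> nat \<Rightarrow> nat" where
  "ival Add a b = a + b"
| "ival Sub a b = a - b"
| "ival Eq a b = of_bool (a = b)"
| "ival Less a b = of_bool (a < b)"
| "ival _ a b = 0"

text \<open>The operands for which the machine agrees with unbounded arithmetic.\<close>

fun okB :: "nat \<Rightarrow> binop \<Rightarrow> nat \<Rightarrow> nat \<Rightarrow> bool" where
  "okB U Add a b = (a + b \<le> U)"
| "okB U Sub a b = (b \<le> a)"
| "okB U Eq a b = True"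
| "okB U Less a b = True"
| "okB U _ a b = False"

type_synonym store = "(nat \<Rightarrow> nat) \<times> (nat \<Rightarrow> nat)"

fun aval :: "exp \<Rightarrow> store \<Rightarrow> nat" where
  "aval (Lit c) s = c"
| "aval (Var x) s = fst s x"
| "aval (Ld e) s = snd s (aval e s)"
| "aval (Inc e c) s = aval e s + c"
| "aval (Bin f a b) s = ival f (aval a s) (aval b s)"

text \<open>\<open>Inc\<close> has no guard: its literal is at most the largest literal of the
  program, and \<open>aval_bound\<close> charges the growth to the running time. Sums of two
  run-time values could double a word and must stay below \<open>U\<close>.\<close>

fun okE :: "nat \<Rightarrow> exp \<Rightarrow> store \<Rightarrow> bool" where
  "okE U (Lit c) s = True"
| "okE U (Var x) s = True"
| "okE U (Ld e) s = okE U e s"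
| "okE U (Inc e c) s = okE U e s"
| "okE U (Bin f a b) s = (okE U a s \<and> okE U b s \<and> okB U f (aval a s) (aval b s))"

text \<open>Variables live in the even registers, temporary values in the odd ones.\<close>

fun compE :: "nat \<Rightarrow> exp \<Rightarrow> instr list" where
  "compE d (Lit c) = [Const (2 * d + 1) c]"
| "compE d (Var x) = [Op Or (2 * d + 1) (2 * x) (2 * x)]"
| "compE d (Ld e) = compE d e @ [Load (2 * d + 1) (2 * d + 1)]"
| "compE d (Inc e c) = compE d e @ [Const (2 * d + 3) c, Op Add (2 * d + 1) (2 * d + 1) (2 * d + 3)]"
| "compE d (Bin f a b) = compE d a @ compE (Suc d) b @ [Op f (2 * d + 1) (2 * d + 1) (2 * d + 3)]"

text \<open>Expressions compile to straight-line code, so one number serves as code length and as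
  running time. \<open>Inc\<close> costs two because its literal is first loaded into the next
  temporary.\<close>

fun tmE :: "exp \<Rightarrow> nat" where
  "tmE (Lit c) = 1"
| "tmE (Var x) = 1"
| "tmE (Ld e) = tmE e + 1"
| "tmE (Inc e c) = tmE e + 2"
| "tmE (Bin f a b) = tmE a + tmE b + 1"

lemma length_compE [simp]: "length (compE d e) = tmE e"
  by (induction e arbitrary: d) auto

fun maxE :: "exp \<Rightarrow> nat" where
  "maxE (Lit c) = c"
| "maxE (Var x) = 0"
| "maxE (Ld e) = maxE e"
| "maxE (Inc e c) = max (maxE e) c"
| "maxE (Bin f a b) = max (maxE a) (maxE b)"

datatype com =
    Skip
  | Asg nat exp  ("_ ::= _" [70, 65] 61)
  | Sto exp exp
  | Sq com com  (infixr ";;" 60)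
  | Cnd exp com com
  | While exp com

fun maxC :: "com \<Rightarrow> nat" where
  "maxC Skip = 0"
| "maxC (x ::= e) = maxE e"
| "maxC (Sto a e) = max (maxE a) (maxE e)"
| "maxC (c ;; d) = max (maxC c) (maxC d)"
| "maxC (Cnd e c d) = max (maxE e) (max (maxC c) (maxC d))"
| "maxC (While e c) = max (maxE e) (maxC c)"

text \<open>Jump targets are absolute and may point behind code not yet generated, so lengths must
  be known independently of \<open>compC\<close>.\<close>

fun lenC :: "com \<Rightarrow> nat" where
  "lenC Skip = 0"
| "lenC (x ::= e) = tmE e + 1"
| "lenC (Sto a e) = tmE a + tmE e + 1"
| "lenC (c ;; d) = lenC c + lenC d"
| "lenC (Cnd e c d) = tmE e + lenC c + lenC d + 2"
| "lenC (While e c) = tmE e + lenC c + 2"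

fun compC :: "nat \<Rightarrow> com \<Rightarrow> instr list" where
  "compC l Skip = []"
| "compC l (x ::= e) = compE 0 e @ [Op Or (2 * x) 1 1]"
| "compC l (Sto a e) = compE 0 a @ compE 1 e @ [Store 1 3]"
| "compC l (c ;; d) = compC l c @ compC (l + lenC c) d"
| "compC l (Cnd e c d) = compE 0 e @ [JumpIfZero 1 (l + tmE e + lenC c + 2)] @
     compC (l + tmE e + 1) c @ [Jump (l + tmE e + lenC c + lenC d + 2)] @
     compC (l + tmE e + lenC c + 2) d"
| "compC l (While e c) = compE 0 e @ [JumpIfZero 1 (l + tmE e + lenC c + 2)] @
     compC (l + tmE e + 1) c @ [Jump l]"

lemma length_compC [simp]: "length (compC l c) = lenC c"
  by (induction c arbitrary: l) auto

text \<open>The cost is exact: 2 stands for the conditional jump and the closing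
  \<open>Jump\<close>, 1 for the conditional jump alone. A derivation exists only if all evaluated
  operands pass \<open>okE\<close>, so a run also certifies that no guarded operation
  overflows.\<close>

inductive bs :: "nat \<Rightarrow> com \<Rightarrow> store \<Rightarrow> nat \<Rightarrow> store \<Rightarrow> bool" for U where
  Skip: "bs U Skip s 0 s"
| Asg: "okE U e s \<Longrightarrow> bs U (x ::= e) s (tmE e + 1) ((fst s)(x := aval e s), snd s)"
| Sto: "okE U a s \<Longrightarrow> okE U e s \<Longrightarrow>
    bs U (Sto a e) s (tmE a + tmE e + 1) (fst s, (snd s)(aval a s := aval e s))"
| Sq: "bs U c s t1 s1 \<Longrightarrow> bs U d s1 t2 s2 \<Longrightarrow> bs U (c ;; d) s (t1 + t2) s2"
| CndT: "okE U e s \<Longrightarrow> aval e s \<noteq> 0 \<Longrightarrow> bs U c s t s' \<Longrightarrow> bs U (Cnd e c d) s (tmE e + t + 2) s'"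
| CndF: "okE U e s \<Longrightarrow> aval e s = 0 \<Longrightarrow> bs U d s t s' \<Longrightarrow> bs U (Cnd e c d) s (tmE e + t + 1) s'"
| WhileF: "okE U e s \<Longrightarrow> aval e s = 0 \<Longrightarrow> bs U (While e c) s (tmE e + 1) s"
| WhileT: "okE U e s \<Longrightarrow> aval e s \<noteq> 0 \<Longrightarrow> bs U c s t1 s1 \<Longrightarrow> bs U (While e c) s1 t2 s2 \<Longrightarrow>
    bs U (While e c) s (tmE e + t1 + 2 + t2) s2"

section \<open>Simulation of structured programs by the machine\<close>

definition code_at :: "instr list \<Rightarrow> nat \<Rightarrow> instr list \<Rightarrow> bool" where
  "code_at P l cs \<longleftrightarrow> (\<forall>i<length cs. l + i < length P \<and> P ! (l + i) = cs ! i)"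

lemma code_at_append:
  "code_at P l (xs @ ys) \<longleftrightarrow> code_at P l xs \<and> code_at P (l + length xs) ys"
proof
  assume *: "code_at P l (xs @ ys)"
  show "code_at P l xs \<and> code_at P (l + length xs) ys"
    unfolding code_at_def
  proof (intro conjI allI impI)
    fix i assume "i < length xs"
    with * show "l + i < length P" "P ! (l + i) = xs ! i"
      unfolding code_at_def by (auto simp: nth_append dest: spec[of _ i])
  next
    fix i assume "i < length ys"
    with * show "l + length xs + i < length P" "P ! (l + length xs + i) = ys ! i"
      unfolding code_at_def by (auto simp: nth_append add.assoc dest: spec[of _ "length xs + i"])
  qed
next
  assume *: "code_at P l xs \<and> code_at P (l + length xs) ys"
  show "code_at P l (xs @ ys)"
    unfolding code_at_def
  proof (intro allI impI)
    fix i assume i: "i < length (xs @ ys)"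
    show "l + i < length P \<and> P ! (l + i) = (xs @ ys) ! i"
    proof (cases "i < length xs")
      case True
      with * show ?thesis unfolding code_at_def by (auto simp: nth_append)
    next
      case False
      hence "i - length xs < length ys" using i by simp
      with * have "l + length xs + (i - length xs) < length P \<and>
          P ! (l + length xs + (i - length xs)) = ys ! (i - length xs)"
        unfolding code_at_def by blast
      moreover have "l + length xs + (i - length xs) = l + i" using False by simp
      ultimately show ?thesis using False by (simp add: nth_append)
    qed
  qed
qed

lemma code_at_Cons:
  "code_at P l (x # xs) \<longleftrightarrow> l < length P \<and> P ! l = x \<and> code_at P (Suc l) xs"
  using code_at_append[of P l "[x]" xs] by (auto simp: code_at_def)

lemma code_at_Nil [simp]: "code_at P l []"
  by (simp add: code_at_def)

text \<open>No word overflows: a step raises the bound \<open>M\<close> on all words by at most the largest literal \<open>K\<close>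
  of the program, since the other additions are guarded by \<open>U\<close>.\<close>

definition below :: "nat \<Rightarrow> store \<Rightarrow> bool" where
  "below M s \<longleftrightarrow> (\<forall>x. fst s x \<le> M) \<and> (\<forall>x. snd s x \<le> M)"

lemma below_mono: "below M s \<Longrightarrow> M \<le> M' \<Longrightarrow> below M' s"
  unfolding below_def by (meson order_trans)

text \<open>Nothing is said about the odd registers, whose temporaries are dead between
  commands.\<close>

definition rel :: "ram_state \<Rightarrow> store \<Rightarrow> bool" where
  "rel st s \<longleftrightarrow> (\<forall>x. reg st (2 * x) = fst s x) \<and> mem st = snd s"

text \<open>Variables and cells are at most \<open>M\<close>, guarded sums at most
  \<open>U \<le> M\<close>, and differences do not grow; only literals contribute, each at most
  \<open>K\<close>. Comparisons yield up to 1, which is where \<open>1 \<le> K\<close>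
  enters.\<close>

lemma aval_bound:
  assumes "below M s" "okE U e s" "U \<le> M" "maxE e \<le> K" "1 \<le> K"
  shows "aval e s \<le> M + K * tmE e"
  using assms
proof (induction e)
  case (Inc e c)
  hence "aval e s \<le> M + K * tmE e" "c \<le> K" by auto
  thus ?case by (simp add: algebra_simps)
next
  case (Bin f a b)
  hence "aval a s \<le> M + K * tmE a" by auto
  thus ?case using Bin by (cases f) (auto simp: algebra_simps of_bool_def)
qed (auto simp: below_def intro: le_trans trans_le_add1 trans_le_add2)

lemma steps_add: "(step w P ^^ (a + b)) st = (step w P ^^ b) ((step w P ^^ a) st)"
  by (metis add.commute comp_apply funpow_add)

lemma step_exec: "pc st < length P \<Longrightarrow> P ! pc st = x \<Longrightarrow> step w P st = exec w x st"
  by (simp add: step_def halted_def)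

lemma odd_ne_even [simp]: "(2 * x = Suc (2 * y)) = False" "(Suc (2 * y) = 2 * x) = False"
    "(2 * x = Suc (Suc (Suc (2 * y)))) = False" "(Suc (Suc (Suc (2 * y))) = 2 * x) = False"
  by presburger+

lemma binop_chosen_ival:
  assumes "okB U f a b" "U < 2 ^ w" "a < 2 ^ w" "1 < (2 :: nat) ^ w"
  shows "binop_val w f a b = ival f a b"
proof (cases f)
  case Sub
  hence "a + 2 ^ w - b = (a - b) + 2 ^ w" using assms by simp
  moreover have "(a - b + 2 ^ w) mod 2 ^ w = a - b" using assms by (simp only: mod_add_self2) simp
  ultimately show ?thesis using Sub by simp
qed (use assms in auto)

text \<open>The clause on the temporaries below \<open>d\<close> protects the value of the first
  operand of \<open>Bin\<close> while the second is computed one level higher.\<close>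

lemma compE_correct:
  assumes "code_at P l (compE d e)" "pc st = l" "rel st s"
    and "okE U e s" "below M s" "U \<le> M" "maxE e \<le> K" "1 \<le> K" "M + K * tmE e < 2 ^ w"
  shows "\<exists>st'. (step w P ^^ tmE e) st = st' \<and> pc st' = l + tmE e \<and> rel st' s \<and>
    reg st' (2 * d + 1) = aval e s \<and> (\<forall>i<d. reg st' (2 * i + 1) = reg st (2 * i + 1))"
  using assms
proof (induction e arbitrary: l d st)
  case (Lit c)
  have "c < 2 ^ w" using Lit by simp
  have "step w P st = exec w (Const (2 * d + 1) c) st" using Lit
    by (intro step_exec) (simp_all add: code_at_Cons)
  thus ?case using Lit \<open>c < 2 ^ w\<close> by (auto simp: rel_def)
next
  case (Var x)
  have "step w P st = exec w (Op Or (2 * d + 1) (2 * x) (2 * x)) st" using Var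
    by (intro step_exec) (simp_all add: code_at_Cons)
  thus ?case using Var by (auto simp: rel_def)
next
  case (Ld e)
  have "\<exists>st'. (step w P ^^ tmE e) st = st' \<and> pc st' = l + tmE e \<and> rel st' s \<and>
    reg st' (2 * d + 1) = aval e s \<and> (\<forall>i<d. reg st' (2 * i + 1) = reg st (2 * i + 1))"
    using Ld.prems by (intro Ld.IH) (auto simp: code_at_append)
  then obtain st' where st': "(step w P ^^ tmE e) st = st'" "pc st' = l + tmE e" "rel st' s"
    "reg st' (2 * d + 1) = aval e s" "\<forall>i<d. reg st' (2 * i + 1) = reg st (2 * i + 1)" by blast
  have "step w P st' = exec w (Load (2 * d + 1) (2 * d + 1)) st'"
    using Ld.prems st' by (intro step_exec) (simp_all add: code_at_append code_at_Cons)
  thus ?case using st' by (auto simp: rel_def)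
next
  case (Inc e c)
  have cl: "c \<le> K" "M + K * tmE e + K * 2 < 2 ^ w" using Inc.prems by (auto simp: algebra_simps)
  have "\<exists>st'. (step w P ^^ tmE e) st = st' \<and> pc st' = l + tmE e \<and> rel st' s \<and>
    reg st' (2 * d + 1) = aval e s \<and> (\<forall>i<d. reg st' (2 * i + 1) = reg st (2 * i + 1))"
    using Inc.prems by (intro Inc.IH) (auto simp: code_at_append)
  then obtain st' where st': "(step w P ^^ tmE e) st = st'" "pc st' = l + tmE e" "rel st' s"
    "reg st' (2 * d + 1) = aval e s" "\<forall>i<d. reg st' (2 * i + 1) = reg st (2 * i + 1)" by blast
  have "aval e s \<le> M + K * tmE e" using Inc.prems by (intro aval_bound) auto
  hence small: "c < 2 ^ w" "aval e s + c < 2 ^ w" using cl by linarith+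
  have 1: "step w P st' = exec w (Const (2 * d + 3) c) st'"
    using Inc.prems st' by (intro step_exec) (simp_all add: code_at_append code_at_Cons)
  have 2: "step w P (step w P st') = exec w (Op Add (2 * d + 1) (2 * d + 1) (2 * d + 3)) (step w P st')"
    using Inc.prems st' by (intro step_exec) (simp_all add: code_at_append 1 code_at_Cons)
  have "(step w P ^^ tmE (Inc e c)) st = step w P (step w P st')" using st'(1) by simp
  thus ?case using 1 2 small st' by (auto simp: rel_def numeral_3_eq_3)
next
  case (Bin f a b)
  have "\<exists>st'. (step w P ^^ tmE a) st = st' \<and> pc st' = l + tmE a \<and> rel st' s \<and>
    reg st' (2 * d + 1) = aval a s \<and> (\<forall>i<d. reg st' (2 * i + 1) = reg st (2 * i + 1))"
    using Bin.prems by (intro Bin.IH) (auto simp: code_at_append algebra_simps)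
  then obtain st' where st': "(step w P ^^ tmE a) st = st'" "pc st' = l + tmE a" "rel st' s"
    "reg st' (2 * d + 1) = aval a s" "\<forall>i<d. reg st' (2 * i + 1) = reg st (2 * i + 1)" by blast
  have "\<exists>st2. (step w P ^^ tmE b) st' = st2 \<and> pc st2 = l + tmE a + tmE b \<and> rel st2 s \<and>
    reg st2 (2 * Suc d + 1) = aval b s \<and> (\<forall>i<Suc d. reg st2 (2 * i + 1) = reg st' (2 * i + 1))"
    using Bin.prems st' by (intro Bin.IH) (auto simp: code_at_append algebra_simps)
  then obtain st2 where st2: "(step w P ^^ tmE b) st' = st2" "pc st2 = l + tmE a + tmE b" "rel st2 s"
    "reg st2 (2 * Suc d + 1) = aval b s" "\<forall>i<Suc d. reg st2 (2 * i + 1) = reg st' (2 * i + 1)" by blast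
  have "step w P st2 = exec w (Op f (2 * d + 1) (2 * d + 1) (2 * d + 3)) st2"
    using Bin.prems st2 by (intro step_exec) (simp_all add: code_at_append code_at_Cons algebra_simps)
  moreover have "(step w P ^^ tmE (Bin f a b)) st = step w P st2"
    using st'(1) st2(1) by (simp add: steps_add)
  moreover have "aval a s \<le> M + K * tmE a" using Bin.prems by (intro aval_bound) auto
  hence "aval a s < 2 ^ w" "1 < (2 :: nat) ^ w" using Bin.prems by (auto simp: algebra_simps)
  hence "binop_val w f (aval a s) (aval b s) = ival f (aval a s) (aval b s)"
    using Bin.prems binop_chosen_ival[of U f "aval a s" "aval b s" w] by simp
  ultimately show ?case using st' st2 by (auto simp: rel_def numeral_3_eq_3)
qed

lemma below_exec_update:
  assumes "below M s" "M \<le> M'" "v \<le> M'"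
  shows "below M' ((fst s)(x := v), snd s)" "below M' (fst s, (snd s)(x := v))"
  using assms by (auto simp: below_def intro: order_trans)

text \<open>A step raises the bound on the words by at most \<open>K\<close>, so
  \<open>M + K * t < 2 ^ w\<close> at the end of the run rules out overflow at every earlier moment.
  \<open>M\<close> is arbitrary in the induction, since each piece of code starts from the bound
  that its predecessor leaves.\<close>

lemma compC_correct:
  assumes "bs U c s t s'" "code_at P l (compC l c)" "pc st = l" "rel st s"
    and "below M s" "U \<le> M" "maxC c \<le> K" "1 \<le> K" "M + K * t < 2 ^ w"
  shows "\<exists>st'. (step w P ^^ t) st = st' \<and> pc st' = l + lenC c \<and> rel st' s' \<and>
    below (M + K * t) s'"
  using assms
proof (induction arbitrary: l st M rule: bs.induct)
  case (Skip s)
  thus ?case by simp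
next
  case (Asg e s x)
  have "aval e s \<le> M + K * tmE e" using Asg by (intro aval_bound) auto
  have "\<exists>st'. (step w P ^^ tmE e) st = st' \<and> pc st' = l + tmE e \<and> rel st' s \<and>
    reg st' (2 * 0 + 1) = aval e s \<and> (\<forall>i<0. reg st' (2 * i + 1) = reg st (2 * i + 1))"
    using Asg by (intro compE_correct[where M = M and U = U and K = K]) (auto simp: code_at_append)
  then obtain st' where st': "(step w P ^^ tmE e) st = st'" "pc st' = l + tmE e" "rel st' s"
    "reg st' 1 = aval e s" by auto
  have "step w P st' = exec w (Op Or (2 * x) 1 1) st'"
    using Asg.prems st' by (intro step_exec) (simp_all add: code_at_append code_at_Cons)
  moreover have "below (M + K * (tmE e + 1)) ((fst s)(x := aval e s), snd s)"
    using Asg \<open>aval e s \<le> _\<close> by (intro below_exec_update) (auto simp: algebra_simps)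
  ultimately show ?case using st' by (auto simp: rel_def)
next
  case (Sto a s e)
  have "aval e s \<le> M + K * tmE e" using Sto by (intro aval_bound) auto
  have "\<exists>st'. (step w P ^^ tmE a) st = st' \<and> pc st' = l + tmE a \<and> rel st' s \<and>
    reg st' (2 * 0 + 1) = aval a s \<and> (\<forall>i<0. reg st' (2 * i + 1) = reg st (2 * i + 1))"
    using Sto by (intro compE_correct[where M = M and U = U and K = K])
      (auto simp: code_at_append algebra_simps)
  then obtain st' where st': "(step w P ^^ tmE a) st = st'" "pc st' = l + tmE a" "rel st' s"
    "reg st' 1 = aval a s" by auto
  have "\<exists>st2. (step w P ^^ tmE e) st' = st2 \<and> pc st2 = l + tmE a + tmE e \<and> rel st2 s \<and>
    reg st2 (2 * 1 + 1) = aval e s \<and> (\<forall>i<1. reg st2 (2 * i + 1) = reg st' (2 * i + 1))"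
    using Sto st' by (intro compE_correct[where M = M and U = U and K = K])
      (auto simp: code_at_append algebra_simps)
  then obtain st2 where st2: "(step w P ^^ tmE e) st' = st2" "pc st2 = l + tmE a + tmE e" "rel st2 s"
    "reg st2 3 = aval e s" "reg st2 1 = reg st' 1" by auto
  have "step w P st2 = exec w (Store 1 3) st2"
    using Sto.prems st2 by (intro step_exec) (simp_all add: code_at_append code_at_Cons algebra_simps)
  moreover have "below (M + K * (tmE a + tmE e + 1)) (fst s, (snd s)(aval a s := aval e s))"
    using Sto \<open>aval e s \<le> _\<close> by (intro below_exec_update) (auto simp: algebra_simps)
  ultimately show ?case using st' st2 by (auto simp: rel_def steps_add)
next
  case (Sq c s t1 s1 d t2 s2)
  have "\<exists>st'. (step w P ^^ t1) st = st' \<and> pc st' = l + lenC c \<and> rel st' s1 \<and> below (M + K * t1) s1"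
    using Sq.prems by (intro Sq.IH(1)) (auto simp: code_at_append algebra_simps)
  then obtain st' where st': "(step w P ^^ t1) st = st'" "pc st' = l + lenC c" "rel st' s1"
    "below (M + K * t1) s1" by auto
  have "\<exists>st2. (step w P ^^ t2) st' = st2 \<and> pc st2 = l + lenC c + lenC d \<and> rel st2 s2 \<and>
    below (M + K * t1 + K * t2) s2"
    using Sq.prems st' by (intro Sq.IH(2)) (auto simp: code_at_append algebra_simps)
  thus ?case using st' by (auto simp: steps_add algebra_simps)
next
  case (CndT e s c t s' d)
  have "\<exists>st'. (step w P ^^ tmE e) st = st' \<and> pc st' = l + tmE e \<and> rel st' s \<and>
    reg st' (2 * 0 + 1) = aval e s \<and> (\<forall>i<0. reg st' (2 * i + 1) = reg st (2 * i + 1))"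
    using CndT by (intro compE_correct[where M = M and U = U and K = K])
      (auto simp: code_at_append algebra_simps)
  then obtain st' where st': "(step w P ^^ tmE e) st = st'" "pc st' = l + tmE e" "rel st' s"
    "reg st' 1 = aval e s" by auto
  have 1: "step w P st' = exec w (JumpIfZero 1 (l + tmE e + lenC c + 2)) st'"
    using CndT.prems st' by (intro step_exec) (simp_all add: code_at_append code_at_Cons algebra_simps)
  have "\<exists>st2. (step w P ^^ t) (step w P st') = st2 \<and> pc st2 = l + tmE e + 1 + lenC c \<and> rel st2 s' \<and>
    below (M + K * t) s'"
    using CndT.prems st' CndT.hyps(2) 1
    by (intro CndT.IH) (auto simp: rel_def code_at_append code_at_Cons algebra_simps)
  then obtain st2 where st2: "(step w P ^^ t) (step w P st') = st2" "pc st2 = l + tmE e + 1 + lenC c"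
    "rel st2 s'" "below (M + K * t) s'" by auto
  have 2: "step w P st2 = exec w (Jump (l + tmE e + lenC c + lenC d + 2)) st2"
    using CndT.prems st2 by (intro step_exec) (simp_all add: code_at_append code_at_Cons algebra_simps)
  have "(step w P ^^ (tmE e + t + 2)) st = (step w P ^^ (tmE e + (1 + t) + 1)) st" by simp
  also have "\<dots> = step w P st2" using st' st2 by (simp only: steps_add) simp
  finally show ?case using 2 st2 by (auto simp: rel_def add_mult_distrib2 elim!: below_mono)
next
  case (CndF e s d t s' c)
  have "\<exists>st'. (step w P ^^ tmE e) st = st' \<and> pc st' = l + tmE e \<and> rel st' s \<and>
    reg st' (2 * 0 + 1) = aval e s \<and> (\<forall>i<0. reg st' (2 * i + 1) = reg st (2 * i + 1))"
    using CndF by (intro compE_correct[where M = M and U = U and K = K])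
      (auto simp: code_at_append algebra_simps)
  then obtain st' where st': "(step w P ^^ tmE e) st = st'" "pc st' = l + tmE e" "rel st' s"
    "reg st' 1 = aval e s" by auto
  have 1: "step w P st' = exec w (JumpIfZero 1 (l + tmE e + lenC c + 2)) st'"
    using CndF.prems st' by (intro step_exec) (simp_all add: code_at_append code_at_Cons algebra_simps)
  have "\<exists>st2. (step w P ^^ t) (step w P st') = st2 \<and> pc st2 = l + tmE e + lenC c + 2 + lenC d \<and>
    rel st2 s' \<and> below (M + K * t) s'"
    using CndF.prems st' CndF.hyps(2) 1
    by (intro CndF.IH) (auto simp: rel_def code_at_append code_at_Cons algebra_simps)
  then obtain st2 where st2: "(step w P ^^ t) (step w P st') = st2"
    "pc st2 = l + tmE e + lenC c + 2 + lenC d" "rel st2 s'" "below (M + K * t) s'" by auto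
  have "(step w P ^^ (tmE e + t + 1)) st = (step w P ^^ (tmE e + (1 + t))) st" by simp
  also have "\<dots> = st2" using st' st2 by (simp only: steps_add) simp
  finally show ?case using st2 by (auto simp: rel_def add_mult_distrib2 elim!: below_mono)
next
  case (WhileF e s c)
  have "\<exists>st'. (step w P ^^ tmE e) st = st' \<and> pc st' = l + tmE e \<and> rel st' s \<and>
    reg st' (2 * 0 + 1) = aval e s \<and> (\<forall>i<0. reg st' (2 * i + 1) = reg st (2 * i + 1))"
    using WhileF by (intro compE_correct[where M = M and U = U and K = K])
      (auto simp: code_at_append algebra_simps)
  then obtain st' where st': "(step w P ^^ tmE e) st = st'" "pc st' = l + tmE e" "rel st' s"
    "reg st' 1 = aval e s" by auto
  have 1: "step w P st' = exec w (JumpIfZero 1 (l + tmE e + lenC c + 2)) st'"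
    using WhileF.prems st' by (intro step_exec) (simp_all add: code_at_append code_at_Cons algebra_simps)
  show ?case using 1 st' WhileF by (auto simp: rel_def add_mult_distrib2 elim!: below_mono)
next
  case (WhileT e s c t1 s1 t2 s2)
  have "\<exists>st'. (step w P ^^ tmE e) st = st' \<and> pc st' = l + tmE e \<and> rel st' s \<and>
    reg st' (2 * 0 + 1) = aval e s \<and> (\<forall>i<0. reg st' (2 * i + 1) = reg st (2 * i + 1))"
    using WhileT by (intro compE_correct[where M = M and U = U and K = K])
      (auto simp: code_at_append algebra_simps)
  then obtain st' where st': "(step w P ^^ tmE e) st = st'" "pc st' = l + tmE e" "rel st' s"
    "reg st' 1 = aval e s" by auto
  have 1: "step w P st' = exec w (JumpIfZero 1 (l + tmE e + lenC c + 2)) st'"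
    using WhileT.prems st' by (intro step_exec) (simp_all add: code_at_append code_at_Cons algebra_simps)
  have "\<exists>st2. (step w P ^^ t1) (step w P st') = st2 \<and> pc st2 = l + tmE e + 1 + lenC c \<and> rel st2 s1 \<and>
    below (M + K * t1) s1"
    using WhileT.prems st' WhileT.hyps(2) 1
    by (intro WhileT.IH(1)) (auto simp: rel_def code_at_append code_at_Cons algebra_simps)
  then obtain st2 where st2: "(step w P ^^ t1) (step w P st') = st2" "pc st2 = l + tmE e + 1 + lenC c"
    "rel st2 s1" "below (M + K * t1) s1" by auto
  have 2: "step w P st2 = exec w (Jump l) st2"
    using WhileT.prems st2 by (intro step_exec) (simp_all add: code_at_append code_at_Cons algebra_simps)
  have "\<exists>st3. (step w P ^^ t2) (step w P st2) = st3 \<and> pc st3 = l + lenC (While e c) \<and> rel st3 s2 \<and>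
    below (M + K * t1 + K * t2) s2"
    using WhileT.prems st2 2
    by (intro WhileT.IH(2)) (auto simp: rel_def algebra_simps)
  then obtain st3 where st3: "(step w P ^^ t2) (step w P st2) = st3" "pc st3 = l + lenC (While e c)"
    "rel st3 s2" "below (M + K * t1 + K * t2) s2" by auto
  have "(step w P ^^ (tmE e + t1 + 2 + t2)) st = (step w P ^^ (tmE e + (1 + t1) + 1 + t2)) st" by simp
  also have "\<dots> = st3" using st' st2 st3 by (simp only: steps_add) simp
  finally show ?case using st3 by (auto simp: algebra_simps elim!: below_mono)
qed

subsection \<open>A program logic that counts time\<close>

text \<open>Total correctness with a clock: \<open>t\<close> and \<open>t'\<close> are upper bounds
  on the time, and \<open>t + d \<le> t'\<close> leaves slack, so that costs may be rounded
  up.\<close>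

definition wp :: "nat \<Rightarrow> com \<Rightarrow> (store \<Rightarrow> nat \<Rightarrow> bool) \<Rightarrow> store \<Rightarrow> nat \<Rightarrow> bool" where
  "wp U c Q s t \<longleftrightarrow> (\<exists>d s' t'. bs U c s d s' \<and> t + d \<le> t' \<and> Q s' t')"

lemma wp_mono: "wp U c Q s t \<Longrightarrow> (\<And>s' t'. Q s' t' \<Longrightarrow> R s' t') \<Longrightarrow> wp U c R s t"
  unfolding wp_def by blast

lemma wp_Sq: "wp U c (\<lambda>s t. wp U d Q s t) s t \<Longrightarrow> wp U (c ;; d) Q s t"
proof -
  assume "wp U c (\<lambda>s t. wp U d Q s t) s t"
  then obtain k1 s1 t1 k2 s2 t2 where "bs U c s k1 s1" "t + k1 \<le> t1" "bs U d s1 k2 s2" "t1 + k2 \<le> t2"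
    "Q s2 t2" unfolding wp_def by blast
  thus "wp U (c ;; d) Q s t"
    unfolding wp_def by (intro exI[of _ "k1 + k2"] exI[of _ s2] exI[of _ t2]) (auto intro: bs.Sq)
qed

lemma wp_Cnd:
  assumes "okE U e s"
    and "aval e s \<noteq> 0 \<Longrightarrow> wp U c Q s (t + tmE e + 2)"
    and "aval e s = 0 \<Longrightarrow> wp U d Q s (t + tmE e + 2)"
  shows "wp U (Cnd e c d) Q s t"
proof (cases "aval e s = 0")
  case True
  then obtain k s' t' where "bs U d s k s'" "t + tmE e + 2 + k \<le> t'" "Q s' t'"
    using assms(3) unfolding wp_def by blast
  thus ?thesis unfolding wp_def using assms(1) True
    using bs.CndF[of U e s d k s' c]
    by (intro exI[of _ "tmE e + k + 1"] exI[of _ s'] exI[of _ t']) auto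
next
  case False
  then obtain k s' t' where "bs U c s k s'" "t + tmE e + 2 + k \<le> t'" "Q s' t'"
    using assms(2) unfolding wp_def by blast
  thus ?thesis unfolding wp_def using assms(1) False
    using bs.CndT[of U e s c k s' d]
    by (intro exI[of _ "tmE e + k + 2"] exI[of _ s'] exI[of _ t']) auto
qed

text \<open>Since every test of the guard takes time, a bound on the time of the invariant states yields
  termination.\<close>

lemma wp_While:
  assumes "I s t"
    and time: "\<And>s t. I s t \<Longrightarrow> t \<le> T"
    and ok: "\<And>s t. I s t \<Longrightarrow> okE U e s"
    and body: "\<And>s t. I s t \<Longrightarrow> aval e s \<noteq> 0 \<Longrightarrow> wp U c I s (t + tmE e + 2)"
    and fin: "\<And>s t. I s t \<Longrightarrow> aval e s = 0 \<Longrightarrow> Q s (t + tmE e + 2)"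
  shows "wp U (While e c) Q s t"
  using assms(1)
proof (induction "T - t" arbitrary: s t rule: less_induct)
  case less
  show ?case
  proof (cases "aval e s = 0")
    case True
    thus ?thesis unfolding wp_def using ok[OF less.prems] fin[OF less.prems]
      using bs.WhileF[of U e s c]
      by (intro exI[of _ "tmE e + 1"] exI[of _ s] exI[of _ "t + tmE e + 2"]) auto
  next
    case False
    then obtain k s1 t1 where k: "bs U c s k s1" "t + tmE e + 2 + k \<le> t1" "I s1 t1"
      using body[OF less.prems] unfolding wp_def by blast
    have "wp U (While e c) Q s1 t1"
      using k time[OF k(3)] by (intro less.hyps) auto
    then obtain k2 s2 t2 where k2: "bs U (While e c) s1 k2 s2" "t1 + k2 \<le> t2" "Q s2 t2"
      unfolding wp_def by blast
    show ?thesis unfolding wp_def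
      using bs.WhileT[OF ok[OF less.prems] False k(1) k2(1)] k(2) k2(2,3)
      by (intro exI[of _ "tmE e + k + 2 + k2"] exI[of _ s2] exI[of _ t2]) auto
  qed
qed

section \<open>Loop-free programs evaluated by a function\<close>

fun loop_free :: "com \<Rightarrow> bool" where
  "loop_free (c ;; d) = (loop_free c \<and> loop_free d)"
| "loop_free (Cnd e c d) = (loop_free c \<and> loop_free d)"
| "loop_free (While e c) = False"
| "loop_free _ = True"

text \<open>Both branches of a conditional are charged, which makes the bound for loop-free code
  independent of the state.\<close>

fun tmC :: "com \<Rightarrow> nat" where
  "tmC (x ::= e) = tmE e + 1"
| "tmC (Sto a e) = tmE a + tmE e + 1"
| "tmC (c ;; d) = tmC c + tmC d"
| "tmC (Cnd e c d) = tmE e + tmC c + tmC d + 2"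
| "tmC _ = 0"

text \<open>Loop-free code always terminates, so its effect can be computed by rewriting rather than
  by building derivations of \<open>bs\<close>.\<close>

fun ex :: "com \<Rightarrow> store \<Rightarrow> store" where
  "ex (x ::= e) s = ((fst s)(x := aval e s), snd s)"
| "ex (Sto a e) s = (fst s, (snd s)(aval a s := aval e s))"
| "ex (c ;; d) s = ex d (ex c s)"
| "ex (Cnd e c d) s = (if aval e s \<noteq> 0 then ex c s else ex d s)"
| "ex _ s = s"

fun okC :: "nat \<Rightarrow> com \<Rightarrow> store \<Rightarrow> bool" where
  "okC U (x ::= e) s = okE U e s"
| "okC U (Sto a e) s = (okE U a s \<and> okE U e s)"
| "okC U (c ;; d) s = (okC U c s \<and> okC U d (ex c s))"
| "okC U (Cnd e c d) s = (okE U e s \<and> (if aval e s \<noteq> 0 then okC U c s else okC U d s))"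
| "okC U _ s = True"

lemma loop_free_bs: "loop_free c \<Longrightarrow> okC U c s \<Longrightarrow> \<exists>d\<le>tmC c. bs U c s d (ex c s)"
proof (induction c arbitrary: s)
  case (Sq c d)
  from Sq.IH(1)[of s] Sq.prems obtain t1 where "t1 \<le> tmC c" "bs U c s t1 (ex c s)" by auto
  moreover from Sq.IH(2)[of "ex c s"] Sq.prems obtain t2 where "t2 \<le> tmC d"
    "bs U d (ex c s) t2 (ex d (ex c s))" by auto
  ultimately show ?case by (intro exI[of _ "t1 + t2"]) (auto intro: bs.Sq)
next
  case (Cnd e c d)
  show ?case
  proof (cases "aval e s = 0")
    case True
    with Cnd.IH(2)[of s] Cnd.prems obtain t where "t \<le> tmC d" "bs U d s t (ex d s)" by auto
    thus ?thesis using True Cnd.prems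
      by (intro exI[of _ "tmE e + t + 1"]) (use bs.CndF[of U e s d t "ex d s" c] in auto)
  next
    case False
    with Cnd.IH(1)[of s] Cnd.prems obtain t where "t \<le> tmC c" "bs U c s t (ex c s)" by auto
    thus ?thesis using False Cnd.prems
      by (intro exI[of _ "tmE e + t + 2"]) (use bs.CndT[of U e s c t "ex c s" d] in auto)
  qed
next
  case (Asg x e)
  thus ?case by (intro exI[of _ "tmE e + 1"]) (use bs.Asg[of U e s x] in auto)
next
  case (Sto a e)
  thus ?case by (intro exI[of _ "tmE a + tmE e + 1"]) (use bs.Sto[of U a s e] in auto)
qed (auto intro: bs.Skip)

lemma wp_loop_free:
  assumes "loop_free c" "okC U c s" "Q (ex c s) (t + tmC c)"
  shows "wp U c Q s t"
proof -
  obtain d where "d \<le> tmC c" "bs U c s d (ex c s)" using loop_free_bs[OF assms(1,2)] by blast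
  thus ?thesis unfolding wp_def using assms(3)
    by (intro exI[of _ d] exI[of _ "ex c s"] exI[of _ "t + tmC c"]) auto
qed

primrec seqs :: "com list \<Rightarrow> com" where
  "seqs [] = Skip"
| "seqs (c # cs) = c ;; seqs cs"

lemma loop_free_seqs [simp]: "loop_free (seqs cs) \<longleftrightarrow> (\<forall>c\<in>set cs. loop_free c)"
  by (induction cs) auto

lemma ex_seqs: "ex (seqs cs) s = fold ex cs s"
  by (induction cs arbitrary: s) auto

subsection \<open>Suffix trees\<close>

abbreviation lcp :: "nat list \<Rightarrow> nat list \<Rightarrow> nat list" where
  "lcp \<equiv> longest_common_prefix"

text \<open>The case \<open>u = v\<close> makes every suffix a node, including those that end inside
  an edge. This replaces the usual end marker, which would not be a letter of the alphabet.\<close>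

definition nodes :: "nat list \<Rightarrow> nat list set" where
  "nodes w = {lcp u v | u v. suffix u w \<and> suffix v w}"

definition factors :: "nat list \<Rightarrow> nat list set" where
  "factors w = {u. \<exists>v. suffix v w \<and> prefix u v}"

text \<open>The explicit node at the lower end of the edge on which \<open>u\<close> ends. It exists
  for every factor because nodes are closed under \<open>lcp\<close>.\<close>

definition locus :: "nat list set \<Rightarrow> nat list \<Rightarrow> nat list" where
  "locus F u = (THE z. z \<in> F \<and> prefix u z \<and> (\<forall>z'\<in>F. prefix u z' \<longrightarrow> prefix z z'))"

definition parent :: "nat list set \<Rightarrow> nat list \<Rightarrow> nat list" where
  "parent F x = (THE z. z \<in> F \<and> strict_prefix z x \<and> (\<forall>z'\<in>F. strict_prefix z' x \<longrightarrow> prefix z' z))"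

lemma lcp_eqI:
  assumes "prefix x u" "prefix x v" "\<And>y. prefix y u \<Longrightarrow> prefix y v \<Longrightarrow> prefix y x"
  shows "lcp u v = x"
  using assms by (meson longest_common_prefix_max_prefix longest_common_prefix_prefix1
      longest_common_prefix_prefix2 prefix_order.antisym)

lemma lcp_self [simp]: "lcp u u = u"
  by (rule lcp_eqI) auto

lemma lcp_absorb: "prefix u v \<Longrightarrow> lcp u v = u"
  by (rule lcp_eqI) auto

lemma lcp_suffixes_in_nodes: "suffix u w \<Longrightarrow> suffix v w \<Longrightarrow> lcp u v \<in> nodes w"
  unfolding nodes_def by auto

lemma suffix_in_nodes: "suffix v w \<Longrightarrow> v \<in> nodes w"
  unfolding nodes_def by (metis (mono_tags, lifting) lcp_self mem_Collect_eq)

lemma Nil_in_nodes [simp]: "[] \<in> nodes w"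
  by (rule suffix_in_nodes) simp

lemma self_in_nodes [simp]: "w \<in> nodes w"
  by (rule suffix_in_nodes) simp

lemma finite_nodes [simp]: "finite (nodes w)"
proof -
  have "nodes w \<subseteq> (\<lambda>(u, v). lcp u v) ` (set (suffixes w) \<times> set (suffixes w))"
    unfolding nodes_def by (auto simp: image_iff)
  thus ?thesis by (rule finite_subset) simp
qed

lemma nodes_subset_factors: "z \<in> nodes w \<Longrightarrow> z \<in> factors w"
  unfolding nodes_def factors_def by (auto intro: longest_common_prefix_prefix1)

lemma Nil_in_factors [simp]: "[] \<in> factors w"
  by (simp add: nodes_subset_factors)

lemma prefix_in_factors: "u \<in> factors w \<Longrightarrow> prefix u' u \<Longrightarrow> u' \<in> factors w"
  unfolding factors_def using prefix_order.trans by blast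

lemma Cons_in_facD:
  assumes "c # u \<in> factors w"
  obtains v where "suffix (c # v) w" "suffix v w" "prefix u v"
proof -
  obtain v where "suffix v w" "prefix (c # u) v" using assms unfolding factors_def by auto
  then obtain v1 where "v = c # v1" "prefix u v1" by (cases v) auto
  thus thesis using that[of v1] \<open>suffix v w\<close> suffix_ConsD[of c v1 w] by simp
qed

lemma length_factors: "u \<in> factors w \<Longrightarrow> length u \<le> length w"
  unfolding factors_def by (auto dest!: prefix_length_le suffix_length_le)

text \<open>The fact behind suffix links: removing the common first letter from two suffixes leaves
  two suffixes that branch one letter earlier.\<close>

lemma tl_in_nodes: "c # y \<in> nodes w \<Longrightarrow> y \<in> nodes w"
proof -
  assume "c # y \<in> nodes w"
  then obtain u v where uv: "suffix u w" "suffix v w" "lcp u v = c # y" unfolding nodes_def by auto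
  then obtain u1 v1 where "u = c # u1" "v = c # v1" "lcp u1 v1 = y"
    by (cases u; cases v) (auto split: if_splits)
  thus ?thesis using uv unfolding nodes_def by (auto dest: suffix_ConsD)
qed

text \<open>Two incomparable nodes are prefixes of two suffixes that separate where the nodes do, so
  their \<open>lcp\<close> is that of these suffixes.\<close>

lemma lcp_in_nodes:
  assumes "z1 \<in> nodes w" "z2 \<in> nodes w"
  shows "lcp z1 z2 \<in> nodes w"
proof (cases "prefix z1 z2 \<or> prefix z2 z1")
  case True
  thus ?thesis using assms lcp_absorb longest_common_prefix_commute by metis
next
  case False
  obtain u1 u2 where 1: "suffix u1 w" "suffix u2 w" "z1 = lcp u1 u2" using assms unfolding nodes_def by auto
  obtain v1 v2 where 2: "suffix v1 w" "suffix v2 w" "z2 = lcp v1 v2" using assms unfolding nodes_def by auto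
  have p: "prefix z1 u1" "prefix z2 v1" using 1 2 by (auto intro: longest_common_prefix_prefix1)
  have "lcp u1 v1 = lcp z1 z2"
  proof (rule lcp_eqI)
    show "prefix (lcp z1 z2) u1" "prefix (lcp z1 z2) v1"
      using p longest_common_prefix_prefix1 longest_common_prefix_prefix2 prefix_order.trans by metis+
  next
    fix y assume y: "prefix y u1" "prefix y v1"
    have "prefix y z1 \<or> prefix z1 y" "prefix y z2 \<or> prefix z2 y"
      using y p prefix_same_cases by metis+
    hence "prefix y z1 \<and> prefix y z2" using False prefix_same_cases[of z1 y z2] prefix_order.trans by metis
    thus "prefix y (lcp z1 z2)" by (auto intro: longest_common_prefix_max_prefix)
  qed
  thus ?thesis using 1 2 lcp_suffixes_in_nodes by metis
qed

lemma locus_eqI: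
  assumes "z \<in> F" "prefix u z" "\<And>z'. z' \<in> F \<Longrightarrow> prefix u z' \<Longrightarrow> prefix z z'"
  shows "locus F u = z"
  unfolding locus_def
proof (rule the_equality)
  show "z' = z" if "z' \<in> F \<and> prefix u z' \<and> (\<forall>z''\<in>F. prefix u z'' \<longrightarrow> prefix z' z'')" for z'
    using that assms by (meson prefix_order.antisym)
qed (use assms in blast)

text \<open>A shortest node extending \<open>u\<close> is the least one: its \<open>lcp\<close> with
  any other node extending \<open>u\<close> is again such a node, hence not shorter.\<close>

lemma locus:
  assumes "u \<in> factors w"
  shows "locus (nodes w) u \<in> nodes w" "prefix u (locus (nodes w) u)"
    "\<And>z. z \<in> nodes w \<Longrightarrow> prefix u z \<Longrightarrow> prefix (locus (nodes w) u) z"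
proof -
  obtain v where v: "v \<in> nodes w" "prefix u v" using assms suffix_in_nodes unfolding factors_def by auto
  define z where "z = arg_min length (\<lambda>z. z \<in> nodes w \<and> prefix u z)"
  have z: "z \<in> nodes w" "prefix u z"
    unfolding z_def using arg_min_natI[of "\<lambda>z. z \<in> nodes w \<and> prefix u z" v length] v by auto
  have least: "prefix z z'" if "z' \<in> nodes w" "prefix u z'" for z'
  proof -
    have "length z \<le> length (lcp z z')"
      unfolding z_def
      by (rule arg_min_nat_le) (use that z lcp_in_nodes longest_common_prefix_max_prefix
          in \<open>auto simp: z_def\<close>)
    moreover have p: "prefix (lcp z z') z" by (rule longest_common_prefix_prefix1)
    ultimately have "lcp z z' = z"
      by (metis not_equal_is_parallel prefix_length_prefix prefix_order.antisym prefix_order.refl)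
    thus ?thesis by (metis longest_common_prefix_prefix2)
  qed
  have "locus (nodes w) u = z" by (rule locus_eqI) (use z least in auto)
  thus "locus (nodes w) u \<in> nodes w" "prefix u (locus (nodes w) u)"
    "\<And>z. z \<in> nodes w \<Longrightarrow> prefix u z \<Longrightarrow> prefix (locus (nodes w) u) z" using z least by auto
qed

lemma locus_node: "z \<in> nodes w \<Longrightarrow> locus (nodes w) z = z"
  by (rule locus_eqI) auto

lemma locus_Nil [simp]: "locus (nodes w) [] = []"
  by (rule locus_node) simp

lemma finite_prefixes [simp]: "finite {u. prefix u x}"
proof -
  have "{u. prefix u x} = set (prefixes x)" by auto
  thus ?thesis by (metis List.finite_set)
qed

lemma longest_exists:
  assumes "finite A" "A \<noteq> {}"
  shows "\<exists>z\<in>A. \<forall>y\<in>A. length y \<le> length z"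
proof -
  have "Max (length ` A) \<in> length ` A" using assms by (intro Max_in) auto
  then obtain z where "z \<in> A" "length z = Max (length ` A)" by auto
  thus ?thesis using assms by (intro bexI[of _ z]) auto
qed

lemma parent_eqI:
  assumes "z \<in> F" "strict_prefix z x" "\<And>z'. z' \<in> F \<Longrightarrow> strict_prefix z' x \<Longrightarrow> prefix z' z"
  shows "parent F x = z"
  unfolding parent_def
proof (rule the_equality)
  show "z' = z" if "z' \<in> F \<and> strict_prefix z' x \<and> (\<forall>z''\<in>F. strict_prefix z'' x \<longrightarrow> prefix z'' z')" for z'
    using that assms by (meson prefix_order.antisym)
qed (use assms in blast)

lemma parent:
  assumes "[] \<in> F" "x \<noteq> []"
  shows "parent F x \<in> F" "strict_prefix (parent F x) x"
    "\<And>z. z \<in> F \<Longrightarrow> strict_prefix z x \<Longrightarrow> prefix z (parent F x)"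
proof -
  let ?A = "{z \<in> F. strict_prefix z x}"
  have fin: "finite ?A" by (rule finite_subset[of _ "{u. prefix u x}"]) (auto simp: strict_prefix_def)
  have ne: "?A \<noteq> {}" using assms by (auto simp: strict_prefix_def intro!: exI[of _ "[]"])
  obtain z where z: "z \<in> ?A" "\<forall>y\<in>?A. length y \<le> length z"
    using longest_exists[OF fin ne] by (elim bexE)
  have great: "prefix z' z" if "z' \<in> F" "strict_prefix z' x" for z'
    using z that by (intro prefix_length_prefix[of z' x z]) (auto simp: strict_prefix_def)
  have "parent F x = z" by (rule parent_eqI) (use z great in auto)
  thus "parent F x \<in> F" "strict_prefix (parent F x) x"
    "\<And>z. z \<in> F \<Longrightarrow> strict_prefix z x \<Longrightarrow> prefix z (parent F x)" using z great by auto
qed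

text \<open>Together with \<open>parent_locus\<close> this identifies the edges leaving a node
  \<open>x\<close> with the letters \<open>c\<close> for which \<open>x @ [c]\<close> is a factor;
  the memory can therefore store children by letter.\<close>

lemma locus_parent:
  assumes "y \<in> nodes w" "y \<noteq> []"
  defines "x \<equiv> parent (nodes w) y"
  shows "length x < length y" "x @ [y ! length x] \<in> factors w" "locus (nodes w) (x @ [y ! length x]) = y"
proof -
  have x: "x \<in> nodes w" "strict_prefix x y" "\<And>z. z \<in> nodes w \<Longrightarrow> strict_prefix z y \<Longrightarrow> prefix z x"
    unfolding x_def using parent[of "nodes w" y] assms(1,2) by auto
  obtain c r where y: "y = x @ c # r" using x(2) by (elim strict_prefixE')
  show "length x < length y" using y by simp
  show f: "x @ [y ! length x] \<in> factors w"
    by (rule prefix_in_factors[OF nodes_subset_factors[OF assms(1)]]) (simp add: y)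
  let ?l = "locus (nodes w) (x @ [y ! length x])"
  have l: "?l \<in> nodes w" "prefix (x @ [y ! length x]) ?l" "prefix ?l y"
    using locus(1,2)[OF f] locus(3)[OF f assms(1)] y by auto
  show "?l = y"
  proof (rule ccontr)
    assume "?l \<noteq> y"
    hence "strict_prefix ?l y" using l(3) by (simp add: strict_prefix_def)
    hence "prefix ?l x" by (rule x(3)[OF l(1)])
    hence "length ?l \<le> length x" by (rule prefix_length_le)
    thus False using prefix_length_le[OF l(2)] by simp
  qed
qed

lemma parent_locus:
  assumes "x \<in> nodes w" "x @ [c] \<in> factors w"
  defines "y \<equiv> locus (nodes w) (x @ [c])"
  shows "y \<in> nodes w" "y \<noteq> []" "parent (nodes w) y = x" "y ! length x = c" "length x < length y"
proof -
  have y: "y \<in> nodes w" "prefix (x @ [c]) y" "\<And>z. z \<in> nodes w \<Longrightarrow> prefix (x @ [c]) z \<Longrightarrow> prefix y z"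
    unfolding y_def using locus[OF assms(2)] by auto
  show "y \<in> nodes w" "y \<noteq> []" "y ! length x = c" "length x < length y"
    using y by (auto simp: prefix_def)
  show "parent (nodes w) y = x"
  proof (rule parent_eqI)
    show "strict_prefix x y" using y(2) by (auto simp: strict_prefix_def prefix_def)
  next
    fix z assume z: "z \<in> nodes w" "strict_prefix z y"
    have "\<not> prefix (x @ [c]) z"
    proof
      assume "prefix (x @ [c]) z"
      hence "prefix y z" using z y(3) by blast
      thus False using z(2) by (simp add: prefix_order.less_le_not_le)
    qed
    hence "prefix z (x @ [c])" "z \<noteq> x @ [c]"
      using prefix_same_cases[of z y "x @ [c]"] z y(2) by (auto simp: strict_prefix_def)
    thus "prefix z x" by simp
  qed (use assms in auto)
qed

text \<open>A word and its locus start at the same positions of the text, so the same letters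
  precede them. This justifies copying the transitions of the old locus when an edge is
  split.\<close>

lemma extend_locus:
  assumes "u \<in> factors w"
  defines "z \<equiv> locus (nodes w) u"
  shows "c # u \<in> factors w \<longleftrightarrow> c # z \<in> factors w"
    "c # u \<in> factors w \<Longrightarrow> locus (nodes w) (c # u) = locus (nodes w) (c # z)"
proof -
  note lcu = locus[OF assms(1), folded z_def]
  show iff: "c # u \<in> factors w \<longleftrightarrow> c # z \<in> factors w"
  proof
    assume "c # u \<in> factors w"
    then obtain v where "suffix (c # v) w" "suffix v w" "prefix u v" by (erule Cons_in_facD)
    thus "c # z \<in> factors w" using lcu(3)[of v] by (auto simp: factors_def suffix_in_nodes)
  next
    assume "c # z \<in> factors w"
    thus "c # u \<in> factors w" by (rule prefix_in_factors) (use lcu in auto)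
  qed
  assume cu: "c # u \<in> factors w"
  obtain y where y: "locus (nodes w) (c # u) = c # y" "prefix u y"
    using locus(2)[OF cu] by (cases "locus (nodes w) (c # u)") auto
  hence "y \<in> nodes w" using locus(1)[OF cu] tl_in_nodes by metis
  hence "prefix z y" using y lcu by auto
  show "locus (nodes w) (c # u) = locus (nodes w) (c # z)"
  proof (rule locus_eqI[symmetric])
    show "prefix (c # z) (locus (nodes w) (c # u))" using y \<open>prefix z y\<close> by simp
    show "prefix (locus (nodes w) (c # u)) z'" if "z' \<in> nodes w" "prefix (c # z) z'" for z'
    proof (rule locus(3)[OF cu])
      show "prefix (c # u) z'" using that lcu(2) by (metis Cons_prefix_Cons prefix_order.trans)
    qed (use that in auto)
  qed (use locus[OF cu] in auto)
qed

subsection \<open>Prepending a letter\<close>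

text \<open>McCreight's head: the longest prefix of the new text that occurs in the old one, which
  is where the new leaf branches off.\<close>

definition head :: "nat \<Rightarrow> nat list \<Rightarrow> nat list \<Rightarrow> bool" where
  "head a w m \<longleftrightarrow> prefix m (a # w) \<and> (\<forall>u. prefix u (a # w) \<longrightarrow> (u \<in> factors w \<longleftrightarrow> prefix u m))"

lemma head_exists: "\<exists>m. head a w m"
proof -
  let ?A = "{u \<in> factors w. prefix u (a # w)}"
  have fin: "finite ?A" by (rule finite_subset[of _ "{u. prefix u (a # w)}"]) auto
  have ne: "?A \<noteq> {}" by (auto intro!: exI[of _ "[]"])
  obtain z where z: "z \<in> ?A" "\<forall>y\<in>?A. length y \<le> length z"
    using longest_exists[OF fin ne] by (elim bexE)
  have "head a w z"
    unfolding head_def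
  proof (intro conjI allI impI iffI)
    fix u assume u: "prefix u (a # w)"
    { assume "u \<in> factors w"
      thus "prefix u z" using z u by (intro prefix_length_prefix[of u "a # w" z]) auto }
    { assume "prefix u z"
      thus "u \<in> factors w" using z prefix_in_factors by auto }
  qed (use z in auto)
  thus ?thesis ..
qed

lemma factors_Cons: "factors (a # w) = factors w \<union> {u. prefix u (a # w)}"
  unfolding factors_def by (auto simp: suffix_Cons)

context
  fixes a w m
  assumes head: "head a w m"
begin

lemma head_in_factors: "m \<in> factors w" and head_prefix: "prefix m (a # w)"
  and head_iff: "prefix u (a # w) \<Longrightarrow> u \<in> factors w \<longleftrightarrow> prefix u m"
  using head unfolding head_def by auto

lemma length_head: "length m \<le> length w"
  using length_factors[OF head_in_factors] .

text \<open>If the head occurs in \<open>w\<close> as a prefix of the suffix \<open>a # v\<close>,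
  then \<open>w\<close> and \<open>v\<close> agree exactly on the tail of the head: a longer
  agreement would give a longer head. The tail is thus a node, and the climb from \<open>w\<close>
  cannot miss the head.\<close>

lemma head_cases:
  assumes "m \<noteq> []"
  obtains x where "m = a # x" "x \<in> nodes w" "prefix x w"
proof -
  obtain x where x: "m = a # x" "prefix x w" using head_prefix assms by (cases m) auto
  then obtain v where v: "suffix (a # v) w" "suffix v w" "prefix x v"
    using head_in_factors by (auto elim: Cons_in_facD)
  have "lcp w v = x"
  proof (rule lcp_eqI)
    fix y assume y: "prefix y w" "prefix y v"
    hence "a # y \<in> factors w" using v by (auto simp: factors_def)
    thus "prefix y x" using head_iff[of "a # y"] y x by simp
  qed (use x v in auto)
  thus thesis using x v that[of x] lcp_suffixes_in_nodes[of w w v] by simp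
qed

text \<open>A new branching pairs \<open>a # w\<close> with an old suffix \<open>v\<close>. If
  \<open>v\<close> extends the head, they separate at the head; otherwise \<open>v\<close> leaves
  the head earlier, and the old suffix \<open>v0\<close> that extends the head separates from
  \<open>v\<close> at the same point.\<close>

lemma nodes_Cons: "nodes (a # w) = nodes w \<union> {a # w, m}"
proof
  obtain v0 where v0: "suffix v0 w" "prefix m v0" using head_in_factors unfolding factors_def by auto
  have "lcp (a # w) v0 = m"
  proof (rule lcp_eqI)
    fix y assume y: "prefix y (a # w)" "prefix y v0"
    hence "y \<in> factors w" using v0 by (auto simp: factors_def)
    thus "prefix y m" using head_iff y by simp
  qed (use v0 head_prefix in auto)
  hence "m \<in> nodes (a # w)" using v0 lcp_suffixes_in_nodes[of "a # w" "a # w" v0] by (simp add: suffix_Cons)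
  moreover have "nodes w \<subseteq> nodes (a # w)" unfolding nodes_def by (auto simp: suffix_Cons)
  ultimately show "nodes w \<union> {a # w, m} \<subseteq> nodes (a # w)" by auto
  have *: "lcp (a # w) v \<in> nodes w \<union> {m}" if v: "suffix v w" for v
  proof (cases "prefix m v")
    case True
    have "prefix (lcp (a # w) v) m"
      using v head_iff[of "lcp (a # w) v"] longest_common_prefix_prefix1[of "a # w" v]
        longest_common_prefix_prefix2[of "a # w" v] by (auto simp: factors_def)
    moreover have "prefix m (lcp (a # w) v)"
      using True head_prefix by (auto intro: longest_common_prefix_max_prefix)
    ultimately show ?thesis by (auto dest: prefix_order.antisym)
  next
    case False
    have "lcp (a # w) v = lcp v0 v"
    proof (rule lcp_eqI)
      have p: "prefix (lcp v0 v) v0" "prefix (lcp v0 v) v"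
        by (rule longest_common_prefix_prefix1 longest_common_prefix_prefix2)+
      hence "prefix (lcp v0 v) m"
        using v0 False prefix_same_cases[of "lcp v0 v" v0 m] prefix_order.trans by blast
      thus "prefix (lcp v0 v) (a # w)" using head_prefix prefix_order.trans by blast
      show "prefix (lcp v0 v) v" by fact
    next
      fix y assume y: "prefix y (a # w)" "prefix y v"
      hence "y \<in> factors w" using v by (auto simp: factors_def)
      hence "prefix y m" using head_iff y by simp
      hence "prefix y v0" using v0 prefix_order.trans by blast
      thus "prefix y (lcp v0 v)" using y by (auto intro: longest_common_prefix_max_prefix)
    qed
    thus ?thesis using v v0 lcp_suffixes_in_nodes by simp
  qed
  show "nodes (a # w) \<subseteq> nodes w \<union> {a # w, m}"
  proof
    fix z assume "z \<in> nodes (a # w)"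
    then obtain u v where uv: "z = lcp u v" "suffix u (a # w)" "suffix v (a # w)"
      unfolding nodes_def by auto
    show "z \<in> nodes w \<union> {a # w, m}"
    proof (cases "u = a # w"; cases "v = a # w")
      assume "u = a # w" "v = a # w" thus ?thesis using uv by simp
    next
      assume "u = a # w" "v \<noteq> a # w" thus ?thesis using uv * by (auto simp: suffix_Cons)
    next
      assume "u \<noteq> a # w" "v = a # w"
      thus ?thesis using uv *[of u] longest_common_prefix_commute[of u v] by (auto simp: suffix_Cons)
    next
      assume "u \<noteq> a # w" "v \<noteq> a # w"
      thus ?thesis using uv lcp_suffixes_in_nodes by (simp add: suffix_Cons)
    qed
  qed
qed

lemma Cons_notin_nodes: "a # w \<notin> nodes w"
  using nodes_subset_factors length_factors by fastforce

lemma head_neq: "m \<noteq> a # w"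
  using length_head by auto

lemma not_prefix_node: "z \<in> nodes w \<Longrightarrow> \<not> prefix (a # w) z"
  using nodes_subset_factors length_factors prefix_length_le by fastforce

text \<open>Inserting the head cuts the edge that ends in its old locus. Only words on the upper
  piece of that edge change their locus.\<close>

lemma locus_Cons_old:
  assumes "u \<in> factors w"
  shows "locus (nodes (a # w)) u =
    (if prefix u m \<and> locus (nodes w) u = locus (nodes w) m then m else locus (nodes w) u)"
proof (cases "prefix u m \<and> locus (nodes w) u = locus (nodes w) m")
  case True
  have "prefix m z" if "z \<in> nodes (a # w)" "prefix u z" for z
    using that True locus[OF assms] locus[OF head_in_factors] head_prefix nodes_Cons
    by (metis UnE insertE prefix_order.refl prefix_order.trans singletonD)
  thus ?thesis using True nodes_Cons by (auto intro!: locus_eqI)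
next
  case False
  let ?l = "locus (nodes w) u"
  have m: "prefix ?l m" if "prefix u m"
  proof -
    have "prefix ?l (locus (nodes w) m)"
      using locus[OF assms] locus[OF head_in_factors] that prefix_order.trans by metis
    moreover have "\<not> prefix m ?l"
    proof
      assume "prefix m ?l"
      hence "prefix (locus (nodes w) m) ?l" using locus[OF assms] locus[OF head_in_factors] by blast
      thus False using False that calculation by (auto dest: prefix_order.antisym)
    qed
    ultimately show ?thesis using locus(2)[OF head_in_factors] prefix_same_cases by blast
  qed
  have "prefix ?l z" if z: "z \<in> nodes (a # w)" "prefix u z" for z
  proof -
    consider "z \<in> nodes w" | "z = m" | "z = a # w" using z nodes_Cons by auto
    thus ?thesis
    proof cases
      case 1 thus ?thesis using locus[OF assms] z by blast
    next
      case 2 thus ?thesis using m z by blast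
    next
      case 3
      hence "prefix u m" using z assms head_iff by blast
      thus ?thesis using m 3 head_prefix prefix_order.trans by blast
    qed
  qed
  thus ?thesis using False locus[OF assms] nodes_Cons by (auto intro!: locus_eqI)
qed

lemma locus_Cons_new:
  assumes "prefix u (a # w)" "u \<notin> factors w"
  shows "locus (nodes (a # w)) u = a # w"
proof (rule locus_eqI)
  fix z assume z: "z \<in> nodes (a # w)" "prefix u z"
  have "z \<notin> factors w" using z assms prefix_in_factors by blast
  thus "prefix (a # w) z" using z nodes_Cons nodes_subset_factors head_in_factors by auto
qed (use assms in auto)

text \<open>Only the lower end of the cut edge receives a new parent; its old one is inherited by
  the head (\<open>parent_Cons_head\<close>).\<close>

lemma parent_Cons_old:
  assumes "x \<in> nodes w" "x \<noteq> []"
  shows "parent (nodes (a # w)) x = (if x = locus (nodes w) m \<and> x \<noteq> m then m else parent (nodes w) x)"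
proof (cases "x = locus (nodes w) m \<and> x \<noteq> m")
  case True
  have mx: "strict_prefix m x" using True locus(2)[OF head_in_factors] by (auto simp: strict_prefix_def)
  have "parent (nodes (a # w)) x = m"
  proof (rule parent_eqI)
    fix z assume z: "z \<in> nodes (a # w)" "strict_prefix z x"
    hence "z \<in> nodes w \<or> z = m"
      using nodes_Cons not_prefix_node[OF assms(1)] by (auto simp: strict_prefix_def)
    moreover have "prefix z m" if "z \<in> nodes w"
    proof -
      have "\<not> prefix m z" using that locus(3)[OF head_in_factors, of z] True z
        by (meson prefix_order.less_le_not_le)
      thus ?thesis using z mx prefix_same_cases[of z x m] by (auto simp: strict_prefix_def)
    qed
    ultimately show "prefix z m" by auto
  qed (use mx nodes_Cons in auto)
  thus ?thesis by (simp only: if_P[OF True])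
next
  case False
  note p = parent[of "nodes w" x, OF _ assms(2)]
  have m: "prefix m (parent (nodes w) x)" if "strict_prefix m x"
  proof -
    have l: "prefix (locus (nodes w) m) x" using locus(3)[OF head_in_factors assms(1)] that
      by (auto simp: strict_prefix_def)
    have "x \<noteq> m" using that by auto
    hence "strict_prefix (locus (nodes w) m) x" using l False by (auto simp: strict_prefix_def)
    hence "prefix (locus (nodes w) m) (parent (nodes w) x)" using p locus(1)[OF head_in_factors] by auto
    thus ?thesis using locus(2)[OF head_in_factors] prefix_order.trans by blast
  qed
  have "parent (nodes (a # w)) x = parent (nodes w) x"
  proof (rule parent_eqI)
    fix z assume z: "z \<in> nodes (a # w)" "strict_prefix z x"
    hence "z \<in> nodes w \<or> z = m"
      using nodes_Cons not_prefix_node[OF assms(1)] by (auto simp: strict_prefix_def)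
    thus "prefix z (parent (nodes w) x)" using p z m by auto
  qed (use p nodes_Cons in auto)
  thus ?thesis by (simp only: if_not_P[OF False])
qed

lemma parent_Cons_self: "parent (nodes (a # w)) (a # w) = m"
proof (rule parent_eqI)
  fix z assume z: "z \<in> nodes (a # w)" "strict_prefix z (a # w)"
  hence "z \<in> factors w" using nodes_Cons nodes_subset_factors head_in_factors by auto
  thus "prefix z m" using head_iff z by (auto simp: strict_prefix_def)
qed (use nodes_Cons head_prefix head_neq in \<open>auto simp: strict_prefix_def\<close>)

lemma parent_Cons_head:
  assumes "m \<notin> nodes w"
  shows "parent (nodes (a # w)) m = parent (nodes w) (locus (nodes w) m)"
proof -
  let ?l = "locus (nodes w) m"
  have "m \<noteq> []" using assms by auto
  hence "?l \<noteq> []" using locus(2)[OF head_in_factors] by auto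
  note p = parent[of "nodes w" ?l, OF _ this]
  have ml: "strict_prefix m ?l" using locus[OF head_in_factors] assms by (auto simp: strict_prefix_def)
  have "strict_prefix z m" if z: "z \<in> nodes w" "strict_prefix z ?l" for z
  proof -
    have "\<not> prefix m z" using z locus(3)[OF head_in_factors, of z] by (meson prefix_order.less_le_not_le)
    thus ?thesis using z ml prefix_same_cases[of z ?l m] by (auto simp: strict_prefix_def)
  qed
  note below = this
  show ?thesis
  proof (rule parent_eqI)
    show "parent (nodes w) ?l \<in> nodes (a # w)" using p(1) nodes_Cons by simp
    show "strict_prefix (parent (nodes w) ?l) m" using below p(1,2) by simp
  next
    fix z assume z: "z \<in> nodes (a # w)" "strict_prefix z m"
    have "z \<noteq> a # w"
      using z(2) length_head by (auto dest: prefix_length_less)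
    hence "z \<in> nodes w" using z nodes_Cons by auto
    moreover have "strict_prefix z ?l" using z(2) ml by (rule prefix_order.less_trans)
    ultimately show "prefix z (parent (nodes w) ?l)" using p(3) by simp
  qed
qed

text \<open>The nodes visited while \<open>a\<close> is prepended, each of them coded by the word that the transition
  with \<open>a\<close> leads to; the empty word codes the sentinel above the root.\<close>

definition chain :: "nat list set" where
  "chain = {u. prefix u (a # w) \<and> (u = [] \<or> tl u \<in> nodes w)}"

text \<open>One \<open>Link\<close> upwards in this coding: the root is coded by \<open>[a]\<close>,
  and above it comes the sentinel.\<close>

definition up :: "nat list \<Rightarrow> nat list" where
  "up u = (if tl u = [] then [] else a # parent (nodes w) (tl u))"

lemma finite_chain [simp]: "finite chain"
  by (rule finite_subset[of _ "{u. prefix u (a # w)}"]) (auto simp: chain_def)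

lemma chain_linear: "u \<in> chain \<Longrightarrow> v \<in> chain \<Longrightarrow> length u \<le> length v \<Longrightarrow> prefix u v"
  unfolding chain_def by (auto intro: prefix_length_prefix)

lemma head_in_chain: "m \<in> chain"
proof (cases "m = []")
  case False
  then obtain x where "m = a # x" "x \<in> nodes w" "prefix x w" by (rule head_cases)
  thus ?thesis by (simp add: chain_def)
qed (simp add: chain_def)

lemma Cons_in_chain: "a # w \<in> chain"
  by (simp add: chain_def)

text \<open>By the second claim no element of the chain is skipped, so the elements left behind by a
  climb are exactly those longer than the present one and can be counted.\<close>

lemma up:
  assumes "u \<in> chain" "u \<noteq> []"
  shows "up u \<in> chain" "{v \<in> chain. length (up u) < length v} = insert u {v \<in> chain. length u < length v}"
    "length (up u) < length u"
proof -
  obtain y where y: "u = a # y" "y \<in> nodes w" "prefix y w" using assms unfolding chain_def by (cases u) auto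
  have 1: "up u \<in> chain \<and> length (up u) < length u \<and>
      (\<forall>v\<in>chain. length v < length u \<longrightarrow> length v \<le> length (up u))"
  proof (cases "y = []")
    case True
    thus ?thesis using y by (simp add: up_def chain_def)
  next
    case False
    let ?p = "parent (nodes w) y"
    note p = parent[OF Nil_in_nodes False]
    have uu: "up u = a # ?p" using y False by (simp add: up_def)
    have "length v \<le> length (up u)" if "v \<in> chain" "length v < length u" for v
    proof (cases v)
      case (Cons b z)
      hence z: "z \<in> nodes w" "prefix z w" "length z < length y" using that y unfolding chain_def by auto
      have "prefix z y" using z(3) by (intro prefix_length_prefix[OF z(2) y(3)]) simp
      hence "strict_prefix z y" using z(3) by (auto simp: strict_prefix_def)
      hence "prefix z ?p" by (rule p(3)[OF z(1)])
      hence "length z \<le> length ?p" by (rule prefix_length_le)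
      thus ?thesis using Cons uu by simp
    qed simp
    moreover have "prefix ?p w"
      using prefix_order.trans[OF _ y(3)] p(2) by (simp add: strict_prefix_def)
    moreover have "length ?p < length y" using p(2) by (rule prefix_length_less)
    ultimately show ?thesis using p(1) y(1) uu by (simp add: chain_def)
  qed
  thus "up u \<in> chain" "length (up u) < length u" by auto
  have "v = u" if "v \<in> chain" "length v = length u" for v
    using chain_linear[of u v] chain_linear[of v u] that assms by (auto dest: prefix_order.antisym)
  hence "v \<in> chain \<and> length (up u) < length v \<longleftrightarrow> v = u \<or> v \<in> chain \<and> length u < length v" for v
    using 1 assms(1) by (metis leD linorder_neqE_nat order_less_trans)
  thus "{v \<in> chain. length (up u) < length v} = insert u {v \<in> chain. length u < length v}" by auto
qed

text \<open>On the chain, being a factor is a matter of length. This turns the test of the first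
  climb into a comparison with the head.\<close>

lemma chain_factors: "u \<in> chain \<Longrightarrow> u \<in> factors w \<longleftrightarrow> length u \<le> length m"
  using head_iff[of u] chain_linear[OF _ head_in_chain, of u] unfolding chain_def
  by (auto dest: prefix_length_le)

end

definition depth :: "nat list \<Rightarrow> nat" where
  "depth w = card {y \<in> nodes w. prefix y w}"

lemma tl_in_nodes_Cons: "c # y \<in> nodes (a # w) \<Longrightarrow> y \<in> nodes w"
proof -
  assume "c # y \<in> nodes (a # w)"
  then obtain u v where uv: "suffix u (a # w)" "suffix v (a # w)" "lcp u v = c # y"
    unfolding nodes_def by auto
  then obtain u1 v1 where uv1: "u = c # u1" "v = c # v1" "lcp u1 v1 = y"
    by (cases u; cases v) (auto split: if_splits)
  hence "suffix u1 w" "suffix v1 w" using uv by (auto simp: suffix_Cons dest: suffix_ConsD)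
  thus ?thesis using uv1 unfolding nodes_def by auto
qed

text \<open>The set \<open>A\<close> of visited elements and the set of nodes that are prefixes of
  \<open>a # w\<close> both lie in the chain, which has \<open>depth w + 1\<close> elements, the
  extra one being the sentinel. They share at most the head and the new text, which gives the
  constant 3 = 1 + 2.\<close>

lemma chain_potential:
  assumes "head a w m" "A \<subseteq> chain a w" "A \<inter> nodes (a # w) \<subseteq> {m, a # w}"
  shows "card A + depth (a # w) \<le> depth w + 3"
proof -
  let ?B = "{y \<in> nodes (a # w). prefix y (a # w)}"
  have B: "?B \<subseteq> chain a w"
  proof
    fix y assume y: "y \<in> ?B"
    show "y \<in> chain a w"
      using y by (cases y) (auto simp: chain_def[OF assms(1)] dest: tl_in_nodes_Cons)
  qed
  note fin = finite_chain[OF assms(1)]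
  have "chain a w = insert [] ((#) a ` {y \<in> nodes w. prefix y w})"
    unfolding chain_def[OF assms(1)] by (auto simp: image_iff prefix_Cons)
  hence "card (chain a w) = depth w + 1"
    by (simp add: card_insert_if image_iff card_image depth_def)
  moreover have "card (A \<union> ?B) \<le> card (chain a w)" using assms(2) B fin by (intro card_mono) auto
  moreover have "card (A \<inter> ?B) \<le> card {m, a # w}" using assms(3) by (intro card_mono) auto
  moreover have "card {m, a # w} \<le> 2" by (simp add: card_insert_if)
  moreover have "card A + card ?B = card (A \<union> ?B) + card (A \<inter> ?B)"
    using finite_subset[OF assms(2) fin] by (intro card_Un_Int) auto
  ultimately show ?thesis by (simp add: depth_def)
qed

section \<open>Runs and changes\<close>

fun changes :: "'a list \<Rightarrow> nat" where
  "changes (x # y # xs) = of_bool (x \<noteq> y) + changes (y # xs)"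
| "changes _ = 0"

lemma changes_eq_sum: "changes xs = (\<Sum>i<length xs - 1. of_bool (xs ! i \<noteq> xs ! Suc i))"
proof (induction xs rule: changes.induct)
  case (1 x y xs)
  have "(\<Sum>i<length (x # y # xs) - 1. of_bool ((x # y # xs) ! i \<noteq> (x # y # xs) ! Suc i)) =
      (\<Sum>i<Suc (length xs). of_bool ((x # y # xs) ! i \<noteq> (y # xs) ! i))" by simp
  also have "\<dots> = of_bool (x \<noteq> y) + (\<Sum>i<length xs. of_bool ((y # xs) ! i \<noteq> xs ! i) :: nat)"
    by (subst sum.lessThan_Suc_shift) simp
  finally show ?case using 1 by simp
qed auto

text \<open>A run is determined by its first position, and the first positions are 0 and those right
  behind a change. Minimising runs thus means minimising changes, which are additive up to the
  joints of a concatenation.\<close>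

lemma num_runs_eq_changes:
  assumes "xs \<noteq> []"
  shows "num_runs xs = changes xs + 1"
proof -
  let ?S = "{i. i < length xs \<and> (i = 0 \<or> xs ! (i - 1) \<noteq> xs ! i)}"
  have inj: "inj_on fst (runs xs)"
  proof (rule inj_onI)
    have *: False if r: "(i, j) \<in> runs xs" "(i, j') \<in> runs xs" "j < j'" for i j j'
    proof -
      have 1: "i \<le> j" "\<forall>k\<in>{i..j}. xs ! k = xs ! i" "Suc j = length xs \<or> xs ! Suc j \<noteq> xs ! j"
        using r(1) unfolding runs_def mem_Collect_eq prod.case by blast+
      have 2: "j' < length xs" "\<forall>k\<in>{i..j'}. xs ! k = xs ! i"
        using r(2) unfolding runs_def mem_Collect_eq prod.case by blast+
      have "xs ! j = xs ! i" using 1(1,2) by (meson atLeastAtMost_iff order_refl)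
      moreover have "Suc j \<in> {i..j'}" using 1(1) r(3) by simp
      hence "xs ! Suc j = xs ! i" using 2(2) by blast
      ultimately show False using 1(3) 2(1) r(3) by simp
    qed
    fix a b assume "a \<in> runs xs" "b \<in> runs xs" "fst a = fst b"
    thus "a = b" using *[of "fst a" "snd a" "snd b"] *[of "fst a" "snd b" "snd a"]
      by (metis linorder_neqE_nat prod.collapse)
  qed
  have "fst ` runs xs = ?S"
  proof
    show "fst ` runs xs \<subseteq> ?S"
    proof
      fix i assume "i \<in> fst ` runs xs"
      then obtain j where "(i, j) \<in> runs xs" by auto
      hence "i \<le> j" "j < length xs" "i = 0 \<or> xs ! (i - 1) \<noteq> xs ! i"
        unfolding runs_def mem_Collect_eq prod.case by blast+
      thus "i \<in> ?S" by simp
    qed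
    show "?S \<subseteq> fst ` runs xs"
    proof
      fix i assume i: "i \<in> ?S"
      let ?J = "{j. i \<le> j \<and> j < length xs \<and> (\<forall>k\<in>{i..j}. xs ! k = xs ! i)}"
      have fin: "finite ?J" by (rule finite_subset[of _ "{..<length xs}"]) auto
      have "i \<in> ?J" using i by auto
      define j where "j = Max ?J"
      have j: "j \<in> ?J" unfolding j_def using fin \<open>i \<in> ?J\<close> by (intro Max_in) auto
      hence jj: "i \<le> j" "j < length xs" "\<forall>k\<in>{i..j}. xs ! k = xs ! i" by blast+
      have "Suc j \<notin> ?J"
      proof
        assume "Suc j \<in> ?J"
        with fin have "Suc j \<le> Max ?J" by (rule Max_ge)
        thus False unfolding j_def[symmetric] by simp
      qed
      hence "Suc j = length xs \<or> xs ! Suc j \<noteq> xs ! j"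
      proof -
        have eq: "xs ! j = xs ! i" using jj(1,3) by (meson atLeastAtMost_iff order_refl)
        have "\<not> (Suc j < length xs \<and> xs ! Suc j = xs ! i)"
        proof
          assume a: "Suc j < length xs \<and> xs ! Suc j = xs ! i"
          have h: "\<forall>k\<in>{i..Suc j}. xs ! k = xs ! i"
          proof
            fix k assume k: "k \<in> {i..Suc j}"
            show "xs ! k = xs ! i"
            proof (cases "k = Suc j")
              case True
              thus ?thesis using a by blast
            next
              case False
              hence "k \<in> {i..j}" using k by simp
              thus ?thesis using jj(3) by blast
            qed
          qed
          have le: "i \<le> Suc j" using jj(1) by simp
          have "Suc j \<in> ?J" unfolding mem_Collect_eq using le h a by (iprover intro: conjI elim: conjE)
          thus False by (rule \<open>Suc j \<notin> ?J\<close>[THEN notE])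
        qed
        thus ?thesis using jj(2) unfolding eq by (metis Suc_lessI)
      qed
      moreover have "i = 0 \<or> xs ! (i - 1) \<noteq> xs ! i" using i by blast
      ultimately have "(i, j) \<in> runs xs" using jj unfolding runs_def mem_Collect_eq prod.case by blast
      thus "i \<in> fst ` runs xs" by (rule image_eqI[rotated]) simp
    qed
  qed
  hence "num_runs xs = card ?S" unfolding num_runs_def using card_image[OF inj] by simp
  also have "\<dots> = (\<Sum>i<length xs. of_bool (i = 0 \<or> xs ! (i - 1) \<noteq> xs ! i))"
    by (simp add: of_bool_def sum.If_cases lessThan_def Collect_conj_eq Int_commute)
  also have "\<dots> = (\<Sum>i<Suc (length xs - 1). of_bool (i = 0 \<or> xs ! (i - 1) \<noteq> xs ! i))"
    using assms by simp
  also have "\<dots> = changes xs + 1"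
    by (subst sum.lessThan_Suc_shift) (simp add: changes_eq_sum)
  finally show ?thesis .
qed

subsection \<open>First and last symbols\<close>

type_synonym ends = "(nat \<times> nat) option"

text \<open>\<open>None\<close>, for the empty part, is needed because some letters do not continue
  a given context.\<close>

definition ends_of :: "nat list \<Rightarrow> ends" where
  "ends_of xs = (if xs = [] then None else Some (hd xs, last xs))"

fun join :: "ends \<Rightarrow> ends \<Rightarrow> ends" where
  "join None t = t"
| "join t None = t"
| "join (Some (a, b)) (Some (c, d)) = Some (a, d)"

fun joint :: "ends \<Rightarrow> ends \<Rightarrow> nat" where
  "joint (Some (a, b)) (Some (c, d)) = of_bool (b \<noteq> c)"
| "joint _ _ = 0"

primrec join_list :: "ends list \<Rightarrow> ends" where
  "join_list [] = None"
| "join_list (t # ts) = join t (join_list ts)"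

primrec joint_list :: "ends list \<Rightarrow> nat" where
  "joint_list [] = 0"
| "joint_list (t # ts) = joint t (join_list ts) + joint_list ts"

lemma ends_of_Nil [simp]: "ends_of [] = None"
  by (simp add: ends_of_def)

lemma join_None [simp]: "join t None = t"
  by (cases t) auto

lemma ends_of_append: "ends_of (xs @ ys) = join (ends_of xs) (ends_of ys)"
  by (simp add: ends_of_def)

lemma changes_Cons: "ys \<noteq> [] \<Longrightarrow> changes (x # ys) = of_bool (x \<noteq> hd ys) + changes ys"
  by (cases ys) auto

lemma changes_append: "changes (xs @ ys) = changes xs + changes ys + joint (ends_of xs) (ends_of ys)"
proof (cases "ys = []")
  case False
  show ?thesis
  proof (induction xs)
    case (Cons x xs)
    show ?case
    proof (cases "xs = []")
      case True
      thus ?thesis using False by (simp add: changes_Cons ends_of_def)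
    next
      case xs: False
      thus ?thesis using False Cons by (simp add: changes_Cons ends_of_def)
    qed
  qed simp
qed simp

lemma ends_of_concat: "ends_of (concat xss) = join_list (map ends_of xss)"
  by (induction xss) (auto simp: ends_of_append)

lemma changes_concat: "changes (concat xss) = sum_list (map changes xss) + joint_list (map ends_of xss)"
  by (induction xss) (auto simp: changes_append ends_of_concat)

lemma changes_less_length: "xs \<noteq> [] \<Longrightarrow> changes xs < length xs"
  by (induction xs rule: changes.induct) auto

subsection \<open>Splitting the matrix at a context\<close>

lemma sorted_partition:
  "sorted (map f L) \<Longrightarrow> \<forall>y\<in>set L. f y \<le> N \<Longrightarrow>
    L = filter (\<lambda>y. f y < N) L @ filter (\<lambda>y. f y = N) L" for N :: nat
proof (induction L)
  case (Cons y L)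
  show ?case
  proof (cases "f y < N")
    case True
    thus ?thesis using Cons by simp
  next
    case False
    hence eq: "\<forall>z\<in>set (y # L). f z = N" using Cons.prems by fastforce
    hence "filter (\<lambda>y. f y < N) (y # L) = []" by (simp add: filter_empty_conv)
    moreover have "filter (\<lambda>y. f y = N) (y # L) = y # L" using eq by (intro filter_True)
    ultimately show ?thesis by (simp only: append_Nil)
  qed
qed simp

lemma sorted_concat_filter:
  "sorted (map f L) \<Longrightarrow> \<forall>y\<in>set L. f y < (N :: nat) \<Longrightarrow>
    L = concat (map (\<lambda>r. filter (\<lambda>y. f y = r) L) [0..<N])"
proof (induction N arbitrary: L)
  case (Suc N)
  let ?L = "filter (\<lambda>y. f y < N) L"
  have "sorted (map f ?L)" using Suc.prems(1) by (rule sorted_filter)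
  hence "?L = concat (map (\<lambda>r. filter (\<lambda>y. f y = r) ?L) [0..<N])" by (intro Suc.IH) auto
  also have "map (\<lambda>r. filter (\<lambda>y. f y = r) ?L) [0..<N] = map (\<lambda>r. filter (\<lambda>y. f y = r) L) [0..<N]"
    by (auto intro!: filter_cong)
  finally have "?L = concat (map (\<lambda>r. filter (\<lambda>y. f y = r) L) [0..<N])" .
  moreover have "L = ?L @ filter (\<lambda>y. f y = N) L"
    using Suc.prems by (intro sorted_partition) auto
  ultimately show ?case by simp
qed simp

lemma lcp_diff:
  assumes "prefix x u" "prefix x v" "length x < length u" "length x < length v"
    "u ! length x \<noteq> v ! length x"
  shows "lcp u v = x"
proof (rule lcp_eqI)
  fix y assume y: "prefix y u" "prefix y v"
  have "length y \<le> length x"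
  proof (rule ccontr)
    assume "\<not> length y \<le> length x"
    hence "y ! length x = u ! length x" "y ! length x = v ! length x"
      using y by (auto simp: prefix_def nth_append)
    thus False using assms by simp
  qed
  thus "prefix y x" using y assms prefix_length_prefix by blast
qed (use assms in auto)

definition rows :: "nat list \<Rightarrow> orderings \<Rightarrow> nat list \<Rightarrow> nat list list" where
  "rows s \<pi> x = filter (prefix x) (bwt_matrix \<pi> s)"

definition part :: "nat list \<Rightarrow> orderings \<Rightarrow> nat list \<Rightarrow> nat list" where
  "part s \<pi> x = map last (rows s \<pi> x)"

lemma prefix_snoc_iff:
  "length x < length R \<Longrightarrow> prefix (x @ [b]) R \<longleftrightarrow> prefix x R \<and> R ! length x = b"
proof
  assume "length x < length R" "prefix x R \<and> R ! length x = b"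
  then obtain z where "R = x @ z" "z \<noteq> []" "z ! 0 = b" by (auto simp: prefix_def nth_append)
  thus "prefix (x @ [b]) R" by (cases z) auto
qed (auto simp: prefix_def nth_append)

lemma sort_key_cong_on: "(\<And>x. x \<in> set xs \<Longrightarrow> f x = g x) \<Longrightarrow> sort_key f xs = sort_key g xs"
proof (induction xs)
  case (Cons x xs)
  have "insort_key f x ys = insort_key g x ys" if "set ys \<subseteq> set xs" for ys
    using that Cons.prems by (induction ys) auto
  thus ?case using Cons by simp
qed simp

lemma sort_key_permutation:
  assumes "p permutes {..<\<sigma>}"
  shows "map p (sort_key p [0..<\<sigma>]) = [0..<\<sigma>]"
proof (rule sorted_distinct_set_unique)
  have inj: "inj_on p {..<\<sigma>}" using permutes_inj[OF assms] by (rule inj_on_subset) simp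
  show "distinct (map p (sort_key p [0..<\<sigma>]))"
    using inj by (simp add: distinct_map atLeast0LessThan)
  show "set (map p (sort_key p [0..<\<sigma>])) = set [0..<\<sigma>]"
    using permutes_image[OF assms] by (simp add: atLeast0LessThan)
qed simp_all

locale input =
  fixes \<sigma> :: nat and s :: "nat list"
  assumes prim: "primitive s" and letters: "set s \<subseteq> {..<\<sigma>}"
begin

abbreviation "n \<equiv> length s"
abbreviation "W \<equiv> s @ s"
abbreviation "F \<equiv> nodes W"

lemma n_pos: "0 < n"
  using prim by (simp add: primitive_def)

lemma rotations_eq: "rotations s = (\<lambda>i. take n (drop i W)) ` {..<n}"
  unfolding rotations_def by (intro image_cong) (auto simp: rotate_drop_take)

lemma rotations: "R \<in> rotations s \<Longrightarrow> length R = n \<and> set R \<subseteq> {..<\<sigma>}"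
  using letters unfolding rotations_def by auto

text \<open>Two rows of the block that differ right behind \<open>x\<close> have \<open>x\<close> as
  longest common prefix, so only \<open>\<pi> x\<close> decides between them: the block is sorted by
  the rank of the next letter.\<close>

lemma rows_split:
  assumes "is_orderings \<sigma> \<pi>" "x \<in> lists {..<\<sigma>}" "length x < n"
  shows "rows s \<pi> x = concat (map (\<lambda>b. rows s \<pi> (x @ [b])) (sort_key (\<pi> x) [0..<\<sigma>]))"
proof -
  note M = bwt_matrix[OF assms(1) letters]
  have perm: "\<pi> x permutes {..<\<sigma>}" using assms(1,2) by (simp add: is_orderings_def)
  let ?f = "\<lambda>R. \<pi> x (R ! length x)"
  let ?L = "rows s \<pi> x"
  have mem: "R \<in> rotations s" "prefix x R" "length R = n" "set R \<subseteq> {..<\<sigma>}" if "R \<in> set ?L" for R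
    using that M rotations unfolding rows_def by auto
  have "sorted_wrt (\<lambda>u v. ?f u \<le> ?f v) ?L"
  proof (rule sorted_wrt_mono_rel)
    show "sorted_wrt (ctx_less \<pi>) ?L" unfolding rows_def using M(3) by (rule sorted_wrt_filter)
    fix u v assume uv: "u \<in> set ?L" "v \<in> set ?L" "ctx_less \<pi> u v"
    show "?f u \<le> ?f v"
    proof (cases "u ! length x = v ! length x")
      case False
      have "lcp u v = x" using mem uv assms(3) False by (intro lcp_diff) auto
      thus ?thesis using uv(3) by (simp add: ctx_less_def Let_def)
    qed simp
  qed
  hence "sorted (map ?f ?L)" by (simp add: sorted_wrt_map)
  moreover have "?f R < \<sigma>" if "R \<in> set ?L" for R
  proof -
    have "R ! length x \<in> {..<\<sigma>}" using mem[OF that] assms(3) nth_mem by (metis subsetD)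
    thus ?thesis using permutes_in_image[OF perm] by blast
  qed
  ultimately have "?L = concat (map (\<lambda>r. filter (\<lambda>y. ?f y = r) ?L) [0..<\<sigma>])"
    by (intro sorted_concat_filter) auto
  \<comment> \<open>Listing the ranks in order is the same as listing the ranks of the letters
    sorted by rank; this changes the index from ranks to letters.\<close>
  also have "\<dots> = concat (map (\<lambda>r. filter (\<lambda>y. ?f y = r) ?L) (map (\<pi> x) (sort_key (\<pi> x) [0..<\<sigma>])))"
    using sort_key_permutation[OF perm] by simp
  also have "\<dots> = concat (map (\<lambda>b. filter (\<lambda>y. ?f y = \<pi> x b) ?L) (sort_key (\<pi> x) [0..<\<sigma>]))"
    by (simp add: comp_def)
  also have "(\<lambda>b. filter (\<lambda>y. ?f y = \<pi> x b) ?L) = (\<lambda>b. rows s \<pi> (x @ [b]))"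
  proof
    fix b
    have inj: "\<pi> x c = \<pi> x b \<longleftrightarrow> c = b" for c using permutes_inj[OF perm] by (auto dest: injD)
    have "prefix (x @ [b]) R \<longleftrightarrow> prefix x R \<and> R ! length x = b" if "R \<in> set (bwt_matrix \<pi> s)" for R
      using that M(2) rotations assms(3) by (intro prefix_snoc_iff) auto
    thus "filter (\<lambda>y. ?f y = \<pi> x b) ?L = rows s \<pi> (x @ [b])"
      unfolding rows_def filter_filter inj by (intro filter_cong) auto
  qed
  finally show ?thesis .
qed

lemma factors_letters: "u \<in> factors W \<Longrightarrow> u \<in> lists {..<\<sigma>}"
proof -
  assume "u \<in> factors W"
  then obtain v where "suffix v W" "prefix u v" unfolding factors_def by blast
  hence "set u \<subseteq> set W" using set_mono_suffix set_mono_prefix by blast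
  thus ?thesis using letters by auto
qed

lemma factors_drop: "u \<in> factors W \<longleftrightarrow> (\<exists>i. prefix u (drop i W))"
proof
  assume "u \<in> factors W"
  then obtain v z where "W = z @ v" "prefix u v" unfolding factors_def suffix_def by blast
  hence "v = drop (length z) W" by simp
  thus "\<exists>i. prefix u (drop i W)" using \<open>prefix u v\<close> by blast
next
  show "u \<in> factors W" if "\<exists>i. prefix u (drop i W)" using that suffix_drop unfolding factors_def by blast
qed

text \<open>A row starting with \<open>y\<close> is a window of the text, and the suffix at its
  position also starts with the locus of \<open>y\<close>. The locus may be longer than a row, hence
  the cut to \<open>n\<close>.\<close>

lemma rows_child:
  assumes "is_orderings \<sigma> \<pi>" "length y \<le> n"
  shows "rows s \<pi> y = (if y \<in> factors W then rows s \<pi> (take n (locus F y)) else [])"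
proof (cases "y \<in> factors W")
  case True
  note l = locus[OF True]
  have "prefix y R \<longleftrightarrow> prefix (take n (locus F y)) R" if "R \<in> rotations s" for R
  proof -
    obtain i where i: "i < n" "R = take n (drop i W)" using \<open>R \<in> _\<close> unfolding rotations_eq by blast
    have R: "prefix R (drop i W)" "length R = n" using i by (auto simp: take_is_prefix)
    show ?thesis
    proof
      assume "prefix y R"
      hence "prefix y (drop i W)" using R prefix_order.trans by blast
      hence "prefix (locus F y) (drop i W)" by (intro l(3) suffix_in_nodes suffix_drop)
      hence "prefix (take n (locus F y)) (drop i W)" using take_is_prefix prefix_order.trans by blast
      thus "prefix (take n (locus F y)) R" by (rule prefix_length_prefix[OF _ R(1)]) (simp add: R(2))
    next
      assume R': "prefix (take n (locus F y)) R"
      obtain r where "locus F y = y @ r" using l(2) by (elim prefixE)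
      hence "prefix y (take n (locus F y))" using assms(2) by simp
      thus "prefix y R" using R' prefix_order.trans by blast
    qed
  qed
  thus ?thesis unfolding rows_def using True bwt_matrix(2)[OF assms(1) letters] by (auto intro!: filter_cong)
next
  case False
  have "\<not> prefix y R" if R: "R \<in> rotations s" for R
  proof
    assume "prefix y R"
    moreover obtain i where "R = take n (drop i W)" using R unfolding rotations_eq by blast
    ultimately have "prefix y (drop i W)" using take_is_prefix prefix_order.trans by metis
    thus False using False factors_drop by blast
  qed
  thus ?thesis unfolding rows_def using False bwt_matrix(2)[OF assms(1) letters]
    by (auto simp: filter_empty_conv)
qed

text \<open>The row is determined by \<open>n\<close> letters. An occurrence of so long a factor
  starts at position \<open>n\<close> at the latest, and position \<open>n\<close> yields the same
  window as position 0.\<close>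

lemma rows_leaf:
  assumes "is_orderings \<sigma> \<pi>" "x \<in> factors W" "n \<le> length x"
  shows "rows s \<pi> (take n x) = [take n x]"
proof -
  obtain i where i: "prefix x (drop i W)" using assms(2) factors_drop by blast
  hence "length x \<le> 2 * n - i" using prefix_length_le[OF i] by simp
  hence "i \<le> n" using assms(3) n_pos by linarith
  have t: "take n x = take n (drop i W)" using i assms(3) by (auto simp: prefix_def simp del: drop_append)
  have "take n x \<in> rotations s"
  proof (cases "i = n")
    case True
    hence "take n x = take n (drop 0 W)" using t by simp
    thus ?thesis unfolding rotations_eq using n_pos by blast
  next
    case False
    thus ?thesis unfolding rotations_eq using t \<open>i \<le> n\<close> by simp
  qed
  moreover note M = bwt_matrix[OF assms(1) letters]
  moreover have "prefix (take n x) R \<longleftrightarrow> R = take n x" if "R \<in> rotations s" for R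
    using rotations[OF that] assms(3) by (auto simp: prefix_def)
  ultimately have "rows s \<pi> (take n x) = filter (\<lambda>R. R = take n x) (bwt_matrix \<pi> s)"
    unfolding rows_def by (intro filter_cong) auto
  moreover have "distinct L \<Longrightarrow> y \<in> set L \<Longrightarrow> filter (\<lambda>R. R = y) L = [y]" for L :: "nat list list" and y
    by (induction L) (auto simp: filter_empty_conv)
  ultimately show ?thesis using M \<open>take n x \<in> rotations s\<close> by simp
qed

section \<open>Optimal substructure of the tables\<close>

text \<open>The table of a node maps the first and last symbol of its part of the transform to the least
  number of changes inside this part; \<open>None\<close> belongs to the empty part, and \<open>n + 1\<close> is out of
  reach.\<close>

definition infty :: nat where "infty = n + 1"

text \<open>A letter that does not continue \<open>x\<close> is treated as a child with empty part,
  so that every candidate can run over the whole alphabet.\<close>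

definition child_table :: "(nat list \<Rightarrow> ends \<Rightarrow> nat) \<Rightarrow> nat list \<Rightarrow> nat \<Rightarrow> ends \<Rightarrow> nat" where
  "child_table T x c = (if x @
      [c] \<in> factors W then T (locus F (x @ [c])) else (\<lambda>t. if t = None then 0 else infty))"

end

definition all_ends :: "nat \<Rightarrow> ends list" where
  "all_ends \<sigma> = None # concat (map (\<lambda>a. map (\<lambda>b. Some (a, b)) [0..<\<sigma>]) [0..<\<sigma>])"

definition candidates :: "nat \<Rightarrow> (nat list \<times> ends list) list" where
  "candidates \<sigma> = List.product (filter distinct (List.n_lists \<sigma> [0..<\<sigma>])) (List.n_lists \<sigma> (all_ends \<sigma>))"

definition arrange :: "nat \<Rightarrow> nat list \<times> ends list \<Rightarrow> ends list" where
  "arrange \<sigma> C = map ((!) (snd C)) (sort_key ((!) (fst C)) [0..<\<sigma>])"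

definition cost :: "nat \<Rightarrow> (nat \<Rightarrow> ends \<Rightarrow> nat) \<Rightarrow> nat list \<times> ends list \<Rightarrow> nat" where
  "cost \<sigma> f C = (\<Sum>c<\<sigma>. f c (snd C ! c)) + joint_list (arrange \<sigma> C)"

definition perm_of :: "nat \<Rightarrow> nat list \<Rightarrow> nat \<Rightarrow> nat" where
  "perm_of \<sigma> k a = (if a < \<sigma> then k ! a else a)"

lemma set_all_ends: "set (all_ends \<sigma>) = insert None {Some (a, b) | a b. a < \<sigma> \<and> b < \<sigma>}"
  by (auto simp: all_ends_def)

lemma ends_of_in_all_ends: "set xs \<subseteq> {..<\<sigma>} \<Longrightarrow> ends_of xs \<in> set (all_ends \<sigma>)"
  by (auto simp: set_all_ends ends_of_def dest: hd_in_set last_in_set)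

lemma set_candidates:
  "C \<in> set (candidates \<sigma>) \<longleftrightarrow> length (fst C) = \<sigma> \<and> set (fst C) \<subseteq> {..<\<sigma>} \<and> distinct (fst C) \<and>
    length (snd C) = \<sigma> \<and> set (snd C) \<subseteq> set (all_ends \<sigma>)"
  by (cases C) (auto simp: candidates_def set_n_lists)

lemma perm_of_permutes:
  assumes "length k = \<sigma>" "set k \<subseteq> {..<\<sigma>}" "distinct k"
  shows "perm_of \<sigma> k permutes {..<\<sigma>}"
proof (rule bij_imp_permutes)
  have "inj_on (perm_of \<sigma> k) {..<\<sigma>}"
    using assms by (auto simp: inj_on_def perm_of_def nth_eq_iff_index_eq)
  moreover have "perm_of \<sigma> k ` {..<\<sigma>} \<subseteq> {..<\<sigma>}" using assms nth_mem by (fastforce simp: perm_of_def)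
  ultimately show "bij_betw (perm_of \<sigma> k) {..<\<sigma>} {..<\<sigma>}"
    by (simp add: bij_betw_def endo_inj_surj)
qed (simp add: perm_of_def)

context input
begin

lemma part_letters: "is_orderings \<sigma> \<pi> \<Longrightarrow> set (part s \<pi> x) \<subseteq> {..<\<sigma>}"
proof
  fix a assume "is_orderings \<sigma> \<pi>" "a \<in> set (part s \<pi> x)"
  then obtain R where "R \<in> rotations s" "a = last R"
    unfolding part_def rows_def using bwt_matrix(2)[OF _ letters] by auto
  hence "R \<noteq> []" "set R \<subseteq> {..<\<sigma>}" using rotations[of R] n_pos by auto
  thus "a \<in> {..<\<sigma>}" using last_in_set[of R] \<open>a = last R\<close> by blast
qed

lemma part_child:
  assumes "is_orderings \<sigma> \<pi>" "length x < n"
  shows "part s \<pi> (x @ [c]) =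
    (if x @ [c] \<in> factors W then part s \<pi> (take n (locus F (x @ [c]))) else [])"
  unfolding part_def using rows_child[OF assms(1), of "x @ [c]"] assms(2) by simp

lemma part_split:
  assumes "is_orderings \<sigma> \<pi>" "x \<in> F" "length x < n"
  shows "part s \<pi> x = concat (map (\<lambda>c. part s \<pi> (x @ [c])) (sort_key (\<pi> x) [0..<\<sigma>]))"
  using rows_split[OF assms(1) factors_letters[OF nodes_subset_factors[OF assms(2)]] assms(3)]
  by (simp add: part_def map_concat comp_def)

lemma part_cost:
  assumes "is_orderings \<sigma> \<pi>" "x \<in> F" "length x < n"
    and "length k = \<sigma>" "\<And>c. c < \<sigma> \<Longrightarrow> k ! c = \<pi> x c"
    and "length ts = \<sigma>" "\<And>c. c < \<sigma> \<Longrightarrow> ts ! c = ends_of (part s \<pi> (x @ [c]))"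
  shows "ends_of (part s \<pi> x) = join_list (arrange \<sigma> (k, ts))"
    "changes (part s \<pi> x) = (\<Sum>c<\<sigma>. changes (part s \<pi> (x @ [c]))) + joint_list (arrange \<sigma> (k, ts))"
proof -
  have key: "sort_key (\<pi> x) [0..<\<sigma>] = sort_key ((!) k) [0..<\<sigma>]"
    using assms(5) by (intro sort_key_cong_on) auto
  have arrange: "arrange \<sigma> (k, ts) = map ends_of (map (\<lambda>c. part s \<pi> (x @ [c])) (sort_key (\<pi> x) [0..<\<sigma>]))"
    unfolding arrange_def key using assms(7) by simp
  show "ends_of (part s \<pi> x) = join_list (arrange \<sigma> (k, ts))"
    unfolding arrange part_split[OF assms(1,2,3)] by (rule ends_of_concat)
  have "sum_list (map changes (map (\<lambda>c. part s \<pi> (x @ [c])) (sort_key (\<pi> x) [0..<\<sigma>]))) =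
      sum_list (map (\<lambda>c. changes (part s \<pi> (x @ [c]))) (sort_key (\<pi> x) [0..<\<sigma>]))"
    by (simp add: comp_def)
  also have "\<dots> = (\<Sum>c\<in>set (sort_key (\<pi> x) [0..<\<sigma>]). changes (part s \<pi> (x @ [c])))"
    by (intro sum_list_distinct_conv_sum_set) simp
  also have "\<dots> = (\<Sum>c<\<sigma>. changes (part s \<pi> (x @ [c])))" by (simp add: atLeast0LessThan)
  finally show "changes (part s \<pi> x) = (\<Sum>c<\<sigma>. changes (part s \<pi> (x @ [c]))) + joint_list (arrange \<sigma> (k, ts))"
    unfolding arrange part_split[OF assms(1,2,3)] changes_concat by simp
qed

lemma part_leaf:
  assumes "is_orderings \<sigma> \<pi>" "x \<in> F" "n \<le> length x"
  shows "part s \<pi> (take n x) = [last (take n x)]"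
  unfolding part_def using rows_leaf[OF assms(1) nodes_subset_factors[OF assms(2)] assms(3)] by simp

lemma locus_child:
  assumes "x \<in> F" "x @ [c] \<in> factors W"
  shows "locus F (x @ [c]) \<in> F" "length x < length (locus F (x @ [c]))"
  using parent_locus[OF assms] by auto

lemma length_node: "x \<in> F \<Longrightarrow> length x \<le> 2 * n"
  using length_factors[OF nodes_subset_factors, of x W] by simp

text \<open>Any family of orderings induces a candidate at each node: its ranks and the ends that
  the parts of the children really have. The inequality for this candidate, with the induction
  hypothesis for the children, bounds the entry; the induction goes from deep nodes to shallow
  ones.\<close>

lemma table_lower:
  assumes leaf: "\<And>x t. x \<in> F \<Longrightarrow> n \<le> length x \<Longrightarrow> T x (Some (last (take n x), last (take n x))) = 0"
    and inner: "\<And>x C. x \<in> F \<Longrightarrow> length x < n \<Longrightarrow> C \<in> set (candidates \<sigma>) \<Longrightarrow>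
      T x (join_list (arrange \<sigma> C)) \<le> cost \<sigma> (child_table T x) C"
    and \<pi>: "is_orderings \<sigma> \<pi>" and "x \<in> F"
  shows "T x (ends_of (part s \<pi> (take n x))) \<le> changes (part s \<pi> (take n x))"
  using \<open>x \<in> F\<close>
proof (induction "2 * n - length x" arbitrary: x rule: less_induct)
  case less
  show ?case
  proof (cases "length x < n")
    case False
    thus ?thesis using leaf[of x] less.prems part_leaf[OF \<pi> less.prems] by (simp add: ends_of_def)
  next
    case True
    define k where "k = map (\<pi> x) [0..<\<sigma>]"
    define ts where "ts = map (\<lambda>c. ends_of (part s \<pi> (x @ [c]))) [0..<\<sigma>]"
    have p: "\<pi> x permutes {..<\<sigma>}"
      using \<pi> factors_letters[OF nodes_subset_factors[OF less.prems]] by (simp add: is_orderings_def)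
    have "(k, ts) \<in> set (candidates \<sigma>)"
      unfolding set_candidates fst_conv snd_conv
    proof (intro conjI)
      show "length k = \<sigma>" "length ts = \<sigma>" by (simp_all add: k_def ts_def)
      show "set k \<subseteq> {..<\<sigma>}" using permutes_image[OF p] by (simp add: k_def atLeast0LessThan)
      show "distinct k" using inj_on_subset[OF permutes_inj[OF p]] by (simp add: k_def distinct_map)
      show "set ts \<subseteq> set (all_ends \<sigma>)" using ends_of_in_all_ends[OF part_letters[OF \<pi>]] by (auto simp: ts_def)
    qed
    hence "T x (join_list (arrange \<sigma> (k, ts))) \<le> cost \<sigma> (child_table T x) (k, ts)"
      by (rule inner[OF less.prems True])
    moreover have pc: "ends_of (part s \<pi> x) = join_list (arrange \<sigma> (k, ts))"
      "changes (part s \<pi> x) = (\<Sum>c<\<sigma>. changes (part s \<pi> (x @ [c]))) + joint_list (arrange \<sigma> (k, ts))"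
      using part_cost[OF \<pi> less.prems True, of k ts] by (simp_all add: k_def ts_def)
    moreover have "child_table T x c (ts ! c) \<le> changes (part s \<pi> (x @ [c]))" if "c < \<sigma>" for c
    proof (cases "x @ [c] \<in> factors W")
      case False
      thus ?thesis using that part_child[OF \<pi> True, of c] by (simp add: child_table_def ts_def)
    next
      case c: True
      note l = locus_child[OF less.prems c]
      have "2 * n - length (locus F (x @ [c])) < 2 * n - length x"
        using l(2) length_node[OF l(1)] by linarith
      thus ?thesis using less.hyps[OF _ l(1)] part_child[OF \<pi> True, of c] c that
        by (simp add: child_table_def ts_def)
    qed
    hence "(\<Sum>c<\<sigma>. child_table T x c (ts ! c)) \<le> (\<Sum>c<\<sigma>. changes (part s \<pi> (x @ [c])))"
      by (intro sum_mono) simp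
    ultimately show ?thesis using True by (simp add: cost_def)
  qed
qed

text \<open>Here \<open>\<tau>\<close> gives the pair wanted at a node and \<open>K\<close> the
  candidate chosen for it. Along these choices, wanted pairs and table entries turn out to be the
  actual ones. Entries from \<open>infty\<close> on are excluded since they need not be
  realisable.\<close>

lemma table_attained:
  assumes leaf: "\<And>x t. x \<in> F \<Longrightarrow> n \<le> length x \<Longrightarrow> T x t < infty \<Longrightarrow>
      t = Some (last (take n x), last (take n x)) \<and> T x t = 0"
    and inner: "\<And>x. x \<in> F \<Longrightarrow> length x < n \<Longrightarrow> T x (\<tau> x) < infty \<Longrightarrow>
      K x \<in> set (candidates \<sigma>) \<and> join_list (arrange \<sigma> (K x)) = \<tau> x \<and> cost \<sigma> (child_table T x) (K x) =
          T x (\<tau> x) \<and>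
      (\<forall>c<\<sigma>. x @ [c] \<in> factors W \<longrightarrow> \<tau> (locus F (x @ [c])) = snd (K x) ! c) \<and>
      \<pi> x = perm_of \<sigma> (fst (K x))"
    and \<pi>: "is_orderings \<sigma> \<pi>" and "x \<in> F" "T x (\<tau> x) < infty"
  shows "ends_of (part s \<pi> (take n x)) = \<tau> x \<and> changes (part s \<pi> (take n x)) = T x (\<tau> x)"
  using \<open>x \<in> F\<close> \<open>T x (\<tau> x) < infty\<close>
proof (induction "2 * n - length x" arbitrary: x rule: less_induct)
  case less
  show ?case
  proof (cases "length x < n")
    case False
    hence "\<tau> x = Some (last (take n x), last (take n x))" "T x (\<tau> x) = 0"
      using leaf[OF less.prems(1) _ less.prems(2)] by auto
    thus ?thesis using False part_leaf[OF \<pi> less.prems(1)] by (auto simp: ends_of_def)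
  next
    case True
    obtain k ts where K: "K x = (k, ts)" by fastforce
    note i = inner[OF less.prems(1) True less.prems(2), unfolded K fst_conv snd_conv]
    hence len: "length k = \<sigma>" "length ts = \<sigma>" by (auto simp: set_candidates)
    \<comment> \<open>A sum below \<open>infty\<close> has all its summands below
      \<open>infty\<close>, so the condition passes from a node to its children.\<close>
    have "(\<Sum>c<\<sigma>. child_table T x c (ts ! c)) < infty" using i less.prems(2) by (simp add: cost_def)
    hence small: "child_table T x c (ts ! c) < infty" if "c < \<sigma>" for c
      using member_le_sum[of c "{..<\<sigma>}" "\<lambda>c. child_table T x c (ts ! c)"] that by auto
    have ch: "ends_of (part s \<pi> (x @ [c])) = ts ! c \<and> changes (part s \<pi> (x @ [c])) =
        child_table T x c (ts ! c)"
      if "c < \<sigma>" for c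
    proof (cases "x @ [c] \<in> factors W")
      case False
      thus ?thesis using small[OF that] part_child[OF \<pi> True, of c]
        by (auto simp: child_table_def split: if_splits)
    next
      case c: True
      note l = locus_child[OF less.prems(1) c]
      have "2 * n - length (locus F (x @ [c])) < 2 * n - length x"
        using l(2) length_node[OF l(1)] by linarith
      moreover have "\<tau> (locus F (x @ [c])) = ts ! c" using i that c by blast
      ultimately show ?thesis
        using less.hyps[OF _ l(1)] small[OF that] part_child[OF \<pi> True, of c] c by (simp add: child_table_def)
    qed
    have pi: "k ! c = \<pi> x c" if "c < \<sigma>" for c using i that by (simp add: perm_of_def)
    have "ends_of (part s \<pi> x) = join_list (arrange \<sigma> (k, ts))"
      "changes (part s \<pi> x) = (\<Sum>c<\<sigma>. changes (part s \<pi> (x @ [c]))) + joint_list (arrange \<sigma> (k, ts))"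
      using part_cost[OF \<pi> less.prems(1) True len(1) pi len(2)] ch by simp_all
    moreover have "(\<Sum>c<\<sigma>. changes (part s \<pi> (x @ [c]))) = (\<Sum>c<\<sigma>. child_table T x c (ts ! c))"
      using ch by (intro sum.cong) auto
    ultimately show ?thesis using True i by (simp add: cost_def)
  qed
qed

text \<open>The least entry at the root bounds every family from below by
  \<open>table_lower\<close>, and \<open>\<pi>\<close> reaches it by
  \<open>table_attained\<close>.\<close>

lemma table_optimal:
  assumes leaf: "\<And>x t. x \<in> F \<Longrightarrow> n \<le> length x \<Longrightarrow>
      T x t = (if t = Some (last (take n x), last (take n x)) then 0 else infty)"
    and lower: "\<And>x C. x \<in> F \<Longrightarrow> length x < n \<Longrightarrow> C \<in> set (candidates \<sigma>) \<Longrightarrow>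
      T x (join_list (arrange \<sigma> C)) \<le> cost \<sigma> (child_table T x) C"
    and inner: "\<And>x. x \<in> F \<Longrightarrow> length x < n \<Longrightarrow> T x (\<tau> x) < infty \<Longrightarrow>
      K x \<in> set (candidates \<sigma>) \<and> join_list (arrange \<sigma> (K x)) = \<tau> x \<and> cost \<sigma> (child_table T x) (K x) =
          T x (\<tau> x) \<and>
      (\<forall>c<\<sigma>. x @ [c] \<in> factors W \<longrightarrow> \<tau> (locus F (x @ [c])) = snd (K x) ! c) \<and>
      \<pi> x = perm_of \<sigma> (fst (K x))"
    and \<pi>: "is_orderings \<sigma> \<pi>"
    and root: "\<And>t. t \<in> set (all_ends \<sigma>) \<Longrightarrow> T [] (\<tau> []) \<le> T [] t"
  shows "optimal_orderings \<sigma> s \<pi>"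
  unfolding optimal_orderings_def
proof (intro conjI allI impI \<pi>)
  fix \<pi>' assume \<pi>': "is_orderings \<sigma> \<pi>'"
  have bwt: "part s p [] = bwt p s" for p by (simp add: part_def rows_def bwt_def)
  have len: "bwt p s \<noteq> []" "changes (bwt p s) < n" if "is_orderings \<sigma> p" for p
    using length_bwt[OF that letters prim] n_pos changes_less_length[of "bwt p s"] by fastforce+
  have low: "T [] (\<tau> []) \<le> changes (bwt p s)" if p: "is_orderings \<sigma> p" for p
  proof -
    have "T [] (ends_of (part s p (take n []))) \<le> changes (part s p (take n []))"
      by (rule table_lower) (use leaf lower p in auto)
    moreover have "T [] (\<tau> []) \<le> T [] (ends_of (part s p []))"
      by (intro root ends_of_in_all_ends part_letters p)
    ultimately show ?thesis by (simp add: bwt)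
  qed
  \<comment> \<open>The lower bound, applied to \<open>\<pi>\<close> itself, keeps the entry below
    \<open>infty\<close>, as a nonempty list of length \<open>n\<close> has fewer than
    \<open>n\<close> changes.\<close>
  have "T [] (\<tau> []) < infty" using low[OF \<pi>] len(2)[OF \<pi>] by (simp add: infty_def)
  hence "ends_of (part s \<pi> (take n [])) = \<tau> [] \<and> changes (part s \<pi> (take n [])) = T [] (\<tau> [])"
    by (intro table_attained[where K = K] \<pi>) (use leaf inner in \<open>auto split: if_splits\<close>)
  hence "changes (bwt \<pi> s) = T [] (\<tau> [])" by (simp add: bwt)
  thus "num_runs (bwt \<pi> s) \<le> num_runs (bwt \<pi>' s)"
    using low[OF \<pi>'] len \<pi> \<pi>' by (simp add: num_runs_eq_changes)
qed

end

subsection \<open>The suffix tree in memory\<close>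

text \<open>The record of a node \<open>x\<close> of the suffix tree: the transitions \<open>Next c\<close> to the least node that
  extends \<open>c # x\<close> (0 if there is none), its length plus one, so that only the sentinel above the
  root has \<open>Len\<close> 0, the \<open>Link\<close> to its parent, the address of the first letter of an occurrence, the
  pair of symbols chosen for its part of the transform, its children, and its table.\<close>

datatype fld = Next nat | Len | Link | Pos | Cho | Child nat | Tab ends

text \<open>With 0 for \<open>None\<close>, a cleared cell \<open>Cho\<close> is the code of a legal
  choice.\<close>

fun encode :: "nat \<Rightarrow> ends \<Rightarrow> nat" where
  "encode \<sigma> None = 0"
| "encode \<sigma> (Some (a, b)) = 1 + a * \<sigma> + b"

fun offset :: "nat \<Rightarrow> fld \<Rightarrow> nat" where
  "offset \<sigma> (Next c) = c"
| "offset \<sigma> Len = \<sigma>"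
| "offset \<sigma> Link = \<sigma> + 1"
| "offset \<sigma> Pos = \<sigma> + 2"
| "offset \<sigma> Cho = \<sigma> + 3"
| "offset \<sigma> (Child c) = \<sigma> + 4 + c"
| "offset \<sigma> (Tab t) = 2 * \<sigma> + 4 + encode \<sigma> t"

fun valid_field :: "nat \<Rightarrow> fld \<Rightarrow> bool" where
  "valid_field \<sigma> (Next c) = (c < \<sigma>)"
| "valid_field \<sigma> (Child c) = (c < \<sigma>)"
| "valid_field \<sigma> (Tab t) = (t \<in> set (all_ends \<sigma>))"
| "valid_field \<sigma> _ = True"

text \<open>The sum of \<open>\<sigma>\<close> transitions, four single fields,
  \<open>\<sigma>\<close> children and \<open>\<sigma> * \<sigma> + 1\<close> table entries.\<close>

definition rec_size :: "nat \<Rightarrow> nat" where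
  "rec_size \<sigma> = 2 * \<sigma> + 5 + \<sigma> * \<sigma>"

definition cell :: "nat \<Rightarrow> nat \<Rightarrow> fld \<Rightarrow> nat" where
  "cell \<sigma> p f = p + offset \<sigma> f"

lemma rec_size_pos [simp]: "0 < rec_size \<sigma>" "rec_size \<sigma> \<noteq> 0"
  by (simp_all add: rec_size_def)

lemma encode_le: "t \<in> set (all_ends \<sigma>) \<Longrightarrow> encode \<sigma> t \<le> \<sigma> * \<sigma>"
proof -
  assume "t \<in> set (all_ends \<sigma>)"
  moreover have "1 + a * \<sigma> + b \<le> \<sigma> * \<sigma>" if "a < \<sigma>" "b < \<sigma>" for a b
  proof -
    have "Suc a * \<sigma> \<le> \<sigma> * \<sigma>" using that by (intro mult_le_mono1) simp
    thus ?thesis using that by simp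
  qed
  ultimately show ?thesis by (auto simp: set_all_ends)
qed

lemma encode_inj:
  assumes "t \<in> set (all_ends \<sigma>)" "t' \<in> set (all_ends \<sigma>)" "encode \<sigma> t = encode \<sigma> t'"
  shows "t = t'"
proof -
  have *: "a = a' \<and> b = b'" if "a * \<sigma> + b = a' * \<sigma> + b'" "b < \<sigma>" "b' < \<sigma>" for a b a' b'
  proof -
    have "a = (a * \<sigma> + b) div \<sigma>" using that(2) by simp
    also have "\<dots> = (a' * \<sigma> + b') div \<sigma>" by (simp only: that(1))
    also have "\<dots> = a'" using that(3) by simp
    finally have "a = a'" .
    thus ?thesis using that by simp
  qed
  have "t = None \<or> (\<exists>a b. t = Some (a, b) \<and> b < \<sigma>)" "t' = None \<or> (\<exists>a b. t' = Some (a, b) \<and> b < \<sigma>)"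
    using assms(1,2) unfolding set_all_ends by blast+
  thus ?thesis using assms(3) by (auto dest: *)
qed

lemma offset_less: "valid_field \<sigma> f \<Longrightarrow> offset \<sigma> f < rec_size \<sigma>"
  using encode_le by (cases f) (auto simp: rec_size_def le_imp_less_Suc)

lemma offset_inj: "valid_field \<sigma> f \<Longrightarrow> valid_field \<sigma> g \<Longrightarrow> offset \<sigma> f = offset \<sigma> g \<Longrightarrow> f = g"
  using encode_inj by (cases f; cases g) auto

text \<open>An offset is smaller than a record, so division by the record size recovers the record,
  and the rest determines the field. Questions of aliasing between records are reduced to this
  equivalence.\<close>

lemma cell_mult_eq:
  assumes "valid_field \<sigma> f" "valid_field \<sigma> g"
  shows "cell \<sigma> (d + rec_size \<sigma> * j) f = cell \<sigma> (d + rec_size \<sigma> * k) g \<longleftrightarrow> j = k \<and> f = g"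
proof
  assume "cell \<sigma> (d + rec_size \<sigma> * j) f = cell \<sigma> (d + rec_size \<sigma> * k) g"
  hence *: "rec_size \<sigma> * j + offset \<sigma> f = rec_size \<sigma> * k + offset \<sigma> g" by (simp add: cell_def)
  have "j = (rec_size \<sigma> * j + offset \<sigma> f) div rec_size \<sigma>" using offset_less[OF assms(1)] by simp
  also have "\<dots> = (rec_size \<sigma> * k + offset \<sigma> g) div rec_size \<sigma>" by (simp only: *)
  also have "\<dots> = k" using offset_less[OF assms(2)] by simp
  finally have "j = k" .
  thus "j = k \<and> f = g" using * offset_inj assms by simp
qed simp

definition Fd :: "nat \<Rightarrow> exp \<Rightarrow> fld \<Rightarrow> exp" where
  "Fd \<sigma> e f = Inc e (offset \<sigma> f)"

text \<open>The \<open>Next\<close> fields come first in a record, so a letter known only at run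
  time can serve as displacement.\<close>

definition Trans :: "nat \<Rightarrow> nat \<Rightarrow> nat \<Rightarrow> exp" where
  "Trans \<sigma> p a = Pl (Var p) (Var a)"

definition Child_cell :: "nat \<Rightarrow> nat \<Rightarrow> nat \<Rightarrow> exp" where
  "Child_cell \<sigma> p a = Pl (Inc (Var p) (\<sigma> + 4)) (Var a)"

lemma Fd [simp]: "aval (Fd \<sigma> e f) s = cell \<sigma> (aval e s) f" "okE U (Fd \<sigma> e f) s = okE U e s"
  by (simp_all add: Fd_def cell_def)

lemma Trans [simp]: "aval (Trans \<sigma> p a) s = cell \<sigma> (fst s p) (Next (fst s a))"
  "okE U (Trans \<sigma> p a) s \<longleftrightarrow> cell \<sigma> (fst s p) (Next (fst s a)) \<le> U"
  by (simp_all add: Trans_def cell_def)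

lemma Child_cell [simp]: "aval (Child_cell \<sigma> p a) s = cell \<sigma> (fst s p) (Child (fst s a))"
  "okE U (Child_cell \<sigma> p a) s \<longleftrightarrow> cell \<sigma> (fst s p) (Child (fst s a)) \<le> U"
  by (simp_all add: Child_cell_def cell_def add.assoc)

text \<open>Loops over the alphabet are unrolled into such stores. The third premise fixes the value
  of \<open>e c\<close> in every memory that agrees with \<open>m\<close> off the written cells, so
  earlier stores of the list cannot disturb later ones.\<close>

lemma ex_stores:
  assumes "distinct (map adr cs)"
    and "\<And>c m'. c \<in> set cs \<Longrightarrow> aval (a c) (r, m') = adr c"
    and "\<And>c m'. c \<in> set cs \<Longrightarrow> (\<forall>b. b \<notin> adr ` set cs \<longrightarrow> m' b = m b) \<Longrightarrow> aval (e c) (r, m') = chosen c"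
  shows "\<exists>m'. ex (seqs (map (\<lambda>c. Sto (a c) (e c)) cs)) (r, m) = (r, m') \<and>
    (\<forall>c\<in>set cs. m' (adr c) = chosen c) \<and> (\<forall>b. b \<notin> adr ` set cs \<longrightarrow> m' b = m b)"
  using assms
proof (induction cs arbitrary: m)
  case (Cons c cs)
  have "aval (a c) (r, m) = adr c" "aval (e c) (r, m) = chosen c" using Cons.prems by simp_all
  hence e: "ex (Sto (a c) (e c)) (r, m) = (r, m(adr c := chosen c))" by simp
  have "\<exists>m'. ex (seqs (map (\<lambda>c. Sto (a c) (e c)) cs)) (r, m(adr c := chosen c)) = (r, m') \<and>
    (\<forall>c\<in>set cs. m' (adr c) = chosen c) \<and> (\<forall>b. b \<notin> adr ` set cs \<longrightarrow> m' b = (m(adr c := chosen c)) b)"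
  proof (rule Cons.IH)
    fix c' m'
    assume c': "c' \<in> set cs" and m': "\<forall>b. b \<notin> adr ` set cs \<longrightarrow> m' b = (m(adr c := chosen c)) b"
    show "aval (e c') (r, m') = chosen c'"
      using c' m' by (intro Cons.prems(3)) auto
  qed (use Cons.prems in auto)
  then obtain m' where m': "ex (seqs (map (\<lambda>c. Sto (a c) (e c)) cs)) (r, m(adr c := chosen c)) = (r, m')"
    "\<forall>c\<in>set cs. m' (adr c) = chosen c" "\<forall>b. b \<notin> adr ` set cs \<longrightarrow> m' b = (m(adr c := chosen c)) b" by blast
  have "adr c \<notin> adr ` set cs" using Cons.prems(1) by simp
  hence "m' (adr c) = chosen c" using m'(3) by simp
  thus ?case using m' e by (intro exI[of _ m']) auto
qed simp

lemma okC_stores: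
  assumes "\<And>c m'. c \<in> set cs \<Longrightarrow> okE U (a c) (r, m') \<and> okE U (e c) (r, m')"
  shows "okC U (seqs (map (\<lambda>c. Sto (a c) (e c)) cs)) (r, m)"
  using assms by (induction cs arbitrary: m) auto

abbreviation (input) "vn \<equiv> 1 :: nat"
abbreviation (input) "vi \<equiv> 2 :: nat"
abbreviation (input) "vd \<equiv> 3 :: nat"
abbreviation (input) "vfr \<equiv> 4 :: nat"
abbreviation (input) "vlast \<equiv> 5 :: nat"
abbreviation (input) "va \<equiv> 6 :: nat"
abbreviation (input) "vcur \<equiv> 7 :: nat"
abbreviation (input) "vp \<equiv> 8 :: nat"
abbreviation (input) "vq \<equiv> 9 :: nat"
abbreviation (input) "vcl \<equiv> 10 :: nat"

definition prepend_leaf :: "nat \<Rightarrow> com" where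
  "prepend_leaf \<sigma> = va ::= Ld (Var vi);; vcur ::= Var vfr;; vfr ::= Inc (Var vfr) (rec_size \<sigma>);;
    Sto (Fd \<sigma> (Var vcur) Len) (Inc (Ld (Fd \<sigma> (Var vlast) Len)) 1);;
    Sto (Fd \<sigma> (Var vcur) Pos) (Var vi);; vp ::= Var vlast"

definition prepend_climb :: "nat \<Rightarrow> com" where
  "prepend_climb \<sigma> = Sto (Trans \<sigma> vp va) (Var vcur);; vp ::= Ld (Fd \<sigma> (Var vp) Link)"

definition prepend_copy :: "nat \<Rightarrow> com" where
  "prepend_copy \<sigma> = seqs (map (\<lambda>c. Sto (Fd \<sigma> (Var vcl) (Next c)) (Ld (Fd \<sigma> (Var vq) (Next c)))) [0..<\<sigma>])"

definition prepend_split :: "nat \<Rightarrow> com" where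
  "prepend_split \<sigma> = vcl ::= Var vfr;; vfr ::= Inc (Var vfr) (rec_size \<sigma>);;
    Sto (Fd \<sigma> (Var vcl) Len) (Inc (Ld (Fd \<sigma> (Var vp) Len)) 1);;
    Sto (Fd \<sigma> (Var vcl) Link) (Ld (Fd \<sigma> (Var vq) Link));;
    Sto (Fd \<sigma> (Var vcl) Pos) (Var vi)"

definition prepend_redirect :: "nat \<Rightarrow> com" where
  "prepend_redirect \<sigma> = Sto (Trans \<sigma> vp va) (Var vcl);; vp ::= Ld (Fd \<sigma> (Var vp) Link)"

definition prepend_links :: "nat \<Rightarrow> com" where
  "prepend_links \<sigma> = Sto (Fd \<sigma> (Var vq) Link) (Var vcl);; Sto (Fd \<sigma> (Var vcur) Link) (Var vcl)"

definition prepend_next :: "com" where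
  "prepend_next = vlast ::= Var vcur;; vi ::= Mi (Var vi) (Lit 1)"

text \<open>As for suffix automata: the first climb gives the new leaf to all nodes without a
  transition; the test asks whether the target is just one letter longer than the node, that is,
  whether the head is a node already; if not, a copy of the target replaces it in the second climb.
  \<open>Len\<close> 0 of the sentinel makes the test come out right for the empty head.\<close>

definition prepend :: "nat \<Rightarrow> com" where
  "prepend \<sigma> = prepend_leaf \<sigma>;; While (Equ (Ld (Trans \<sigma> vp va)) (Lit 0)) (prepend_climb \<sigma>);;
    vq ::= Ld (Trans \<sigma> vp va);;
    Cnd (Equ (Ld (Fd \<sigma> (Var vq) Len)) (Inc (Ld (Fd \<sigma> (Var vp) Len)) 1))
      (Sto (Fd \<sigma> (Var vcur) Link) (Var vq))
      (prepend_split \<sigma>;; prepend_copy \<sigma>;; While (Equ (Ld (Trans \<sigma> vp va)) (Var vq)) (prepend_redirect \<sigma>);;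
          prepend_links \<sigma>);;
    prepend_next"

definition overwrite :: "(nat \<Rightarrow> nat) \<Rightarrow> nat set \<Rightarrow> nat \<Rightarrow> nat \<Rightarrow> nat" where
  "overwrite m A v = (\<lambda>b. if b \<in> A then v else m b)"

lemma overwrite_empty [simp]: "overwrite m {} v = m"
  by (simp add: overwrite_def)

lemma overwrite_insert: "(overwrite m A v)(b := v) = overwrite m (insert b A) v"
  by (auto simp: overwrite_def)

context input
begin

text \<open>Memory contains the length \<open>n\<close>, the text \<open>W\<close>, the record of the sentinel at \<open>D\<close>, the records
  of the nodes up to \<open>fr\<close>, and later the queue of the branching nodes and the output.\<close>

abbreviation "S \<equiv> rec_size \<sigma>"
definition D :: nat where "D = 2 * n + 1"
abbreviation "at m p f \<equiv> (m :: nat \<Rightarrow> nat) (cell \<sigma> p f)"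

text \<open>The bound \<open>U\<close> for guarded sums. It covers the addresses of all records, of
  which there are at most \<open>4 * n + 3\<close>, the addresses of the text, and sums of
  \<open>\<sigma>\<close> table entries (\<open>cell_le_bnd\<close>, \<open>n_le_bnd\<close>,
  \<open>sigma_bnd\<close>).\<close>

definition bnd :: nat where "bnd = 8 * S * (n + 1)"

text \<open>Record number 0 is the sentinel; all its transitions lead to the root, so every first
  climb ends there at the latest. Each letter adds at most two nodes, hence
  \<open>2 * length w + 2\<close>. As all cells from \<open>fr\<close> on are 0, a fresh record has
  no transitions and no children.\<close>

definition inv :: "nat list \<Rightarrow> (nat \<Rightarrow> nat) \<Rightarrow> nat \<Rightarrow> (nat list \<Rightarrow> nat) \<Rightarrow> nat \<Rightarrow> bool" where
  "inv w m fr ad cnt \<longleftrightarrow>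
    fr = D + S * cnt \<and> bij_betw ad (nodes w) ((\<lambda>j. D + S * j) ` {1..<cnt}) \<and> cnt \<le> 2 * length w + 2 \<and>
    1 \<le> cnt \<and> (\<forall>i<2 * n. m (Suc i) = W ! i) \<and> (\<forall>b\<ge>fr. m b = 0) \<and>
    at m D Len = 0 \<and> (\<forall>c<\<sigma>. at m D (Next c) = ad []) \<and>
    (\<forall>x\<in>nodes w. at m (ad x) Len = Suc (length x) \<and>
      at m (ad x) Link = (if x = [] then D else ad (parent (nodes w) x)) \<and>
      1 \<le> at m (ad x) Pos \<and> at m (ad x) Pos \<le> 2 * n \<and> prefix x (drop (at m (ad x) Pos - 1) W) \<and>
      (\<forall>c<\<sigma>. at m (ad x) (Next c) = (if c # x \<in> factors w then ad (locus (nodes w) (c # x)) else 0)) \<and>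
      (\<forall>c<\<sigma>. at m (ad x) (Child c) = 0))"

lemma S_pos: "5 \<le> S"
  by (simp add: rec_size_def)

lemma cell_le_bnd:
  assumes "j < cnt" "cnt \<le> 4 * n + 3" "valid_field \<sigma> f"
  shows "cell \<sigma> (D + S * j) f \<le> bnd"
proof -
  have "S * (j + 1) \<le> S * (4 * n + 3)" using assms by (intro mult_le_mono2) simp
  moreover have "5 * (n + 1) \<le> S * (n + 1)" using S_pos by (intro mult_le_mono1)
  ultimately show ?thesis
    using offset_less[OF assms(3)] by (simp add: cell_def bnd_def D_def algebra_simps)
qed

end

section \<open>One step of Weiner's construction in memory\<close>

locale weiner = input +
  fixes w a mm m fr ad cnt i
  assumes inv: "inv w m fr ad cnt" and head: "head a w mm" and a: "a < \<sigma>"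
    and i: "a # w = drop (i - 1) W" "1 \<le> i" "i \<le> 2 * n"
begin

abbreviation "N \<equiv> nodes w"
abbreviation "N' \<equiv> nodes (a # w)"
abbreviation "C \<equiv> chain a w"
abbreviation "cur \<equiv> fr"
abbreviation "cl \<equiv> fr + S"

definition chain_adr :: "nat list \<Rightarrow> nat" where
  "chain_adr u = (if u = [] then D else ad (tl u))"

text \<open>The two extra numbers admit the fresh records \<open>cur\<close> and
  \<open>cl\<close>.\<close>

definition is_record :: "nat \<Rightarrow> bool" where
  "is_record p \<longleftrightarrow> (\<exists>j<cnt + 2. p = D + S * j)"

lemma cell_eq:
  assumes "is_record p" "is_record p'" "valid_field \<sigma> f" "valid_field \<sigma> g"
  shows "cell \<sigma> p f = cell \<sigma> p' g \<longleftrightarrow> p = p' \<and> f = g"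
proof -
  obtain j j' where "p = D + S * j" "p' = D + S * j'" using assms unfolding is_record_def by blast
  thus ?thesis using cell_mult_eq[OF assms(3,4), of D j j'] S_pos by auto
qed

lemma length_w: "length w < 2 * n" "length w = 2 * n - i"
  using i(2,3) arg_cong[OF i(1), of length] by auto

lemma cnt: "cnt + 2 \<le> 4 * n + 3" "1 \<le> cnt"
  using inv length_w unfolding inv_def by auto

lemma ad_is_record: "x \<in> N \<Longrightarrow> is_record (ad x)" "x \<in> N \<Longrightarrow> ad x < fr" "x \<in> N \<Longrightarrow> D < ad x"
proof -
  assume "x \<in> N"
  hence "ad x \<in> (\<lambda>j. D + S * j) ` {1..<cnt}" using inv unfolding inv_def bij_betw_def by blast
  then obtain j where "ad x = D + S * j" "j \<in> {1..<cnt}" by blast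
  hence j: "ad x = D + S * j" "1 \<le> j" "j < cnt" by auto
  thus "is_record (ad x)" unfolding is_record_def by (intro exI[of _ j]) simp
  have "S * j < S * cnt" using j S_pos by simp
  thus "ad x < fr" using j inv unfolding inv_def by simp
  show "D < ad x" using j S_pos by simp
qed

lemma fr_eq: "fr = D + S * cnt"
  using inv unfolding inv_def by blast

lemma is_record [simp]: "is_record D" "is_record cur" "is_record cl"
  unfolding is_record_def
  by (intro exI[of _ 0] exI[of _ cnt] exI[of _ "Suc cnt"]; simp add: fr_eq)+

lemma neq [simp]: "D \<noteq> cur" "D \<noteq> cl" "cur \<noteq> cl" "x \<in> N \<Longrightarrow> ad x \<noteq> cur" "x \<in> N \<Longrightarrow> ad x \<noteq> cl"
  "x \<in> N \<Longrightarrow> ad x \<noteq> D" "x \<in> N \<Longrightarrow> ad x \<noteq> 0" "x \<in> N \<Longrightarrow> D \<noteq> ad x"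
  "x \<in> N \<Longrightarrow> cur \<noteq> ad x" "x \<in> N \<Longrightarrow> cl \<noteq> ad x"
  using ad_is_record[of x] S_pos cnt by (auto simp: fr_eq)

lemma ad_inj: "x \<in> N \<Longrightarrow> y \<in> N \<Longrightarrow> ad x = ad y \<longleftrightarrow> x = y"
  using inv unfolding inv_def bij_betw_def by (meson inj_on_eq_iff)

lemma is_record_le: "is_record p \<Longrightarrow> valid_field \<sigma> f \<Longrightarrow> cell \<sigma> p f \<le> bnd"
  unfolding is_record_def using cell_le_bnd cnt(1) by blast

lemma text_cell: "is_record p \<Longrightarrow> b \<le> 2 * n \<Longrightarrow> b \<noteq> cell \<sigma> p f"
  unfolding is_record_def by (auto simp: cell_def D_def)

lemma inv_node:
  assumes "x \<in> N"
  shows "at m (ad x) Len = Suc (length x)"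
    "at m (ad x) Link = (if x = [] then D else ad (parent N x))"
    "1 \<le> at m (ad x) Pos" "at m (ad x) Pos \<le> 2 * n" "prefix x (drop (at m (ad x) Pos - 1) W)"
    "c < \<sigma> \<Longrightarrow> at m (ad x) (Next c) = (if c # x \<in> factors w then ad (locus N (c # x)) else 0)"
    "c < \<sigma> \<Longrightarrow> at m (ad x) (Child c) = 0"
  using inv assms unfolding inv_def by simp_all

lemma inv_D: "at m D Len = 0" "c < \<sigma> \<Longrightarrow> at m D (Next c) = ad []" "j < 2 * n \<Longrightarrow> m (Suc j) = W ! j"
    "fr \<le> b \<Longrightarrow> m b = 0"
  using inv unfolding inv_def by simp_all

lemma fresh: "at m cur f = 0" "at m cl f = 0"
  by (rule inv_D(4), simp add: cell_def)+

lemma chain_cases: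
  assumes "u \<in> C"
  obtains "u = []" "chain_adr u = D" | y where "u = a # y" "y \<in> N" "prefix y w" "chain_adr u = ad y"
proof (cases u)
  case Nil
  thus thesis using that(1) by (simp add: chain_adr_def)
next
  case (Cons b y)
  thus thesis using that(2)[of y] assms chain_def[OF head] by (simp add: chain_adr_def)
qed

lemma chain_adr [simp]:
  assumes "u \<in> C"
  shows "is_record (chain_adr u)" "chain_adr u < fr" "chain_adr u \<noteq> cur" "chain_adr u \<noteq> cl"
proof -
  have "D < fr" using fr_eq S_pos cnt by simp
  hence "is_record (chain_adr u) \<and> chain_adr u < fr" using ad_is_record
    by (rule_tac chain_cases[OF assms]) simp_all
  thus "is_record (chain_adr u)" "chain_adr u < fr" "chain_adr u \<noteq> cur" "chain_adr u \<noteq> cl" by auto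
qed

lemma chain_adr_inj: "u \<in> C \<Longrightarrow> v \<in> C \<Longrightarrow> chain_adr u = chain_adr v \<longleftrightarrow> u = v"
  by (elim chain_cases) (auto simp: ad_inj)

lemma chain_adr_Len: "u \<in> C \<Longrightarrow> at m (chain_adr u) Len = length u"
  by (erule chain_cases) (auto simp: inv_node inv_D)

lemma chain_adr_Next: "u \<in> C \<Longrightarrow> at m (chain_adr u) (Next a) = (if u \<in> factors w then ad (locus N u) else 0)"
  by (erule chain_cases) (auto simp: inv_node(6)[OF _ a] inv_D(2)[OF a])

lemma chain_adr_Link: "u \<in> C \<Longrightarrow> u \<noteq> [] \<Longrightarrow> at m (chain_adr u) Link = chain_adr (up a w u)"
  by (erule chain_cases) (auto simp: inv_node(2) chain_adr_def up_def[OF head])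

lemma chain_adr_eq_ad: "x \<in> N \<Longrightarrow> u \<in> C \<Longrightarrow> chain_adr u = ad x \<longleftrightarrow> u = a # x"
  by (erule chain_cases) (auto simp: ad_inj)

lemma cell_lt: "is_record p \<Longrightarrow> p < q \<Longrightarrow> is_record q \<Longrightarrow> valid_field \<sigma> f \<Longrightarrow> cell \<sigma> p f < q"
proof -
  assume *: "is_record p" "p < q" "is_record q" "valid_field \<sigma> f"
  then obtain j k where jk: "p = D + S * j" "q = D + S * k" unfolding is_record_def by blast
  hence "S * j < S * k" using * by simp
  hence "j < k" by simp
  hence "S * Suc j \<le> S * k" by (intro mult_le_mono2) simp
  thus ?thesis using offset_less[OF *(4)] jk by (simp add: cell_def)
qed

text \<open>The transitions redirected by the time the first climb has reached \<open>l\<close>;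
  \<open>Bcells\<close> serves the second climb, which starts at the head \<open>mm\<close>.\<close>

definition Acells :: "nat list \<Rightarrow> nat set" where
  "Acells l = {cell \<sigma> (chain_adr u) (Next a) | u. u \<in> C \<and> length l < length u}"

definition Bcells :: "nat list \<Rightarrow> nat set" where
  "Bcells l = {cell \<sigma> (chain_adr u) (Next a) | u. u \<in> C \<and> length u \<le> length mm \<and> length l < length u}"

text \<open>The memory once the new leaf has its record; after the first climb it is
  \<open>m2\<close>.\<close>

definition m1 :: "nat \<Rightarrow> nat" where
  "m1 = m(cell \<sigma> cur Len := Suc (Suc (length w)), cell \<sigma> cur Pos := i)"

definition m2 :: "nat \<Rightarrow> nat" where
  "m2 = overwrite m1 (Acells mm) cur"

lemma m2_at:
  assumes "is_record p" "valid_field \<sigma> f"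
  shows "at m2 p f = (if p = cur \<and> f = Len then Suc (Suc (length w)) else
    if p = cur \<and> f = Pos then i else
    if f = Next a \<and> (\<exists>u\<in>C. length mm < length u \<and> chain_adr u = p) then cur else at m p f)"
proof -
  have "cell \<sigma> p f \<in> Acells mm \<longleftrightarrow> f = Next a \<and> (\<exists>u\<in>C. length mm < length u \<and> chain_adr u = p)"
  proof -
    have "cell \<sigma> p f = cell \<sigma> (chain_adr u) (Next a) \<longleftrightarrow> p = chain_adr u \<and> f = Next a" if "u \<in> C" for u
      using cell_eq[OF assms(1) chain_adr(1)[OF that] assms(2)] a by simp
    thus ?thesis unfolding Acells_def by auto
  qed
  thus ?thesis using assms by (auto simp: m2_def m1_def overwrite_def cell_eq)
qed

lemma m2_other:
  assumes "\<And>p f. is_record p \<Longrightarrow> p < cl \<Longrightarrow> valid_field \<sigma> f \<Longrightarrow> b \<noteq> cell \<sigma> p f"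
  shows "m2 b = m b"
proof -
  have "b \<notin> Acells mm" unfolding Acells_def using assms[of _ "Next a"] chain_adr a S_pos by fastforce
  thus ?thesis using assms[of cur Len] assms[of cur Pos] S_pos by (simp add: m2_def m1_def overwrite_def)
qed

lemma m2_node:
  assumes "x \<in> N" "valid_field \<sigma> f"
  shows "at m2 (ad x) f =
    (if f = Next a \<and> prefix x w \<and> length mm < Suc (length x) then cur else at m (ad x) f)"
proof -
  have "(\<exists>u\<in>C. length mm < length u \<and> chain_adr u = ad x) \<longleftrightarrow> prefix x w \<and> length mm < Suc (length x)"
    using chain_adr_eq_ad[OF assms(1)] assms(1) by (auto simp: chain_def[OF head])
  thus ?thesis using m2_at[of "ad x" f] ad_is_record[OF assms(1)] assms by auto
qed

lemma m2_D: "valid_field \<sigma> f \<Longrightarrow> at m2 D f = at m D f"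
proof -
  assume f: "valid_field \<sigma> f"
  have "\<not> (\<exists>u\<in>C. length mm < length u \<and> chain_adr u = D)"
    using chain_cases neq(6) by (metis list.size(3) not_less_zero)
  thus ?thesis using m2_at[of D f] f by auto
qed

abbreviation "z \<equiv> locus N mm"

lemma z: "z \<in> N" "prefix mm z" "\<And>y. y \<in> N \<Longrightarrow> prefix mm y \<Longrightarrow> prefix z y"
  using locus[OF head_in_factors[OF head]] by auto

lemma z_eq: "mm \<in> N \<longleftrightarrow> length z = length mm"
proof
  assume "length z = length mm"
  hence "z = mm" using z(2) by (auto simp: prefix_def)
  thus "mm \<in> N" using z(1) by simp
qed (simp add: locus_node)

text \<open>The common end of both branches of the program. The premises list what has happened to
  each kind of record, and the lemmas on \<open>nodes (a # w)\<close> show that this is the tree of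
  the longer text.\<close>

lemma inv_Cons:
  assumes ad': "ad' = (if mm \<in> N then ad(a # w := cur) else ad(a # w := cur, mm := cl))"
    and cnt': "cnt' = (if mm \<in> N then cnt + 1 else cnt + 2)"
    and txt': "\<And>j. j < 2 * n \<Longrightarrow> m' (Suc j) = m (Suc j)"
    and zero: "\<And>b. D + S * cnt' \<le> b \<Longrightarrow> m' b = 0"
    and D': "at m' D Len = 0" "\<And>c. c < \<sigma> \<Longrightarrow> at m' D (Next c) = ad []"
    and Len': "\<And>x. x \<in> N \<Longrightarrow> at m' (ad x) Len = at m (ad x) Len"
    and Pos': "\<And>x. x \<in> N \<Longrightarrow> at m' (ad x) Pos = at m (ad x) Pos"
    and Child': "\<And>x c. x \<in> N \<Longrightarrow> c < \<sigma> \<Longrightarrow> at m' (ad x) (Child c) = at m (ad x) (Child c)"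
    and Link': "\<And>x. x \<in> N \<Longrightarrow> at m' (ad x) Link =
      (if x = z \<and> mm \<notin> N then cl else at m (ad x) Link)"
    and Next': "\<And>x c. x \<in> N \<Longrightarrow> c < \<sigma> \<Longrightarrow> at m' (ad x) (Next c) =
      (if c = a \<and> prefix x w \<and> length mm < Suc (length x) then cur
       else if c = a \<and> prefix x w \<and> mm \<notin> N \<and> a # x \<in> factors w \<and> locus N (a # x) = z then cl
       else at m (ad x) (Next c))"
    and cur': "at m' cur Len = Suc (Suc (length w))" "at m' cur Pos = i"
      "at m' cur Link = (if mm \<in> N then ad mm else cl)"
      "\<And>c. c < \<sigma> \<Longrightarrow> at m' cur (Next c) = 0" "\<And>c. c < \<sigma> \<Longrightarrow> at m' cur (Child c) = 0"
    and cl': "mm \<notin> N \<Longrightarrow> at m' cl Len = Suc (length mm)" "mm \<notin> N \<Longrightarrow> at m' cl Pos = i"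
      "mm \<notin> N \<Longrightarrow> at m' cl Link = at m (ad z) Link"
      "\<And>c. mm \<notin> N \<Longrightarrow> c < \<sigma> \<Longrightarrow> at m' cl (Next c) = at m2 (ad z) (Next c)"
      "\<And>c. mm \<notin> N \<Longrightarrow> c < \<sigma> \<Longrightarrow> at m' cl (Child c) = 0"
  shows "inv (a # w) m' (D + S * cnt') ad' cnt'"
proof -
  note h = head
  have aw: "a # w \<notin> N" "mm \<noteq> a # w" using Cons_notin_nodes[OF h] head_neq[OF h] by auto
  have N': "N' = insert (a # w) (insert mm N)" using nodes_Cons[OF h] by auto
  have ad_old: "ad' x = ad x" if "x \<in> N" for x using that aw unfolding ad' by auto
  have ad_cur: "ad' (a # w) = cur" using aw unfolding ad' by auto
  have ad_mm: "ad' mm = (if mm \<in> N then ad mm else cl)" using aw unfolding ad' by auto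
  have fac': "factors (a # w) = factors w \<union> {u. prefix u (a # w)}" by (rule factors_Cons)
  have hin: "mm \<in> factors w" and hp: "prefix mm (a # w)" using head_in_factors[OF h] head_prefix[OF h] .
  have mmNil: "mm \<noteq> []" if "mm \<notin> N" using that by auto
  show ?thesis
    unfolding inv_def
  proof (intro conjI ballI allI impI)
    have ran: "ad ` N = (\<lambda>j. D + S * j) ` {1..<cnt}" and inj: "inj_on ad N"
      using inv unfolding inv_def bij_betw_def by auto
    have "bij_betw ad' (insert (a # w) (insert mm N)) ((\<lambda>j. D + S * j) ` {1..<cnt'})"
    proof (cases "mm \<in> N")
      case True
      have "ad' ` N' = insert cur (ad ` N)" using True ad_old ad_cur N' by (auto simp: insert_absorb)
      also have "\<dots> = (\<lambda>j. D + S * j) ` {1..<cnt'}"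
        using ran cnt(2) True unfolding cnt' fr_eq by (simp add: atLeastLessThanSuc)
      finally show ?thesis using True N' ad_old ad_cur inj aw
        by (auto simp: bij_betw_def inj_on_def insert_absorb ad_inj)
    next
      case False
      have "ad' ` N' = insert cur (insert cl (ad ` N))" using False ad_old ad_cur ad_mm N' by auto
      also have "\<dots> = (\<lambda>j. D + S * j) ` {1..<cnt'}"
        using ran cnt(2) False unfolding cnt' fr_eq by (auto simp: atLeastLessThanSuc algebra_simps)
      finally show ?thesis using False N' ad_old ad_cur ad_mm inj aw S_pos
        by (auto simp: bij_betw_def inj_on_def ad_inj)
    qed
    thus "bij_betw ad' (nodes (a # w)) ((\<lambda>j. D + S * j) ` {1..<cnt'})" using N' by simp
    show "cnt' \<le> 2 * length (a # w) + 2" "1 \<le> cnt'"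
      using inv unfolding cnt' inv_def by auto
    show "m' (Suc j) = W ! j" if "j < 2 * n" for j using txt' inv_D(3) that by simp
    show "at m' D (Next c) = ad' []" if "c < \<sigma>" for c using D'(2)[OF that] ad_old[of "[]"] by simp
  next
    fix x assume "x \<in> nodes (a # w)"
    then consider (old) "x \<in> N" | (new) "x = mm" "mm \<notin> N" | (word) "x = a # w" using N' by auto
    note cs = this
    show "at m' (ad' x) Len = Suc (length x)"
      using cs by cases (simp_all add: ad_old ad_cur ad_mm Len' inv_node cl' cur')
    have dw: "drop (i - 1) W = a # w" using i(1) by simp
    show "1 \<le> at m' (ad' x) Pos"
      using cs
    proof cases
      case old
      thus ?thesis using inv_node(3)[OF old] by (simp only: ad_old[OF old] Pos'[OF old])
    next
      case new
      thus ?thesis using i(2) by (simp only: ad_mm cl'(2)[OF new(2)] if_False)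
    next
      case word
      thus ?thesis using i(2) by (simp only: ad_cur cur'(2))
    qed
    show "at m' (ad' x) Pos \<le> 2 * n"
      using cs by cases (simp_all add: ad_old ad_cur ad_mm Pos' inv_node cl' cur' i(3))
    show "prefix x (drop (at m' (ad' x) Pos - 1) W)"
      using cs
    proof cases
      case old
      thus ?thesis using inv_node(5)[OF old] by (simp only: ad_old[OF old] Pos'[OF old])
    next
      case new
      thus ?thesis using hp by (simp only: ad_mm cl'(2)[OF new(2)] dw if_False)
    next
      case word
      thus ?thesis by (simp only: ad_cur cur'(2) dw prefix_order.refl)
    qed
    show "at m' (ad' x) (Child c) = 0" if "c < \<sigma>" for c
      using cs by cases (simp_all add: ad_old ad_cur ad_mm Child' inv_node cl' cur' that)
    show "at m' (ad' x) Link = (if x = [] then D else ad' (parent N' x))"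
      using cs
    proof cases
      case old
      show ?thesis
      proof (cases "x = []")
        case True
        have "\<not> ([] = z \<and> mm \<notin> N)" using z(2) by auto
        have "at m' (ad []) Link = at m (ad []) Link"
          using Link'[of "[]"] by (simp only: if_not_P[OF \<open>\<not> ([] = z \<and> mm \<notin> N)\<close>] Nil_in_nodes)
        thus ?thesis using True inv_node(2)[of "[]"] ad_old[of "[]"] by simp
      next
        case False
        have "parent N x \<in> N" using parent(1)[OF _ False, of N] by simp
        moreover have "x = z \<and> x \<noteq> mm \<longleftrightarrow> x = z \<and> mm \<notin> N"
          using old locus_node z(1) by metis
        ultimately show ?thesis
          using Link'[OF old] inv_node(2)[OF old] ad_old parent_Cons_old[OF h old False] False ad_mm old
          by auto
      qed
    next
      case new
      have "z \<noteq> []" using z(2) mmNil[OF new(2)] by auto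
      moreover have "parent N z \<in> N" using parent(1)[OF _ \<open>z \<noteq> []\<close>, of N] by simp
      ultimately show ?thesis
        using new cl'(3) ad_mm parent_Cons_head[OF h new(2)] inv_node(2)[OF z(1)] ad_old mmNil by auto
    next
      case word
      thus ?thesis using cur'(3) ad_cur ad_mm parent_Cons_self[OF h] by simp
    qed
    show "at m' (ad' x) (Next c) = (if c # x \<in> factors (a # w) then ad' (locus N' (c # x)) else 0)"
      if c: "c < \<sigma>" for c
      using cs
    proof cases
      case old
      show ?thesis
      proof (cases "c # x \<in> factors w")
        case True
        have l: "locus N (c # x) \<in> N" using locus(1)[OF True] .
        \<comment> \<open>An existing transition is not one redirected to the new leaf: its word
          would be a factor and thus a prefix of the head, against its length.\<close>
        have "\<not> (c = a \<and> prefix x w \<and> length mm < Suc (length x))"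
        proof
          assume *: "c = a \<and> prefix x w \<and> length mm < Suc (length x)"
          hence "prefix (c # x) mm" using head_iff[OF h, of "c # x"] True by simp
          thus False using * prefix_length_le by fastforce
        qed
        moreover have "prefix (c # x) mm \<longleftrightarrow> c = a \<and> prefix x w"
          using head_iff[OF h, of "c # x"] True hp prefix_order.trans[of "c # x" mm "a # w"] by auto
        ultimately show ?thesis
          using Next'[OF old c] ad_old[OF old] ad_old[OF l] True locus_Cons_old[OF h True] ad_mm
            inv_node(6)[OF old c] fac' locus_node[of mm w]
          by auto
      next
        case False
        show ?thesis
        proof (cases "c = a \<and> prefix x w")
          case True
          have "\<not> prefix (c # x) mm" using head_iff[OF h, of "c # x"] True False by simp
          hence "length mm < Suc (length x)"
            using prefix_length_prefix[of "c # x" "a # w" mm] hp True by fastforce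
          thus ?thesis
            using Next'[OF old c] True ad_old[OF old] locus_Cons_new[OF h, of "c # x"] False ad_cur fac'
              by auto
        next
          case neither: False
          thus ?thesis
            using Next'[OF old c] False inv_node(6)[OF old c] fac' ad_old[OF old] by auto
        qed
      qed
    next
      case new
      have e: "c # mm \<in> factors w \<longleftrightarrow> c # z \<in> factors w"
        "c # mm \<in> factors w \<Longrightarrow> locus N (c # mm) = locus N (c # z)"
        using extend_locus[OF hin, of c] by auto
      have "z \<noteq> mm" using new z(1) by auto
      have "length mm \<le> length z" using z(2) prefix_length_le by blast
      \<comment> \<open>The transitions are copied after the first climb, so one to the new leaf is
        inherited too. This is right because \<open>z\<close> is a prefix of \<open>w\<close> iff
        the head is.\<close>
      hence m2z: "at m2 (ad z) (Next c) =
          (if c = a \<and> prefix z w then cur else if c # z \<in> factors w then ad (locus N (c # z)) else 0)"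
        using m2_node[OF z(1), of "Next c"] c inv_node(6)[OF z(1) c] by auto
      show ?thesis
      proof (cases "c # mm \<in> factors w")
        case True
        have "\<not> prefix (c # mm) mm" using prefix_length_le by fastforce
        have "\<not> (c = a \<and> prefix mm w)"
        proof
          assume "c = a \<and> prefix mm w"
          hence "prefix (c # mm) (a # w)" by simp
          hence "prefix (c # mm) mm" using head_iff[OF h] True by blast
          thus False using \<open>\<not> prefix (c # mm) mm\<close> by simp
        qed
        moreover have "prefix z w \<Longrightarrow> prefix mm w" using z(2) prefix_order.trans by blast
        moreover have "locus N (c # mm) \<in> N" using locus(1)[OF True] .
        ultimately show ?thesis
          using new True e m2z cl'(4)[OF new(2) c] ad_mm fac' locus_Cons_old[OF h True] \<open>\<not> prefix (c # mm) mm\<close>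
            ad_old[of "locus N (c # mm)"] by auto
      next
        case False
        have "prefix mm w \<longleftrightarrow> prefix z w"
          using z(2) z(3)[OF self_in_nodes] prefix_order.trans by blast
        thus ?thesis
          using new False e m2z cl'(4)[OF new(2) c] ad_mm ad_cur fac' locus_Cons_new[OF h, of "c # mm"]
            by auto
      qed
    next
      case word
      have "c # a # w \<notin> factors (a # w)" using length_factors[of "c # a # w" "a # w"] by auto
      thus ?thesis using word cur'(4)[OF c] ad_cur by simp
    qed
  qed (use D' zero in auto)
qed

end

definition climb_time :: "nat \<Rightarrow> nat" where
  "climb_time \<sigma> = tmC (prepend_climb \<sigma>) + tmE (Equ (Ld (Trans \<sigma> vp va)) (Lit 0)) + 2 +
    tmC (prepend_redirect \<sigma>) + tmE (Equ (Ld (Trans \<sigma> vp va)) (Var vq)) + 2"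

text \<open>The summand \<open>3 * climb_time\<close> comes from the constant 3 of
  \<open>chain_potential\<close>; the rest runs once per letter.\<close>

definition prepend_time :: "nat \<Rightarrow> nat" where
  "prepend_time \<sigma> = 3 * climb_time \<sigma> + tmC (prepend_leaf \<sigma>) + tmE (Equ (Ld (Trans \<sigma> vp va)) (Lit 0)) + 2 +
      tmC (vq ::= Ld (Trans \<sigma> vp va)) +
    tmE (Equ (Ld (Fd \<sigma> (Var vq) Len)) (Inc (Ld (Fd \<sigma> (Var vp) Len)) 1)) + 2 +
    tmC (Sto (Fd \<sigma> (Var vcur) Link) (Var vq)) + tmC (prepend_split \<sigma>) + tmC (prepend_copy \<sigma>) +
    tmE (Equ (Ld (Trans \<sigma> vp va)) (Var vq)) + 2 + tmC (prepend_links \<sigma>) + tmC prepend_next"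

section \<open>Correctness and amortised time of a step\<close>

context weiner
begin

lemma letter: "m i = a"
proof -
  have "a = hd (drop (i - 1) W)" using i(1)[symmetric] by simp
  also have "\<dots> = W ! (i - 1)" using i(2,3) by (intro hd_drop_conv_nth) simp
  finally show ?thesis using inv_D(3)[of "i - 1"] i(2,3) by simp
qed

lemma chain_same_length: "u \<in> C \<Longrightarrow> v \<in> C \<Longrightarrow> length u = length v \<Longrightarrow> u = v"
  using chain_linear[OF head, of u v] chain_linear[OF head, of v u] by (auto dest: prefix_order.antisym)

lemma mm_C: "mm \<in> C"
  by (rule head_in_chain[OF head])

lemma up_props:
  assumes "u \<in> C" "u \<noteq> []"
  shows "up a w u \<in> C" "Acells (up a w u) = insert (cell \<sigma> (chain_adr u) (Next a)) (Acells u)"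
    "card {v \<in> C. length (up a w u) < length v} = Suc (card {v \<in> C. length u < length v})"
    "v \<in> C \<Longrightarrow> length v < length u \<Longrightarrow> length v \<le> length (up a w u)"
    "v \<in> C \<Longrightarrow> length (up a w u) < length v \<longleftrightarrow> v = u \<or> length u < length v"
    "length (up a w u) < length u"
proof -
  note up = up[OF head assms]
  show "up a w u \<in> C" "length (up a w u) < length u" by (rule up)+
  have iff: "v \<in> C \<and> length (up a w u) < length v \<longleftrightarrow> v = u \<or> v \<in> C \<and> length u < length v" for v
    using up(2) by blast
  thus "v \<in> C \<Longrightarrow> length (up a w u) < length v \<longleftrightarrow> v = u \<or> length u < length v" by blast
  thus "v \<in> C \<Longrightarrow> length v < length u \<Longrightarrow> length v \<le> length (up a w u)"
    by (metis leI less_asym less_irrefl)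
  show "Acells (up a w u) = insert (cell \<sigma> (chain_adr u) (Next a)) (Acells u)"
    unfolding Acells_def iff by blast
  have "finite {v \<in> C. length u < length v}" using finite_chain[OF head] by simp
  thus "card {v \<in> C. length (up a w u) < length v} = Suc (card {v \<in> C. length u < length v})"
    unfolding up(2) by simp
qed

lemma Acells_top: "Acells (a # w) = {}" "{v \<in> C. length (a # w) < length v} = {}"
  unfolding Acells_def chain_def[OF head] by (auto dest: prefix_length_le)

lemma cell_chain_adr_eq: "u \<in> C \<Longrightarrow> is_record p \<Longrightarrow> valid_field \<sigma> f \<Longrightarrow> cell \<sigma> p f =
    cell \<sigma> (chain_adr u) (Next a) \<longleftrightarrow> p = chain_adr u \<and> f = Next a"
  using cell_eq[of p "chain_adr u" f "Next a"] a by simp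

lemma Acells_iff: "is_record p \<Longrightarrow> valid_field \<sigma> f \<Longrightarrow>
    cell \<sigma> p f \<in> Acells l \<longleftrightarrow> f = Next a \<and> (\<exists>u\<in>C. length l < length u \<and> chain_adr u = p)"
  unfolding Acells_def using cell_chain_adr_eq by auto

lemma m1_at: "is_record p \<Longrightarrow> p \<noteq> cur \<Longrightarrow> valid_field \<sigma> f \<Longrightarrow> at m1 p f = at m p f"
  by (simp add: m1_def cell_eq)

lemma ex_prepend_leaf:
  assumes "r vi = i" "r vfr = fr" "r vlast = ad w"
  shows "ex (prepend_leaf \<sigma>) (r, m) = (r(va := a, vcur := fr, vfr := fr + S, vp := ad w), m1)"
    "okC bnd (prepend_leaf \<sigma>) (r, m)"
  using assms letter inv_node(1)[of w] by (simp_all add: prepend_leaf_def m1_def)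

text \<open>A chain element has a transition iff it is a factor, that is, no longer than the head;
  so the climb stops exactly there. The clock pays \<open>climb_time\<close> for each chain element
  longer than the present one.\<close>

lemma wp_loop1:
  assumes r: "r va = a" "r vcur = fr" "r vp = ad w"
    and Q: "\<And>t'. t' \<le> t + climb_time \<sigma> * card {v \<in> C. length mm < length v} +
        tmE (Equ (Ld (Trans \<sigma> vp va)) (Lit 0)) + 2 \<Longrightarrow>
      Q (r(vp := chain_adr mm), m2) t'"
  shows "wp bnd (While (Equ (Ld (Trans \<sigma> vp va)) (Lit 0)) (prepend_climb \<sigma>)) Q (r, m1) t"
proof -
  let ?k = "\<lambda>u. card {v \<in> C. length u < length v}"
  let ?I = "\<lambda>s t1. \<exists>u\<in>C. length mm \<le> length u \<and> s = (r(vp := chain_adr u), overwrite m1 (Acells u) fr) \<and>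
    t1 \<le> t + climb_time \<sigma> * ?k u"
  have lookup: "overwrite m1 (Acells u) fr (cell \<sigma> (chain_adr u) (Next a)) =
      (if u \<in> factors w then ad (locus N u) else 0)"
    if u: "u \<in> C" for u
  proof -
    have "cell \<sigma> (chain_adr u) (Next a) \<notin> Acells u"
      using Acells_iff[of "chain_adr u" "Next a" u] u a chain_adr_inj by auto
    thus ?thesis using m1_at[of "chain_adr u" "Next a"] u a chain_adr_Next[OF u] by (simp add: overwrite_def)
  qed
  have nz: "ad (locus N u) \<noteq> 0" if "u \<in> factors w" for u using locus(1)[OF that] by simp
  show ?thesis
  proof (rule wp_While[where I = ?I and T = "t + climb_time \<sigma> * card C"])
    have "r = r(vp := chain_adr (a # w))" using r(3) by (auto simp: chain_adr_def)
    moreover have "m1 = overwrite m1 (Acells (a # w)) fr" unfolding Acells_top by simp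
    moreover have "t \<le> t + climb_time \<sigma> * ?k (a # w)" by simp
    moreover have "length mm \<le> length (a # w)" using head_prefix[OF head] by (rule prefix_length_le)
    ultimately show "?I (r, m1) t" using Cons_in_chain[OF head] by blast
  next
    fix s t1 assume "?I s t1"
    then obtain u where u: "u \<in> C" "length mm \<le> length u"
        "s = (r(vp := chain_adr u), overwrite m1 (Acells u) fr)"
      "t1 \<le> t + climb_time \<sigma> * ?k u" by blast
    have "?k u \<le> card C" using finite_chain[OF head] by (intro card_mono) auto
    hence "climb_time \<sigma> * ?k u \<le> climb_time \<sigma> * card C" by (rule mult_le_mono2)
    thus "t1 \<le> t + climb_time \<sigma> * card C" using u(4) by linarith
    show "okE bnd (Equ (Ld (Trans \<sigma> vp va)) (Lit 0)) s"
      using u is_record_le[of "chain_adr u" "Next a"] a r(1) by simp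
    { assume g: "aval (Equ (Ld (Trans \<sigma> vp va)) (Lit 0)) s \<noteq> 0"
      have nf: "u \<notin> factors w" using g lookup[OF u(1)] nz[of u] u(3) r(1) by (auto split: if_splits)
      hence "u \<noteq> []" by auto
      note up = up_props[OF u(1) \<open>u \<noteq> []\<close>]
      have "overwrite m1 (Acells (up a w u)) fr (cell \<sigma> (chain_adr u) Link) = chain_adr (up a w u)"
      proof -
        have "cell \<sigma> (chain_adr u) Link \<notin> Acells (up a w u)" using Acells_iff[of "chain_adr u" Link] u(1)
          by auto
        thus ?thesis using m1_at[of "chain_adr u" Link] chain_adr_Link[OF u(1) \<open>u \<noteq> []\<close>] u(1)
          by (simp add: overwrite_def)
      qed
      hence ex: "ex (prepend_climb \<sigma>) s =
          (r(vp := chain_adr (up a w u)), overwrite m1 (Acells (up a w u)) fr)"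
        using u(3) r by (simp add: prepend_climb_def overwrite_insert up(2))
      have ok: "okC bnd (prepend_climb \<sigma>) s" using u is_record_le[of "chain_adr u" "Next a"] a r(1)
        by (simp add: prepend_climb_def)
      have le: "length mm \<le> length (up a w u)"
      proof (rule up(4)[OF mm_C])
        show "length mm < length u" using chain_factors[OF head u(1)] nf by simp
      qed
      have "climb_time \<sigma> * ?k (up a w u) = climb_time \<sigma> + climb_time \<sigma> * ?k u" unfolding up(3) by simp
      moreover have "tmC (prepend_climb \<sigma>) + tmE (Equ (Ld (Trans \<sigma> vp va)) (Lit 0)) + 2 \<le> climb_time \<sigma>"
        by (simp add: climb_time_def)
      ultimately have "t1 + tmE (Equ (Ld (Trans \<sigma> vp va)) (Lit 0)) + 2 + tmC (prepend_climb \<sigma>) \<le> t +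
          climb_time \<sigma> * ?k (up a w u)"
        using u(4) by linarith
      hence "?I (ex (prepend_climb \<sigma>) s) (t1 + tmE (Equ (Ld (Trans \<sigma> vp va)) (Lit 0)) + 2 +
          tmC (prepend_climb \<sigma>))"
        using up(1) le ex by blast
      moreover have "loop_free (prepend_climb \<sigma>)" by (simp add: prepend_climb_def)
      ultimately show "wp bnd (prepend_climb \<sigma>) ?I s (t1 + tmE (Equ (Ld (Trans \<sigma> vp va)) (Lit 0)) + 2)"
        by (intro wp_loop_free ok) }
    { assume g: "aval (Equ (Ld (Trans \<sigma> vp va)) (Lit 0)) s = 0"
      have "u \<in> factors w" using g lookup[OF u(1)] u(3) r(1) by (auto split: if_splits)
      hence "length u \<le> length mm" using chain_factors[OF head u(1)] by simp
      hence "u = mm" using u(2) chain_same_length[OF u(1) mm_C] by simp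
      thus "Q s (t1 + tmE (Equ (Ld (Trans \<sigma> vp va)) (Lit 0)) + 2)"
        using u(3,4) Q by (simp add: m2_def) }
  qed
qed

lemma m2_chain_adr: "u \<in> C \<Longrightarrow> length u \<le> length mm \<Longrightarrow> valid_field \<sigma> f \<Longrightarrow> at m2 (chain_adr u) f =
    at m (chain_adr u) f"
  using m2_at[of "chain_adr u" f] chain_adr_inj[of _ u] by auto

lemma m2_z: "at m2 (chain_adr mm) (Next a) = ad z" "at m2 (ad z) Len = Suc (length z)"
    "at m2 (chain_adr mm) Len = length mm" "at m2 (ad z) Link = at m (ad z) Link"
  using m2_chain_adr[OF mm_C order_refl, of "Next a"] m2_chain_adr[OF mm_C order_refl, of Len] a
      chain_adr_Next[OF mm_C]
    head_in_factors[OF head] chain_adr_Len[OF mm_C] m2_node[OF z(1), of Len] m2_node[OF z(1), of Link]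
        inv_node(1)[OF z(1)]
  by simp_all

text \<open>A predicate rather than a function, because the record \<open>cl\<close> is described
  only as far as the invariant speaks about it.\<close>

definition m3 :: "(nat \<Rightarrow> nat) \<Rightarrow> bool" where
  "m3 M \<longleftrightarrow> at M cl Len = Suc (length mm) \<and> at M cl Link = at m (ad z) Link \<and> at M cl Pos = i \<and>
    (\<forall>c<\<sigma>. at M cl (Next c) = at m2 (ad z) (Next c)) \<and> (\<forall>c<\<sigma>. at M cl (Child c) = 0) \<and>
    (\<forall>b. (\<forall>f. valid_field \<sigma> f \<longrightarrow> b \<noteq> cell \<sigma> cl f) \<longrightarrow> M b = m2 b)"

lemma ex_copy:
  assumes "r vfr = cl" "r vp = chain_adr mm" "r vq = ad z" "r vi = i"
  shows "\<exists>M. ex (prepend_split \<sigma>;; prepend_copy \<sigma>) (r, m2) = (r(vcl := cl, vfr := cl + S), M) \<and> m3 M"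
    "okC bnd (prepend_split \<sigma>;; prepend_copy \<sigma>) (r, m2)"
proof -
  let ?r = "r(vcl := cl, vfr := cl + S)"
  let ?m = "m2(cell \<sigma> cl Len := Suc (length mm), cell \<sigma> cl Link := at m (ad z) Link, cell \<sigma> cl Pos := i)"
  have ex4: "ex (prepend_split \<sigma>) (r, m2) = (?r, ?m)"
    using assms m2_z z(1) ad_is_record(1)[OF z(1)] by (simp add: prepend_split_def cell_eq)
  have "\<exists>M. ex (prepend_copy \<sigma>) (?r, ?m) = (?r, M) \<and>
      (\<forall>c\<in>set [0..<\<sigma>]. at M cl (Next c) = at m2 (ad z) (Next c)) \<and>
      (\<forall>b. b \<notin> (\<lambda>c. cell \<sigma> cl (Next c)) ` set [0..<\<sigma>] \<longrightarrow> M b = ?m b)"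
    unfolding prepend_copy_def
  proof (rule ex_stores)
    show "distinct (map (\<lambda>c. cell \<sigma> cl (Next c)) [0..<\<sigma>])" by (simp add: distinct_map inj_on_def cell_def)
    show "aval (Fd \<sigma> (Var vcl) (Next c)) (?r, m') = cell \<sigma> cl (Next c)" for c m' by simp
    fix c m' assume c: "c \<in> set [0..<\<sigma>]"
      and m': "\<forall>b. b \<notin> (\<lambda>c. cell \<sigma> cl (Next c)) ` set [0..<\<sigma>] \<longrightarrow> m' b = ?m b"
    have "cell \<sigma> (ad z) (Next c) \<notin> (\<lambda>c. cell \<sigma> cl (Next c)) ` set [0..<\<sigma>]"
      using c z(1) ad_is_record(1)[OF z(1)] by (auto simp: cell_eq)
    hence "m' (cell \<sigma> (ad z) (Next c)) = ?m (cell \<sigma> (ad z) (Next c))" using m' by blast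
    thus "aval (Ld (Fd \<sigma> (Var vq) (Next c))) (?r, m') = at m2 (ad z) (Next c)"
      using c assms(3) z(1) ad_is_record(1)[OF z(1)] by (simp add: cell_eq)
  qed
  then obtain M where M0: "ex (prepend_copy \<sigma>) (?r, ?m) = (?r, M)"
    "\<forall>c\<in>set [0..<\<sigma>]. at M cl (Next c) = at m2 (ad z) (Next c)"
    "\<forall>b. b \<notin> (\<lambda>c. cell \<sigma> cl (Next c)) ` set [0..<\<sigma>] \<longrightarrow> M b = ?m b" by blast
  have M: "ex (prepend_copy \<sigma>) (?r, ?m) = (?r, M)"
    "\<And>c. c < \<sigma> \<Longrightarrow> at M cl (Next c) = at m2 (ad z) (Next c)"
    "\<And>b. (\<forall>c<\<sigma>. b \<noteq> cell \<sigma> cl (Next c)) \<Longrightarrow> M b = ?m b"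
  proof -
    fix b assume "\<forall>c<\<sigma>. b \<noteq> cell \<sigma> cl (Next c)"
    hence "b \<notin> (\<lambda>c. cell \<sigma> cl (Next c)) ` set [0..<\<sigma>]" by auto
    thus "M b = ?m b" using M0(3) by blast
  qed (use M0 in simp_all)
  have at: "at M cl f = at ?m cl f" if "valid_field \<sigma> f" "\<forall>c. f \<noteq> Next c" for f
    using that by (intro M(3)) (simp add: cell_eq)
  have fr0: "at m2 cl (Child c) = 0" if "c < \<sigma>" for c
    using m2_at[of cl "Child c"] that fresh by simp
  have "m3 M"
    unfolding m3_def
  proof (intro conjI allI impI)
    fix b assume b: "\<forall>f. valid_field \<sigma> f \<longrightarrow> b \<noteq> cell \<sigma> cl f"
    have "M b = ?m b" using b by (intro M(3)) simp
    thus "M b = m2 b" using b by simp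
  qed (simp_all add: at cell_eq M(2) fr0)
  thus "\<exists>M. ex (prepend_split \<sigma>;; prepend_copy \<sigma>) (r, m2) = (?r, M) \<and> m3 M" using ex4 M(1) by auto
  have "okC bnd (prepend_copy \<sigma>) (?r, ?m)" unfolding prepend_copy_def by (rule okC_stores) simp
  thus "okC bnd (prepend_split \<sigma>;; prepend_copy \<sigma>) (r, m2)" using ex4 by (simp) (simp add: prepend_split_def)
qed

lemma m3_at: "m3 M \<Longrightarrow> is_record p \<Longrightarrow> p \<noteq> cl \<Longrightarrow> valid_field \<sigma> f \<Longrightarrow> at M p f = at m2 p f"
  unfolding m3_def using cell_eq by auto

text \<open>The chain elements with locus \<open>z\<close> form an interval ending at the head, so
  the second climb may stop at the first element with another locus.\<close>

lemma locus_between: "u \<in> C \<Longrightarrow> v \<in> C \<Longrightarrow> length v \<le> length u \<Longrightarrow> length u \<le> length mm \<Longrightarrow> locus N v = z \<Longrightarrow>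
    locus N u = z"
proof -
  assume *: "u \<in> C" "v \<in> C" "length v \<le> length u" "length u \<le> length mm" "locus N v = z"
  hence f: "u \<in> factors w" "v \<in> factors w" using chain_factors[OF head] by auto
  have p: "prefix v u" "prefix u mm" using chain_linear[OF head] * mm_C by auto
  have "prefix u z" using p(2) z(2) by (rule prefix_order.trans)
  hence "prefix (locus N u) z" by (rule locus(3)[OF f(1) z(1)])
  moreover have "prefix v (locus N u)" using p(1) locus(2)[OF f(1)] by (rule prefix_order.trans)
  hence "prefix z (locus N u)" using locus(3)[OF f(2) locus(1)[OF f(1)]] *(5) by simp
  ultimately show "locus N u = z" by (rule prefix_order.antisym)
qed

lemma Bcells_iff: "is_record p \<Longrightarrow> valid_field \<sigma> f \<Longrightarrow>
    cell \<sigma> p f \<in> Bcells l \<longleftrightarrow> f = Next a \<and> (\<exists>u\<in>C. length u \<le> length mm \<and> length l < length u \<and> chain_adr u = p)"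
  unfolding Bcells_def using cell_chain_adr_eq by auto

lemma wp_loop2:
  assumes r: "r va = a" "r vp = chain_adr mm" "r vq = ad z" "r vcl = cl" and M: "m3 M" and new: "mm \<notin> N"
    and Q: "\<And>t' u. u \<in> C \<Longrightarrow> \<forall>v\<in>C. length v \<le> length mm \<longrightarrow> (length u < length v \<longleftrightarrow> locus N v = z) \<Longrightarrow>
      length u \<le> length mm \<Longrightarrow>
      t' \<le> t + climb_time \<sigma> * card {v \<in> C. length v \<le> length mm \<and> length u < length v} +
        tmE (Equ (Ld (Trans \<sigma> vp va)) (Var vq)) + 2 \<Longrightarrow>
      Q (r(vp := chain_adr u), overwrite M (Bcells u) cl) t'"
  shows "wp bnd (While (Equ (Ld (Trans \<sigma> vp va)) (Var vq)) (prepend_redirect \<sigma>)) Q (r, M) t"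
proof -
  let ?k = "\<lambda>u. card {v \<in> C. length v \<le> length mm \<and> length u < length v}"
  let ?I = "\<lambda>s t1. \<exists>u\<in>C. length u \<le> length mm \<and> s = (r(vp := chain_adr u), overwrite M (Bcells u) cl) \<and>
    (\<forall>v\<in>C. length v \<le> length mm \<and> length u < length v \<longrightarrow> locus N v = z) \<and> t1 \<le> t + climb_time \<sigma> * ?k u"
  have fin: "finite {v \<in> C. P v}" for P using finite_chain[OF head] by simp
  have lookup: "overwrite M (Bcells u) cl (cell \<sigma> (chain_adr u) (Next a)) = ad (locus N u)"
    if u: "u \<in> C" "length u \<le> length mm" for u
  proof -
    have "cell \<sigma> (chain_adr u) (Next a) \<notin> Bcells u"
      using Bcells_iff[of "chain_adr u" "Next a" u] u a chain_adr_inj by auto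
    thus ?thesis using m3_at[OF M, of "chain_adr u" "Next a"] u a chain_adr_Next[OF u(1)]
        m2_chain_adr[OF u, of "Next a"]
      chain_factors[OF head u(1)] by (simp add: overwrite_def)
  qed
  \<comment> \<open>The transitions of the sentinel lead to the root, so this keeps the loop from
    climbing past the sentinel.\<close>
  have z_ne: "z \<noteq> []" using z(2) new by auto
  show ?thesis
  proof (rule wp_While[where I = ?I and T = "t + climb_time \<sigma> * card C"])
    have "r = r(vp := chain_adr mm)" using r(2) by auto
    moreover have "Bcells mm = {}" unfolding Bcells_def by auto
    hence "M = overwrite M (Bcells mm) cl" by simp
    moreover have "t \<le> t + climb_time \<sigma> * ?k mm" by simp
    moreover have "\<forall>v\<in>C. length v \<le> length mm \<and> length mm < length v \<longrightarrow> locus N v = z" by auto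
    ultimately show "?I (r, M) t" using mm_C by blast
  next
    fix s t1 assume "?I s t1"
    then obtain u where u: "u \<in> C" "length u \<le> length mm"
        "s = (r(vp := chain_adr u), overwrite M (Bcells u) cl)"
      "\<forall>v\<in>C. length v \<le> length mm \<and> length u < length v \<longrightarrow> locus N v = z"
      "t1 \<le> t + climb_time \<sigma> * ?k u" by blast
    have uf: "u \<in> factors w" using chain_factors[OF head u(1)] u(2) by simp
    have "?k u \<le> card C" using finite_chain[OF head] by (intro card_mono) auto
    hence "climb_time \<sigma> * ?k u \<le> climb_time \<sigma> * card C" by (rule mult_le_mono2)
    thus "t1 \<le> t + climb_time \<sigma> * card C" using u(5) by linarith
    show "okE bnd (Equ (Ld (Trans \<sigma> vp va)) (Var vq)) s"
      using u is_record_le[of "chain_adr u" "Next a"] a r(1) by simp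
    have chosen: "aval (Equ (Ld (Trans \<sigma> vp va)) (Var vq)) s = of_bool (locus N u = z)"
      using lookup[OF u(1,2)] u(3) r(1,3) ad_inj[OF locus(1)[OF uf] z(1)] by simp
    { assume "aval (Equ (Ld (Trans \<sigma> vp va)) (Var vq)) s \<noteq> 0"
      hence g: "locus N u = z" unfolding chosen by simp
      hence "u \<noteq> []" using z_ne by auto
      note up = up_props[OF u(1) \<open>u \<noteq> []\<close>]
      have B: "Bcells (up a w u) = insert (cell \<sigma> (chain_adr u) (Next a)) (Bcells u)"
        unfolding Bcells_def using up(5) u(1,2) by blast
      have "overwrite M (Bcells (up a w u)) cl (cell \<sigma> (chain_adr u) Link) = chain_adr (up a w u)"
      proof -
        have "cell \<sigma> (chain_adr u) Link \<notin> Bcells (up a w u)" using Bcells_iff[of "chain_adr u" Link] u(1)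
          by auto
        thus ?thesis using m3_at[OF M, of "chain_adr u" Link] chain_adr_Link[OF u(1) \<open>u \<noteq> []\<close>] u(1)
          m2_chain_adr[OF u(1,2), of Link] by (simp add: overwrite_def)
      qed
      hence ex: "ex (prepend_redirect \<sigma>) s =
          (r(vp := chain_adr (up a w u)), overwrite M (Bcells (up a w u)) cl)"
        using u(3) r by (simp add: prepend_redirect_def overwrite_insert B)
      have ok: "okC bnd (prepend_redirect \<sigma>) s" using u is_record_le[of "chain_adr u" "Next a"] a r(1)
        by (simp add: prepend_redirect_def)
      have "{v \<in> C. length v \<le> length mm \<and> length (up a w u) < length v} =
          insert u {v \<in> C. length v \<le> length mm \<and> length u < length v}"
        using up(5) u(1,2) by auto
      hence "?k (up a w u) = Suc (?k u)" using fin by simp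
      hence "climb_time \<sigma> * ?k (up a w u) = climb_time \<sigma> + climb_time \<sigma> * ?k u" by simp
      moreover have "tmC (prepend_redirect \<sigma>) + tmE (Equ (Ld (Trans \<sigma> vp va)) (Var vq)) + 2 \<le> climb_time \<sigma>"
        by (simp add: climb_time_def)
      ultimately have "t1 + tmE (Equ (Ld (Trans \<sigma> vp va)) (Var vq)) + 2 + tmC (prepend_redirect \<sigma>) \<le> t +
          climb_time \<sigma> * ?k (up a w u)"
        using u(5) by linarith
      moreover have "\<forall>v\<in>C. length v \<le> length mm \<and> length (up a w u) < length v \<longrightarrow> locus N v = z"
        using up(5) u(4) g by blast
      moreover have "length (up a w u) \<le> length mm" using up(6) u(2) by simp
      ultimately have "?I (ex (prepend_redirect \<sigma>) s) (t1 + tmE (Equ (Ld (Trans \<sigma> vp va)) (Var vq)) + 2 +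
          tmC (prepend_redirect \<sigma>))"
        using up(1) ex by blast
      moreover have "loop_free (prepend_redirect \<sigma>)" by (simp add: prepend_redirect_def)
      ultimately show "wp bnd (prepend_redirect \<sigma>) ?I s (t1 + tmE (Equ (Ld (Trans \<sigma> vp va)) (Var vq)) + 2)"
        by (intro wp_loop_free ok) }
    { assume "aval (Equ (Ld (Trans \<sigma> vp va)) (Var vq)) s = 0"
      hence g: "locus N u \<noteq> z" unfolding chosen by simp
      have "\<forall>v\<in>C. length v \<le> length mm \<longrightarrow> (length u < length v \<longleftrightarrow> locus N v = z)"
        using u(4) g locus_between[OF u(1) _ _ u(2)] by (meson not_le_imp_less)
      thus "Q s (t1 + tmE (Equ (Ld (Trans \<sigma> vp va)) (Var vq)) + 2)"
        unfolding u(3) using u(1,2,5) by (intro Q) auto }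
  qed
qed

lemma old_case:
  assumes "mm \<in> N"
  shows "inv (a # w) (m2(cell \<sigma> cur Link := ad z)) cl (ad(a # w := cur)) (cnt + 1)"
proof -
  let ?m = "m2(cell \<sigma> cur Link := ad z)"
  have zm: "z = mm" using assms by (rule locus_node)
  have far: "?m b = m b" if "b \<le> 2 * n \<or> cl \<le> b" for b
  proof -
    have "b \<noteq> cell \<sigma> p f" if "is_record p" "p < cl" "valid_field \<sigma> f" for p f
      using text_cell[OF that(1), of b f] cell_lt[OF that(1,2) is_record(3) that(3)] \<open>b \<le> 2 * n \<or> cl \<le> b\<close>
        by auto
    thus ?thesis using m2_other[of b] S_pos by simp
  qed
  have "inv (a # w) ?m (D + S * (cnt + 1)) (ad(a # w := cur)) (cnt + 1)"
  proof (rule inv_Cons)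
    show "?m b = 0" if "D + S * (cnt + 1) \<le> b" for b
      using far[of b] that inv_D(4)[of b] by (simp add: fr_eq)
    show "?m (Suc j) = m (Suc j)" if "j < 2 * n" for j using far that by simp
  qed (use assms zm inv_D m2_D ad_is_record m2_at[of cur] fresh in \<open>simp_all add: cell_eq m2_node\<close>)
  thus ?thesis by (simp add: fr_eq algebra_simps)
qed

lemma new_case:
  assumes new: "mm \<notin> N" and M: "m3 M"
    and u: "\<forall>v\<in>C. length v \<le> length mm \<longrightarrow> (length u < length v \<longleftrightarrow> locus N v = z)"
  shows "inv (a # w) ((overwrite M (Bcells u) cl)(cell \<sigma> (ad z) Link := cl, cell \<sigma> cur Link := cl)) (cl + S)
    (ad(a # w := cur, mm := cl)) (cnt + 2)"
proof -
  let ?m = "(overwrite M (Bcells u) cl)(cell \<sigma> (ad z) Link := cl, cell \<sigma> cur Link := cl)"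
  note zi = ad_is_record(1)[OF z(1)]
  have at: "at ?m p f = (if p = cur \<and> f = Link then cl else if p = ad z \<and> f = Link then cl
      else if f = Next a \<and> (\<exists>v\<in>C. v \<in> factors w \<and> locus N v = z \<and> chain_adr v = p) then cl else at M p f)"
    if "is_record p" "valid_field \<sigma> f" for p f
  proof -
    have "(\<exists>v\<in>C. length v \<le> length mm \<and> length u < length v \<and> chain_adr v = p) \<longleftrightarrow>
        (\<exists>v\<in>C. v \<in> factors w \<and> locus N v = z \<and> chain_adr v = p)"
      using u chain_factors[OF head] by blast
    hence B: "cell \<sigma> p f \<in> Bcells u \<longleftrightarrow> f = Next a \<and> (\<exists>v\<in>C. v \<in> factors w \<and> locus N v = z \<and> chain_adr v = p)"
      using Bcells_iff[OF that, of u] by simp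
    show ?thesis unfolding B[symmetric] using that zi by (simp add: cell_eq overwrite_def)
  qed
  have node: "at ?m (ad x) f = (if x = z \<and> f = Link then cl else
      if f = Next a \<and> prefix x w \<and> a # x \<in> factors w \<and> locus N (a # x) = z then cl else at m2 (ad x) f)"
    if "x \<in> N" "valid_field \<sigma> f" for x f
  proof -
    have "(\<exists>v\<in>C. v \<in> factors w \<and> locus N v = z \<and> chain_adr v = ad x) \<longleftrightarrow>
        prefix x w \<and> a # x \<in> factors w \<and> locus N (a # x) = z"
      using chain_adr_eq_ad[OF that(1)] that(1) by (auto simp: chain_def[OF head])
    thus ?thesis using at[OF ad_is_record(1)[OF that(1)] that(2)]
        m3_at[OF M ad_is_record(1)[OF that(1)] _ that(2)]
      that z(1) by (simp add: ad_inj)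
  qed
  have noD: "\<not> (\<exists>v\<in>C. v \<in> factors w \<and> locus N v = z \<and> chain_adr v = D)"
  proof
    assume "\<exists>v\<in>C. v \<in> factors w \<and> locus N v = z \<and> chain_adr v = D"
    then obtain v where v: "v \<in> C" "locus N v = z" "chain_adr v = D" by blast
    hence "v = []" using neq(6) by (rule_tac chain_cases[OF v(1)]) auto
    hence "z = []" using v(2) by simp
    thus False using z(2) new by auto
  qed
  have DD: "at ?m D f = at m D f" if "valid_field \<sigma> f" for f
    using at[OF is_record(1) that] noD m3_at[OF M is_record(1) _ that] m2_D[OF that] z(1) by simp
  have none: "\<not> (\<exists>v\<in>C. v \<in> factors w \<and> locus N v = z \<and> chain_adr v = cur)"
      "\<not> (\<exists>v\<in>C. v \<in> factors w \<and> locus N v = z \<and> chain_adr v = cl)"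
    using chain_adr by blast+
  have cc: "at ?m cur f = (if f = Link then cl else at m2 cur f)" if "valid_field \<sigma> f" for f
    using at[OF is_record(2) that] none m3_at[OF M is_record(2) _ that] z(1) by simp
  have ll: "at ?m cl f = at M cl f" if "valid_field \<sigma> f" for f
    using at[OF is_record(3) that] none z(1) by simp
  have far: "?m b = m b" if "b \<le> 2 * n \<or> cl + S \<le> b" for b
  proof -
    have nb: "b \<noteq> cell \<sigma> p f" if "is_record p" "valid_field \<sigma> f" for p f
    proof -
      from that(1) obtain j where "j < cnt + 2" "p = D + S * j" unfolding is_record_def by blast
      moreover have "S * Suc j \<le> S * (cnt + 2)" using calculation(1) by (intro mult_le_mono2) simp
      ultimately have "cell \<sigma> p f < cl + S" using offset_less[OF that(2)] by (simp add: cell_def fr_eq)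
      thus ?thesis using text_cell[OF that(1), of b f] \<open>b \<le> 2 * n \<or> cl + S \<le> b\<close> by auto
    qed
    have "b \<notin> Bcells u" unfolding Bcells_def using nb[OF chain_adr(1), of _ "Next a"] a by auto
    hence "?m b = M b" using nb[OF zi, of Link] nb[OF is_record(2), of Link] by (simp add: overwrite_def)
    also have "M b = m2 b" using M nb[OF is_record(3)] unfolding m3_def by blast
    also have "m2 b = m b" using nb by (intro m2_other) blast
    finally show ?thesis .
  qed
  have M': "at M cl Len = Suc (length mm)" "at M cl Link = at m (ad z) Link" "at M cl Pos = i"
    "c < \<sigma> \<Longrightarrow> at M cl (Next c) = at m2 (ad z) (Next c)" "c < \<sigma> \<Longrightarrow> at M cl (Child c) = 0" for c
    using M unfolding m3_def by blast+
  have "inv (a # w) ?m (D + S * (cnt + 2)) (ad(a # w := cur, mm := cl)) (cnt + 2)"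
  proof (rule inv_Cons)
    show "?m b = 0" if "D + S * (cnt + 2) \<le> b" for b
      using far[of b] that inv_D(4)[of b] by (simp add: fr_eq)
    show "?m (Suc j) = m (Suc j)" if "j < 2 * n" for j using far that by simp
    show "at ?m (ad x) (Next c) =
      (if c = a \<and> prefix x w \<and> length mm < Suc (length x) then cur
       else if c = a \<and> prefix x w \<and> mm \<notin> N \<and> a # x \<in> factors w \<and> locus N (a # x) = z then cl
       else at m (ad x) (Next c))" if "x \<in> N" "c < \<sigma>" for x c
    proof -
      have "a # x \<notin> factors w" if "prefix x w" "length mm < Suc (length x)"
        using chain_factors[OF head, of "a # x"] that \<open>x \<in> N\<close> by (simp add: chain_def[OF head])
      thus ?thesis using node[OF that(1), of "Next c"] m2_node[OF that(1), of "Next c"] that(2) new by auto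
    qed
  qed (use new inv_D DD node m2_at[of cur] fresh cc ll M' in \<open>simp_all add: m2_node\<close>)
  thus ?thesis by (simp add: fr_eq algebra_simps)
qed

text \<open>The potential is \<open>climb_time\<close> times \<open>depth\<close>: a long climb is
  paid by a drop of the depth.\<close>

lemma wp_ext:
  assumes r: "r vn = n" "r vd = D" "r vi = i" "r vfr = fr" "r vlast = ad w"
  shows "wp bnd (prepend \<sigma>) (\<lambda>s t'. fst s vn = n \<and> fst s vd = D \<and> fst s vi = i - 1 \<and>
    (\<exists>ad' cnt'. inv (a # w) (snd s) (fst s vfr) ad' cnt' \<and> fst s vlast = ad' (a # w)) \<and>
    t' + climb_time \<sigma> * depth (a # w) \<le> t + climb_time \<sigma> * depth w + prepend_time \<sigma>) (r, m)
        t" (is "wp bnd _ ?Q _ t")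
proof -
  let ?r1 = "r(va := a, vcur := fr, vfr := fr + S, vp := ad w)"
  let ?r2 = "?r1(vp := chain_adr mm, vq := ad z)"
  let ?A = "{v \<in> C. length mm < length v}"
  let ?B = "\<lambda>u. {v \<in> C. length v \<le> length mm \<and> length u < length v}"
  note e1 = ex_prepend_leaf[OF r(3,4,5)]
  have fin: "finite {v \<in> C. P v}" for P using finite_chain[OF head] by simp
  \<comment> \<open>The first climb passes words that are no factors of \<open>w\<close>, so those
    among them that are nodes of \<open>a # w\<close> are new.\<close>
  have nA: "v = a # w \<or> v = mm" if "v \<in> ?A" "v \<in> N'" for v
  proof -
    have "v \<notin> factors w" using that(1) chain_factors[OF head, of v] by simp
    hence "v \<notin> N" using nodes_subset_factors by blast
    thus ?thesis using that(2) nodes_Cons[OF head] by auto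
  qed
  show ?thesis
    unfolding prepend_def
  proof (rule wp_Sq, rule wp_loop_free, goal_cases)
    case 1
    show ?case by (simp add: prepend_leaf_def)
  next
    case 2
    show ?case by (rule e1)
  next
    case 3
    show ?case
      unfolding e1(1)
    proof (rule wp_Sq, rule wp_loop1, goal_cases)
      case (4 t1)
      show ?case
      proof (rule wp_Sq, rule wp_loop_free, goal_cases)
        case 2
        show ?case using is_record_le[OF chain_adr(1)[OF mm_C], of "Next a"] a by simp
      next
        case 3
        have e: "ex (vq ::= Ld (Trans \<sigma> vp va)) (?r1(vp := chain_adr mm), m2) = (?r2, m2)" using m2_z(1)
          by simp
        have g: "aval (Equ (Ld (Fd \<sigma> (Var vq) Len)) (Inc (Ld (Fd \<sigma> (Var vp) Len)) 1)) (?r2, m2) =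
            of_bool (mm \<in> N)"
          using m2_z z_eq by simp
        show ?case
          unfolding e
        proof (rule wp_Sq, rule wp_Cnd)
          assume "aval (Equ (Ld (Fd \<sigma> (Var vq) Len)) (Inc (Ld (Fd \<sigma> (Var vp) Len)) 1)) (?r2, m2) \<noteq> 0"
          hence mm: "mm \<in> N" unfolding g by simp
          have "card ?A + depth (a # w) \<le> depth w + 3"
            using nA by (intro chain_potential[OF head]) auto
          hence "climb_time \<sigma> * (card ?A + depth (a # w)) \<le> climb_time \<sigma> * (depth w + 3)"
            by (rule mult_le_mono2)
          hence time: "climb_time \<sigma> * card ?A + climb_time \<sigma> * depth (a # w) \<le> climb_time \<sigma> * depth w +
              3 * climb_time \<sigma>"
            by (simp add: algebra_simps)
          show "wp bnd (Sto (Fd \<sigma> (Var vcur) Link) (Var vq)) (wp bnd prepend_next ?Q) (?r2, m2)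
            (t1 + tmC (vq ::= Ld (Trans \<sigma> vp va)) +
                tmE (Equ (Ld (Fd \<sigma> (Var vq) Len)) (Inc (Ld (Fd \<sigma> (Var vp) Len)) 1)) + 2)"
          proof (rule wp_loop_free, simp, simp, rule wp_loop_free)
            show "loop_free prepend_next" by (simp add: prepend_next_def)
            show "okC bnd prepend_next (ex (Sto (Fd \<sigma> (Var vcur) Link) (Var vq)) (?r2, m2))"
              using r i(2) by (simp add: prepend_next_def)
            have e: "ex prepend_next (ex (Sto (Fd \<sigma> (Var vcur) Link) (Var vq)) (?r2, m2)) =
                (?r2(vlast := fr, vi := i - 1), m2(cell \<sigma> cur Link := ad z))"
              using r by (simp add: prepend_next_def)
            show "?Q (ex prepend_next (ex (Sto (Fd \<sigma> (Var vcur) Link) (Var vq)) (?r2, m2)))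
              (t1 + tmC (vq ::= Ld (Trans \<sigma> vp va)) +
                  tmE (Equ (Ld (Fd \<sigma> (Var vq) Len)) (Inc (Ld (Fd \<sigma> (Var vp) Len)) 1)) + 2 +
                tmC (Sto (Fd \<sigma> (Var vcur) Link) (Var vq)) + tmC prepend_next)"
              unfolding e using r old_case[OF mm] time 4
              by (intro conjI exI[of _ "ad(a # w := cur)"] exI[of _ "cnt + 1"])
                (auto simp add: prepend_time_def simp del: tmC.simps tmE.simps)
          qed
        next
          assume "aval (Equ (Ld (Fd \<sigma> (Var vq) Len)) (Inc (Ld (Fd \<sigma> (Var vp) Len)) 1)) (?r2, m2) = 0"
          hence new: "mm \<notin> N" unfolding g by simp
          let ?r3 = "?r2(vcl := cl, vfr := cl + S)"
          let ?t = "t1 + tmC (vq ::= Ld (Trans \<sigma> vp va)) +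
              tmE (Equ (Ld (Fd \<sigma> (Var vq) Len)) (Inc (Ld (Fd \<sigma> (Var vp) Len)) 1)) + 2"
          obtain M where M: "ex (prepend_split \<sigma>;; prepend_copy \<sigma>) (?r2, m2) = (?r3, M)" "m3 M"
            using ex_copy(1)[of ?r2] r by auto
          have ok: "okC bnd (prepend_split \<sigma>;; prepend_copy \<sigma>) (?r2, m2)" using ex_copy(2)[of ?r2] r by simp
          show "wp bnd (prepend_split \<sigma>;; prepend_copy \<sigma>;;
              While (Equ (Ld (Trans \<sigma> vp va)) (Var vq)) (prepend_redirect \<sigma>);; prepend_links \<sigma>)
                  (wp bnd prepend_next ?Q)
            (?r2, m2) ?t"
          proof (rule wp_Sq, rule wp_loop_free)
            show "loop_free (prepend_split \<sigma>)" "okC bnd (prepend_split \<sigma>) (?r2, m2)" using ok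
              by (simp add: prepend_split_def, simp)
            show "wp bnd (prepend_copy \<sigma>;; While (Equ (Ld (Trans \<sigma> vp va)) (Var vq)) (prepend_redirect \<sigma>);;
                prepend_links \<sigma>)
              (wp bnd prepend_next ?Q) (ex (prepend_split \<sigma>) (?r2, m2)) (?t + tmC (prepend_split \<sigma>))"
            proof (rule wp_Sq, rule wp_loop_free)
              show "loop_free (prepend_copy \<sigma>)" "okC bnd (prepend_copy \<sigma>) (ex (prepend_split \<sigma>) (?r2, m2))"
                using ok by (simp add: prepend_copy_def, simp)
              have e3: "ex (prepend_copy \<sigma>) (ex (prepend_split \<sigma>) (?r2, m2)) = (?r3, M)" using M(1) by simp
              show "wp bnd (While (Equ (Ld (Trans \<sigma> vp va)) (Var vq)) (prepend_redirect \<sigma>);; prepend_links \<sigma>)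
                (wp bnd prepend_next ?Q) (ex (prepend_copy \<sigma>) (ex (prepend_split \<sigma>) (?r2, m2)))
                    (?t + tmC (prepend_split \<sigma>) + tmC (prepend_copy \<sigma>))"
                unfolding e3
              proof (rule wp_Sq, rule wp_loop2[OF _ _ _ _ M(2) new], goal_cases)
                case (5 t2 u)
                let ?AB = "?A \<union> ?B u"
                have "card ?AB + depth (a # w) \<le> depth w + 3"
                proof (rule chain_potential[OF head])
                  \<comment> \<open>The words of the second climb have locus \<open>z\<close>, which
                    is properly longer than the head since the head is no old node. An old node is
                    its own locus and would be too short.\<close>
                  have "v = mm \<or> v = a # w" if v: "v \<in> ?B u" "v \<in> N'" for v
                  proof (rule ccontr)
                    assume "\<not> (v = mm \<or> v = a # w)"
                    hence "v \<in> N" using v(2) nodes_Cons[OF head] by auto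
                    hence "locus N v = v" by (rule locus_node)
                    moreover have "locus N v = z" using v(1) 5(2) by auto
                    ultimately have "length z \<le> length mm" using v(1) by simp
                    moreover have "length mm \<le> length z" using z(2) by (rule prefix_length_le)
                    ultimately show False using new z_eq by simp
                  qed
                  thus "?AB \<inter> N' \<subseteq> {mm, a # w}" using nA by blast
                qed auto
                moreover have "card ?AB = card ?A + card (?B u)" using fin by (intro card_Un_disjoint) auto
                ultimately have "climb_time \<sigma> * (card ?A + card (?B u) + depth (a # w)) \<le>
                    climb_time \<sigma> * (depth w + 3)"
                  by (intro mult_le_mono2) simp
                hence time: "climb_time \<sigma> * card ?A + climb_time \<sigma> * card (?B u) +
                    climb_time \<sigma> * depth (a # w) \<le>
                    climb_time \<sigma> * depth w + 3 * climb_time \<sigma>" by (simp add: algebra_simps)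
                show ?case
                proof (rule wp_loop_free)
                  show "loop_free (prepend_links \<sigma>)"
                      "okC bnd (prepend_links \<sigma>) (?r3(vp := chain_adr u), overwrite M (Bcells u) cl)"
                    by (simp_all add: prepend_links_def)
                  show "wp bnd prepend_next ?Q
                      (ex (prepend_links \<sigma>) (?r3(vp := chain_adr u), overwrite M (Bcells u) cl))
                          (t2 + tmC (prepend_links \<sigma>))"
                  proof (rule wp_loop_free)
                    show "loop_free prepend_next" by (simp add: prepend_next_def)
                    show "okC bnd prepend_next
                        (ex (prepend_links \<sigma>) (?r3(vp := chain_adr u), overwrite M (Bcells u) cl))"
                      using r i(2) by (simp add: prepend_next_def prepend_links_def)
                    have e: "ex prepend_next (ex (prepend_links \<sigma>)
                        (?r3(vp := chain_adr u), overwrite M (Bcells u) cl)) =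
                        (?r3(vp := chain_adr u, vlast := fr, vi := i - 1),
                         (overwrite M (Bcells u) cl)(cell \<sigma> (ad z) Link := cl, cell \<sigma> cur Link := cl))"
                      using r by (simp add: prepend_next_def prepend_links_def)
                    show "?Q (ex prepend_next
                        (ex (prepend_links \<sigma>) (?r3(vp := chain_adr u), overwrite M (Bcells u) cl)))
                        (t2 + tmC (prepend_links \<sigma>) + tmC prepend_next)"
                      unfolding e using r new_case[OF new M(2) 5(2)] head_neq[OF head] time 4 5(4)
                      by (intro conjI exI[of _ "ad(a # w := cur, mm := cl)"] exI[of _ "cnt + 2"])
                        (auto simp add: prepend_time_def simp del: tmC.simps tmE.simps)
                  qed
                qed
              qed simp_all
            qed
          qed
        qed simp
      qed simp
    qed simp_all
  qed
qed

end

section \<open>Initial tree and complete construction\<close>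

definition root_init :: "nat \<Rightarrow> com" where
  "root_init \<sigma> = vd ::= Inc (Pl (Var vn) (Var vn)) 1;; vfr ::= Inc (Var vd) (rec_size \<sigma>);; vlast ::= Var vfr;;
    Sto (Fd \<sigma> (Var vlast) Len) (Lit 1);; Sto (Fd \<sigma> (Var vlast) Link) (Var vd);;
    Sto (Fd \<sigma> (Var vlast) Pos) (Lit 1);;
    vfr ::= Inc (Var vfr) (rec_size \<sigma>);; vi ::= Pl (Var vn) (Var vn)"

definition sentinel_init :: "nat \<Rightarrow> com" where
  "sentinel_init \<sigma> = seqs (map (\<lambda>c. Sto (Fd \<sigma> (Var vd) (Next c)) (Var vlast)) [0..<\<sigma>])"

definition copy_letter :: com where
  "copy_letter = vi ::= Inc (Var vi) 1;; Sto (Pl (Var vi) (Var vn)) (Ld (Var vi))"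

definition build :: "nat \<Rightarrow> com" where
  "build \<sigma> = vn ::= Ld (Lit 0);;
    While (Les (Var vi) (Var vn)) copy_letter;;
    root_init \<sigma>;; sentinel_init \<sigma>;;
    While (Var vi) (prepend \<sigma>)"

text \<open>The lone \<open>climb_time\<close> pays the initial potential
  \<open>depth [] = 1\<close>.\<close>

definition build_time :: "nat \<Rightarrow> nat" where
  "build_time \<sigma> = tmC (vn ::= Ld (Lit 0)) + (tmE (Les (Var vi) (Var vn)) + 2 + tmC copy_letter) +
      tmC (root_init \<sigma>) + tmC (sentinel_init \<sigma>) +
    climb_time \<sigma> + (prepend_time \<sigma> + tmE (Var vi) + 2)"

lemma depth_Nil: "depth [] = 1"
proof -
  have "{y \<in> nodes []. prefix y []} = {[]}" by auto
  thus ?thesis by (simp add: depth_def)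
qed

lemma nodes_Nil: "nodes [] = {[]}"
  using nodes_subset_factors length_factors by fastforce

context input
begin

lemma n_le_bnd: "n + n \<le> bnd"
proof -
  have "5 * (n + 1) \<le> S * (n + 1)" using S_pos by (intro mult_le_mono1)
  thus ?thesis by (simp add: bnd_def algebra_simps)
qed

lemma wp_copy:
  assumes r: "r vn = n" "r vi = 0" and m: "\<And>i. i < n \<Longrightarrow> m (Suc i) = s ! i"
    and Q: "\<And>t' m'. (\<And>i. i < 2 * n \<Longrightarrow> m' (Suc i) = W ! i) \<Longrightarrow> (\<And>b. b \<notin> {1..2 * n} \<Longrightarrow> m' b = m b) \<Longrightarrow>
      t' \<le> t + (tmE (Les (Var vi) (Var vn)) + 2 + tmC copy_letter) * (n + 1) \<Longrightarrow> Q (r(vi := n), m') t'"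
  shows "wp bnd (While (Les (Var vi) (Var vn)) copy_letter) Q (r, m) t"
proof -
  let ?K = "tmE (Les (Var vi) (Var vn)) + 2 + tmC copy_letter"
  let ?m = "\<lambda>k b. if n < b \<and> b \<le> n + k then m (b - n) else m b"
  let ?I = "\<lambda>st t1. \<exists>k\<le>n. st = (r(vi := k), ?m k) \<and> t1 \<le> t + ?K * k"
  show ?thesis
  proof (rule wp_While[where I = ?I and T = "t + ?K * n"])
    have "r = r(vi := 0)" using r by auto
    moreover have "m = ?m 0" by auto
    ultimately show "?I (r, m) t" by (intro exI[of _ 0]) simp
  next
    fix st t1 assume "?I st t1"
    then obtain k where k: "k \<le> n" "st = (r(vi := k), ?m k)" "t1 \<le> t + ?K * k" by blast
    have "?K * k \<le> ?K * n" using k(1) by (rule mult_le_mono2)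
    thus "t1 \<le> t + ?K * n" using k(3) by linarith
    show "okE bnd (Les (Var vi) (Var vn)) st" by simp
    { assume "aval (Les (Var vi) (Var vn)) st \<noteq> 0"
      hence "k < n" using k r by (simp split: if_splits)
      have e: "ex copy_letter st = (r(vi := Suc k), (?m k)(Suc k + n := ?m k (Suc k)))"
        using k(2) r by (simp add: copy_letter_def)
      also have "(?m k)(Suc k + n := ?m k (Suc k)) = ?m (Suc k)" using \<open>k < n\<close> by (auto simp: fun_eq_iff)
      finally have e: "ex copy_letter st = (r(vi := Suc k), ?m (Suc k))" .
      have "okC bnd copy_letter st" using k r \<open>k < n\<close> n_le_bnd by (simp add: copy_letter_def)
      moreover have "t1 + tmE (Les (Var vi) (Var vn)) + 2 + tmC copy_letter \<le> t + ?K * Suc k" using k(3)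
        by simp
      hence "?I (ex copy_letter st) (t1 + tmE (Les (Var vi) (Var vn)) + 2 + tmC copy_letter)"
        unfolding e using \<open>k < n\<close> by (intro exI[of _ "Suc k"] conjI refl) simp_all
      moreover have "loop_free copy_letter" by (simp add: copy_letter_def)
      ultimately show "wp bnd copy_letter ?I st (t1 + tmE (Les (Var vi) (Var vn)) + 2)"
        by (intro wp_loop_free) }
    { assume "aval (Les (Var vi) (Var vn)) st = 0"
      hence "k = n" using k r by (simp split: if_splits)
      show "Q st (t1 + tmE (Les (Var vi) (Var vn)) + 2)"
        unfolding k(2) \<open>k = n\<close>
      proof (rule Q)
        show "?m n (Suc i) = W ! i" if "i < 2 * n" for i
        proof (cases "i < n")
          case True
          thus ?thesis using m[of i] by (simp add: nth_append)
        next
          case False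
          hence "?m n (Suc i) = m (Suc (i - n))" using that by (simp add: Suc_diff_le)
          thus ?thesis using m[of "i - n"] False that by (simp add: nth_append)
        qed
        show "t1 + tmE (Les (Var vi) (Var vn)) + 2 \<le> t + ?K * (n + 1)"
          using k(3) \<open>k = n\<close> by simp
      qed auto }
  qed
qed

lemma inv_Nil:
  assumes "\<And>i. i < 2 * n \<Longrightarrow> m (Suc i) = W ! i" "\<And>b. D \<le> b \<Longrightarrow> m b = 0"
    and m': "\<And>c. c < \<sigma> \<Longrightarrow> at m' D (Next c) = D + S" "at m' (D + S) Len = 1" "at m' (D + S) Link = D"
      "at m' (D + S) Pos = 1"
      "\<And>b. (\<And>c. c < \<sigma> \<Longrightarrow> b \<noteq> cell \<sigma> D (Next c)) \<Longrightarrow> b \<noteq> cell \<sigma> (D + S) Len \<Longrightarrow> b \<noteq> cell \<sigma> (D + S) Link \<Longrightarrow>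
        b \<noteq> cell \<sigma> (D + S) Pos \<Longrightarrow> m' b = m b"
  shows "inv [] m' (D + S * 2) (\<lambda>_. D + S) 2"
proof -
  note fe = cell_mult_eq[of \<sigma> _ _ D 0 1, simplified] cell_mult_eq[of \<sigma> _ _ D 1 0, simplified]
    cell_mult_eq[of \<sigma> _ _ D 1 1, simplified] cell_mult_eq[of \<sigma> _ _ D 0 0, simplified]
  have old: "m' b = m b" if "b \<le> 2 * n \<or> D + S * 2 \<le> b" for b
  proof (rule m')
    have o: "offset \<sigma> Len < S" "offset \<sigma> Link < S" "offset \<sigma> Pos < S" by (rule offset_less, simp)+
    show "b \<noteq> cell \<sigma> D (Next c)" if "c < \<sigma>" for c
      using that \<open>b \<le> 2 * n \<or> D + S * 2 \<le> b\<close> offset_less[of \<sigma> "Next c"] by (auto simp: cell_def D_def)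
    show "b \<noteq> cell \<sigma> (D + S) Len" "b \<noteq> cell \<sigma> (D + S) Link" "b \<noteq> cell \<sigma> (D + S) Pos"
      using that o by (auto simp: cell_def D_def)
  qed
  have z: "at m' p f = 0" if "p = D \<or> p = D + S" "valid_field \<sigma> f"
    "p = D \<Longrightarrow> \<forall>c. f \<noteq> Next c" "p = D + S \<Longrightarrow> f \<noteq> Len \<and> f \<noteq> Link \<and> f \<noteq> Pos" for p f
  proof -
    have "m' (cell \<sigma> p f) = m (cell \<sigma> p f)" using that by (intro m'(5)) (auto simp: fe)
    thus ?thesis using assms(2)[of "cell \<sigma> p f"] that(1) by (auto simp: cell_def)
  qed
  have f1: "[c] \<notin> factors []" for c :: nat using length_factors[of "[c]" "[]"] by auto
  show ?thesis
    unfolding inv_def nodes_Nil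
  proof (intro conjI ballI allI impI)
    show "m' (Suc i) = W ! i" if "i < 2 * n" for i using assms(1) old that by simp
    show "m' b = 0" if "D + S * 2 \<le> b" for b using assms(2)[of b] old[of b] that by simp
    show "at m' D Len = 0" using z[of D Len] by simp
    fix x :: "nat list" assume x: "x \<in> {[]}"
    show "at m' (D + S) Pos \<le> 2 * n" using m'(4) n_pos by linarith
    show "at m' (D + S) (Next c) = (if c # x \<in> factors [] then D + S else 0)" if "c < \<sigma>" for c
      using z[of "D + S" "Next c"] that x f1 by simp
    show "at m' (D + S) (Child c) = 0" if "c < \<sigma>" for c using z[of "D + S" "Child c"] that by simp
  qed (use m' in \<open>auto simp: bij_betw_def\<close>)
qed

lemma ex_ini:
  assumes "r vn = n"
  shows "\<exists>m'. ex (sentinel_init \<sigma>) (ex (root_init \<sigma>) (r, m)) =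
      (r(vd := D, vfr := D + S, vlast := D + S, vfr := D + S + S, vi := n + n), m') \<and>
    (\<forall>c<\<sigma>. at m' D (Next c) = D + S) \<and> at m' (D + S) Len = 1 \<and> at m' (D + S) Link = D \<and>
    at m' (D + S) Pos = 1 \<and>
    (\<forall>b. (\<forall>c<\<sigma>. b \<noteq> cell \<sigma> D (Next c)) \<longrightarrow> b \<noteq> cell \<sigma> (D + S) Len \<longrightarrow> b \<noteq> cell \<sigma> (D + S) Link \<longrightarrow>
        b \<noteq> cell \<sigma> (D + S) Pos \<longrightarrow> m' b = m b)"
    "okC bnd (root_init \<sigma>) (r, m)" "okC bnd (sentinel_init \<sigma>) (ex (root_init \<sigma>) (r, m))"
proof -
  let ?r = "r(vd := D, vfr := D + S, vlast := D + S, vfr := D + S + S, vi := n + n)"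
  let ?m = "m(cell \<sigma> (D + S) Len := 1, cell \<sigma> (D + S) Link := D, cell \<sigma> (D + S) Pos := 1)"
  have e: "ex (root_init \<sigma>) (r, m) = (?r, ?m)"
  proof -
    have "Suc (n + n) = D" by (simp add: D_def)
    thus ?thesis using assms by (simp add: root_init_def)
  qed
  have "\<exists>m'. ex (sentinel_init \<sigma>) (?r, ?m) = (?r, m') \<and> (\<forall>c\<in>set [0..<\<sigma>]. at m' D (Next c) = D + S) \<and>
      (\<forall>b. b \<notin> (\<lambda>c. cell \<sigma> D (Next c)) ` set [0..<\<sigma>] \<longrightarrow> m' b = ?m b)"
    unfolding sentinel_init_def
    by (rule ex_stores) (simp_all add: distinct_map inj_on_def cell_def)
  then obtain m' where m': "ex (sentinel_init \<sigma>) (?r, ?m) = (?r, m')"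
      "\<forall>c\<in>set [0..<\<sigma>]. at m' D (Next c) = D + S"
    "\<forall>b. b \<notin> (\<lambda>c. cell \<sigma> D (Next c)) ` set [0..<\<sigma>] \<longrightarrow> m' b = ?m b" by blast
  have k: "m' b = ?m b" if "\<forall>c<\<sigma>. b \<noteq> cell \<sigma> D (Next c)" for b
  proof -
    have "b \<notin> (\<lambda>c. cell \<sigma> D (Next c)) ` set [0..<\<sigma>]" using that by auto
    thus ?thesis using m'(3) by blast
  qed
  note fe = cell_mult_eq[of \<sigma> _ _ D 0 1, simplified] cell_mult_eq[of \<sigma> _ _ D 1 0, simplified]
    cell_mult_eq[of \<sigma> _ _ D 1 1, simplified]
  have kk: "m' (cell \<sigma> (D + S) f) = ?m (cell \<sigma> (D + S) f)" if "valid_field \<sigma> f" for f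
    using that by (intro k) (simp add: fe)
  show "\<exists>m'. ex (sentinel_init \<sigma>) (ex (root_init \<sigma>) (r, m)) = (?r, m') \<and>
    (\<forall>c<\<sigma>. at m' D (Next c) = D + S) \<and> at m' (D + S) Len = 1 \<and> at m' (D + S) Link = D \<and>
    at m' (D + S) Pos = 1 \<and>
    (\<forall>b. (\<forall>c<\<sigma>. b \<noteq> cell \<sigma> D (Next c)) \<longrightarrow> b \<noteq> cell \<sigma> (D + S) Len \<longrightarrow> b \<noteq> cell \<sigma> (D + S) Link \<longrightarrow>
        b \<noteq> cell \<sigma> (D + S) Pos \<longrightarrow> m' b = m b)"
    unfolding e using m'(1,2) k kk by (intro exI[of _ m']) (simp add: fe)
  show "okC bnd (root_init \<sigma>) (r, m)" using assms n_le_bnd by (simp add: root_init_def)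
  show "okC bnd (sentinel_init \<sigma>) (ex (root_init \<sigma>) (r, m))" unfolding e sentinel_init_def
    by (rule okC_stores) simp
qed

lemma wp_build:
  assumes r: "\<And>x. r x = 0" and m: "m 0 = n" "\<And>i. i < n \<Longrightarrow> m (Suc i) = s ! i" "\<And>b. n < b \<Longrightarrow> m b = 0"
  shows "wp bnd (build \<sigma>) (\<lambda>st t. fst st vn = n \<and> fst st vd = D \<and>
    (\<exists>ad cnt. inv W (snd st) (fst st vfr) ad cnt) \<and> t \<le> build_time \<sigma> * (2 * n + 2)) (r, m)
        0" (is "wp bnd _ ?Q _ _")
proof -
  let ?K1 = "tmE (Les (Var vi) (Var vn)) + 2 + tmC copy_letter"
  define t0 where "t0 = tmC (vn ::= Ld (Lit 0)) + ?K1 * (n + 1) + tmC (root_init \<sigma>) + tmC (sentinel_init \<sigma>)"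
  define K2 where "K2 = prepend_time \<sigma> + tmE (Var vi) + 2"
  \<comment> \<open>\<open>vi\<close> runs down from \<open>2 * n\<close>; beyond the potential,
    \<open>K2\<close> is paid for each letter prepended so far.\<close>
  let ?I = "\<lambda>st t. fst st vn = n \<and> fst st vd = D \<and> fst st vi \<le> 2 * n \<and>
    (\<exists>ad cnt. inv (drop (fst st vi) W) (snd st) (fst st vfr) ad cnt \<and> fst st vlast =
        ad (drop (fst st vi) W)) \<and>
    t + climb_time \<sigma> * depth (drop (fst st vi) W) \<le> t0 + climb_time \<sigma> + K2 * (2 * n - fst st vi)"
  have bound: "t0 + climb_time \<sigma> + K2 * (2 * n) + K2 \<le> build_time \<sigma> * (2 * n + 2)"
    by (simp add: build_time_def t0_def K2_def algebra_simps)
  have loop: "wp bnd (While (Var vi) (prepend \<sigma>)) ?Q st t" if "?I st t" for st t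
  proof (rule wp_While[where I = ?I and T = "t0 + climb_time \<sigma> + K2 * (2 * n)"])
    show "?I st t" by fact
  next
    fix st t assume I: "?I st t"
    have "K2 * (2 * n - fst st vi) \<le> K2 * (2 * n)" by (intro mult_le_mono2) simp
    thus t: "t \<le> t0 + climb_time \<sigma> + K2 * (2 * n)" using I by linarith
    show "okE bnd (Var vi) st" by simp
    { assume "aval (Var vi) st = 0"
      hence "fst st vi = 0" by simp
      moreover have "t + tmE (Var vi) + 2 \<le> build_time \<sigma> * (2 * n + 2)"
        using t bound unfolding K2_def by linarith
      ultimately show "?Q st (t + tmE (Var vi) + 2)" using I by auto }
    { assume "aval (Var vi) st \<noteq> 0"
      define i where "i = fst st vi"
      define a where "a = W ! (i - 1)"
      have i: "1 \<le> i" "i \<le> 2 * n" using I \<open>aval (Var vi) st \<noteq> 0\<close> by (auto simp: i_def)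
      have aw: "a # drop i W = drop (i - 1) W"
        using i Cons_nth_drop_Suc[of "i - 1" W] by (simp add: a_def)
      have "a \<in> set W" unfolding a_def using i by (intro nth_mem) simp
      hence a: "a < \<sigma>" using letters by auto
      obtain mm where mm: "head a (drop i W) mm" using head_exists by blast
      obtain ad cnt where ad: "inv (drop i W) (snd st) (fst st vfr) ad cnt" "fst st vlast = ad (drop i W)"
        using I unfolding i_def by blast
      interpret w: weiner \<sigma> s "drop i W" a mm "snd st" "fst st vfr" ad cnt i
        by unfold_locales (use ad mm a aw i in auto)
      have "wp bnd (prepend \<sigma>) (\<lambda>st' t'. fst st' vn = n \<and> fst st' vd = D \<and> fst st' vi = i - 1 \<and>
        (\<exists>ad' cnt'. inv (a # drop i W) (snd st') (fst st' vfr) ad' cnt' \<and> fst st' vlast =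
            ad' (a # drop i W)) \<and>
        t' + climb_time \<sigma> * depth (a # drop i W) \<le> t + tmE (Var vi) + 2 + climb_time \<sigma> * depth (drop i W) +
            prepend_time \<sigma>)
        (fst st, snd st) (t + tmE (Var vi) + 2)"
        using I ad(2) i_def by (intro w.wp_ext) auto
      thus "wp bnd (prepend \<sigma>) ?I st (t + tmE (Var vi) + 2)"
        unfolding prod.collapse
      proof (rule wp_mono)
        fix st' t'
        assume *: "fst st' vn = n \<and> fst st' vd = D \<and> fst st' vi = i - 1 \<and>
          (\<exists>ad' cnt'. inv (a # drop i W) (snd st') (fst st' vfr) ad' cnt' \<and> fst st' vlast =
              ad' (a # drop i W)) \<and>
          t' + climb_time \<sigma> * depth (a # drop i W) \<le> t + tmE (Var vi) + 2 +
              climb_time \<sigma> * depth (drop i W) + prepend_time \<sigma>"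
        have "2 * n - (i - 1) = Suc (2 * n - i)" using i by simp
        hence "K2 * (2 * n - (i - 1)) = K2 + K2 * (2 * n - i)" by simp
        hence "t' + climb_time \<sigma> * depth (drop (i - 1) W) \<le> t0 + climb_time \<sigma> + K2 * (2 * n - (i - 1))"
          using * I unfolding aw i_def[symmetric] by (simp only: K2_def) linarith
        moreover have vi': "fst st' vi = i - 1" using * by blast
        moreover have "i - 1 \<le> 2 * n" using i by simp
        ultimately show "?I st' t'" unfolding vi' using * unfolding aw by blast
      qed }
  qed
  show ?thesis
    unfolding build_def
  proof (rule wp_Sq, rule wp_loop_free, goal_cases)
    case 3
    have e: "ex (vn ::= Ld (Lit 0)) (r, m) = (r(vn := n), m)" using m by simp
    show ?case
      unfolding e
    proof (rule wp_Sq, rule wp_copy, goal_cases)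
      case (4 t1 m1)
      note i = ex_ini[of "r(vn := n, vi := n)" m1]
      obtain m2 where m2: "ex (sentinel_init \<sigma>) (ex (root_init \<sigma>) (r(vn := n, vi := n), m1)) =
        (r(vn := n, vi := n, vd := D, vfr := D + S, vlast := D + S, vfr := D + S + S, vi := n + n), m2)"
        "\<forall>c<\<sigma>. at m2 D (Next c) = D + S" "at m2 (D + S) Len = 1" "at m2 (D + S) Link = D"
        "at m2 (D + S) Pos = 1"
        "\<forall>b. (\<forall>c<\<sigma>. b \<noteq> cell \<sigma> D (Next c)) \<longrightarrow> b \<noteq> cell \<sigma> (D + S) Len \<longrightarrow> b \<noteq> cell \<sigma> (D + S) Link \<longrightarrow>
          b \<noteq> cell \<sigma> (D + S) Pos \<longrightarrow> m2 b = m1 b"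
        using i(1) by auto
      have "inv [] m2 (D + S * 2) (\<lambda>_. D + S) 2"
      proof (rule inv_Nil)
        show "m1 (Suc i) = W ! i" if "i < 2 * n" for i using 4(1) that .
        show "m1 b = 0" if "D \<le> b" for b using 4(2)[of b] m(3)[of b] that n_pos by (auto simp: D_def)
      qed (use m2 in auto)
      hence "inv [] m2 (D + S + S) (\<lambda>_. D + S) 2" by (simp add: mult_2_right add.assoc)
      hence "?I (ex (sentinel_init \<sigma>) (ex (root_init \<sigma>) (r(vn := n, vi := n), m1)))
          (t1 + tmC (root_init \<sigma>) + tmC (sentinel_init \<sigma>))"
        unfolding m2(1) using 4(3) depth_Nil
        by (auto simp: t0_def simp del: tmC.simps tmE.simps intro!: exI[of _ "\<lambda>_. D + S"] exI[of _ 2])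
      note I = this
      show ?case
      proof (rule wp_Sq, rule wp_loop_free)
        show "loop_free (root_init \<sigma>)" by (simp add: root_init_def)
        show "okC bnd (root_init \<sigma>) (r(vn := n, vi := n), m1)" by (rule i) simp
        show "wp bnd (sentinel_init \<sigma>;; While (Var vi) (prepend \<sigma>)) ?Q
            (ex (root_init \<sigma>) (r(vn := n, vi := n), m1)) (t1 + tmC (root_init \<sigma>))"
        proof (rule wp_Sq, rule wp_loop_free)
          show "loop_free (sentinel_init \<sigma>)" by (simp add: sentinel_init_def)
          show "okC bnd (sentinel_init \<sigma>) (ex (root_init \<sigma>) (r(vn := n, vi := n), m1))" by (rule i) simp
        qed (rule loop[OF I])
      qed
    qed (use r m in simp_all)
  qed simp_all
qed

end

subsection \<open>Children and dynamic programming\<close>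

abbreviation (input) "vroot \<equiv> 11 :: nat"
abbreviation (input) "vh \<equiv> 12 :: nat"
abbreviation (input) "vt \<equiv> 13 :: nat"

text \<open>The stored value \<open>n + 1\<close> is \<open>infty\<close>.\<close>

definition clear_table :: "nat \<Rightarrow> nat \<Rightarrow> com" where
  "clear_table \<sigma> p = seqs (map (\<lambda>t. Sto (Fd \<sigma> (Var p) (Tab t)) (Inc (Var vn) 1)) (all_ends \<sigma>))"

text \<open>\<open>Pos\<close> is the address of the first letter of an occurrence, so the last
  letter of the row lies \<open>n - 1\<close> cells further on.\<close>

definition load_last :: "nat \<Rightarrow> com" where
  "load_last \<sigma> = va ::= Ld (Pl (Ld (Fd \<sigma> (Var vp) Pos)) (Mi (Var vn) (Lit 1)))"

text \<open>The offset of a table entry is a literal, whereas the letter is read at run time; hence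
  one test per letter.\<close>

definition leaf_entry :: "nat \<Rightarrow> com" where
  "leaf_entry \<sigma> = seqs (map (\<lambda>c. Cnd (Equ (Var va) (Lit c))
    (Sto (Fd \<sigma> (Var vp) (Tab (Some (c, c)))) (Lit 0)) Skip) [0..<\<sigma>])"

text \<open>\<open>Len\<close> of the parent minus one is its length, so the cell read holds the
  first letter of the edge to the node.\<close>

definition link :: "nat \<Rightarrow> com" where
  "link \<sigma> = vq ::= Ld (Fd \<sigma> (Var vp) Link);;
    va ::= Ld (Pl (Ld (Fd \<sigma> (Var vp) Pos)) (Mi (Ld (Fd \<sigma> (Var vq) Len)) (Lit 1)));;
    Sto (Child_cell \<sigma> vq va) (Var vp)"

text \<open>\<open>Len\<close> being the length plus one, \<open>vn < Len\<close> singles out the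
  nodes of length at least \<open>n\<close>, where the recursion ends. The root has no parent to be
  linked to.\<close>

definition child :: "nat \<Rightarrow> com" where
  "child \<sigma> = Cnd (Equ (Var vp) (Var vroot)) Skip (link \<sigma>;;
      Cnd (Les (Var vn) (Ld (Fd \<sigma> (Var vp) Len))) (clear_table \<sigma> vp;; load_last \<sigma>;; leaf_entry \<sigma>) Skip);;
    vp ::= Inc (Var vp) (rec_size \<sigma>)"

text \<open>The sentinel gets the table of an empty part so that it can later stand in for absent
  children. All its transitions lead to the root; the one with letter 0 exists because the alphabet
  is not empty.\<close>

definition children_init :: "nat \<Rightarrow> com" where
  "children_init \<sigma> = vroot ::= Ld (Fd \<sigma> (Var vd) (Next 0));; clear_table \<sigma> vd;;
      Sto (Fd \<sigma> (Var vd) (Tab None)) (Lit 0);;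
    vp ::= Inc (Var vd) (rec_size \<sigma>)"

definition children :: "nat \<Rightarrow> com" where
  "children \<sigma> = children_init \<sigma>;; While (Les (Var vp) (Var vfr)) (child \<sigma>)"

lemma distinct_all_ends: "distinct (all_ends \<sigma>)"
proof -
  have "distinct (concat (map (\<lambda>a. map (\<lambda>b. Some (a, b)) [0..<\<sigma>]) [0..<k]))" for k
    by (induction k) (auto simp: distinct_map inj_on_def)
  thus ?thesis by (auto simp: all_ends_def)
qed

lemma None_in_all_ends [simp]: "None \<in> set (all_ends \<sigma>)"
  by (simp add: set_all_ends)

lemma ex_clear_table:
  assumes "r p = d"
  shows "\<exists>m'. ex (clear_table \<sigma> p) (r, m) = (r, m') \<and>
      (\<forall>t\<in>set (all_ends \<sigma>). m' (cell \<sigma> d (Tab t)) = Suc (r vn)) \<and>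
    (\<forall>b. b \<notin> (\<lambda>t. cell \<sigma> d (Tab t)) ` set (all_ends \<sigma>) \<longrightarrow> m' b = m b)"
  unfolding clear_table_def
proof (rule ex_stores)
  have "inj_on (\<lambda>t. cell \<sigma> d (Tab t)) (set (all_ends \<sigma>))"
    by (rule inj_onI) (simp add: cell_def encode_inj)
  thus "distinct (map (\<lambda>t. cell \<sigma> d (Tab t)) (all_ends \<sigma>))" using distinct_all_ends
    by (simp add: distinct_map)
qed (use assms in simp_all)

lemma okC_clear_table: "okC U (clear_table \<sigma> p) s"
  unfolding clear_table_def by (cases s) (auto intro: okC_stores)

lemma ex_leaf_entry:
  "ex (leaf_entry \<sigma>) (r, m) = (r, if r va < \<sigma> then m(cell \<sigma> (r vp) (Tab (Some (r va, r va))) := 0) else m)"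
proof -
  let ?c = "\<lambda>c. Cnd (Equ (Var va) (Lit c)) (Sto (Fd \<sigma> (Var vp) (Tab (Some (c, c)))) (Lit 0)) Skip"
  have "ex (seqs (map ?c [0..<k])) (r, m) =
      (r, if r va < k then m(cell \<sigma> (r vp) (Tab (Some (r va, r va))) := 0) else m)" for k
    unfolding ex_seqs by (induction k) auto
  thus ?thesis unfolding leaf_entry_def .
qed

lemma okC_leaf_entry: "okC U (leaf_entry \<sigma>) s"
proof -
  have "okC U (seqs (map (\<lambda>c. Cnd (Equ (Var va) (Lit c)) (Sto (Fd \<sigma> (Var vp) (Tab (Some (c, c)))) (Lit 0))
      Skip) cs)) s" for cs
    by (induction cs arbitrary: s) auto
  thus ?thesis unfolding leaf_entry_def .
qed

locale built = input +
  fixes m0 fr ad cnt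
  assumes inv0: "inv W m0 fr ad cnt"
begin

definition is_record :: "nat \<Rightarrow> bool" where
  "is_record p \<longleftrightarrow> (\<exists>j<cnt. p = D + S * j)"

lemma fr_eq: "fr = D + S * cnt"
  using inv0 unfolding inv_def by blast

lemma cnt: "cnt \<le> 4 * n + 2" "1 \<le> cnt"
  using inv0 unfolding inv_def by auto

lemma bij: "bij_betw ad F ((\<lambda>j. D + S * j) ` {1..<cnt})"
  using inv0 unfolding inv_def by blast

lemma cell_eq:
  assumes "is_record p" "is_record p'" "valid_field \<sigma> f" "valid_field \<sigma> g"
  shows "cell \<sigma> p f = cell \<sigma> p' g \<longleftrightarrow> p = p' \<and> f = g"
proof -
  from assms obtain j j' where "p = D + S * j" "p' = D + S * j'" unfolding is_record_def by blast
  thus ?thesis using cell_mult_eq[OF assms(3,4), of D j j'] by auto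
qed

lemma is_record_D [simp]: "is_record D"
  unfolding is_record_def using cnt by (intro exI[of _ 0]) simp

lemma ad_cases:
  assumes "x \<in> F"
  obtains j where "ad x = D + S * j" "1 \<le> j" "j < cnt"
proof -
  have "ad x \<in> (\<lambda>j. D + S * j) ` {1..<cnt}" using bij assms unfolding bij_betw_def by blast
  thus thesis using that by auto
qed

lemma ad [simp]: "x \<in> F \<Longrightarrow> is_record (ad x)" "x \<in> F \<Longrightarrow> ad x \<noteq> D" "x \<in> F \<Longrightarrow> D \<noteq> ad x" "x \<in> F \<Longrightarrow> ad x \<noteq> 0"
  by (erule ad_cases; auto simp: is_record_def D_def)+

lemma ad_inj: "x \<in> F \<Longrightarrow> y \<in> F \<Longrightarrow> ad x = ad y \<longleftrightarrow> x = y"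
  using bij unfolding bij_betw_def by (meson inj_on_eq_iff)

lemma ad_surj: "1 \<le> j \<Longrightarrow> j < cnt \<Longrightarrow> \<exists>x\<in>F. ad x = D + S * j"
proof -
  assume "1 \<le> j" "j < cnt"
  hence "D + S * j \<in> ad ` F" using bij unfolding bij_betw_def by auto
  thus ?thesis by auto
qed

lemma is_record_le: "is_record p \<Longrightarrow> valid_field \<sigma> f \<Longrightarrow> cell \<sigma> p f \<le> bnd"
  unfolding is_record_def using cell_le_bnd cnt(1) by auto

lemma is_record_fr: "is_record p \<Longrightarrow> valid_field \<sigma> f \<Longrightarrow> cell \<sigma> p f < fr" "is_record p \<Longrightarrow> 2 * n < cell \<sigma> p f"
proof -
  assume "is_record p"
  then obtain j where j: "j < cnt" "p = D + S * j" unfolding is_record_def by blast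
  have "S * Suc j \<le> S * cnt" using j(1) by (intro mult_le_mono2) simp
  thus "valid_field \<sigma> f \<Longrightarrow> cell \<sigma> p f < fr" using offset_less[of \<sigma> f] j by (simp add: cell_def fr_eq)
  show "2 * n < cell \<sigma> p f" using j by (simp add: cell_def D_def)
qed

lemma fr_neq: "is_record p \<Longrightarrow> valid_field \<sigma> f \<Longrightarrow> fr \<le> b \<Longrightarrow> cell \<sigma> p f \<noteq> b"
  using is_record_fr(1)[of p f] by auto

lemma sigma_pos: "0 < \<sigma>"
  using letters n_pos by (cases s) auto

lemma inv_node:
  assumes "x \<in> F"
  shows "at m0 (ad x) Len = Suc (length x)"
    "at m0 (ad x) Link = (if x = [] then D else ad (parent F x))"
    "1 \<le> at m0 (ad x) Pos" "at m0 (ad x) Pos \<le> 2 * n" "prefix x (drop (at m0 (ad x) Pos - 1) W)"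
    "c < \<sigma> \<Longrightarrow> at m0 (ad x) (Child c) = 0"
  using inv0 assms unfolding inv_def by simp_all

lemma inv_D: "c < \<sigma> \<Longrightarrow> at m0 D (Next c) = ad []" "j < 2 * n \<Longrightarrow> m0 (Suc j) = W ! j"
  using inv0 unfolding inv_def by simp_all

text \<open>Cells that are not written after the construction of the tree.\<close>

definition fixed :: "nat \<Rightarrow> bool" where
  "fixed b \<longleftrightarrow> b \<le> 2 * n \<or> (\<exists>p. is_record p \<and> (b = cell \<sigma> p Len \<or> b = cell \<sigma> p Link \<or> b = cell \<sigma> p Pos \<or>
     (\<exists>c<\<sigma>. b = cell \<sigma> p (Next c))))"

definition base :: "(nat \<Rightarrow> nat) \<Rightarrow> bool" where
  "base m \<longleftrightarrow> (\<forall>b. fixed b \<longrightarrow> m b = m0 b)"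

lemma base_upd: "base m \<Longrightarrow> \<not> fixed b \<Longrightarrow> base (m(b := v))"
  unfolding base_def by auto

lemma not_fixed [simp]:
  "is_record p \<Longrightarrow> c < \<sigma> \<Longrightarrow> \<not> fixed (cell \<sigma> p (Child c))"
      "is_record p \<Longrightarrow> t \<in> set (all_ends \<sigma>) \<Longrightarrow> \<not> fixed (cell \<sigma> p (Tab t))"
  "is_record p \<Longrightarrow> \<not> fixed (cell \<sigma> p Cho)" "fr \<le> b \<Longrightarrow> \<not> fixed b"
proof -
  show "\<not> fixed (cell \<sigma> p (Child c))" if "is_record p" "c < \<sigma>"
    using that is_record_fr(2)[OF that(1), of "Child c"] unfolding fixed_def by (auto simp: cell_eq)
  show "\<not> fixed (cell \<sigma> p (Tab t))" if "is_record p" "t \<in> set (all_ends \<sigma>)"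
    using that is_record_fr(2)[OF that(1), of "Tab t"] unfolding fixed_def by (auto simp: cell_eq)
  show "\<not> fixed (cell \<sigma> p Cho)" if "is_record p"
    using that is_record_fr(2)[OF that(1), of Cho] unfolding fixed_def by (auto simp: cell_eq)
  show "\<not> fixed b" if "fr \<le> b"
  proof
    assume "fixed b"
    hence "b \<le> 2 * n \<or> (\<exists>p f. is_record p \<and> valid_field \<sigma> f \<and> b = cell \<sigma> p f)"
      unfolding fixed_def by (metis valid_field.simps)
    thus False using \<open>fr \<le> b\<close> fr_neq[of _ _ b] fr_eq by (auto simp: D_def)
  qed
qed

lemma base_at:
  assumes "base m"
  shows "x \<in> F \<Longrightarrow> at m (ad x) Len = Suc (length x)"
    "x \<in> F \<Longrightarrow> at m (ad x) Link = (if x = [] then D else ad (parent F x))"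
    "x \<in> F \<Longrightarrow> at m (ad x) Pos = at m0 (ad x) Pos"
    "at m D (Next 0) = ad []" "1 \<le> j \<Longrightarrow> j \<le> 2 * n \<Longrightarrow> m j = W ! (j - 1)"
proof -
  have f: "x \<in> F \<Longrightarrow> fixed (cell \<sigma> (ad x) Len)" "x \<in> F \<Longrightarrow> fixed (cell \<sigma> (ad x) Link)"
    "x \<in> F \<Longrightarrow> fixed (cell \<sigma> (ad x) Pos)" "fixed (cell \<sigma> D (Next 0))" "j \<le> 2 * n \<Longrightarrow> fixed j"
    unfolding fixed_def using sigma_pos ad is_record_D by blast+
  show "x \<in> F \<Longrightarrow> at m (ad x) Len = Suc (length x)"
    "x \<in> F \<Longrightarrow> at m (ad x) Link = (if x = [] then D else ad (parent F x))"
    "x \<in> F \<Longrightarrow> at m (ad x) Pos = at m0 (ad x) Pos" "at m D (Next 0) = ad []"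
    using assms f inv_node(1,2) inv_D(1)[OF sigma_pos] unfolding base_def by simp_all
  show "m j = W ! (j - 1)" if "1 \<le> j" "j \<le> 2 * n"
    using assms f(5) inv_D(2)[of "j - 1"] that unfolding base_def by simp
qed

abbreviation "pos x \<equiv> at m0 (ad x) Pos"

lemma letter_at:
  assumes "base m" "x \<in> F" "k < length x"
  shows "m (pos x + k) = x ! k" "pos x + k \<le> 2 * n"
proof -
  note p = inv_node(3,4,5)[OF assms(2)]
  have "length x \<le> 2 * n - (pos x - 1)" using prefix_length_le[OF p(3)] by simp
  thus le: "pos x + k \<le> 2 * n" using assms(3) p(1,2) by linarith
  have "m (pos x + k) = W ! (pos x - 1 + k)"
    using base_at(5)[OF assms(1), of "pos x + k"] p(1) le by simp
  also have "\<dots> = drop (pos x - 1) W ! k" using p(1) le by (intro nth_drop[symmetric]) simp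
  also have "\<dots> = x ! k" using p(3) assms(3) by (auto simp: prefix_def nth_append simp del: drop_append)
  finally show "m (pos x + k) = x ! k" .
qed

abbreviation "leafc x \<equiv> last (take n x)"

definition leaf_table :: "nat list \<Rightarrow> ends \<Rightarrow> nat" where
  "leaf_table x t = (if t = Some (leafc x, leafc x) then 0 else infty)"

text \<open>\<open>Y\<close> is the set of nodes processed so far: they are linked from their
  parents and, if long enough, carry the table of a leaf.\<close>

definition tables_ok :: "(nat \<Rightarrow> nat) \<Rightarrow> nat list set \<Rightarrow> bool" where
  "tables_ok m Y \<longleftrightarrow> base m \<and>
    (\<forall>x\<in>F. \<forall>c<\<sigma>. at m (ad x) (Child c) =
      (if x @ [c] \<in> factors W \<and> locus F (x @ [c]) \<in> Y then ad (locus F (x @ [c])) else 0)) \<and>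
    (\<forall>y\<in>Y. n \<le> length y \<longrightarrow> (\<forall>t\<in>set (all_ends \<sigma>). at m (ad y) (Tab t) = leaf_table y t)) \<and>
    (\<forall>t\<in>set (all_ends \<sigma>). at m D (Tab t) = (if t = None then 0 else infty))"

lemma leafc:
  assumes "x \<in> F" "n \<le> length x"
  shows "leafc x = x ! (n - 1)" "leafc x < \<sigma>"
proof -
  show 1: "leafc x = x ! (n - 1)" using assms(2) n_pos by (subst last_conv_nth) (auto simp: min_def)
  have "x ! (n - 1) \<in> set x" using assms(2) n_pos by (intro nth_mem) linarith
  thus "leafc x < \<sigma>" using factors_letters[OF nodes_subset_factors[OF assms(1)]] unfolding 1 by auto
qed

lemma ex_leaf:
  assumes "base m" "y \<in> F" "n \<le> length y" "r vp = ad y" "r vn = n"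
  shows "\<exists>m'. ex (clear_table \<sigma> vp;; load_last \<sigma>;; leaf_entry \<sigma>) (r, m) = (r(va := leafc y), m') \<and>
      (\<forall>t\<in>set (all_ends \<sigma>). at m' (ad y) (Tab t) = leaf_table y t) \<and>
      (\<forall>b. b \<notin> (\<lambda>t. cell \<sigma> (ad y) (Tab t)) ` set (all_ends \<sigma>) \<longrightarrow> m' b = m b)"
    "okC bnd (clear_table \<sigma> vp;; load_last \<sigma>;; leaf_entry \<sigma>) (r, m)"
proof -
  from ex_clear_table[of r vp "ad y" \<sigma> m] assms(4,5) obtain m1
      where m1: "ex (clear_table \<sigma> vp) (r, m) = (r, m1)"
    "\<forall>t\<in>set (all_ends \<sigma>). at m1 (ad y) (Tab t) = Suc n"
    "\<forall>b. b \<notin> (\<lambda>t. cell \<sigma> (ad y) (Tab t)) ` set (all_ends \<sigma>) \<longrightarrow> m1 b = m b" by auto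
  have "base m1"
    using assms(1,2) m1(3) not_fixed(2)[OF ad(1)[OF assms(2)]] unfolding base_def
      by (metis (no_types, lifting) imageE)
  have lt: "n - 1 < length y" using assms(3) n_pos by linarith
  have pos: "at m1 (ad y) Pos = pos y" using base_at(3)[OF \<open>base m1\<close> assms(2)] .
  have e1: "ex (load_last \<sigma>) (r, m1) = (r(va := leafc y), m1)"
    using letter_at(1)[OF \<open>base m1\<close> assms(2) lt] leafc(1)[OF assms(2,3)] pos assms(4,5)
    by (simp add: load_last_def)
  let ?m = "m1(cell \<sigma> (ad y) (Tab (Some (leafc y, leafc y))) := 0)"
  have l: "leafc y < \<sigma>" using leafc(2)[OF assms(2,3)] .
  have s: "Some (leafc y, leafc y) \<in> set (all_ends \<sigma>)" using l by (simp add: set_all_ends)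
  have e: "ex (clear_table \<sigma> vp;; load_last \<sigma>;; leaf_entry \<sigma>) (r, m) = (r(va := leafc y), ?m)"
    using m1(1) e1 ex_leaf_entry[of \<sigma> "r(va := leafc y)" m1] l assms(4) by simp
  have "\<forall>t\<in>set (all_ends \<sigma>). at ?m (ad y) (Tab t) = leaf_table y t"
    using m1(2) s assms(2) by (auto simp: leaf_table_def cell_eq infty_def)
  moreover have "\<forall>b. b \<notin> (\<lambda>t. cell \<sigma> (ad y) (Tab t)) ` set (all_ends \<sigma>) \<longrightarrow> ?m b = m b"
    using m1(3) s by auto
  ultimately show "\<exists>m'. ex (clear_table \<sigma> vp;; load_last \<sigma>;; leaf_entry \<sigma>) (r, m) = (r(va := leafc y), m') \<and>
      (\<forall>t\<in>set (all_ends \<sigma>). at m' (ad y) (Tab t) = leaf_table y t) \<and>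
      (\<forall>b. b \<notin> (\<lambda>t. cell \<sigma> (ad y) (Tab t)) ` set (all_ends \<sigma>) \<longrightarrow> m' b = m b)"
    using e by blast
  have "pos y + (n - 1) \<le> bnd"
    using letter_at(2)[OF assms(1,2) lt] n_le_bnd by simp
  thus "okC bnd (clear_table \<sigma> vp;; load_last \<sigma>;; leaf_entry \<sigma>) (r, m)"
    using okC_clear_table okC_leaf_entry m1(1) pos assms(4,5) n_pos by (simp add: load_last_def Suc_le_eq)
qed

lemma locus_eq_iff:
  assumes "y \<in> F" "y \<noteq> []" "x \<in> F"
  shows "x @ [c] \<in> factors W \<and> locus F (x @ [c]) = y \<longleftrightarrow> x = parent F y \<and> c = y ! length x"
  using locus_parent[OF assms(1,2)] parent_locus[OF assms(3), of c] by auto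

lemma child_letter: "y \<in> F \<Longrightarrow> y \<noteq> [] \<Longrightarrow> y ! length (parent F y) < \<sigma>"
  using locus_parent(1)[of y W] factors_letters[OF nodes_subset_factors, of y]
      nth_mem[of "length (parent F y)" y]
  by auto

lemma wp_child:
  assumes tables_ok: "tables_ok m Y" and YF: "Y \<subseteq> F" and y: "y \<in> F" "y \<notin> Y" and root: "[] \<in> F"
    and r: "r vp = ad y" "r vn = n" "r vroot = ad []"
    and Q: "\<And>r' m'. tables_ok m' (insert y Y) \<Longrightarrow> (\<forall>x. x \<noteq> va \<and> x \<noteq> vq \<and> x \<noteq> vp \<longrightarrow> r' x = r x) \<Longrightarrow>
      r' vp = ad y + S \<Longrightarrow> (\<forall>b\<ge>fr. m' b = m b) \<Longrightarrow> Q (r', m') (t + tmC (child \<sigma>))"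
  shows "wp bnd (child \<sigma>) Q (r, m) t"
proof -
  have base: "base m" using tables_ok unfolding tables_ok_def by blast
  have loop_free: "loop_free (child \<sigma>)"
    by (auto simp: child_def link_def clear_table_def load_last_def leaf_entry_def)
  show ?thesis
  proof (cases "y = []")
    case True
    have "tables_ok m (insert y Y)"
      using tables_ok True n_pos parent_locus(2)[of _ W] unfolding tables_ok_def by (auto simp: True)
    moreover have "ex (child \<sigma>) (r, m) = (r(vp := ad y + S), m)" using r True by (simp add: child_def)
    moreover have "okC bnd (child \<sigma>) (r, m)" using r True by (simp add: child_def)
    ultimately show ?thesis using Q[of m "r(vp := ad y + S)"] by (intro wp_loop_free loop_free) auto
  next
    case False
    let ?x = "parent F y"
    let ?c = "y ! length ?x"
    have x: "?x \<in> F" using parent(1)[OF _ False, of F] by simp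
    have lt: "length ?x < length y" using locus_parent(1)[OF y(1) False] .
    have c: "?c < \<sigma>" using child_letter[OF y(1) False] .
    let ?r1 = "r(vq := ad ?x, va := ?c)"
    let ?m1 = "m(cell \<sigma> (ad ?x) (Child ?c) := ad y)"
    have e1: "ex (link \<sigma>) (r, m) = (?r1, ?m1)"
      using base_at[OF base] letter_at(1)[OF base y(1) lt] x y False r by (simp add: link_def)
    have ok1: "okC bnd (link \<sigma>) (r, m)"
      using base_at[OF base] letter_at[OF base y(1) lt] x y False r is_record_le[of "ad ?x" "Child ?c"] c
          n_le_bnd
      by (simp add: link_def)
    have base1: "base ?m1" using base x c by (intro base_upd) auto
    have ch: "at ?m1 (ad x') (Child c') =
        (if x' @ [c'] \<in> factors W \<and> locus F (x' @ [c']) \<in> insert y Y then ad (locus F (x' @ [c'])) else 0)"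
      if "x' \<in> F" "c' < \<sigma>" for x' c'
    proof (cases "x' = ?x \<and> c' = ?c")
      case True
      thus ?thesis using locus_eq_iff[OF y(1) False that(1), of c'] by auto
    next
      case neither: False
      hence "\<not> (x' @ [c'] \<in> factors W \<and> locus F (x' @ [c']) = y)"
        using locus_eq_iff[OF y(1) False that(1), of c'] by auto
      moreover have "at ?m1 (ad x') (Child c') = at m (ad x') (Child c')"
        using neither that x c by (auto simp: cell_eq ad_inj)
      ultimately show ?thesis using tables_ok that unfolding tables_ok_def by auto
    qed
    have tabs: "at ?m1 p (Tab t) = at m p (Tab t)" if "is_record p" "t \<in> set (all_ends \<sigma>)" for p t
      using that x c by (simp add: cell_eq)
    have hi1: "?m1 b = m b" if "fr \<le> b" for b using fr_neq[of "ad ?x" "Child ?c" b] that x c by auto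
    have g: "aval (Equ (Var vp) (Var vroot)) (r, m) = 0"
      using r y(1) root False by (simp add: ad_inj)
    have g2: "aval (Les (Var vn) (Ld (Fd \<sigma> (Var vp) Len))) (?r1, ?m1) = of_bool (n \<le> length y)"
      using base_at(1)[OF base1 y(1)] r by simp
    show ?thesis
    proof (cases "n \<le> length y")
      case True
      from ex_leaf(1)[OF base1 y(1) True, of ?r1] r obtain m2 where
        m2: "ex (clear_table \<sigma> vp;; load_last \<sigma>;; leaf_entry \<sigma>) (?r1, ?m1) = (?r1(va := leafc y), m2)"
        "\<forall>t\<in>set (all_ends \<sigma>). at m2 (ad y) (Tab t) = leaf_table y t"
        "\<forall>b. b \<notin> (\<lambda>t. cell \<sigma> (ad y) (Tab t)) ` set (all_ends \<sigma>) \<longrightarrow> m2 b = ?m1 b" by auto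
      have ok2: "okC bnd (clear_table \<sigma> vp;; load_last \<sigma>;; leaf_entry \<sigma>) (?r1, ?m1)"
        using ex_leaf(2)[OF base1 y(1) True, of ?r1] r by simp
      have same: "m2 b = ?m1 b" if "\<And>t. t \<in> set (all_ends \<sigma>) \<Longrightarrow> b \<noteq> cell \<sigma> (ad y) (Tab t)" for b
      proof -
        have "b \<notin> (\<lambda>t. cell \<sigma> (ad y) (Tab t)) ` set (all_ends \<sigma>)" using that by blast
        thus ?thesis using m2(3) by blast
      qed
      have "base m2" unfolding base_def
      proof (intro allI impI)
        fix b assume b: "fixed b"
        have "m2 b = ?m1 b" using b not_fixed(2)[OF ad(1)[OF y(1)]] by (intro same) blast
        thus "m2 b = m0 b" using base1 b unfolding base_def by simp
      qed
      moreover have "at m2 (ad x') (Child c') = at ?m1 (ad x') (Child c')" if "x' \<in> F" "c' < \<sigma>" for x' c'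
        using that y(1) by (intro same) (simp add: cell_eq)
      moreover have "at m2 p (Tab t) = at ?m1 p (Tab t)" if "is_record p" "p \<noteq> ad y" "t \<in> set (all_ends \<sigma>)"
          for p t
        using that y(1) by (intro same) (simp add: cell_eq)
      ultimately have "tables_ok m2 (insert y Y)"
        unfolding tables_ok_def
      proof (intro conjI ballI allI impI, goal_cases)
        case 1
        thus ?case by blast
      next
        case (2 x' c')
        thus ?case using ch by simp
      next
        case (3 y' t)
        show ?case
        proof (cases "y' = y")
          case True
          thus ?thesis using m2(2) 3 by simp
        next
          case False
          hence "y' \<in> Y" "y' \<in> F" using 3 YF by auto
          hence "ad y' \<noteq> ad y" using False y(1) by (simp add: ad_inj)
          hence "at m2 (ad y') (Tab t) = at m (ad y') (Tab t)"
            using 3 tabs \<open>y' \<in> F\<close> by simp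
          thus ?thesis using tables_ok \<open>y' \<in> Y\<close> 3 unfolding tables_ok_def by simp
        qed
      next
        case (4 t)
        thus ?case using tabs tables_ok y(1) unfolding tables_ok_def by simp
      qed
      moreover have "\<forall>b\<ge>fr. m2 b = m b"
      proof (intro allI impI)
        fix b assume b: "fr \<le> b"
        have "b \<noteq> cell \<sigma> (ad y) (Tab t)" if "t \<in> set (all_ends \<sigma>)" for t
          using fr_neq[of "ad y" "Tab t" b] b y(1) that by auto
        hence "m2 b = ?m1 b" by (rule same)
        thus "m2 b = m b" using hi1[OF b] by simp
      qed
      moreover have e: "ex (child \<sigma>) (r, m) = (?r1(va := leafc y, vp := ad y + S), m2)"
        using g g2 e1 m2(1) True r by (simp add: child_def)
      moreover have "okC bnd (child \<sigma>) (r, m)"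
        using g g2 e1 ok1 ok2 True by (simp add: child_def)
      ultimately show ?thesis using Q[of m2 "?r1(va := leafc y, vp := ad y + S)"]
        by (intro wp_loop_free loop_free) auto
    next
      case short: False
      have "tables_ok ?m1 (insert y Y)"
        unfolding tables_ok_def
      proof (intro conjI ballI allI impI, goal_cases)
        case 1
        show ?case by (rule base1)
      next
        case (2 x' c')
        thus ?case using ch by simp
      next
        case (3 y' t)
        hence "y' \<in> Y" using short by auto
        thus ?case using tabs[of "ad y'" t] tables_ok YF 3 unfolding tables_ok_def by auto
      next
        case (4 t)
        thus ?case using tabs tables_ok unfolding tables_ok_def by simp
      qed
      moreover have e: "ex (child \<sigma>) (r, m) = (?r1(vp := ad y + S), ?m1)"
        using g g2 e1 short r by (simp add: child_def)
      moreover have "okC bnd (child \<sigma>) (r, m)"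
        using g g2 e1 ok1 short by (simp add: child_def)
      ultimately show ?thesis using Q[of ?m1 "?r1(vp := ad y + S)"] hi1 by (intro wp_loop_free loop_free) auto
    qed
  qed
qed

definition children_time :: nat where
  "children_time = tmC (children_init \<sigma>) + tmE (Les (Var vp) (Var vfr)) + 2 + tmC (child \<sigma>)"

lemma wp_children:
  assumes r: "r vn = n" "r vd = D" "r vfr = fr"
    and Q: "\<And>r' m' t'. tables_ok m' F \<Longrightarrow> r' vn = n \<Longrightarrow> r' vd = D \<Longrightarrow> r' vfr = fr \<Longrightarrow> r' vroot = ad [] \<Longrightarrow>
      t' \<le> t + children_time * (cnt + 1) \<Longrightarrow> Q (r', m') t'"
  shows "wp bnd (children \<sigma>) Q (r, m0) t"
proof -
  have b0: "base m0" by (simp add: base_def)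
  let ?r1 = "r(vroot := ad [], vp := D + S)"
  have "\<exists>m1. ex (clear_table \<sigma> vd) (r(vroot := ad []), m0) = (r(vroot := ad []), m1) \<and>
    (\<forall>t\<in>set (all_ends \<sigma>). at m1 D (Tab t) = Suc n) \<and>
    (\<forall>b. b \<notin> (\<lambda>t. cell \<sigma> D (Tab t)) ` set (all_ends \<sigma>) \<longrightarrow> m1 b = m0 b)"
    using ex_clear_table[of "r(vroot := ad [])" vd D \<sigma> m0] r by simp
  then obtain m1 where
    m1: "ex (clear_table \<sigma> vd) (r(vroot := ad []), m0) = (r(vroot := ad []), m1)"
    "\<forall>t\<in>set (all_ends \<sigma>). at m1 D (Tab t) = Suc n"
    "\<forall>b. b \<notin> (\<lambda>t. cell \<sigma> D (Tab t)) ` set (all_ends \<sigma>) \<longrightarrow> m1 b = m0 b" by blast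
  let ?m2 = "m1(cell \<sigma> D (Tab None) := 0)"
  have e: "ex (children_init \<sigma>) (r, m0) = (?r1, ?m2)"
    using m1(1) base_at(4)[OF b0] r by (simp add: children_init_def)
  have same: "?m2 b = m0 b" if "\<And>t. t \<in> set (all_ends \<sigma>) \<Longrightarrow> b \<noteq> cell \<sigma> D (Tab t)" for b
  proof -
    have "b \<notin> (\<lambda>t. cell \<sigma> D (Tab t)) ` set (all_ends \<sigma>)" using that by blast
    thus ?thesis using m1(3) that[of None] by auto
  qed
  have tok0: "tables_ok ?m2 {}"
    unfolding tables_ok_def
  proof (intro conjI ballI allI impI, goal_cases)
    case 1
    show ?case
      unfolding base_def
    proof (intro allI impI)
      fix b assume "fixed b"
      hence "b \<noteq> cell \<sigma> D (Tab t)" if "t \<in> set (all_ends \<sigma>)" for t using not_fixed(2)[OF is_record_D that]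
        by metis
      thus "?m2 b = m0 b" by (rule same)
    qed
  next
    case (2 x c)
    thus ?case using same[of "cell \<sigma> (ad x) (Child c)"] inv_node(6) by (simp add: cell_eq)
  next
    case (4 t)
    thus ?case using m1(2) by (simp add: cell_eq infty_def)
  qed simp
  let ?K = "tmE (Les (Var vp) (Var vfr)) + 2 + tmC (child \<sigma>)"
  \<comment> \<open>Records are scanned in the order of their addresses, which need not respect the
    tree: a node may be linked before its parent has been scanned.\<close>
  let ?Y = "\<lambda>j. {y \<in> F. ad y < D + S * j}"
  let ?I = "\<lambda>s t1. \<exists>j. 1 \<le> j \<and> j \<le> cnt \<and> fst s vp = D + S * j \<and> fst s vn = n \<and> fst s vd = D \<and> fst s vfr = fr \<and>
    fst s vroot = ad [] \<and> tables_ok (snd s) (?Y j) \<and> t1 \<le> t + tmC (children_init \<sigma>) + ?K * j"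
  have Ybase: "?Y 1 = {}"
  proof -
    have "D + S * 1 \<le> ad y" if "y \<in> F" for y
    proof -
      obtain j where "ad y = D + S * j" "1 \<le> j" using ad_cases[OF \<open>y \<in> F\<close>] by metis
      thus ?thesis by (simp add: Suc_le_eq)
    qed
    thus ?thesis by (auto simp: not_less[symmetric])
  qed
  show ?thesis
    unfolding children_def
  proof (rule wp_Sq, rule wp_loop_free)
    show "loop_free (children_init \<sigma>)" by (auto simp: children_init_def clear_table_def)
    show "okC bnd (children_init \<sigma>) (r, m0)" using okC_clear_table by (simp add: children_init_def)
    show "wp bnd (While (Les (Var vp) (Var vfr)) (child \<sigma>)) Q (ex (children_init \<sigma>) (r, m0))
        (t + tmC (children_init \<sigma>))"
      unfolding e
    proof (rule wp_While[where I = ?I and T = "t + tmC (children_init \<sigma>) + ?K * cnt"])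
      show "?I (?r1, ?m2) (t + tmC (children_init \<sigma>))"
      proof -
        have "tables_ok (snd (?r1, ?m2)) (?Y 1)" unfolding Ybase snd_conv by (rule tok0)
        moreover have "t + tmC (children_init \<sigma>) \<le> t + tmC (children_init \<sigma>) + ?K * 1" by simp
        moreover have "fst (?r1, ?m2) vp = D + S * 1" "fst (?r1, ?m2) vn = n" "fst (?r1, ?m2) vd = D"
          "fst (?r1, ?m2) vfr = fr" "fst (?r1, ?m2) vroot = ad []" using r by simp_all
        ultimately show ?thesis using cnt(2) by blast
      qed
    next
      fix s t1 assume "?I s t1"
      then obtain j where j: "1 \<le> j" "j \<le> cnt" "fst s vp = D + S * j" "fst s vn = n" "fst s vd = D"
        "fst s vfr = fr" "fst s vroot = ad []" "tables_ok (snd s) (?Y j)"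
            "t1 \<le> t + tmC (children_init \<sigma>) + ?K * j" by blast
      have "?K * j \<le> ?K * cnt" using j(2) by (rule mult_le_mono2)
      thus t1: "t1 \<le> t + tmC (children_init \<sigma>) + ?K * cnt" using j(9) by linarith
      show "okE bnd (Les (Var vp) (Var vfr)) s" by simp
      { assume "aval (Les (Var vp) (Var vfr)) s \<noteq> 0"
        hence "j < cnt" using j by (simp add: fr_eq split: if_splits)
        then obtain y where y: "y \<in> F" "ad y = D + S * j" using ad_surj[OF j(1)] by blast
        have Y: "insert y (?Y j) = ?Y (Suc j)"
        proof -
          have "ad x < D + S * Suc j \<longleftrightarrow> x = y \<or> ad x < D + S * j" if "x \<in> F" for x
          proof -
            obtain k where k: "ad x = D + S * k" using ad_cases[OF \<open>x \<in> F\<close>] by metis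
            have "x = y \<longleftrightarrow> k = j" using ad_inj[OF \<open>x \<in> F\<close> y(1)] k y(2) by auto
            moreover have "S * k < S * Suc j \<longleftrightarrow> k < Suc j" "S * k < S * j \<longleftrightarrow> k < j"
              by (rule mult_less_cancel1[THEN trans], simp)+
            ultimately show ?thesis using k by auto
          qed
          thus ?thesis using y(1) by blast
        qed
        have "wp bnd (child \<sigma>) ?I (fst s, snd s) (t1 + tmE (Les (Var vp) (Var vfr)) + 2)"
        proof (rule wp_child[OF j(8)])
          fix r' m'
          assume a: "tables_ok m' (insert y (?Y j))" "\<forall>x. x \<noteq> va \<and> x \<noteq> vq \<and> x \<noteq> vp \<longrightarrow> r' x = fst s x"
            "r' vp = ad y + S"
          have "t1 + tmE (Les (Var vp) (Var vfr)) + 2 + tmC (child \<sigma>) \<le> t + tmC (children_init \<sigma>) +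
              ?K * Suc j"
            using j(9) by simp
          thus "?I (r', m') (t1 + tmE (Les (Var vp) (Var vfr)) + 2 + tmC (child \<sigma>))"
            using a j \<open>j < cnt\<close> y(2) unfolding Y
            by (intro exI[of _ "Suc j"]) (simp del: tmC.simps tmE.simps)
        qed (use y j in auto)
        thus "wp bnd (child \<sigma>) ?I s (t1 + tmE (Les (Var vp) (Var vfr)) + 2)" by simp }
      { assume "aval (Les (Var vp) (Var vfr)) s = 0"
        hence "\<not> S * j < S * cnt" using j by (simp add: fr_eq split: if_splits)
        hence "j = cnt" using j(2) by simp
        have "?Y cnt = F"
        proof -
          have "ad y < D + S * cnt" if "y \<in> F" for y
          proof -
            obtain k where "ad y = D + S * k" "k < cnt" using ad_cases[OF \<open>y \<in> F\<close>] by metis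
            thus ?thesis by simp
          qed
          thus ?thesis by blast
        qed
        hence "tables_ok (snd s) F" using j(8) \<open>j = cnt\<close> by simp
        moreover have "t1 + tmE (Les (Var vp) (Var vfr)) + 2 \<le> t + children_time * (cnt + 1)"
          using t1 by (simp add: children_time_def algebra_simps)
        ultimately show "Q s (t1 + tmE (Les (Var vp) (Var vfr)) + 2)"
          using Q[of "snd s" "fst s"] j by simp }
    qed
  qed
qed

end

section \<open>Queue of the nodes shorter than \<open>n\<close>\<close>

definition push :: "nat \<Rightarrow> nat \<Rightarrow> com" where
  "push \<sigma> c = vq ::= Ld (Fd \<sigma> (Var vp) (Child c));;
    Cnd (Var vq) (Cnd (Les (Var vn) (Ld (Fd \<sigma> (Var vq) Len))) Skip
      (Sto (Var vt) (Var vq);; vt ::= Inc (Var vt) 1)) Skip"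

definition bfs_visit :: "nat \<Rightarrow> com" where
  "bfs_visit \<sigma> = vp ::= Ld (Var vh);; seqs (map (push \<sigma>) [0..<\<sigma>]);; vh ::= Inc (Var vh) 1"

definition bfs_init :: com where
  "bfs_init = Sto (Var vfr) (Var vroot);; vh ::= Var vfr;; vt ::= Inc (Var vfr) 1"

text \<open>Breadth-first order puts each node before its children. The tables are then filled by
  reading the queue backwards, and choices are passed on by reading it forwards.\<close>

definition bfs :: "nat \<Rightarrow> com" where
  "bfs \<sigma> = bfs_init;; While (Les (Var vh) (Var vt)) (bfs_visit \<sigma>)"

text \<open>The variables below 20 are left to those with a fixed meaning.\<close>

abbreviation kid :: "nat \<Rightarrow> nat" where "kid c \<equiv> 20 + c"

definition load_children :: "nat \<Rightarrow> com" where
  "load_children \<sigma> = seqs (map (\<lambda>c. kid c ::= Ld (Fd \<sigma> (Var vp) (Child c));;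
    Cnd (Var (kid c)) Skip (kid c ::= Var vd)) [0..<\<sigma>])"

text \<open>The changes at the joints of a candidate are known at compile time and enter as a
  literal, so only entries of the children are read.\<close>

definition sumE :: "nat \<Rightarrow> nat list \<times> ends list \<Rightarrow> exp" where
  "sumE \<sigma> C = Inc (foldr (\<lambda>c. Pl (Ld (Fd \<sigma> (Var (kid c)) (Tab (snd C ! c))))) [0..<\<sigma>] (Lit 0))
      (joint_list (arrange \<sigma> C))"

definition relax :: "nat \<Rightarrow> nat list \<times> ends list \<Rightarrow> com" where
  "relax \<sigma> C = Cnd (Les (sumE \<sigma> C) (Ld (Fd \<sigma> (Var vp) (Tab (join_list (arrange \<sigma> C))))))
    (Sto (Fd \<sigma> (Var vp) (Tab (join_list (arrange \<sigma> C)))) (sumE \<sigma> C)) Skip"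

definition dp_visit :: "nat \<Rightarrow> com" where
  "dp_visit \<sigma> = vh ::= Mi (Var vh) (Lit 1);; vp ::= Ld (Var vh);; Sto (Fd \<sigma> (Var vp) Cho) (Lit 0);;
    load_children \<sigma>;; clear_table \<sigma> vp;; seqs (map (relax \<sigma>) (candidates \<sigma>))"

definition dp :: "nat \<Rightarrow> com" where
  "dp \<sigma> = vh ::= Var vt;; While (Les (Var vfr) (Var vh)) (dp_visit \<sigma>)"

lemma join_list_in_all_ends: "set ts \<subseteq> set (all_ends \<sigma>) \<Longrightarrow> join_list ts \<in> set (all_ends \<sigma>)"
proof (induction ts)
  case (Cons t ts)
  hence a: "t \<in> set (all_ends \<sigma>)" "join_list ts \<in> set (all_ends \<sigma>)" by auto
  show ?case by (cases t; cases "join_list ts") (use a in \<open>auto simp: set_all_ends\<close>)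
qed (simp add: set_all_ends)

lemma join_list_arrange: "C \<in> set (candidates \<sigma>) \<Longrightarrow> join_list (arrange \<sigma> C) \<in> set (all_ends \<sigma>)"
proof (rule join_list_in_all_ends)
  assume C: "C \<in> set (candidates \<sigma>)"
  show "set (arrange \<sigma> C) \<subseteq> set (all_ends \<sigma>)"
  proof
    fix t assume "t \<in> set (arrange \<sigma> C)"
    then obtain c where "c < \<sigma>" "t = snd C ! c" unfolding arrange_def by auto
    thus "t \<in> set (all_ends \<sigma>)" using C nth_mem[of c "snd C"] unfolding set_candidates by auto
  qed
qed

lemma aval_sumE: "aval (sumE \<sigma> C) s = cost \<sigma> (\<lambda>c t. snd s (cell \<sigma> (fst s (kid c)) (Tab t))) C"
proof -
  have "aval (foldr (\<lambda>c. Pl (Ld (Fd \<sigma> (Var (kid c)) (Tab (snd C ! c))))) cs (Lit 0)) s =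
      (\<Sum>c\<leftarrow>cs. snd s (cell \<sigma> (fst s (kid c)) (Tab (snd C ! c))))" for cs
    by (induction cs) auto
  thus ?thesis by (simp add: sumE_def cost_def sum_list_distinct_conv_sum_set atLeast0LessThan)
qed

lemma okE_sumE:
  assumes "\<And>c. c < \<sigma> \<Longrightarrow> snd s (cell \<sigma> (fst s (kid c)) (Tab (snd C ! c))) \<le> B" "\<sigma> * B \<le> U"
  shows "okE U (sumE \<sigma> C) s"
proof -
  have "okE U (foldr (\<lambda>c. Pl (Ld (Fd \<sigma> (Var (kid c)) (Tab (snd C ! c))))) cs (Lit 0)) s \<and>
    aval (foldr (\<lambda>c. Pl (Ld (Fd \<sigma> (Var (kid c)) (Tab (snd C ! c))))) cs (Lit 0)) s \<le> length cs * B"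
    if "set cs \<subseteq> {..<\<sigma>}" "length cs \<le> \<sigma>" for cs
    using that
  proof (induction cs)
    case (Cons c cs)
    have "length (c # cs) * B \<le> \<sigma> * B" using Cons.prems(2) by (rule mult_le_mono1)
    moreover have "snd s (cell \<sigma> (fst s (kid c)) (Tab (snd C ! c))) \<le> B" using Cons.prems(1)
      by (intro assms(1)) simp
    ultimately show ?case using Cons assms(2) by auto
  qed simp
  from this[of "[0..<\<sigma>]"] show ?thesis by (simp add: sumE_def atLeast0LessThan)
qed

text \<open>Premise \<open>g\<close> expresses that candidates read only tables other than the one
  at \<open>p\<close>; so their order does not matter, and every entry ends as the minimum of its
  initial value and its candidates.\<close>

lemma ex_relax:
  assumes g: "\<And>C m'. C \<in> set Cs \<Longrightarrow> (\<forall>b. b \<notin> (\<lambda>t. cell \<sigma> p (Tab t)) ` set (all_ends \<sigma>) \<longrightarrow> m' b = m b) \<Longrightarrow>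
      aval (sumE \<sigma> C) (r, m') = g C"
    and Cs: "set Cs \<subseteq> set (candidates \<sigma>)" and p: "r vp = p"
  shows "\<exists>m'. ex (seqs (map (relax \<sigma>) Cs)) (r, m) = (r, m') \<and>
    (\<forall>b. b \<notin> (\<lambda>t. cell \<sigma> p (Tab t)) ` set (all_ends \<sigma>) \<longrightarrow> m' b = m b) \<and>
    (\<forall>t\<in>set (all_ends \<sigma>). m' (cell \<sigma> p (Tab t)) \<le> m (cell \<sigma> p (Tab t)) \<and>
      (m' (cell \<sigma> p (Tab t)) = m (cell \<sigma> p (Tab t)) \<or>
        (\<exists>C\<in>set Cs. join_list (arrange \<sigma> C) = t \<and> g C = m' (cell \<sigma> p (Tab t))))) \<and>
    (\<forall>C\<in>set Cs. m' (cell \<sigma> p (Tab (join_list (arrange \<sigma> C)))) \<le> g C)"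
  using g Cs
proof (induction Cs arbitrary: m)
  case (Cons C Cs)
  let ?t = "join_list (arrange \<sigma> C)"
  let ?a = "cell \<sigma> p (Tab ?t)"
  let ?A = "(\<lambda>t. cell \<sigma> p (Tab t)) ` set (all_ends \<sigma>)"
  have tC: "?t \<in> set (all_ends \<sigma>)" using Cons.prems(2) join_list_arrange by auto
  have inj: "cell \<sigma> p (Tab t) = ?a \<longleftrightarrow> t = ?t" if "t \<in> set (all_ends \<sigma>)" for t
    using encode_inj[OF that tC] by (auto simp: cell_def)
  define m1 where "m1 = (if g C < m ?a then m(?a := g C) else m)"
  have "aval (sumE \<sigma> C) (r, m) = g C" by (rule Cons.prems(1)) auto
  hence e: "ex (relax \<sigma> C) (r, m) = (r, m1)" using p by (simp add: relax_def m1_def)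
  have out: "m1 b = m b" if "b \<notin> ?A" for b using that tC by (auto simp: m1_def)
  have "\<exists>m'. ex (seqs (map (relax \<sigma>) Cs)) (r, m1) = (r, m') \<and>
    (\<forall>b. b \<notin> ?A \<longrightarrow> m' b = m1 b) \<and>
    (\<forall>t\<in>set (all_ends \<sigma>). m' (cell \<sigma> p (Tab t)) \<le> m1 (cell \<sigma> p (Tab t)) \<and>
      (m' (cell \<sigma> p (Tab t)) = m1 (cell \<sigma> p (Tab t)) \<or>
        (\<exists>C\<in>set Cs. join_list (arrange \<sigma> C) = t \<and> g C = m' (cell \<sigma> p (Tab t))))) \<and>
    (\<forall>C\<in>set Cs. m' (cell \<sigma> p (Tab (join_list (arrange \<sigma> C)))) \<le> g C)"
    using Cons.prems out by (intro Cons.IH) auto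
  then obtain m' where m': "ex (seqs (map (relax \<sigma>) Cs)) (r, m1) = (r, m')"
    "\<forall>b. b \<notin> ?A \<longrightarrow> m' b = m1 b"
    "\<forall>t\<in>set (all_ends \<sigma>). m' (cell \<sigma> p (Tab t)) \<le> m1 (cell \<sigma> p (Tab t)) \<and>
      (m' (cell \<sigma> p (Tab t)) = m1 (cell \<sigma> p (Tab t)) \<or>
        (\<exists>C\<in>set Cs. join_list (arrange \<sigma> C) = t \<and> g C = m' (cell \<sigma> p (Tab t))))"
    "\<forall>C\<in>set Cs. m' (cell \<sigma> p (Tab (join_list (arrange \<sigma> C)))) \<le> g C" by blast
  have m1_at: "m1 (cell \<sigma> p (Tab t)) = (if t = ?t then min (g C) (m ?a) else m (cell \<sigma> p (Tab t)))"
    if "t \<in> set (all_ends \<sigma>)" for t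
    using inj[OF that] by (auto simp: m1_def)
  show ?case
  proof (intro exI[of _ m'] conjI ballI allI impI)
    show "ex (seqs (map (relax \<sigma>) (C # Cs))) (r, m) = (r, m')" using e m'(1) by simp
    show "m' b = m b" if "b \<notin> ?A" for b using m'(2) out that by simp
    show "m' (cell \<sigma> p (Tab (join_list (arrange \<sigma> C')))) \<le> g C'" if "C' \<in> set (C # Cs)" for C'
      using that m'(3,4) m1_at[OF tC] tC by (auto dest!: bspec[OF m'(3)])
    fix t assume t: "t \<in> set (all_ends \<sigma>)"
    show "m' (cell \<sigma> p (Tab t)) \<le> m (cell \<sigma> p (Tab t))"
      using m'(3) t m1_at[OF t] by (auto split: if_splits dest!: bspec[OF m'(3)])
    show "m' (cell \<sigma> p (Tab t)) = m (cell \<sigma> p (Tab t)) \<or>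
        (\<exists>C\<in>set (C # Cs). join_list (arrange \<sigma> C) = t \<and> g C = m' (cell \<sigma> p (Tab t)))"
      using bspec[OF m'(3) t] m1_at[OF t] by (auto simp: min_def split: if_splits)
  qed
qed auto

context built
begin

definition kids :: "nat \<Rightarrow> nat list \<Rightarrow> nat list list" where
  "kids k x = map (\<lambda>c. locus F (x @ [c]))
      (filter (\<lambda>c. x @ [c] \<in> factors W \<and> length (locus F (x @ [c])) < n) [0..<k])"

definition with_queue :: "(nat \<Rightarrow> nat) \<Rightarrow> nat list list \<Rightarrow> nat \<Rightarrow> nat" where
  "with_queue m qs b = (if fr \<le> b \<and> b < fr + length qs then ad (qs ! (b - fr)) else m b)"

lemma with_queue_snoc: "(with_queue m qs)(fr + length qs := ad y) = with_queue m (qs @ [y])"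
  by (auto simp: with_queue_def fun_eq_iff nth_append)

lemma with_queue_Nil [simp]: "with_queue m [] = m"
  by (auto simp: with_queue_def fun_eq_iff)

lemma with_queue_low: "b < fr \<Longrightarrow> with_queue m qs b = m b"
  by (simp add: with_queue_def)

lemma with_queue_at [simp]: "is_record p \<Longrightarrow> valid_field \<sigma> f \<Longrightarrow> at (with_queue m qs) p f = at m p f"
  using is_record_fr(1) by (simp add: with_queue_low)

lemma tables_ok_cong:
  assumes "tables_ok m F" "\<And>b. fixed b \<Longrightarrow> m' b = m b"
      "\<And>x c. x \<in> F \<Longrightarrow> c < \<sigma> \<Longrightarrow> at m' (ad x) (Child c) = at m (ad x) (Child c)"
    "\<And>y t. y \<in> F \<Longrightarrow> n \<le> length y \<Longrightarrow> t \<in> set (all_ends \<sigma>) \<Longrightarrow> at m' (ad y) (Tab t) = at m (ad y) (Tab t)"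
    "\<And>t. t \<in> set (all_ends \<sigma>) \<Longrightarrow> at m' D (Tab t) = at m D (Tab t)"
  shows "tables_ok m' F"
  using assms unfolding tables_ok_def base_def by simp

lemma fixed_lt: "fixed b \<Longrightarrow> b < fr"
  using not_fixed(4)[of b] by (meson not_le_imp_less)

lemma tables_ok_with_queue: "tables_ok m F \<Longrightarrow> tables_ok (with_queue m qs) F"
  by (erule tables_ok_cong) (auto simp: with_queue_low fixed_lt)

lemma tables_ok_child: "tables_ok m F \<Longrightarrow> x \<in> F \<Longrightarrow> c < \<sigma> \<Longrightarrow>
    at m (ad x) (Child c) = (if x @ [c] \<in> factors W then ad (locus F (x @ [c])) else 0)"
  using locus(1)[of "x @ [c]" W] unfolding tables_ok_def by auto

lemma tables_ok_Len: "tables_ok m F \<Longrightarrow> x \<in> F \<Longrightarrow> at m (ad x) Len = Suc (length x)"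
  unfolding tables_ok_def using base_at(1) by blast

lemma ex_push:
  assumes m: "tables_ok m F" and x: "x \<in> F" and r: "r vp = ad x" "r vn = n" "r vt = fr + length qs"
      and k: "k \<le> \<sigma>"
  shows "\<exists>r'. ex (seqs (map (push \<sigma>) [0..<k])) (r, with_queue m qs) = (r', with_queue m (qs @ kids k x)) \<and>
    r' vt = fr + length qs + length (kids k x) \<and> (\<forall>v. v \<noteq> vt \<and> v \<noteq> vq \<longrightarrow> r' v = r v)"
  using k
proof (induction k)
  case 0
  show ?case using r by (simp add: kids_def)
next
  case (Suc k)
  then obtain r1 where r1: "ex (seqs (map (push \<sigma>) [0..<k])) (r, with_queue m qs) =
      (r1, with_queue m (qs @ kids k x))"
    "r1 vt = fr + length qs + length (kids k x)" "\<forall>v. v \<noteq> vt \<and> v \<noteq> vq \<longrightarrow> r1 v = r v" by auto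
  have k: "k < \<sigma>" using Suc.prems by simp
  let ?m = "with_queue m (qs @ kids k x)"
  let ?y = "locus F (x @ [k])"
  have e: "ex (seqs (map (push \<sigma>) [0..<Suc k])) (r, with_queue m qs) = ex (push \<sigma> k) (r1, ?m)"
    using r1(1) by (simp add: ex_seqs)
  have c: "at ?m (ad x) (Child k) = (if x @ [k] \<in> factors W then ad ?y else 0)"
    using tables_ok_child[OF m x k] x k by simp
  show ?case
  proof (cases "x @ [k] \<in> factors W")
    case False
    thus ?thesis unfolding e using r1 r c by (intro exI[of _ "r1(vq := 0)"]) (auto simp: push_def kids_def)
  next
    case True
    have y: "?y \<in> F" using locus(1)[OF True] .
    have l: "at ?m (ad ?y) Len = Suc (length ?y)" using tables_ok_Len[OF m y] y by simp
    show ?thesis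
    proof (cases "length ?y < n")
      case False
      thus ?thesis unfolding e using r1 r c True l y
        by (intro exI[of _ "r1(vq := ad ?y)"]) (auto simp: push_def kids_def)
    next
      case short: True
      have kk: "kids (Suc k) x = kids k x @ [?y]" using True short by (simp add: kids_def)
      have "?m(fr + length qs + length (kids k x) := ad ?y) = with_queue m (qs @ kids (Suc k) x)"
        using with_queue_snoc[of m "qs @ kids k x" ?y] unfolding kk by (simp add: add.assoc)
      thus ?thesis unfolding e using r1 r c True l y short
        by (intro exI[of _ "r1(vq := ad ?y, vt := Suc (fr + length qs + length (kids k x)))"])
          (auto simp: push_def kk)
    qed
  qed
qed

lemma okC_push: "okC U (seqs (map (push \<sigma>) cs)) st"
  by (induction cs arbitrary: st) (auto simp: push_def)

text \<open>The first \<open>h\<close> entries have been expanded. The equation yields completeness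
  once \<open>h\<close> reaches the end, the last clause that parents come before their
  children.\<close>

definition queue :: "nat list list \<Rightarrow> nat \<Rightarrow> bool" where
  "queue qs h \<longleftrightarrow> qs = [] # concat (map (kids \<sigma>) (take h qs)) \<and> distinct qs \<and> h \<le> length qs \<and>
    (\<forall>x\<in>set qs. x \<in> F \<and> length x < n) \<and>
    (\<forall>i<length qs. 0 < i \<longrightarrow> (\<exists>j<i. qs ! i \<in> set (kids \<sigma> (qs ! j))))"

lemma kids:
  assumes "x \<in> F" "y \<in> set (kids \<sigma> x)"
  shows "y \<in> F" "y \<noteq> []" "parent F y = x" "length y < n" "length x < length y"
proof -
  obtain c where c: "y = locus F (x @ [c])" "x @ [c] \<in> factors W" "length y < n" using assms(2)
    unfolding kids_def by auto
  show "y \<in> F" "y \<noteq> []" "parent F y = x" "length x < length y" "length y < n"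
    using parent_locus[OF assms(1) c(2)] c(1,3) by auto
qed

lemma kids_I: "y \<in> F \<Longrightarrow> y \<noteq> [] \<Longrightarrow> length y < n \<Longrightarrow> y \<in> set (kids \<sigma> (parent F y))"
  using locus_parent[of y W] child_letter[of y] unfolding kids_def
  by (auto intro!: image_eqI[of _ _ "y ! length (parent F y)"])

lemma distinct_kids: "x \<in> F \<Longrightarrow> distinct (kids k x)"
  unfolding kids_def distinct_map
proof
  assume x: "x \<in> F"
  show "inj_on (\<lambda>c. locus F (x @ [c]))
      (set (filter (\<lambda>c. x @ [c] \<in> factors W \<and> length (locus F (x @ [c])) < n) [0..<k]))"
  proof (rule inj_onI)
    fix c d
    assume "c \<in> set (filter (\<lambda>c. x @ [c] \<in> factors W \<and> length (locus F (x @ [c])) < n) [0..<k])"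
      "d \<in> set (filter (\<lambda>c. x @ [c] \<in> factors W \<and> length (locus F (x @ [c])) < n) [0..<k])"
      and eq: "locus F (x @ [c]) = locus F (x @ [d])"
    hence f: "x @ [c] \<in> factors W" "x @ [d] \<in> factors W" by simp_all
    have "c = locus F (x @ [c]) ! length x" by (rule parent_locus(4)[OF x f(1), symmetric])
    also have "\<dots> = locus F (x @ [d]) ! length x" by (simp only: eq)
    also have "\<dots> = d" by (rule parent_locus(4)[OF x f(2)])
    finally show "c = d" .
  qed
qed simp

lemma queue_0: "queue [[]] 0"
  using n_pos by (simp add: queue_def)

lemma queue_Suc:
  assumes q: "queue qs h" and h: "h < length qs"
  shows "queue (qs @ kids \<sigma> (qs ! h)) (Suc h)"
proof -
  let ?x = "qs ! h"
  have x: "?x \<in> F" "?x \<in> set qs" using q h unfolding queue_def by auto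
  have qs: "qs = [] # concat (map (kids \<sigma>) (take h qs))" "distinct qs" using q unfolding queue_def by blast+
  \<comment> \<open>A node in both lists would have its only parent \<open>?x\<close> among the
    entries expanded earlier, although the queue has no repetitions.\<close>
  have disj: "set qs \<inter> set (kids \<sigma> ?x) = {}"
  proof -
    have False if y: "y \<in> set qs" "y \<in> set (kids \<sigma> ?x)" for y
    proof -
      have "y \<noteq> []" "parent F y = ?x" using kids[OF x(1) y(2)] by auto
      hence "y \<in> set (concat (map (kids \<sigma>) (take h qs)))" using y(1) qs(1) by (metis set_ConsD)
      then obtain x' where x': "x' \<in> set (take h qs)" "y \<in> set (kids \<sigma> x')" by auto
      have "x' \<in> F" using x'(1) q unfolding queue_def by (meson in_set_takeD)
      hence "x' = ?x" using kids(3)[OF _ x'(2)] \<open>parent F y = ?x\<close> by simp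
      moreover obtain i where "i < h" "x' = qs ! i" using x'(1) h by (auto simp: in_set_conv_nth)
      ultimately show False using qs(2) h by (simp add: nth_eq_iff_index_eq)
    qed
    thus ?thesis by blast
  qed
  have "take (Suc h) (qs @ kids \<sigma> ?x) = take h qs @ [?x]" using h by (simp add: take_Suc_conv_app_nth)
  hence eq: "qs @ kids \<sigma> ?x = [] # concat (map (kids \<sigma>) (take (Suc h) (qs @ kids \<sigma> ?x)))"
    using qs(1) by simp
  have par: "\<exists>j<i. (qs @ kids \<sigma> ?x) ! i \<in> set (kids \<sigma> ((qs @ kids \<sigma> ?x) ! j))"
    if i: "i < length (qs @ kids \<sigma> ?x)" "0 < i" for i
  proof (cases "i < length qs")
    case True
    then obtain j where "j < i" "qs ! i \<in> set (kids \<sigma> (qs ! j))" using q i(2) unfolding queue_def by blast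
    thus ?thesis using True by (intro exI[of _ j]) (simp add: nth_append)
  next
    case False
    hence "(qs @ kids \<sigma> ?x) ! i \<in> set (kids \<sigma> ?x)" using i(1) by (simp add: nth_append)
    thus ?thesis using False h by (intro exI[of _ h]) (simp add: nth_append)
  qed
  show ?thesis
    unfolding queue_def
  proof (intro conjI ballI)
    show "qs @ kids \<sigma> ?x = [] # concat (map (kids \<sigma>) (take (Suc h) (qs @ kids \<sigma> ?x)))" by (rule eq)
    show "distinct (qs @ kids \<sigma> ?x)" using qs(2) disj distinct_kids[OF x(1)] by simp
    show "Suc h \<le> length (qs @ kids \<sigma> ?x)" using h by simp
    show "\<forall>i<length (qs @ kids \<sigma> ?x). 0 < i \<longrightarrow>
        (\<exists>j<i. (qs @ kids \<sigma> ?x) ! i \<in> set (kids \<sigma> ((qs @ kids \<sigma> ?x) ! j)))" using par by blast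
    fix y assume "y \<in> set (qs @ kids \<sigma> ?x)"
    hence "y \<in> set qs \<or> y \<in> set (kids \<sigma> ?x)" by simp
    thus "y \<in> F" "length y < n" using q kids(1,4)[OF x(1)] unfolding queue_def by blast+
  qed
qed

text \<open>Entries are distinct nodes and so have distinct records, none of them the sentinel. This
  makes every pass over the queue linear.\<close>

lemma queue_length:
  assumes "queue qs h"
  shows "length qs < cnt"
proof -
  have "length qs = card (ad ` set qs)"
    using assms ad_inj unfolding queue_def by (subst card_image) (auto simp: inj_on_def distinct_card)
  also have "\<dots> \<le> card ((\<lambda>j. D + S * j) ` {1..<cnt})"
    using assms bij unfolding queue_def bij_betw_def by (intro card_mono) auto
  also have "\<dots> \<le> card {1..<cnt}" by (rule card_image_le) simp
  finally show ?thesis using cnt(2) by simp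
qed

lemma queue_all:
  assumes q: "queue qs (length qs)" and x: "x \<in> F" "length x < n"
  shows "x \<in> set qs"
  using x
proof (induction "length x" arbitrary: x rule: less_induct)
  case less
  have qs: "qs = [] # concat (map (kids \<sigma>) qs)" using q unfolding queue_def by simp
  show ?case
  proof (cases "x = []")
    case True
    thus ?thesis by (subst qs) simp
  next
    case False
    have "length (parent F x) < length x" "parent F x \<in> F"
      using locus_parent(1)[OF less.prems(1) False] parent(1)[OF _ False, of F] by auto
    hence "parent F x \<in> set qs" using less by simp
    thus ?thesis using kids_I[OF less.prems(1) False less.prems(2)] by (subst qs) auto
  qed
qed

lemma queue_child:
  assumes q: "queue qs (length qs)" and i: "i < length qs" "k < length qs"
      and y: "qs ! k \<in> set (kids \<sigma> (qs ! i))"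
  shows "i < k"
proof -
  have F: "qs ! i \<in> F" using q i unfolding queue_def by auto
  have "k \<noteq> 0"
  proof
    assume "k = 0"
    moreover have "qs ! 0 = []" using q unfolding queue_def by (metis nth_Cons_0)
    ultimately show False using kids(2)[OF F y] by simp
  qed
  then obtain j where j: "j < k" "qs ! k \<in> set (kids \<sigma> (qs ! j))" using q i unfolding queue_def by blast
  have "qs ! j \<in> F" using q i j unfolding queue_def by auto
  hence "qs ! j = qs ! i" using kids(3)[OF _ j(2)] kids(3)[OF F y] by simp
  hence "j = i" using q i j unfolding queue_def by (simp add: nth_eq_iff_index_eq)
  thus ?thesis using j by simp
qed

definition bfs_time :: nat where
  "bfs_time = tmC bfs_init + tmE (Les (Var vh) (Var vt)) + 2 + tmC (bfs_visit \<sigma>)"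

lemma wp_bfs:
  assumes m: "tables_ok m F" and r: "r vn = n" "r vd = D" "r vfr = fr" "r vroot = ad []"
    and Q: "\<And>r' qs t'. queue qs (length qs) \<Longrightarrow> r' vn = n \<Longrightarrow> r' vd = D \<Longrightarrow> r' vfr = fr \<Longrightarrow> r' vroot = ad [] \<Longrightarrow>
      r' vt = fr + length qs \<Longrightarrow> t' \<le> t + bfs_time * (cnt + 1) \<Longrightarrow> Q (r', with_queue m qs) t'"
  shows "wp bnd (bfs \<sigma>) Q (r, m) t"
proof -
  let ?K = "tmE (Les (Var vh) (Var vt)) + 2 + tmC (bfs_visit \<sigma>)"
  let ?R = "\<lambda>r. r vn = n \<and> r vd = D \<and> r vfr = fr \<and> r vroot = ad []"
  let ?I = "\<lambda>s t1. \<exists>h qs. queue qs h \<and> fst s vh = fr + h \<and> fst s vt = fr + length qs \<and> ?R (fst s) \<and>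
    snd s = with_queue m qs \<and> t1 \<le> t + tmC bfs_init + ?K * h"
  have e: "ex bfs_init (r, m) = (r(vh := fr, vt := Suc fr), with_queue m [[]])"
    using r with_queue_snoc[of m "[]" "[]"] by (simp add: bfs_init_def)
  show ?thesis
    unfolding bfs_def
  proof (rule wp_Sq, rule wp_loop_free)
    show "loop_free bfs_init" "okC bnd bfs_init (r, m)" by (simp_all add: bfs_init_def)
    show "wp bnd (While (Les (Var vh) (Var vt)) (bfs_visit \<sigma>)) Q (ex bfs_init (r, m)) (t + tmC bfs_init)"
      unfolding e
    proof (rule wp_While[where I = ?I and T = "t + tmC bfs_init + ?K * cnt"])
      show "?I (r(vh := fr, vt := Suc fr), with_queue m [[]]) (t + tmC bfs_init)"
        using queue_0 r by (intro exI[of _ 0] exI[of _ "[[]]"]) simp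
    next
      fix s t1 assume "?I s t1"
      then obtain h qs where h: "queue qs h" "fst s vh = fr + h" "fst s vt = fr + length qs" "?R (fst s)"
        "snd s = with_queue m qs" "t1 \<le> t + tmC bfs_init + ?K * h" by blast
      have "h \<le> length qs" using h(1) unfolding queue_def by blast
      hence "h \<le> cnt" using queue_length[OF h(1)] by simp
      hence "?K * h \<le> ?K * cnt" by (rule mult_le_mono2)
      thus t1: "t1 \<le> t + tmC bfs_init + ?K * cnt" using h(6) by linarith
      show "okE bnd (Les (Var vh) (Var vt)) s" by simp
      { assume "aval (Les (Var vh) (Var vt)) s \<noteq> 0"
        hence lt: "h < length qs" using h by (simp split: if_splits)
        let ?x = "qs ! h"
        have x: "?x \<in> F" using h(1) lt unfolding queue_def by auto
        let ?r = "(fst s)(vp := ad ?x)"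
        have "\<exists>r'. ex (seqs (map (push \<sigma>) [0..<\<sigma>])) (?r, with_queue m qs) =
            (r', with_queue m (qs @ kids \<sigma> ?x)) \<and>
            r' vt = fr + length qs + length (kids \<sigma> ?x) \<and> (\<forall>v. v \<noteq> vt \<and> v \<noteq> vq \<longrightarrow> r' v = ?r v)"
          using h by (intro ex_push m x) auto
        then obtain r' where r': "ex (seqs (map (push \<sigma>) [0..<\<sigma>])) (?r, with_queue m qs) =
            (r', with_queue m (qs @ kids \<sigma> ?x))"
          "r' vt = fr + length qs + length (kids \<sigma> ?x)" "\<forall>v. v \<noteq> vt \<and> v \<noteq> vq \<longrightarrow> r' v = ?r v" by blast
        have "with_queue m qs (fr + h) = ad ?x" using lt by (simp add: with_queue_def)
        hence e1: "ex (bfs_visit \<sigma>) s = (r'(vh := fr + Suc h), with_queue m (qs @ kids \<sigma> ?x))"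
          using r' h by (simp add: bfs_visit_def)
        have "t1 + tmE (Les (Var vh) (Var vt)) + 2 + tmC (bfs_visit \<sigma>) \<le> t + tmC bfs_init + ?K * Suc h"
          using h(6) by simp
        hence "?I (ex (bfs_visit \<sigma>) s) (t1 + tmE (Les (Var vh) (Var vt)) + 2 + tmC (bfs_visit \<sigma>))"
          unfolding e1 using queue_Suc[OF h(1) lt] r' h
          by (intro exI[of _ "Suc h"] exI[of _ "qs @ kids \<sigma> ?x"]) (simp del: tmC.simps tmE.simps)
        moreover have "loop_free (bfs_visit \<sigma>)" by (auto simp: bfs_visit_def push_def)
        moreover have "okC bnd (bfs_visit \<sigma>) s" using okC_push by (simp add: bfs_visit_def)
        ultimately show "wp bnd (bfs_visit \<sigma>) ?I s (t1 + tmE (Les (Var vh) (Var vt)) + 2)"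
          by (intro wp_loop_free) }
      { assume "aval (Les (Var vh) (Var vt)) s = 0"
        hence "h = length qs" using h \<open>h \<le> length qs\<close> by (simp split: if_splits)
        moreover have "t1 + tmE (Les (Var vh) (Var vt)) + 2 \<le> t + bfs_time * (cnt + 1)"
          using t1 by (simp add: bfs_time_def algebra_simps)
        ultimately show "Q s (t1 + tmE (Les (Var vh) (Var vt)) + 2)"
          using Q[of qs "fst s"] h by (metis prod.collapse) }
    qed
  qed
qed

section \<open>Filling the tables from the leaves to the root\<close>

text \<open>The sentinel plays the missing children.\<close>

definition child_adr :: "nat list \<Rightarrow> nat \<Rightarrow> nat" where
  "child_adr x c = (if x @ [c] \<in> factors W then ad (locus F (x @ [c])) else D)"

abbreviation "tb m x t \<equiv> at m (ad x) (Tab t)"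

lemma child_adr [simp]: "is_record (child_adr x c)"
  using locus(1)[of "x @ [c]" W] by (auto simp: child_adr_def)

lemma child_adr_neq: "x \<in> F \<Longrightarrow> child_adr x c \<noteq> ad x"
  using parent_locus[of x W c] by (auto simp: child_adr_def ad_inj)

lemma ex_load_children:
  assumes m: "tables_ok m F" and x: "x \<in> F" and r: "r vp = ad x" "r vd = D"
  shows "\<exists>r'. ex (load_children \<sigma>) (r, m) = (r', m) \<and> (\<forall>c<\<sigma>. r' (kid c) = child_adr x c) \<and>
      (\<forall>v<20. r' v = r v)"
proof -
  let ?c = "\<lambda>c. kid c ::= Ld (Fd \<sigma> (Var vp) (Child c));; Cnd (Var (kid c)) Skip (kid c ::= Var vd)"
  have "\<exists>r'. ex (seqs (map ?c [0..<k])) (r, m) = (r', m) \<and> (\<forall>c<k. r' (kid c) = child_adr x c) \<and>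
      (\<forall>v<20. r' v = r v)"
    if "k \<le> \<sigma>" for k
    using that
  proof (induction k)
    case (Suc k)
    then obtain r1 where r1: "ex (seqs (map ?c [0..<k])) (r, m) = (r1, m)" "\<forall>c<k. r1 (kid c) = child_adr x c"
      "\<forall>v<20. r1 v = r v" by auto
    have k: "k < \<sigma>" using Suc.prems by simp
    have "ex (seqs (map ?c [0..<Suc k])) (r, m) = ex (?c k) (r1, m)" using r1(1) by (simp add: ex_seqs)
    also have "\<dots> = (r1(kid k := child_adr x k), m)"
      using tables_ok_child[OF m x k] r1(3) r locus(1)[of "x @ [k]" W] by (simp add: child_adr_def)
    finally show ?case using r1 by (intro exI[of _ "r1(kid k := child_adr x k)"]) (auto simp: less_Suc_eq)
  qed simp
  from this[of \<sigma>] show ?thesis unfolding load_children_def by simp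
qed

lemma okC_load_children: "okC U (load_children \<sigma>) st"
proof -
  have "okC U (seqs (map (\<lambda>c. kid c ::= Ld (Fd \<sigma> (Var vp) (Child c));;
    Cnd (Var (kid c)) Skip (kid c ::= Var vd)) cs)) st" for cs by (induction cs arbitrary: st) auto
  thus ?thesis unfolding load_children_def .
qed

lemma cost_child_adr:
  assumes m: "tables_ok m F" and x: "x \<in> F" and C: "C \<in> set (candidates \<sigma>)"
  shows "cost \<sigma> (\<lambda>c t. at m (child_adr x c) (Tab t)) C = cost \<sigma> (child_table (tb m) x) C"
  unfolding cost_def
proof (intro arg_cong2[of _ _ _ _ "(+)"] sum.cong refl)
  fix c assume "c \<in> {..<\<sigma>}"
  hence "snd C ! c \<in> set (all_ends \<sigma>)" using C nth_mem[of c "snd C"] unfolding set_candidates by auto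
  thus "at m (child_adr x c) (Tab (snd C ! c)) = child_table (tb m) x c (snd C ! c)"
    using m unfolding tables_ok_def by (simp add: child_adr_def child_table_def)
qed

text \<open>The first half is what \<open>table_lower\<close> asks of a table; the second lets the
  top-down pass find a candidate for each entry below \<open>infty\<close>.\<close>

definition good :: "(nat \<Rightarrow> nat) \<Rightarrow> nat list \<Rightarrow> bool" where
  "good m x \<longleftrightarrow> (\<forall>C\<in>set (candidates \<sigma>). tb m x (join_list (arrange \<sigma> C)) \<le>
      cost \<sigma> (\<lambda>c t. at m (child_adr x c) (Tab t)) C) \<and>
    (\<forall>t\<in>set (all_ends \<sigma>). tb m x t \<le> infty \<and> (tb m x t < infty \<longrightarrow>
      (\<exists>C\<in>set (candidates \<sigma>). join_list (arrange \<sigma> C) = t \<and> cost \<sigma> (\<lambda>c t. at m (child_adr x c) (Tab t)) C =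
          tb m x t)))"

lemma cost_cong: "(\<And>c. c < \<sigma> \<Longrightarrow> f c (snd C ! c) = g c (snd C ! c)) \<Longrightarrow> cost \<sigma> f C = cost \<sigma> g C"
  by (simp add: cost_def)

lemma cand_nth: "C \<in> set (candidates \<sigma>) \<Longrightarrow> c < \<sigma> \<Longrightarrow> snd C ! c \<in> set (all_ends \<sigma>)"
  using nth_mem[of c "snd C"] unfolding set_candidates by auto

lemma good_cong:
  assumes "good m x" "\<And>t. t \<in> set (all_ends \<sigma>) \<Longrightarrow> tb m' x t = tb m x t"
    "\<And>c t. c < \<sigma> \<Longrightarrow> t \<in> set (all_ends \<sigma>) \<Longrightarrow> at m' (child_adr x c) (Tab t) = at m (child_adr x c) (Tab t)"
  shows "good m' x"
proof -
  have "cost \<sigma> (\<lambda>c t. at m' (child_adr x c) (Tab t)) C = cost \<sigma> (\<lambda>c t. at m (child_adr x c) (Tab t)) C"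
    if "C \<in> set (candidates \<sigma>)" for C
    using assms(3) cand_nth[OF that] by (intro cost_cong) simp
  thus ?thesis using assms(1,2) join_list_arrange unfolding good_def by simp
qed

definition dp_time :: nat where
  "dp_time = tmC (vh ::= Var vt) + tmE (Les (Var vfr) (Var vh)) + 2 + tmC (dp_visit \<sigma>)"

lemma sigma_bnd: "\<sigma> * infty \<le> bnd"
proof -
  have "\<sigma> * (n + 1) \<le> 8 * S * (n + 1)" by (intro mult_le_mono1) (simp add: rec_size_def)
  thus ?thesis by (simp add: infty_def bnd_def)
qed

lemma okC_relax:
  assumes "\<And>C m'. C \<in> set Cs \<Longrightarrow> (\<forall>b. b \<notin> (\<lambda>t. cell \<sigma> p (Tab t)) ` set (all_ends \<sigma>) \<longrightarrow> m' b = m b) \<Longrightarrow>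
      okE U (sumE \<sigma> C) (r, m')"
    and "set Cs \<subseteq> set (candidates \<sigma>)" "r vp = p"
  shows "okC U (seqs (map (relax \<sigma>) Cs)) (r, m)"
  using assms(1,2)
proof (induction Cs arbitrary: m)
  case (Cons C Cs)
  have ok: "okE U (sumE \<sigma> C) (r, m)" by (rule Cons.prems(1)) auto
  let ?a = "cell \<sigma> p (Tab (join_list (arrange \<sigma> C)))"
  let ?v = "aval (sumE \<sigma> C) (r, m)"
  define m1 where "m1 = (if ?v < m ?a then m(?a := ?v) else m)"
  have m1: "ex (relax \<sigma> C) (r, m) = (r, m1)"
    "\<forall>b. b \<notin> (\<lambda>t. cell \<sigma> p (Tab t)) ` set (all_ends \<sigma>) \<longrightarrow> m1 b = m b"
    using join_list_arrange[of C \<sigma>] Cons.prems(2) assms(3) by (auto simp: relax_def m1_def)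
  have "okC U (relax \<sigma> C) (r, m)" using ok by (simp add: relax_def)
  moreover have "okC U (seqs (map (relax \<sigma>) Cs)) (r, m1)"
    using Cons.prems m1(2) by (intro Cons.IH) auto
  ultimately show ?case using m1(1) by simp
qed simp

text \<open>Entries of the queue from \<open>k\<close> on are finished. Their \<open>Cho\<close> is
  0, the code of \<open>None\<close>, so that every choice is legal before the top-down pass sets
  it.\<close>

definition dp_inv :: "nat list list \<Rightarrow> (nat \<Rightarrow> nat) \<Rightarrow> nat \<Rightarrow> bool" where
  "dp_inv qs m k \<longleftrightarrow> tables_ok m F \<and> (\<forall>i<length qs. m (fr + i) = ad (qs ! i)) \<and>
    (\<forall>i<length qs. k \<le> i \<longrightarrow> good m (qs ! i) \<and> at m (ad (qs ! i)) Cho = 0)"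

text \<open>A child is absent, a leaf, or a later entry of the queue and then finished. The bound
  keeps sums of \<open>\<sigma>\<close> entries below \<open>bnd\<close>, so that the additions are
  legal.\<close>

lemma kid_le:
  assumes q: "queue qs (length qs)" and k: "k < length qs" and d: "dp_inv qs m (Suc k)"
      and t: "t \<in> set (all_ends \<sigma>)"
  shows "at m (child_adr (qs ! k) c) (Tab t) \<le> infty"
proof (cases "qs ! k @ [c] \<in> factors W")
  case False
  thus ?thesis using d t unfolding dp_inv_def tables_ok_def by (simp add: child_adr_def)
next
  case True
  let ?y = "locus F (qs ! k @ [c])"
  have x: "qs ! k \<in> F" using q k unfolding queue_def by auto
  note y = parent_locus[OF x True]
  show ?thesis
  proof (cases "length ?y < n")
    case False
    thus ?thesis using d t True y(1) unfolding dp_inv_def tables_ok_def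
      by (simp add: child_adr_def leaf_table_def)
  next
    case short: True
    then obtain i where i: "i < length qs" "qs ! i = ?y" using queue_all[OF q y(1)]
      by (auto simp: in_set_conv_nth)
    have "?y \<in> set (kids \<sigma> (qs ! k))" using kids_I[OF y(1,2) short] y(3) by simp
    hence "k < i" using queue_child[OF q k i(1)] i(2) by simp
    hence "good m ?y" using d i unfolding dp_inv_def by (metis Suc_leI)
    thus ?thesis using True t unfolding good_def by (simp add: child_adr_def)
  qed
qed

lemma wp_dp_visit:
  assumes q: "queue qs (length qs)" and k: "k < length qs" and d: "dp_inv qs m (Suc k)"
    and r: "r vn = n" "r vd = D" "r vh = fr + Suc k"
    and Q: "\<And>r' m'. dp_inv qs m' k \<Longrightarrow> r' vh = fr + k \<Longrightarrow> (\<forall>v<20. v \<noteq> vh \<and> v \<noteq> vp \<longrightarrow> r' v = r v) \<Longrightarrow>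
      Q (r', m') (t + tmC (dp_visit \<sigma>))"
  shows "wp bnd (dp_visit \<sigma>) Q (r, m) t"
proof -
  let ?x = "qs ! k"
  have x: "?x \<in> F" "length ?x < n" using q k unfolding queue_def by auto
  have mk: "m (fr + k) = ad ?x" using d k unfolding dp_inv_def by blast
  let ?r1 = "r(vh := fr + k, vp := ad ?x)"
  let ?m1 = "m(cell \<sigma> (ad ?x) Cho := 0)"
  have m1o: "?m1 b = m b" if "b \<noteq> cell \<sigma> (ad ?x) Cho" for b using that by simp
  have tok1: "tables_ok ?m1 F"
  proof (rule tables_ok_cong)
    show "tables_ok m F" using d unfolding dp_inv_def by blast
    show "?m1 b = m b" if "fixed b" for b using that not_fixed(3)[OF ad(1)[OF x(1)]] by auto
  qed (use x in \<open>simp_all add: cell_eq\<close>)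
  from ex_load_children[OF tok1 x(1), of ?r1] r obtain r2
      where r2: "ex (load_children \<sigma>) (?r1, ?m1) = (r2, ?m1)"
    "\<forall>c<\<sigma>. r2 (kid c) = child_adr ?x c" "\<forall>v<20. r2 v = ?r1 v" by auto
  let ?A = "(\<lambda>t. cell \<sigma> (ad ?x) (Tab t)) ` set (all_ends \<sigma>)"
  have p2: "r2 vp = ad ?x" "r2 vn = n" using r2(3) r by auto
  have "\<exists>m2. ex (clear_table \<sigma> vp) (r2, ?m1) = (r2, m2) \<and>
    (\<forall>t\<in>set (all_ends \<sigma>). at m2 (ad ?x) (Tab t) = Suc n) \<and> (\<forall>b. b \<notin> ?A \<longrightarrow> m2 b = ?m1 b)"
    using ex_clear_table[of r2 vp "ad ?x" \<sigma> ?m1] p2 by simp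
  then obtain m2 where m2: "ex (clear_table \<sigma> vp) (r2, ?m1) = (r2, m2)"
    "\<forall>t\<in>set (all_ends \<sigma>). at m2 (ad ?x) (Tab t) = Suc n" "\<forall>b. b \<notin> ?A \<longrightarrow> m2 b = ?m1 b"
    by blast
  let ?g = "\<lambda>C. cost \<sigma> (\<lambda>c t. at m (child_adr ?x c) (Tab t)) C"
  have kt: "m' (cell \<sigma> (child_adr ?x c) (Tab t)) = at m (child_adr ?x c) (Tab t)"
    if "\<forall>b. b \<notin> ?A \<longrightarrow> m' b = m2 b" "t \<in> set (all_ends \<sigma>)" for m' c t
  proof -
    have "cell \<sigma> (child_adr ?x c) (Tab t) \<notin> ?A" using that(2) child_adr_neq[OF x(1)] x(1)
      by (auto simp: cell_eq)
    thus ?thesis using that m2(3) x(1) by (simp add: cell_eq)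
  qed
  have g: "aval (sumE \<sigma> C) (r2, m') = ?g C" if "C \<in> set (candidates \<sigma>)" "\<forall>b. b \<notin> ?A \<longrightarrow> m' b = m2 b" for C m'
    unfolding aval_sumE using r2(2) kt[OF that(2)] cand_nth[OF that(1)] by (intro cost_cong) simp
  from ex_relax[of "candidates \<sigma>" \<sigma> "ad ?x" m2 r2 ?g, OF g order_refl p2(1)]
  obtain m3 where m3: "ex (seqs (map (relax \<sigma>) (candidates \<sigma>))) (r2, m2) = (r2, m3)"
      "\<forall>b. b \<notin> ?A \<longrightarrow> m3 b = m2 b"
    "\<forall>t\<in>set (all_ends \<sigma>). tb m3 ?x t \<le> tb m2 ?x t \<and>
      (tb m3 ?x t = tb m2 ?x t \<or> (\<exists>C\<in>set (candidates \<sigma>). join_list (arrange \<sigma> C) = t \<and> ?g C = tb m3 ?x t))"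
    "\<forall>C\<in>set (candidates \<sigma>). tb m3 ?x (join_list (arrange \<sigma> C)) \<le> ?g C"
    by blast
  have e: "ex (dp_visit \<sigma>) (r, m) = (r2, m3)"
    using r mk r2(1) m2(1) m3(1) by (simp add: dp_visit_def)
  have okr: "okC bnd (seqs (map (relax \<sigma>) (candidates \<sigma>))) (r2, m2)"
  proof (rule okC_relax[where p = "ad ?x"])
    fix C m' assume C: "C \<in> set (candidates \<sigma>)" "\<forall>b. b \<notin> ?A \<longrightarrow> m' b = m2 b"
    show "okE bnd (sumE \<sigma> C) (r2, m')"
    proof (rule okE_sumE[OF _ sigma_bnd])
      show "snd (r2, m') (cell \<sigma> (fst (r2, m') (kid c)) (Tab (snd C ! c))) \<le> infty" if "c < \<sigma>" for c
        using r2(2) that kt[OF C(2) cand_nth[OF C(1) that]] kid_le[OF q k d cand_nth[OF C(1) that]] by simp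
    qed
  qed (use p2 in simp_all)
  have ok: "okC bnd (dp_visit \<sigma>) (r, m)"
    using r mk r2(1) m2(1) okr okC_load_children okC_clear_table by (simp add: dp_visit_def)
  have out: "m3 b = m b" if "b \<notin> ?A" "b \<noteq> cell \<sigma> (ad ?x) Cho" for b
    using that m2(3) m3(2) by simp
  have out_at: "at m3 p f = at m p f"
      if "is_record p" "valid_field \<sigma> f" "f \<noteq> Cho" "p \<noteq> ad ?x \<or> (\<forall>t. f \<noteq> Tab t)" for p f
    using that x(1) by (intro out) (auto simp: cell_eq)
  have outC: "at m3 p Cho = (if p = ad ?x then 0 else at m p Cho)" if "is_record p" for p
  proof -
    have "cell \<sigma> p Cho \<notin> ?A" using that x(1) by (auto simp: cell_eq)
    thus ?thesis using that x(1) m2(3) m3(2) by (simp add: cell_eq)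
  qed
  have "dp_inv qs m3 k"
    unfolding dp_inv_def
  proof (intro conjI allI impI, goal_cases)
    case 1
    show ?case
    proof (rule tables_ok_cong)
      show "tables_ok m F" using d unfolding dp_inv_def by blast
      show "m3 b = m b" if "fixed b" for b
        using that not_fixed(2,3)[OF ad(1)[OF x(1)]] by (intro out) auto
    next
      fix y t assume "y \<in> F" "n \<le> length y" "t \<in> set (all_ends \<sigma>)"
      thus "at m3 (ad y) (Tab t) = at m (ad y) (Tab t)" using x by (intro out_at) (auto simp: ad_inj)
    qed (use x in \<open>simp_all add: out_at\<close>)
  next
    case (2 i)
    have "m3 (fr + i) = m (fr + i)"
      using fr_neq[OF ad(1)[OF x(1)]] by (intro out) (auto, (metis le_add1 valid_field.simps(3,7))+)
    thus ?case using d 2 unfolding dp_inv_def by simp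
  next
    case (3 i)
    show ?case
    proof (cases "i = k")
      case True
      have same: "?g C = cost \<sigma> (\<lambda>c t. at m3 (child_adr ?x c) (Tab t)) C" if "C \<in> set (candidates \<sigma>)" for C
        using cand_nth[OF that] child_adr_neq[OF x(1)] by (intro cost_cong) (simp add: out_at)
      show ?thesis unfolding True good_def using m2(2) m3(3,4) same by (auto simp: infty_def)
    next
      case False
      hence "Suc k \<le> i" using 3 by simp
      hence gd: "good m (qs ! i)" using d 3 unfolding dp_inv_def by blast
      have xi: "qs ! i \<in> F" using q 3 unfolding queue_def by auto
      have ne: "qs ! i \<noteq> ?x" using q 3 k False unfolding queue_def by (simp add: nth_eq_iff_index_eq)
      \<comment> \<open>Children of an entry behind \<open>k\<close> stand still further behind, so
        \<open>?x\<close> is none of them and the finished tables remain correct.\<close>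
      have "child_adr (qs ! i) c \<noteq> ad ?x" for c
      proof
        assume *: "child_adr (qs ! i) c = ad ?x"
        hence c: "qs ! i @ [c] \<in> factors W" using x(1) by (auto simp: child_adr_def split: if_splits)
        note y = parent_locus[OF xi c]
        have "locus F (qs ! i @ [c]) = ?x" using * c y(1) x(1) by (simp add: child_adr_def ad_inj)
        hence "?x \<in> set (kids \<sigma> (qs ! i))" using kids_I[OF x(1) _ x(2)] y by auto
        hence "i < k" using queue_child[OF q _ k, of i] 3 by simp
        thus False using \<open>Suc k \<le> i\<close> by simp
      qed
      thus "good m3 (qs ! i)"
        using xi ne x(1) by (intro good_cong[OF gd] out_at) (auto simp: ad_inj)
    qed
  next
    case (4 i)
    have xi: "qs ! i \<in> F" using q 4 unfolding queue_def by auto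
    show ?case
    proof (cases "i = k")
      case False
      hence "at m (ad (qs ! i)) Cho = 0" using d 4 unfolding dp_inv_def by simp
      thus ?thesis using xi outC by simp
    qed (use x outC in simp)
  qed
  moreover have "loop_free (dp_visit \<sigma>)"
    by (auto simp: dp_visit_def load_children_def clear_table_def relax_def)
  ultimately show ?thesis using Q[of m3 r2] r2(3) e by (intro wp_loop_free ok) auto
qed

lemma wp_dp:
  assumes q: "queue qs (length qs)" and m: "tables_ok m F"
      and r: "r vn = n" "r vd = D" "r vfr = fr" "r vroot = ad []"
    "r vt = fr + length qs"
    and Q: "\<And>r' m' t'. dp_inv qs m' 0 \<Longrightarrow> r' vn = n \<Longrightarrow> r' vd = D \<Longrightarrow> r' vfr = fr \<Longrightarrow> r' vroot = ad [] \<Longrightarrow>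
      r' vt = fr + length qs \<Longrightarrow> t' \<le> t + dp_time * (cnt + 1) \<Longrightarrow> Q (r', m') t'"
  shows "wp bnd (dp \<sigma>) Q (r, with_queue m qs) t"
proof -
  let ?K = "tmE (Les (Var vfr) (Var vh)) + 2 + tmC (dp_visit \<sigma>)"
  let ?R = "\<lambda>r. r vn = n \<and> r vd = D \<and> r vfr = fr \<and> r vroot = ad [] \<and> r vt = fr + length qs"
  let ?I = "\<lambda>s t1. \<exists>k\<le>length qs. fst s vh = fr + k \<and> ?R (fst s) \<and> dp_inv qs (snd s) k \<and>
    t1 \<le> t + tmC (vh ::= Var vt) + ?K * (length qs - k)"
  have d0: "dp_inv qs (with_queue m qs) (length qs)" using tables_ok_with_queue[OF m]
    by (simp add: dp_inv_def with_queue_def)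
  have e: "ex (vh ::= Var vt) (r, with_queue m qs) = (r(vh := fr + length qs), with_queue m qs)" using r
    by simp
  show ?thesis
    unfolding dp_def
  proof (rule wp_Sq, rule wp_loop_free)
    show "wp bnd (While (Les (Var vfr) (Var vh)) (dp_visit \<sigma>)) Q (ex (vh ::= Var vt) (r, with_queue m qs))
        (t + tmC (vh ::= Var vt))"
      unfolding e
    proof (rule wp_While[where I = ?I and T = "t + tmC (vh ::= Var vt) + ?K * cnt"])
      show "?I (r(vh := fr + length qs), with_queue m qs) (t + tmC (vh ::= Var vt))"
        using d0 r by (intro exI[of _ "length qs"]) simp
    next
      fix s t1 assume "?I s t1"
      then obtain k where k: "k \<le> length qs" "fst s vh = fr + k" "?R (fst s)" "dp_inv qs (snd s) k"
        "t1 \<le> t + tmC (vh ::= Var vt) + ?K * (length qs - k)" by blast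
      have "length qs - k \<le> cnt" using queue_length[OF q] by simp
      hence "?K * (length qs - k) \<le> ?K * cnt" by (rule mult_le_mono2)
      thus t1: "t1 \<le> t + tmC (vh ::= Var vt) + ?K * cnt" using k(5) by linarith
      show "okE bnd (Les (Var vfr) (Var vh)) s" by simp
      { assume "aval (Les (Var vfr) (Var vh)) s \<noteq> 0"
        then obtain j where j: "k = Suc j" using k by (cases k) (auto split: if_splits)
        have jl: "j < length qs" using k(1) j by simp
        have "wp bnd (dp_visit \<sigma>) ?I (fst s, snd s) (t1 + tmE (Les (Var vfr) (Var vh)) + 2)"
        proof (rule wp_dp_visit[OF q jl])
          fix r' m' assume a: "dp_inv qs m' j" "r' vh = fr + j" "\<forall>v<20. v \<noteq> vh \<and> v \<noteq> vp \<longrightarrow> r' v = fst s v"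
          have "length qs - j = Suc (length qs - k)" using jl j by simp
          hence "?K * (length qs - j) = ?K + ?K * (length qs - k)" by simp
          hence "t1 + tmE (Les (Var vfr) (Var vh)) + 2 + tmC (dp_visit \<sigma>) \<le> t + tmC (vh ::= Var vt) +
              ?K * (length qs - j)"
            using k(5) by linarith
          moreover have "?R r'" using a(3) k(3) by simp
          ultimately show "?I (r', m') (t1 + tmE (Les (Var vfr) (Var vh)) + 2 + tmC (dp_visit \<sigma>))"
            using a(1,2) jl by (intro exI[of _ j]) (simp del: tmC.simps tmE.simps)
        qed (use k j in auto)
        thus "wp bnd (dp_visit \<sigma>) ?I s (t1 + tmE (Les (Var vfr) (Var vh)) + 2)" by simp }
      { assume "aval (Les (Var vfr) (Var vh)) s = 0"
        hence "k = 0" using k by (simp split: if_splits)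
        moreover have "t1 + tmE (Les (Var vfr) (Var vh)) + 2 \<le> t + dp_time * (cnt + 1)"
          using t1 by (simp add: dp_time_def algebra_simps)
        ultimately show "Q s (t1 + tmE (Les (Var vfr) (Var vh)) + 2)"
          using Q[of "snd s" "fst s"] k by simp }
    qed
  qed simp_all
qed

end

subsection \<open>Emitting the orderings\<close>

abbreviation (input) "vx \<equiv> 14 :: nat"
abbreviation (input) "vo \<equiv> 15 :: nat"
abbreviation (input) "vdone \<equiv> 16 :: nat"
abbreviation (input) "vk \<equiv> 17 :: nat"

definition select_root :: "nat \<Rightarrow> ends \<Rightarrow> com" where
  "select_root \<sigma> t = Cnd (Les (Ld (Fd \<sigma> (Var vroot) (Tab t))) (Var vx))
    (vx ::= Ld (Fd \<sigma> (Var vroot) (Tab t));; Sto (Fd \<sigma> (Var vroot) Cho) (Lit (encode \<sigma> t))) Skip"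

text \<open>The cell at \<open>vt\<close> is kept free for the length of the output. The search for
  a minimal root entry starts with \<open>None\<close>, whose code is 0.\<close>

definition emit_init :: "nat \<Rightarrow> com" where
  "emit_init \<sigma> = vx ::= Ld (Fd \<sigma> (Var vroot) (Tab None));; Sto (Fd \<sigma> (Var vroot) Cho) (Lit 0);;
    seqs (map (select_root \<sigma>) (all_ends \<sigma>));; vh ::= Var vfr;; vo ::= Inc (Var vt) 1;; vk ::= Lit 0"

text \<open>Letters of the text start at address 1, so \<open>Pos\<close> minus one is a position in
  \<open>s @ s\<close>; in the second copy it is reduced by \<open>n\<close>, since a record wants a
  position in \<open>s\<close>.\<close>

definition emit_head :: "nat \<Rightarrow> com" where
  "emit_head \<sigma> = vdone ::= Lit 1;;
    Cnd (Les (Var vn) (Ld (Fd \<sigma> (Var vp) Pos)))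
      (Sto (Var vo) (Mi (Mi (Ld (Fd \<sigma> (Var vp) Pos)) (Var vn)) (Lit 1)))
      (Sto (Var vo) (Mi (Ld (Fd \<sigma> (Var vp) Pos)) (Lit 1)));;
    Sto (Inc (Var vo) 1) (Mi (Ld (Fd \<sigma> (Var vp) Len)) (Lit 1))"

definition emit_ranks :: "nat \<Rightarrow> nat list \<times> ends list \<Rightarrow> com" where
  "emit_ranks \<sigma> C = seqs (map (\<lambda>c. Sto (Inc (Var vo) (2 + c)) (Lit (fst C ! c))) [0..<\<sigma>])"

definition emit_advance :: "nat \<Rightarrow> com" where
  "emit_advance \<sigma> = vo ::= Inc (Var vo) (\<sigma> + 2);; vk ::= Inc (Var vk) (\<sigma> + 2)"

text \<open>For an absent child the store hits \<open>Cho\<close> of the sentinel, which is not read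
  as the choice of any node.\<close>

definition emit_choices :: "nat \<Rightarrow> nat list \<times> ends list \<Rightarrow> com" where
  "emit_choices \<sigma> C = seqs (map (\<lambda>c. Sto (Fd \<sigma> (Var (kid c)) Cho) (Lit (encode \<sigma> (snd C ! c)))) [0..<\<sigma>])"

definition emit_record :: "nat \<Rightarrow> nat list \<times> ends list \<Rightarrow> com" where
  "emit_record \<sigma> C = emit_head \<sigma>;; emit_ranks \<sigma> C;; emit_advance \<sigma>;; emit_choices \<sigma> C"

text \<open>A candidate reaching the entry is found again by recomputing the costs;
  \<open>vdone\<close> lets only the first one emit a record.\<close>

definition select :: "nat \<Rightarrow> nat list \<times> ends list \<Rightarrow> com" where
  "select \<sigma> C = Cnd (Var vdone) Skip
    (Cnd (Equ (Ld (Fd \<sigma> (Var vp) Cho)) (Lit (encode \<sigma> (join_list (arrange \<sigma> C)))))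
      (Cnd (Equ (sumE \<sigma> C) (Ld (Fd \<sigma> (Var vp) (Tab (join_list (arrange \<sigma> C)))))) (emit_record \<sigma> C) Skip)
          Skip)"

definition emit_visit :: "nat \<Rightarrow> com" where
  "emit_visit \<sigma> = vp ::= Ld (Var vh);; load_children \<sigma>;; vdone ::= Lit 0;;
      seqs (map (select \<sigma>) (candidates \<sigma>));;
    vh ::= Inc (Var vh) 1"

text \<open>The free cell behind the queue receives the length of the output. Variable 0 lives in
  register 0, which must hold the address of that cell.\<close>

definition emit_finish :: com where
  "emit_finish = Sto (Var vt) (Var vk);; 0 ::= Var vt"

definition emit :: "nat \<Rightarrow> com" where
  "emit \<sigma> = emit_init \<sigma>;; While (Les (Var vh) (Var vt)) (emit_visit \<sigma>);; emit_finish"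

definition prog :: "nat \<Rightarrow> com" where
  "prog \<sigma> = build \<sigma>;; children \<sigma>;; bfs \<sigma>;; dp \<sigma>;; emit \<sigma>"

lemma emit_record_done: "fst (ex (emit_record \<sigma> C) s) vdone = 1"
proof -
  have st: "fst (ex (seqs (map (\<lambda>c. Sto (a c) (e c)) cs)) s) = fst s" for a e s and cs :: "nat list"
    by (induction cs arbitrary: s) auto
  show ?thesis by (simp add: emit_record_def emit_head_def emit_ranks_def emit_advance_def emit_choices_def
      st)
qed

lemma ex_select_done: "fst s vdone \<noteq> 0 \<Longrightarrow> ex (seqs (map (select \<sigma>) Cs)) s = s"
  by (induction Cs) (auto simp: select_def)

lemma ex_select:
  fixes \<sigma> :: nat and m :: "nat \<Rightarrow> nat"
  assumes "r vdone = 0"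
  defines "match \<equiv> \<lambda>C. m (cell \<sigma> (r vp) Cho) = encode \<sigma> (join_list (arrange \<sigma> C)) \<and>
    aval (sumE \<sigma> C) (r, m) = m (cell \<sigma> (r vp) (Tab (join_list (arrange \<sigma> C))))"
  shows "(\<forall>C\<in>set Cs. \<not> match C) \<and> ex (seqs (map (select \<sigma>) Cs)) (r, m) = (r, m) \<or>
    (\<exists>C\<in>set Cs. match C \<and> ex (seqs (map (select \<sigma>) Cs)) (r, m) = ex (emit_record \<sigma> C) (r, m))"
proof (induction Cs)
  case (Cons C Cs)
  show ?case
  proof (cases "match C")
    case True
    hence "ex (select \<sigma> C) (r, m) = ex (emit_record \<sigma> C) (r, m)" using assms(1)
      by (simp add: select_def match_def)
    hence "ex (seqs (map (select \<sigma>) (C # Cs))) (r, m) = ex (emit_record \<sigma> C) (r, m)"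
      using ex_select_done emit_record_done by simp
    thus ?thesis using True by (metis list.set_intros(1))
  next
    case False
    hence "ex (select \<sigma> C) (r, m) = (r, m)" using assms(1) by (auto simp: select_def match_def)
    thus ?thesis using Cons False by auto
  qed
qed simp

lemma loop_free_emit_visit: "loop_free (emit_visit \<sigma>)"
  by (auto simp: emit_visit_def load_children_def select_def emit_record_def emit_head_def emit_ranks_def
      emit_advance_def emit_choices_def)

definition decode :: "nat \<Rightarrow> nat \<Rightarrow> ends" where
  "decode \<sigma> v = (SOME t. t \<in> set (all_ends \<sigma>) \<and> encode \<sigma> t = v)"

lemma decode_encode: "t \<in> set (all_ends \<sigma>) \<Longrightarrow> decode \<sigma> (encode \<sigma> t) = t"
  unfolding decode_def by (rule some_equality) (auto intro: encode_inj)

context built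
begin

text \<open>An occurrence that starts in the second copy of \<open>s\<close> can be moved back by
  \<open>n\<close> positions.\<close>

definition occ :: "nat list \<Rightarrow> nat" where
  "occ x = (if n < pos x then pos x - n - 1 else pos x - 1)"

lemma occ:
  assumes "x \<in> F" "length x < n"
  shows "occ x < n" "take (length x) (rotate (occ x) s) = x"
proof -
  note p = inv_node(3,4,5)[OF assms(1)]
  show lt: "occ x < n" using p(1,2) n_pos unfolding occ_def by auto
  have "prefix x (drop (occ x) W)"
  proof (cases "n < pos x")
    case False
    thus ?thesis using p(3) by (simp only: occ_def if_False)
  next
    case True
    have "drop (pos x - 1) W = drop (occ x) s" using True by (simp add: occ_def)
    moreover have "prefix (drop (occ x) s) (drop (occ x) W)" using lt by simp
    ultimately show ?thesis using p(3) prefix_order.trans by metis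
  qed
  then obtain v where v: "drop (occ x) W = x @ v" by (elim prefixE)
  have "rotate (occ x) s = take n (drop (occ x) W)" using lt by (simp add: rotate_drop_take)
  hence "take (length x) (rotate (occ x) s) = take (length x) (take n (drop (occ x) W))" by (simp only:)
  also have "\<dots> = take (length x) (drop (occ x) W)" using assms(2)
    by (simp only: take_take min.absorb1 less_imp_le)
  also have "\<dots> = take (length x) (x @ v)" by (simp only: v)
  finally show "take (length x) (rotate (occ x) s) = x" by simp
qed

lemma ex_emit_record:
  assumes m: "tables_ok m F" and x: "x \<in> F" and C: "C \<in> set (candidates \<sigma>)"
    and r: "r vp = ad x" "r vn = n" "fr \<le> r vo" "\<forall>c<\<sigma>. r (kid c) = child_adr x c"
  shows "\<exists>m'. ex (emit_record \<sigma> C) (r, m) = (r(vdone := 1, vo := r vo + (\<sigma> + 2), vk := r vk + (\<sigma> + 2)), m') \<and>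
    (\<forall>i<\<sigma> + 2. m' (r vo + i) = (occ x # length x # fst C) ! i) \<and>
    (\<forall>c<\<sigma>. x @ [c] \<in> factors W \<longrightarrow> at m' (ad (locus F (x @ [c]))) Cho = encode \<sigma> (snd C ! c)) \<and>
    (\<forall>b. b \<notin> {r vo..<r vo + (\<sigma> + 2)} \<longrightarrow> (\<forall>c<\<sigma>. x @ [c] \<in> factors W \<longrightarrow> b \<noteq> cell \<sigma> (ad (locus F (x @ [c]))) Cho) \<longrightarrow>
      b \<noteq> cell \<sigma> D Cho \<longrightarrow> m' b = m b)"
    "okC U (emit_record \<sigma> C) (r, m)"
proof -
  have base: "base m" using m unfolding tables_ok_def by blast
  let ?o = "r vo"
  let ?r1 = "r(vdone := 1)"
  let ?m1 = "m(?o := occ x, ?o + 1 := length x)"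
  have hi: "cell \<sigma> p f \<noteq> b" if "is_record p" "valid_field \<sigma> f" "?o \<le> b" for p f b
    using fr_neq[OF that(1,2), of b] that(3) r(3) by simp
  have e1: "ex (emit_head \<sigma>) (r, m) = (?r1, ?m1)"
    using base_at(1,3)[OF base x] r hi[OF ad(1)[OF x], of Len ?o] by (simp add: emit_head_def occ_def)
  have ok1: "okC U (emit_head \<sigma>) (r, m)"
    using base_at(1,3)[OF base x] r hi[OF ad(1)[OF x], of Len ?o] inv_node(3)[OF x]
      by (simp add: emit_head_def Suc_le_eq)
  have "\<exists>m'. ex (emit_ranks \<sigma> C) (?r1, ?m1) = (?r1, m') \<and> (\<forall>c\<in>set [0..<\<sigma>]. m' (?o + (2 + c)) = fst C ! c) \<and>
      (\<forall>b. b \<notin> (\<lambda>c. ?o + (2 + c)) ` set [0..<\<sigma>] \<longrightarrow> m' b = ?m1 b)"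
    unfolding emit_ranks_def by (rule ex_stores) (simp_all add: distinct_map inj_on_def)
  then obtain m2 where m2: "ex (emit_ranks \<sigma> C) (?r1, ?m1) = (?r1, m2)"
      "\<forall>c\<in>set [0..<\<sigma>]. m2 (?o + (2 + c)) = fst C ! c"
    "\<forall>b. b \<notin> (\<lambda>c. ?o + (2 + c)) ` set [0..<\<sigma>] \<longrightarrow> m2 b = ?m1 b" by blast
  define r3 where "r3 = ?r1(vo := ?o + (\<sigma> + 2), vk := r vk + (\<sigma> + 2))"
  have e3: "ex (emit_advance \<sigma>) (?r1, m2) = (r3, m2)" by (simp add: emit_advance_def r3_def)
  let ?st = "\<lambda>c. Sto (Fd \<sigma> (Var (kid c)) Cho) (Lit (encode \<sigma> (snd C ! c)))"
  have r3: "r3 (kid c) = child_adr x c" if "c < \<sigma>" for c using r(4) that by (simp add: r3_def)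
  have "\<exists>m'. ex (seqs (map ?st [0..<k])) (r3, m2) = (r3, m') \<and>
      (\<forall>c<k. x @ [c] \<in> factors W \<longrightarrow> m' (cell \<sigma> (child_adr x c) Cho) = encode \<sigma> (snd C ! c)) \<and>
      (\<forall>b. (\<forall>c<k. b \<noteq> cell \<sigma> (child_adr x c) Cho) \<longrightarrow> m' b = m2 b)" if "k \<le> \<sigma>" for k
    using that
  proof (induction k)
    case (Suc k)
    from Suc.IH[OF Suc_leD[OF Suc.prems]] obtain m'
        where m': "ex (seqs (map ?st [0..<k])) (r3, m2) = (r3, m')"
      "\<forall>c<k. x @ [c] \<in> factors W \<longrightarrow> m' (cell \<sigma> (child_adr x c) Cho) = encode \<sigma> (snd C ! c)"
      "\<forall>b. (\<forall>c<k. b \<noteq> cell \<sigma> (child_adr x c) Cho) \<longrightarrow> m' b = m2 b" by blast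
    let ?m = "m'(cell \<sigma> (child_adr x k) Cho := encode \<sigma> (snd C ! k))"
    have "ex (seqs (map ?st [0..<Suc k])) (r3, m2) = (r3, ?m)"
      using m'(1) r3[of k] Suc.prems by (simp add: ex_seqs)
    moreover have "?m (cell \<sigma> (child_adr x c) Cho) = encode \<sigma> (snd C ! c)"
        if c: "c < Suc k" "x @ [c] \<in> factors W" for c
    proof (cases "c = k")
      case False
      \<comment> \<open>The edges below a node start with different letters, so different letters
        have different children and no choice is overwritten by a later one.\<close>
      have "child_adr x c \<noteq> child_adr x k"
      proof (cases "x @ [k] \<in> factors W")
        case True
        thus ?thesis using False parent_locus(1,4)[OF x c(2)] parent_locus(1,4)[OF x True] c(2)
          by (auto simp: child_adr_def ad_inj)
      next
        case no: False
        thus ?thesis using parent_locus(1)[OF x c(2)] c(2) by (simp add: child_adr_def)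
      qed
      thus ?thesis using False c m'(2) by (simp add: cell_eq)
    qed simp
    moreover have "?m b = m2 b" if "\<forall>c<Suc k. b \<noteq> cell \<sigma> (child_adr x c) Cho" for b
      using that m'(3) by simp
    ultimately show ?case by blast
  qed simp
  from this[OF order_refl] obtain m4 where m4: "ex (emit_choices \<sigma> C) (r3, m2) = (r3, m4)"
    "\<forall>c<\<sigma>. x @ [c] \<in> factors W \<longrightarrow> m4 (cell \<sigma> (child_adr x c) Cho) = encode \<sigma> (snd C ! c)"
    "\<forall>b. (\<forall>c<\<sigma>. b \<noteq> cell \<sigma> (child_adr x c) Cho) \<longrightarrow> m4 b = m2 b" unfolding emit_choices_def by blast
  have e: "ex (emit_record \<sigma> C) (r, m) = (r3, m4)" using e1 m2(1) e3 m4(1) by (simp add: emit_record_def)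
  have m4hi: "m4 b = m2 b" if "?o \<le> b" for b
  proof -
    have "b \<noteq> cell \<sigma> (child_adr x c) Cho" for c using hi[of "child_adr x c" Cho b] that by auto
    thus ?thesis using m4(3) by blast
  qed
  have locus: "length (fst C) = \<sigma>" using C by (simp add: set_candidates)
  have out: "m4 (?o + i) = (occ x # length x # fst C) ! i" if i: "i < \<sigma> + 2" for i
  proof -
    consider "i = 0" | "i = 1" | c where "i = 2 + c" "c < \<sigma>"
    proof (cases "i < 2")
      case True
      thus thesis using that(1,2) by linarith
    next
      case False
      thus thesis using i by (intro that(3)[of "i - 2"]) simp_all
    qed
    thus ?thesis
    proof cases
      case 1
      have "?o \<notin> (\<lambda>c. ?o + (2 + c)) ` set [0..<\<sigma>]" by auto
      thus ?thesis using 1 m2(3) m4hi by simp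
    next
      case 2
      have "?o + 1 \<notin> (\<lambda>c. ?o + (2 + c)) ` set [0..<\<sigma>]" by auto
      hence "m2 (?o + 1) = length x" using m2(3) by simp
      thus ?thesis using 2 m4hi[of "?o + 1"] by simp
    next
      case 3
      thus ?thesis using m2(2) m4hi[of "?o + (2 + c)"] by simp
    qed
  qed
  have rest: "m4 b = m b" if b: "b \<notin> {?o..<?o + (\<sigma> + 2)}"
    "\<forall>c<\<sigma>. x @ [c] \<in> factors W \<longrightarrow> b \<noteq> cell \<sigma> (ad (locus F (x @ [c]))) Cho" "b \<noteq> cell \<sigma> D Cho" for b
  proof -
    have "m4 b = m2 b" using m4(3) b(2,3) by (simp add: child_adr_def)
    also have "b \<notin> (\<lambda>c. ?o + (2 + c)) ` set [0..<\<sigma>]" using b(1) by auto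
    hence "m2 b = ?m1 b" using m2(3) by blast
    also have "?m1 b = m b" using b(1) by auto
    finally show ?thesis .
  qed
  have "\<exists>m'. ex (emit_record \<sigma> C) (r, m) = (r3, m') \<and>
    (\<forall>i<\<sigma> + 2. m' (r vo + i) = (occ x # length x # fst C) ! i) \<and>
    (\<forall>c<\<sigma>. x @ [c] \<in> factors W \<longrightarrow> at m' (ad (locus F (x @ [c]))) Cho = encode \<sigma> (snd C ! c)) \<and>
    (\<forall>b. b \<notin> {r vo..<r vo + (\<sigma> + 2)} \<longrightarrow> (\<forall>c<\<sigma>. x @ [c] \<in> factors W \<longrightarrow> b \<noteq> cell \<sigma> (ad (locus F (x @ [c]))) Cho) \<longrightarrow>
      b \<noteq> cell \<sigma> D Cho \<longrightarrow> m' b = m b)"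
    using e out rest m4(2) by (intro exI[of _ m4]) (simp add: child_adr_def)
  thus "\<exists>m'. ex (emit_record \<sigma> C) (r, m) = (r(vdone := 1, vo := r vo + (\<sigma> + 2), vk := r vk + (\<sigma> + 2)), m') \<and>
    (\<forall>i<\<sigma> + 2. m' (r vo + i) = (occ x # length x # fst C) ! i) \<and>
    (\<forall>c<\<sigma>. x @ [c] \<in> factors W \<longrightarrow> at m' (ad (locus F (x @ [c]))) Cho = encode \<sigma> (snd C ! c)) \<and>
    (\<forall>b. b \<notin> {r vo..<r vo + (\<sigma> + 2)} \<longrightarrow> (\<forall>c<\<sigma>. x @ [c] \<in> factors W \<longrightarrow> b \<noteq> cell \<sigma> (ad (locus F (x @ [c]))) Cho) \<longrightarrow>
      b \<noteq> cell \<sigma> D Cho \<longrightarrow> m' b = m b)"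
    unfolding r3_def .
  have "okC U (emit_ranks \<sigma> C) (?r1, ?m1)" "okC U (emit_choices \<sigma> C) (r3, m2)"
    unfolding emit_ranks_def emit_choices_def by (rule okC_stores, simp)+
  thus "okC U (emit_record \<sigma> C) (r, m)" using ok1 e1 m2(1) e3
    by (simp add: emit_record_def) (simp add: emit_advance_def)
qed

definition chosen :: "(nat \<Rightarrow> nat) \<Rightarrow> nat list \<Rightarrow> ends" where
  "chosen m x = decode \<sigma> (at m (ad x) Cho)"

text \<open>The tables are those of \<open>m1\<close>, the memory before the top-down pass; the
  choices are read from the present memory \<open>m\<close>.\<close>

definition choice_ok :: "(nat \<Rightarrow> nat) \<Rightarrow> (nat \<Rightarrow> nat) \<Rightarrow> (nat list \<Rightarrow> nat list \<times> ends list) \<Rightarrow> nat list \<Rightarrow> bool"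
    where
  "choice_ok m1 m K x \<longleftrightarrow> K x \<in> set (candidates \<sigma>) \<and> join_list (arrange \<sigma> (K x)) = chosen m x \<and>
    cost \<sigma> (child_table (tb m1) x) (K x) = tb m1 x (chosen m x) \<and>
    (\<forall>c<\<sigma>. x @ [c] \<in> factors W \<longrightarrow> chosen m (locus F (x @ [c])) = snd (K x) ! c)"

definition records_of :: "(nat list \<Rightarrow> nat list \<times> ends list) \<Rightarrow> nat list list \<Rightarrow> nat list" where
  "records_of K es = concat (map (\<lambda>x. occ x # length x # fst (K x)) es)"

text \<open>Below the output, only cells \<open>Cho\<close> differ from \<open>m1\<close>. Among the
  first \<open>k\<close> nodes, those whose chosen entry is below \<open>infty\<close> are in
  \<open>es\<close>, and this is all that \<open>table_attained\<close> asks for.\<close>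

definition emit_inv :: "nat list list \<Rightarrow> (nat \<Rightarrow> nat) \<Rightarrow> (nat \<Rightarrow> nat) \<Rightarrow> nat list list \<Rightarrow>
    (nat list \<Rightarrow> nat list \<times> ends list) \<Rightarrow> nat \<Rightarrow> bool" where
  "emit_inv qs m1 m es K k \<longleftrightarrow>
    (\<forall>b. b < fr + length qs \<and> (\<forall>p. is_record p \<longrightarrow> b \<noteq> cell \<sigma> p Cho) \<longrightarrow> m b = m1 b) \<and>
    (\<forall>i<length qs. \<exists>t\<in>set (all_ends \<sigma>). at m (ad (qs ! i)) Cho = encode \<sigma> t) \<and>
    set es \<subseteq> set (take k qs) \<and> (\<forall>x\<in>set es. choice_ok m1 m K x) \<and>
    (\<forall>i<k. tb m1 (qs ! i) (chosen m (qs ! i)) < infty \<longrightarrow> qs ! i \<in> set es) \<and>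
    (\<forall>i<length (records_of K es). m (fr + length qs + 1 + i) = records_of K es ! i) \<and>
    (\<forall>t\<in>set (all_ends \<sigma>). tb m1 [] (chosen m []) \<le> tb m1 [] t)"

lemma emit_inv_at:
  assumes "emit_inv qs m1 m es K k" "is_record p" "valid_field \<sigma> f" "f \<noteq> Cho"
  shows "at m p f = at m1 p f"
proof -
  have "cell \<sigma> p f < fr + length qs" using is_record_fr(1)[OF assms(2,3)] by simp
  moreover have "cell \<sigma> p f \<noteq> cell \<sigma> p' Cho" if "is_record p'" for p' using that assms(2,3,4)
    by (simp add: cell_eq)
  ultimately show ?thesis using assms(1) unfolding emit_inv_def by blast
qed

lemma fixed_Cho: "fixed b \<Longrightarrow> is_record p \<Longrightarrow> b \<noteq> cell \<sigma> p Cho"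
  using not_fixed(3) by blast

lemma emit_inv_tables_ok: "emit_inv qs m1 m es K k \<Longrightarrow> tables_ok m1 F \<Longrightarrow> tables_ok m F"
proof (rule tables_ok_cong)
  assume e: "emit_inv qs m1 m es K k"
  show "m b = m1 b" if "fixed b" for b
    using e that fixed_lt[OF that] fixed_Cho[OF that] unfolding emit_inv_def by (meson trans_less_add1)
qed (simp_all add: emit_inv_at)

lemma emit_inv_queue: "emit_inv qs m1 m es K k \<Longrightarrow> i < length qs \<Longrightarrow> m (fr + i) = m1 (fr + i)"
proof -
  assume e: "emit_inv qs m1 m es K k" "i < length qs"
  have "fr + i \<noteq> cell \<sigma> p Cho" if "is_record p" for p using fr_neq[OF that, of Cho "fr + i"] by auto
  thus ?thesis using e unfolding emit_inv_def by simp
qed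

lemma emit_inv_step:
  assumes q: "queue qs (length qs)" and k: "k < length qs" and d: "dp_inv qs m1 0"
    and e: "emit_inv qs m1 m es K k" and C: "C \<in> set (candidates \<sigma>)"
    and match: "at m (ad (qs ! k)) Cho = encode \<sigma> (join_list (arrange \<sigma> C))"
      "cost \<sigma> (child_table (tb m1) (qs ! k)) C = tb m1 (qs ! k) (join_list (arrange \<sigma> C))"
    and m': "\<forall>i<\<sigma> + 2. m' (fr + length qs + 1 + length (records_of K es) + i) =
        (occ (qs ! k) # length (qs ! k) # fst C) ! i"
      "\<forall>c<\<sigma>. qs ! k @ [c] \<in> factors W \<longrightarrow> at m' (ad (locus F (qs ! k @ [c]))) Cho = encode \<sigma> (snd C ! c)"
      "\<forall>b. b \<notin> {fr + length qs + 1 + length (records_of K es)..<fr + length qs + 1 +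
          length (records_of K es) + (\<sigma> + 2)} \<longrightarrow>
        (\<forall>c<\<sigma>. qs ! k @ [c] \<in> factors W \<longrightarrow> b \<noteq> cell \<sigma> (ad (locus F (qs ! k @ [c]))) Cho) \<longrightarrow>
        b \<noteq> cell \<sigma> D Cho \<longrightarrow> m' b = m b"
  shows "emit_inv qs m1 m' (es @ [qs ! k]) (K(qs ! k := C)) (Suc k)"
    "length (records_of (K(qs ! k := C)) (es @ [qs ! k])) = length (records_of K es) + (\<sigma> + 2)"
proof -
  let ?x = "qs ! k"
  let ?K = "K(?x := C)"
  have qF: "\<And>i. i < length qs \<Longrightarrow> qs ! i \<in> F \<and> length (qs ! i) < n" and dist: "distinct qs"
    and par: "\<And>i. i < length qs \<Longrightarrow> 0 < i \<Longrightarrow> \<exists>j<i. qs ! i \<in> set (kids \<sigma> (qs ! j))"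
    using q unfolding queue_def by auto
  have q0: "qs ! 0 = []" using q unfolding queue_def by (metis nth_Cons_0)
  have x: "?x \<in> F" using qF k by blast
  have lC: "length (fst C) = \<sigma>" using C by (simp add: set_candidates)
  have notin: "?x \<notin> set (take k qs)" using dist k by (auto simp: in_set_conv_nth nth_eq_iff_index_eq)
  have es: "set es \<subseteq> set (take k qs)" using e unfolding emit_inv_def by blast
  have outK: "records_of ?K es = records_of K es"
    unfolding records_of_def using es notin by (intro arg_cong[of _ _ concat] map_cong refl) auto
  have out: "records_of ?K (es @ [?x]) = records_of K es @ (occ ?x # length ?x # fst C)"
    using outK unfolding records_of_def by simp
  thus len: "length (records_of ?K (es @ [?x])) = length (records_of K es) + (\<sigma> + 2)" using lC by simp
  have low: "m' b = m b" if "b < fr + length qs + 1 + length (records_of K es)"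
      "\<forall>p. is_record p \<longrightarrow> b \<noteq> cell \<sigma> p Cho" for b
  proof -
    have "b \<noteq> cell \<sigma> (ad (locus F (?x @ [c]))) Cho" if "?x @ [c] \<in> factors W" for c
      using \<open>\<forall>p. is_record p \<longrightarrow> b \<noteq> cell \<sigma> p Cho\<close> ad(1)[OF locus(1)[OF that]] by blast
    thus ?thesis using m'(3) that is_record_D by auto
  qed
  have cho: "at m' (ad y) Cho = at m (ad y) Cho" if y: "y \<in> F" "y = [] \<or> parent F y \<noteq> ?x" for y
  proof -
    have "cell \<sigma> (ad y) Cho \<noteq> cell \<sigma> (ad (locus F (?x @ [c]))) Cho" if c: "?x @ [c] \<in> factors W" for c
      using parent_locus(1,2,3)[OF x c] y by (auto simp: cell_eq ad_inj)
    moreover have "cell \<sigma> (ad y) Cho \<notin> {fr + length qs + 1 + length (records_of K es)..<fr + length qs + 1 +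
        length (records_of K es) + (\<sigma> + 2)}"
      using is_record_fr(1)[OF ad(1)[OF y(1)], of Cho] by auto
    ultimately show ?thesis using m'(3) y(1) by (simp add: cell_eq)
  qed
  \<comment> \<open>The parent of an entry up to \<open>k\<close> stands strictly before it and is
    not \<open>?x\<close>; so the choices up to \<open>k\<close> survive the stores to the children
    of \<open>?x\<close>.\<close>
  have early: "qs ! i = [] \<or> parent F (qs ! i) \<noteq> ?x" if i: "i \<le> k" for i
  proof (cases "i = 0")
    case False
    obtain j where j: "j < i" "qs ! i \<in> set (kids \<sigma> (qs ! j))" using par[of i] False i k by auto
    have "parent F (qs ! i) = qs ! j" using kids(3)[OF _ j(2)] qF[of j] j i k by simp
    thus ?thesis using dist j i k by (simp add: nth_eq_iff_index_eq)
  qed (simp add: q0)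
  have val_early: "chosen m' (qs ! i) = chosen m (qs ! i)" if "i \<le> k" for i
    unfolding chosen_def using cho[OF _ early[OF that]] qF[of i] that k by simp
  have val_kid: "chosen m' (locus F (?x @ [c])) = snd C ! c" if "c < \<sigma>" "?x @ [c] \<in> factors W" for c
    unfolding chosen_def using m'(2) that decode_encode[OF cand_nth[OF C that(1)]] by simp
  have val_x: "chosen m' ?x = join_list (arrange \<sigma> C)"
    using val_early[of k] match(1) decode_encode[OF join_list_arrange[OF C]] by (simp add: chosen_def)
  have old: "choice_ok m1 m' ?K y" if y: "y \<in> set es" for y
  proof -
    have "y \<in> set (take k qs)" using y es by blast
    then obtain i where "i < length (take k qs)" "y = take k qs ! i" unfolding in_set_conv_nth by blast
    hence i: "i < k" "y = qs ! i" by simp_all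
    have yF: "y \<in> F" using qF i k by simp
    have "y \<noteq> ?x" using dist i k by (simp add: nth_eq_iff_index_eq)
    \<comment> \<open>A child has only one parent, so the choices of the children of
      \<open>y\<close> are not overwritten either.\<close>
    have "chosen m' (locus F (y @ [c])) = chosen m (locus F (y @ [c]))" if c: "y @ [c] \<in> factors W" for c
      unfolding chosen_def using cho[of "locus F (y @ [c])"] parent_locus(1,3)[OF yF c] \<open>y \<noteq> ?x\<close> by simp
    thus ?thesis using e y val_early[of i] i \<open>y \<noteq> ?x\<close> unfolding emit_inv_def choice_ok_def by simp
  qed
  show "emit_inv qs m1 m' (es @ [?x]) ?K (Suc k)"
    unfolding emit_inv_def
  proof (intro conjI allI impI ballI, goal_cases)
    case (1 b)
    hence "m' b = m b" by (intro low) auto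
    thus ?case using 1 e unfolding emit_inv_def by simp
  next
    case (2 i)
    show ?case
    proof (cases "qs ! i = [] \<or> parent F (qs ! i) \<noteq> ?x")
      case True
      thus ?thesis using cho[of "qs ! i"] qF[OF 2] e 2 unfolding emit_inv_def by simp
    next
      case False
      let ?c = "qs ! i ! length ?x"
      have iF: "qs ! i \<in> F" using qF[OF 2] by blast
      have "?x @ [?c] \<in> factors W" "locus F (?x @ [?c]) = qs ! i" "?c < \<sigma>"
        using locus_parent[OF iF] child_letter[OF iF] False by auto
      thus ?thesis using m'(2) cand_nth[OF C] by metis
    qed
  next
    case 3
    show ?case using es k by (auto simp: take_Suc_conv_app_nth)
  next
    case (4 y)
    hence "y \<in> set es \<or> y = ?x" by auto
    thus ?case
    proof
      assume "y = ?x"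
      thus ?thesis using C val_x match(2) val_kid unfolding choice_ok_def by simp
    qed (rule old)
  next
    case (5 i)
    show ?case
    proof (cases "i = k")
      case False
      hence "i < k" using 5 by simp
      thus ?thesis using e 5 val_early[of i] unfolding emit_inv_def by simp
    qed simp
  next
    case (6 i)
    show ?case
    proof (cases "i < length (records_of K es)")
      case True
      have "m' (fr + length qs + 1 + i) = m (fr + length qs + 1 + i)"
      proof (rule low)
        show "\<forall>p. is_record p \<longrightarrow> fr + length qs + 1 + i \<noteq> cell \<sigma> p Cho"
        proof (intro allI impI)
          fix p assume "is_record p"
          hence "cell \<sigma> p Cho \<noteq> fr + length qs + 1 + i" by (rule fr_neq) simp_all
          thus "fr + length qs + 1 + i \<noteq> cell \<sigma> p Cho" by (rule not_sym)
        qed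
      qed (use True in simp)
      thus ?thesis using e True unfolding emit_inv_def out by (simp add: nth_append)
    next
      case False
      let ?j = "i - length (records_of K es)"
      have "?j < \<sigma> + 2" using 6 len False by simp
      hence "m' (fr + length qs + 1 + length (records_of K es) + ?j) = (occ ?x # length ?x # fst C) ! ?j"
        using m'(1) by blast
      moreover have "fr + length qs + 1 + length (records_of K es) + ?j = fr + length qs + 1 + i"
        using False by simp
      moreover have "records_of ?K (es @ [?x]) ! i = (occ ?x # length ?x # fst C) ! ?j"
        unfolding out using False by (simp only: nth_append if_False)
      ultimately show ?thesis by metis
    qed
  next
    case (7 t)
    have "chosen m' [] = chosen m []" using val_early[of 0] q0 by simp
    thus ?case using e 7 unfolding emit_inv_def by simp
  qed
qed

lemma emit_inv_skip:
  assumes "emit_inv qs m1 m es K k" "k < length qs" "\<not> tb m1 (qs ! k) (chosen m (qs ! k)) < infty"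
  shows "emit_inv qs m1 m es K (Suc k)"
  unfolding emit_inv_def
proof (intro conjI allI impI, goal_cases)
  case 3
  have "set (take k qs) \<subseteq> set (take (Suc k) qs)" by (intro set_take_subset_set_take) simp
  thus ?case using assms(1) unfolding emit_inv_def by blast
next
  case (5 i)
  thus ?case using assms unfolding emit_inv_def by (metis less_SucE)
qed (use assms(1) in \<open>unfold emit_inv_def, blast+\<close>)

lemma wp_emit_visit:
  assumes q: "queue qs (length qs)" and k: "k < length qs" and d: "dp_inv qs m1 0"
    and e: "emit_inv qs m1 m es K k"
    and r: "r vn = n" "r vd = D" "r vt = fr + length qs" "r vh = fr + k"
      "r vo = fr + length qs + 1 + length (records_of K es)" "r vk = length (records_of K es)"
    and Q: "\<And>r' m' es' K'. emit_inv qs m1 m' es' K' (Suc k) \<Longrightarrow> r' vn = n \<Longrightarrow> r' vd = D \<Longrightarrow> r' vt = fr + length qs \<Longrightarrow>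
      r' vh = fr + Suc k \<Longrightarrow> r' vo = fr + length qs + 1 + length (records_of K' es') \<Longrightarrow> r' vk =
          length (records_of K' es') \<Longrightarrow>
      Q (r', m') (t + tmC (emit_visit \<sigma>))"
  shows "wp bnd (emit_visit \<sigma>) Q (r, m) t"
proof -
  let ?x = "qs ! k"
  have x: "?x \<in> F" "length ?x < n" using q k unfolding queue_def by auto
  have t1: "tables_ok m1 F" using d unfolding dp_inv_def by blast
  have tk: "tables_ok m F" using emit_inv_tables_ok[OF e t1] .
  have mk: "m (fr + k) = ad ?x" using emit_inv_queue[OF e k] d k unfolding dp_inv_def by simp
  from ex_load_children[OF tk x(1), of "r(vp := ad ?x)"] r obtain r2
      where r2: "ex (load_children \<sigma>) (r(vp := ad ?x), m) = (r2, m)"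
    "\<forall>c<\<sigma>. r2 (kid c) = child_adr ?x c" "\<forall>v<20. r2 v = (r(vp := ad ?x)) v" by auto
  define r3 where "r3 = r2(vdone := 0)"
  let ?c = "\<lambda>C. cost \<sigma> (child_table (tb m1) ?x) C"
  have g: "aval (sumE \<sigma> C) (r', m) = ?c C" if "C \<in> set (candidates \<sigma>)" "\<forall>c<\<sigma>. r' (kid c) = child_adr ?x c"
      for C r'
  proof -
    have "aval (sumE \<sigma> C) (r', m) = cost \<sigma> (\<lambda>c t. at m1 (child_adr ?x c) (Tab t)) C"
      unfolding aval_sumE using that cand_nth[OF that(1)] by (intro cost_cong) (simp add: emit_inv_at[OF e])
    thus ?thesis using cost_child_adr[OF t1 x(1) that(1)] by simp
  qed
  have k3: "\<forall>c<\<sigma>. r3 (kid c) = child_adr ?x c" using r2(2) by (simp add: r3_def)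
  have d': "dp_inv qs m1 (Suc k)" using d unfolding dp_inv_def by auto
  have oks: "okE bnd (sumE \<sigma> C) (r', m)" if "C \<in> set (candidates \<sigma>)" "\<forall>c<\<sigma>. r' (kid c) = child_adr ?x c"
      for C r'
  proof (rule okE_sumE[OF _ sigma_bnd])
    show "snd (r', m) (cell \<sigma> (fst (r', m) (kid c)) (Tab (snd C ! c))) \<le> infty" if c: "c < \<sigma>" for c
      using that(1) kid_le[OF q k d' cand_nth[OF \<open>C \<in> set (candidates \<sigma>)\<close> c]] \<open>\<forall>c<\<sigma>. r' (kid c) =
          child_adr ?x c\<close>
        cand_nth[OF \<open>C \<in> set (candidates \<sigma>)\<close> c] by (simp add: emit_inv_at[OF e])
  qed
  have p3: "r3 vp = ad ?x" "r3 vn = n" "fr \<le> r3 vo" "r3 vo = fr + length qs + 1 + length (records_of K es)"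
    "r3 vk = length (records_of K es)" "r3 vt = fr + length qs" "r3 vh = fr + k" "r3 vd = D"
    using r2(3) r by (auto simp: r3_def)
  have okem: "okC bnd (emit_record \<sigma> C) (r3, m)" if "C \<in> set (candidates \<sigma>)" for C
    using ex_emit_record(2)[OF tk x(1) that p3(1,2,3) k3] .
  have okse: "okC bnd (seqs (map (select \<sigma>) Cs)) (r3, m)" if "set Cs \<subseteq> set (candidates \<sigma>)" for Cs
    using that
  proof (induction Cs)
    case (Cons C Cs)
    have skip: "okC bnd (seqs (map (select \<sigma>) Cs)) st" if "fst st vdone \<noteq> 0" for st
      using that by (induction Cs) (auto simp: select_def)
    have "okC bnd (select \<sigma> C) (r3, m)"
      using oks[OF _ k3, of C] okem[of C] Cons.prems by (simp add: select_def)
    moreover have "ex (select \<sigma> C) (r3, m) = (r3, m) \<or> ex (select \<sigma> C) (r3, m) = ex (emit_record \<sigma> C) (r3, m)"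
      by (auto simp: select_def)
    ultimately show ?case using Cons skip[of "ex (emit_record \<sigma> C) (r3, m)"]
        emit_record_done[of \<sigma> C "(r3, m)"] by auto
  qed simp
  have done0: "r3 vdone = 0" by (simp add: r3_def)
  let ?s4 = "ex (seqs (map (select \<sigma>) (candidates \<sigma>))) (r3, m)"
  have ex: "ex (emit_visit \<sigma>) (r, m) = ((fst ?s4)(vh := Suc (fst ?s4 vh)), snd ?s4)"
    using r mk r2(1) by (simp add: emit_visit_def r3_def)
  have ok: "okC bnd (emit_visit \<sigma>) (r, m)"
    using r mk r2(1) okC_load_children okse[OF order_refl] by (simp add: emit_visit_def r3_def)
  have tab: "m (cell \<sigma> (r3 vp) (Tab t)) = tb m1 ?x t" if "t \<in> set (all_ends \<sigma>)" for t
    using p3(1) x(1) that by (simp add: emit_inv_at[OF e])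
  have "(\<forall>C\<in>set (candidates \<sigma>).
      \<not> (at m (ad ?x) Cho = encode \<sigma> (join_list (arrange \<sigma> C)) \<and> ?c C = tb m1 ?x (join_list (arrange \<sigma> C)))) \<and>
      ?s4 = (r3, m) \<or>
    (\<exists>C\<in>set (candidates \<sigma>). at m (ad ?x) Cho = encode \<sigma> (join_list (arrange \<sigma> C)) \<and> ?c C =
        tb m1 ?x (join_list (arrange \<sigma> C)) \<and>
      ?s4 = ex (emit_record \<sigma> C) (r3, m))"
    using ex_select[where r = r3 and m = m and \<sigma> = \<sigma> and Cs = "candidates \<sigma>"] done0 g[OF _ k3] tab
        join_list_arrange p3(1) by auto
  thus ?thesis
  proof
    assume a: "(\<forall>C\<in>set (candidates \<sigma>).
        \<not> (at m (ad ?x) Cho = encode \<sigma> (join_list (arrange \<sigma> C)) \<and> ?c C =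
            tb m1 ?x (join_list (arrange \<sigma> C)))) \<and>
      ?s4 = (r3, m)"
    \<comment> \<open>By \<open>good\<close>, an entry below \<open>infty\<close> is reached by some
      candidate, and that candidate would have matched.\<close>
    have "\<not> tb m1 ?x (chosen m ?x) < infty"
    proof
      assume lt: "tb m1 ?x (chosen m ?x) < infty"
      obtain t where t: "t \<in> set (all_ends \<sigma>)" "at m (ad ?x) Cho = encode \<sigma> t" using e k
        unfolding emit_inv_def by blast
      hence v: "chosen m ?x = t" by (simp add: chosen_def decode_encode)
      have "good m1 ?x" using d k unfolding dp_inv_def by simp
      then obtain C where "C \<in> set (candidates \<sigma>)" "join_list (arrange \<sigma> C) = t"
        "cost \<sigma> (\<lambda>c t. at m1 (child_adr ?x c) (Tab t)) C = tb m1 ?x t"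
        using lt t(1) unfolding good_def v by blast
      thus False using a t(2) cost_child_adr[OF t1 x(1)] by metis
    qed
    hence "emit_inv qs m1 m es K (Suc k)" by (rule emit_inv_skip[OF e k])
    thus ?thesis using Q[of m es K "r3(vh := fr + Suc k)"] a ex p3
      by (intro wp_loop_free loop_free_emit_visit ok) simp
  next
    assume "\<exists>C\<in>set (candidates \<sigma>). at m (ad ?x) Cho = encode \<sigma> (join_list (arrange \<sigma> C)) \<and> ?c C =
        tb m1 ?x (join_list (arrange \<sigma> C)) \<and>
      ?s4 = ex (emit_record \<sigma> C) (r3, m)"
    then obtain C where C: "C \<in> set (candidates \<sigma>)" "at m (ad ?x) Cho = encode \<sigma> (join_list (arrange \<sigma> C))"
      "?c C = tb m1 ?x (join_list (arrange \<sigma> C))" "?s4 = ex (emit_record \<sigma> C) (r3, m)" by blast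
    from ex_emit_record(1)[OF tk x(1) C(1) p3(1,2,3) k3] obtain m' where
      m': "ex (emit_record \<sigma> C) (r3, m) = (r3(vdone := 1, vo := r3 vo + (\<sigma> + 2), vk := r3 vk + (\<sigma> + 2)), m')"
      "\<forall>i<\<sigma> + 2. m' (r3 vo + i) = (occ ?x # length ?x # fst C) ! i"
      "\<forall>c<\<sigma>. ?x @ [c] \<in> factors W \<longrightarrow> at m' (ad (locus F (?x @ [c]))) Cho = encode \<sigma> (snd C ! c)"
      "\<forall>b. b \<notin> {r3 vo..<r3 vo + (\<sigma> + 2)} \<longrightarrow>
          (\<forall>c<\<sigma>. ?x @ [c] \<in> factors W \<longrightarrow> b \<noteq> cell \<sigma> (ad (locus F (?x @ [c]))) Cho) \<longrightarrow>
        b \<noteq> cell \<sigma> D Cho \<longrightarrow> m' b = m b" by blast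
    note st = emit_inv_step[OF q k d e C(1,2,3) m'(2,3,4)[unfolded p3(4)]]
    show ?thesis
      using Q[of m' "es @ [?x]" "K(?x := C)"
          "r3(vdone := 1, vo := r3 vo + (\<sigma> + 2), vk := r3 vk + (\<sigma> + 2), vh := fr + Suc k)"]
        st C(4) m'(1) ex p3 by (intro wp_loop_free loop_free_emit_visit ok) simp
  qed
qed

end

definition result :: "store \<Rightarrow> nat list \<Rightarrow> bool" where
  "result st ys \<longleftrightarrow> snd st (fst st 0) = length ys \<and> (\<forall>i<length ys. snd st (fst st 0 + 1 + i) = ys ! i)"

context built
begin

lemma ex_select_root:
  assumes "set ts \<subseteq> set (all_ends \<sigma>)" "t0 \<in> set (all_ends \<sigma>)" "r vroot = ad []"
  shows "\<exists>t1\<in>insert t0 (set ts).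
    ex (seqs (map (select_root \<sigma>) ts)) (r(vx := tb m [] t0), m(cell \<sigma> (ad []) Cho := encode \<sigma> t0)) =
      (r(vx := tb m [] t1), m(cell \<sigma> (ad []) Cho := encode \<sigma> t1)) \<and>
    (\<forall>t\<in>insert t0 (set ts). tb m [] t1 \<le> tb m [] t)"
  using assms(1,2)
proof (induction ts arbitrary: t0)
  case (Cons t ts)
  have F: "[] \<in> F" by simp
  have t: "t \<in> set (all_ends \<sigma>)" using Cons.prems by simp
  define u where "u = (if tb m [] t < tb m [] t0 then t else t0)"
  have u: "u \<in> set (all_ends \<sigma>)" "u \<in> {t, t0}" "tb m [] u \<le> tb m [] t" "tb m [] u \<le> tb m [] t0"
    using t Cons.prems by (auto simp: u_def)
  have e: "ex (select_root \<sigma> t) (r(vx := tb m [] t0), m(cell \<sigma> (ad []) Cho := encode \<sigma> t0)) =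
      (r(vx := tb m [] u), m(cell \<sigma> (ad []) Cho := encode \<sigma> u))"
    using t assms(3) by (simp add: select_root_def u_def cell_eq)
  have "set ts \<subseteq> set (all_ends \<sigma>)" using Cons.prems by simp
  from Cons.IH[OF this u(1)] obtain t1 where t1: "t1 \<in> insert u (set ts)"
    "ex (seqs (map (select_root \<sigma>) ts)) (r(vx := tb m [] u), m(cell \<sigma> (ad []) Cho := encode \<sigma> u)) =
      (r(vx := tb m [] t1), m(cell \<sigma> (ad []) Cho := encode \<sigma> t1))"
    "\<forall>t\<in>insert u (set ts). tb m [] t1 \<le> tb m [] t" by blast
  have "t1 \<in> insert t0 (set (t # ts))" using t1(1) u(2) by auto
  moreover have "\<forall>v\<in>insert t0 (set (t # ts)). tb m [] t1 \<le> tb m [] v"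
    using t1(3) u(3,4) order_trans by auto
  moreover have "ex (seqs (map (select_root \<sigma>) (t # ts)))
      (r(vx := tb m [] t0), m(cell \<sigma> (ad []) Cho := encode \<sigma> t0)) =
      (r(vx := tb m [] t1), m(cell \<sigma> (ad []) Cho := encode \<sigma> t1))"
    using e t1(2) by simp
  ultimately show ?case by blast
qed simp

lemma okC_select_root: "okC U (seqs (map (select_root \<sigma>) ts)) st"
  by (induction ts arbitrary: st) (auto simp: select_root_def)

lemma loop_free_emit_init: "loop_free (emit_init \<sigma>)"
  by (auto simp: emit_init_def select_root_def)

lemma ex_emit_init:
  assumes q: "queue qs (length qs)" and d: "dp_inv qs m1 0"
    and r: "r vroot = ad []" "r vfr = fr" "r vt = fr + length qs"
  shows "\<exists>r' m. ex (emit_init \<sigma>) (r, m1) = (r', m) \<and> emit_inv qs m1 m [] K 0 \<and> r' vh = fr \<and>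
    r' vo = fr + length qs + 1 \<and> r' vk = 0 \<and> (\<forall>v<14. v \<noteq> vh \<longrightarrow> r' v = r v)"
    "okC U (emit_init \<sigma>) (r, m1)"
proof -
  have F: "[] \<in> F" by simp
  note ins = insert_absorb[OF None_in_all_ends]
  have "\<exists>t1\<in>insert None (set (all_ends \<sigma>)).
    ex (seqs (map (select_root \<sigma>) (all_ends \<sigma>)))
        (r(vx := tb m1 [] None), m1(cell \<sigma> (ad []) Cho := encode \<sigma> None)) =
      (r(vx := tb m1 [] t1), m1(cell \<sigma> (ad []) Cho := encode \<sigma> t1)) \<and>
    (\<forall>t\<in>insert None (set (all_ends \<sigma>)). tb m1 [] t1 \<le> tb m1 [] t)"
    by (rule ex_select_root) (use r(1) None_in_all_ends in blast)+
  from this[unfolded ins] obtain t1 where t1: "t1 \<in> set (all_ends \<sigma>)"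
    "ex (seqs (map (select_root \<sigma>) (all_ends \<sigma>)))
        (r(vx := tb m1 [] None), m1(cell \<sigma> (ad []) Cho := encode \<sigma> None)) =
      (r(vx := tb m1 [] t1), m1(cell \<sigma> (ad []) Cho := encode \<sigma> t1))"
    "\<forall>t\<in>set (all_ends \<sigma>). tb m1 [] t1 \<le> tb m1 [] t" by blast
  let ?m = "m1(cell \<sigma> (ad []) Cho := encode \<sigma> t1)"
  let ?r = "r(vx := tb m1 [] t1, vh := fr, vo := fr + length qs + 1, vk := 0)"
  have e: "ex (emit_init \<sigma>) (r, m1) = (?r, ?m)" using t1(2) r by (simp add: emit_init_def)
  have v: "chosen ?m [] = t1" using decode_encode[OF t1(1)] by (simp add: chosen_def)
  have "emit_inv qs m1 ?m [] K 0"
    unfolding emit_inv_def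
  proof (intro conjI allI impI, goal_cases)
    case (1 b)
    hence "b \<noteq> cell \<sigma> (ad []) Cho" using ad(1)[OF F] by blast
    thus ?case by simp
  next
    case (2 i)
    have iF: "qs ! i \<in> F" using q 2 unfolding queue_def by auto
    show ?case
    proof (cases "qs ! i = []")
      case True
      thus ?thesis using t1(1) by auto
    next
      case False
      hence "at ?m (ad (qs ! i)) Cho = 0" using iF F d 2 unfolding dp_inv_def by (simp add: cell_eq ad_inj)
      thus ?thesis by (intro bexI[of _ None]) simp_all
    qed
  next
    case 7
    show ?case unfolding v by (rule t1(3))
  qed (simp_all add: records_of_def)
  thus "\<exists>r' m. ex (emit_init \<sigma>) (r, m1) = (r', m) \<and> emit_inv qs m1 m [] K 0 \<and> r' vh = fr \<and>
    r' vo = fr + length qs + 1 \<and> r' vk = 0 \<and> (\<forall>v<14. v \<noteq> vh \<longrightarrow> r' v = r v)"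
    using e by (intro exI[of _ ?r] exI[of _ ?m]) auto
  show "okC U (emit_init \<sigma>) (r, m1)" using okC_select_root by (simp add: emit_init_def)
qed

definition emit_time :: nat where
  "emit_time = tmC (emit_init \<sigma>) + tmE (Les (Var vh) (Var vt)) + 2 + tmC (emit_visit \<sigma>) + tmC emit_finish"

lemma wp_emit:
  assumes q: "queue qs (length qs)" and d: "dp_inv qs m1 0"
    and r: "r vn = n" "r vd = D" "r vroot = ad []" "r vfr = fr" "r vt = fr + length qs"
    and Q: "\<And>st t' m es K. emit_inv qs m1 m es K (length qs) \<Longrightarrow> result st (records_of K es) \<Longrightarrow>
      t' \<le> t + emit_time * (cnt + 1) \<Longrightarrow> Q st t'"
  shows "wp bnd (emit \<sigma>) Q (r, m1) t"
proof -
  let ?K = "tmE (Les (Var vh) (Var vt)) + 2 + tmC (emit_visit \<sigma>)"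
  let ?I = "\<lambda>st t1. \<exists>k\<le>length qs. \<exists>es K. emit_inv qs m1 (snd st) es K k \<and> fst st vn = n \<and> fst st vd = D \<and>
    fst st vt = fr + length qs \<and> fst st vh = fr + k \<and> fst st vo = fr + length qs + 1 +
        length (records_of K es) \<and>
    fst st vk = length (records_of K es) \<and> t1 \<le> t + tmC (emit_init \<sigma>) + ?K * k"
  \<comment> \<open>No record has been emitted yet, so any assignment of candidates will do at the
    start.\<close>
  fix K0 :: "nat list \<Rightarrow> nat list \<times> ends list"
  from ex_emit_init(1)[OF q d r(3,4,5), of K0] obtain r0 m where e: "ex (emit_init \<sigma>) (r, m1) = (r0, m)"
    "emit_inv qs m1 m [] K0 0" "r0 vh = fr" "r0 vo = fr + length qs + 1" "r0 vk = 0"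
    "\<forall>v<14. v \<noteq> vh \<longrightarrow> r0 v = r v" by blast
  show ?thesis
    unfolding emit_def
  proof (rule wp_Sq, rule wp_loop_free)
    show "loop_free (emit_init \<sigma>)" by (rule loop_free_emit_init)
    show "okC bnd (emit_init \<sigma>) (r, m1)" by (rule ex_emit_init(2)[OF q d r(3,4,5)])
    show "wp bnd (While (Les (Var vh) (Var vt)) (emit_visit \<sigma>);; emit_finish) Q (ex (emit_init \<sigma>) (r, m1))
        (t + tmC (emit_init \<sigma>))"
      unfolding e(1)
    proof (rule wp_Sq, rule wp_While[where I = ?I and T = "t + tmC (emit_init \<sigma>) + ?K * cnt"])
      have "r0 vn = n" "r0 vd = D" "r0 vt = fr + length qs" using e(6) r by simp_all
      thus "?I (r0, m) (t + tmC (emit_init \<sigma>))"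
        using e by (intro exI[of _ 0] conjI exI[of _ "[]"] exI[of _ K0]) (simp_all add: records_of_def)
    next
      fix st t1 assume "?I st t1"
      then obtain k es K where k: "k \<le> length qs" "emit_inv qs m1 (snd st) es K k" "fst st vn = n"
          "fst st vd = D"
        "fst st vt = fr + length qs" "fst st vh = fr + k"
            "fst st vo = fr + length qs + 1 + length (records_of K es)"
        "fst st vk = length (records_of K es)" "t1 \<le> t + tmC (emit_init \<sigma>) + ?K * k" by blast
      have "k \<le> cnt" using queue_length[OF q] k(1) by simp
      hence "?K * k \<le> ?K * cnt" by (rule mult_le_mono2)
      thus t1: "t1 \<le> t + tmC (emit_init \<sigma>) + ?K * cnt" using k(9) by linarith
      show "okE bnd (Les (Var vh) (Var vt)) st" by simp
      { assume "aval (Les (Var vh) (Var vt)) st \<noteq> 0"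
        hence kl: "k < length qs" using k by (simp split: if_splits)
        have "wp bnd (emit_visit \<sigma>) ?I (fst st, snd st) (t1 + tmE (Les (Var vh) (Var vt)) + 2)"
        proof (rule wp_emit_visit[OF q kl d k(2)])
          fix r' m' es' K'
          assume a: "emit_inv qs m1 m' es' K' (Suc k)" "r' vn = n" "r' vd = D" "r' vt = fr + length qs"
            "r' vh = fr + Suc k" "r' vo = fr + length qs + 1 + length (records_of K' es')"
                "r' vk = length (records_of K' es')"
          have "t1 + tmE (Les (Var vh) (Var vt)) + 2 + tmC (emit_visit \<sigma>) \<le> t + tmC (emit_init \<sigma>) +
              ?K * Suc k"
            using k(9) by simp
          moreover have "Suc k \<le> length qs" using kl by simp
          ultimately show "?I (r', m') (t1 + tmE (Les (Var vh) (Var vt)) + 2 + tmC (emit_visit \<sigma>))"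
            using a unfolding fst_conv snd_conv by blast
        qed (use k in auto)
        thus "wp bnd (emit_visit \<sigma>) ?I st (t1 + tmE (Les (Var vh) (Var vt)) + 2)" by simp }
      { assume "aval (Les (Var vh) (Var vt)) st = 0"
        hence kl: "k = length qs" using k(1,5,6) by (simp split: if_splits)
        have res: "result (ex emit_finish st) (records_of K es)"
          using k(2,5,8) unfolding result_def emit_inv_def by (simp add: emit_finish_def)
        have le: "t1 + tmE (Les (Var vh) (Var vt)) + 2 + tmC emit_finish \<le> t + emit_time * (cnt + 1)"
          using t1 by (simp add: emit_time_def algebra_simps)
        have loop_free: "loop_free emit_finish" "okC bnd emit_finish st" by (simp_all add: emit_finish_def)
        show "wp bnd emit_finish Q st (t1 + tmE (Les (Var vh) (Var vt)) + 2)"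
          by (rule wp_loop_free[OF loop_free(1) loop_free(2)]) (rule Q[OF k(2)[unfolded kl] res le]) }
    qed
  qed
qed

section \<open>Optimality of the emitted family\<close>

definition chosen_orderings :: "(nat list \<Rightarrow> nat list \<times> ends list) \<Rightarrow> nat list list \<Rightarrow> orderings" where
  "chosen_orderings K es x = (if x \<in> set es then perm_of \<sigma> (fst (K x)) else id)"

lemma emit_inv_final:
  assumes q: "queue qs (length qs)" and d: "dp_inv qs m1 0" and e: "emit_inv qs m1 m es K (length qs)"
  shows "encodes_orderings \<sigma> s (records_of K es) (chosen_orderings K es)"
      "optimal_orderings \<sigma> s (chosen_orderings K es)"
proof -
  have es: "x \<in> F" "length x < n" "choice_ok m1 m K x" if "x \<in> set es" for x
  proof -
    have "x \<in> set qs" using e that unfolding emit_inv_def by auto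
    thus "x \<in> F" "length x < n" using q unfolding queue_def by auto
    show "choice_ok m1 m K x" using e that unfolding emit_inv_def by blast
  qed
  have build_time: "length (fst (K x)) = \<sigma>" "set (fst (K x)) \<subseteq> {..<\<sigma>}" "distinct (fst (K x))"
      if "x \<in> set es" for x
    using es(3)[OF that] unfolding choice_ok_def set_candidates by auto
  have tables_ok: "tables_ok m1 F" using d unfolding dp_inv_def by blast
  let ?rs = "map (\<lambda>x. (occ x, length x, fst (K x))) es"
  have rec: "take (length x) (rotate (occ x) s) = x" if "x \<in> set es" for x
    using occ(2)[OF es(1)[OF that] es(2)[OF that]] .
  show "encodes_orderings \<sigma> s (records_of K es) (chosen_orderings K es)"
    unfolding encodes_orderings_def
  proof (intro exI[of _ ?rs] conjI ballI impI)
    show "records_of K es = concat (map (\<lambda>(i, l, p). i # l # p) ?rs)" by (simp add: records_of_def comp_def)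
    fix z assume "z \<in> set ?rs"
    then obtain x where x: "x \<in> set es" "z = (occ x, length x, fst (K x))" by auto
    have "fst (K x) = map (chosen_orderings K es x) [0..<\<sigma>]"
      using build_time(1)[OF x(1)] x(1)
        by (intro nth_equalityI) (simp_all add: chosen_orderings_def perm_of_def)
    thus "case z of (i, l, p) \<Rightarrow> i < n \<and> l < n \<and> p = map (chosen_orderings K es (take l (rotate i s))) [0..<\<sigma>]"
      using occ(1)[OF es(1)[OF x(1)] es(2)[OF x(1)]] es(2)[OF x(1)] rec[OF x(1)] unfolding x(2) by simp
  next
    fix x assume "x \<notin> (\<lambda>(i, l, p). take l (rotate i s)) ` set ?rs"
    hence "x \<notin> set es" using rec by force
    thus "chosen_orderings K es x = id" by (simp add: chosen_orderings_def)
  qed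
  \<comment> \<open>Only pairs in \<open>all_ends\<close> have a cell; elsewhere the table is
    completed by \<open>infty\<close>, as the leaf condition of \<open>table_optimal\<close> speaks
    about all pairs.\<close>
  define T where "T = (\<lambda>x t. if t \<in> set (all_ends \<sigma>) then tb m1 x t else infty)"
  have ctT: "cost \<sigma> (child_table T x) C = cost \<sigma> (child_table (tb m1) x) C" if "C \<in> set (candidates \<sigma>)"
      for x C
    using cand_nth[OF that] by (intro cost_cong) (simp add: child_table_def T_def)
  have q0: "qs ! 0 = []" "0 < length qs" using q unfolding queue_def
    by (metis nth_Cons_0, metis list.distinct(1) length_greater_0_conv)
  have gd: "good m1 x" if x: "x \<in> F" "length x < n" for x
  proof -
    obtain i where "i < length qs" "x = qs ! i" using queue_all[OF q x] by (metis in_set_conv_nth)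
    thus ?thesis using d unfolding dp_inv_def by simp
  qed
  show "optimal_orderings \<sigma> s (chosen_orderings K es)"
  proof (rule table_optimal[where T = T and K = K and \<tau> = "chosen m"])
    fix x t assume x: "x \<in> F" "n \<le> length x"
    have "Some (leafc x, leafc x) \<in> set (all_ends \<sigma>)" using leafc(2)[OF x] by (simp add: set_all_ends)
    thus "T x t = (if t = Some (leafc x, leafc x) then 0 else infty)"
      using tables_ok x unfolding tables_ok_def T_def leaf_table_def by auto
  next
    fix x C assume x: "x \<in> F" "length x < n" and C: "C \<in> set (candidates \<sigma>)"
    have "tb m1 x (join_list (arrange \<sigma> C)) \<le> cost \<sigma> (\<lambda>c t. at m1 (child_adr x c) (Tab t)) C"
      using gd[OF x] C unfolding good_def by blast
    thus "T x (join_list (arrange \<sigma> C)) \<le> cost \<sigma> (child_table T x) C"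
      using ctT[OF C] cost_child_adr[OF tables_ok x(1) C] join_list_arrange[OF C] by (simp add: T_def)
  next
    fix x assume x: "x \<in> F" "length x < n" "T x (chosen m x) < infty"
    hence t: "chosen m x \<in> set (all_ends \<sigma>)" "tb m1 x (chosen m x) < infty"
      by (auto simp: T_def split: if_splits)
    obtain i where "i < length qs" "x = qs ! i" using queue_all[OF q x(1,2)] by (metis in_set_conv_nth)
    hence "x \<in> set es" using e t(2) unfolding emit_inv_def by blast
    moreover have "choice_ok m1 m K x" using es(3)[OF calculation] .
    ultimately show "K x \<in> set (candidates \<sigma>) \<and> join_list (arrange \<sigma> (K x)) = chosen m x \<and>
      cost \<sigma> (child_table T x) (K x) = T x (chosen m x) \<and>
      (\<forall>c<\<sigma>. x @ [c] \<in> factors W \<longrightarrow> chosen m (locus F (x @ [c])) = snd (K x) ! c) \<and>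
      chosen_orderings K es x = perm_of \<sigma> (fst (K x))"
      using ctT t(1) unfolding choice_ok_def by (simp add: T_def chosen_orderings_def)
  next
    show "is_orderings \<sigma> (chosen_orderings K es)"
      unfolding is_orderings_def chosen_orderings_def using perm_of_permutes[OF build_time] permutes_id
        by auto
  next
    fix t assume t: "t \<in> set (all_ends \<sigma>)"
    obtain t0 where "t0 \<in> set (all_ends \<sigma>)" "at m (ad []) Cho = encode \<sigma> t0"
      using e q0 unfolding emit_inv_def by metis
    hence "chosen m [] \<in> set (all_ends \<sigma>)" by (simp add: chosen_def decode_encode)
    thus "T [] (chosen m []) \<le> T [] t" using e t unfolding emit_inv_def T_def by simp
  qed
qed

lemma wp_tree:
  assumes r: "r vn = n" "r vd = D" "r vfr = fr"
  shows "wp bnd (children \<sigma>;; bfs \<sigma>;; dp \<sigma>;; emit \<sigma>) (\<lambda>st t'. \<exists>ys \<pi>. result st ys \<and>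
    encodes_orderings \<sigma> s ys \<pi> \<and> optimal_orderings \<sigma> s \<pi> \<and>
    t' \<le> t + (children_time + bfs_time + dp_time + emit_time) * (cnt + 1)) (r, m0) t"
proof (rule wp_Sq, rule wp_children[OF r])
  fix r1 m1 t1
  assume 1: "tables_ok m1 F" "r1 vn = n" "r1 vd = D" "r1 vfr = fr" "r1 vroot = ad []"
      "t1 \<le> t + children_time * (cnt + 1)"
  show "wp bnd (bfs \<sigma>;; dp \<sigma>;; emit \<sigma>) (\<lambda>st t'. \<exists>ys \<pi>. result st ys \<and>
    encodes_orderings \<sigma> s ys \<pi> \<and> optimal_orderings \<sigma> s \<pi> \<and>
    t' \<le> t + (children_time + bfs_time + dp_time + emit_time) * (cnt + 1)) (r1, m1) t1"
  proof (rule wp_Sq, rule wp_bfs[OF 1(1-5)])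
    fix r2 qs t2
    assume 2: "queue qs (length qs)" "r2 vn = n" "r2 vd = D" "r2 vfr = fr" "r2 vroot = ad []"
      "r2 vt = fr + length qs" "t2 \<le> t1 + bfs_time * (cnt + 1)"
    show "wp bnd (dp \<sigma>;; emit \<sigma>) (\<lambda>st t'. \<exists>ys \<pi>. result st ys \<and>
      encodes_orderings \<sigma> s ys \<pi> \<and> optimal_orderings \<sigma> s \<pi> \<and>
      t' \<le> t + (children_time + bfs_time + dp_time + emit_time) * (cnt + 1)) (r2, with_queue m1 qs) t2"
    proof (rule wp_Sq, rule wp_dp[OF 2(1) 1(1) 2(2-6)])
      fix r3 m3 t3
      assume 3: "dp_inv qs m3 0" "r3 vn = n" "r3 vd = D" "r3 vfr = fr" "r3 vroot = ad []"
        "r3 vt = fr + length qs" "t3 \<le> t2 + dp_time * (cnt + 1)"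
      show "wp bnd (emit \<sigma>) (\<lambda>st t'. \<exists>ys \<pi>. result st ys \<and>
        encodes_orderings \<sigma> s ys \<pi> \<and> optimal_orderings \<sigma> s \<pi> \<and>
        t' \<le> t + (children_time + bfs_time + dp_time + emit_time) * (cnt + 1)) (r3, m3) t3"
      proof (rule wp_emit[OF 2(1) 3(1,2,3,5,4,6)])
        fix st t4 m es K
        assume 4: "emit_inv qs m3 m es K (length qs)" "result st (records_of K es)"
            "t4 \<le> t3 + emit_time * (cnt + 1)"
        have "t4 \<le> t + (children_time + bfs_time + dp_time + emit_time) * (cnt + 1)"
          using 1(6) 2(7) 3(7) 4(3) by (simp add: add_mult_distrib)
        thus "\<exists>ys \<pi>. result st ys \<and> encodes_orderings \<sigma> s ys \<pi> \<and> optimal_orderings \<sigma> s \<pi> \<and>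
          t4 \<le> t + (children_time + bfs_time + dp_time + emit_time) * (cnt + 1)"
          using emit_inv_final[OF 2(1) 3(1) 4(1)] 4(2) by blast
      qed
    qed
  qed
qed

end

section \<open>Total time and word length\<close>

definition linear :: "nat \<Rightarrow> nat" where
  "linear \<sigma> = 4 * build_time \<sigma> +
      7 * (built.children_time \<sigma> + built.bfs_time \<sigma> + built.dp_time \<sigma> + built.emit_time \<sigma>)"

lemma (in input) wp_prog:
  assumes r: "\<And>x. r x = 0" and m: "m 0 = n" "\<And>i. i < n \<Longrightarrow> m (Suc i) = s ! i" "\<And>b. n < b \<Longrightarrow> m b = 0"
  shows "wp bnd (prog \<sigma>) (\<lambda>st t. \<exists>ys \<pi>. result st ys \<and> encodes_orderings \<sigma> s ys \<pi> \<and>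
    optimal_orderings \<sigma> s \<pi> \<and> t \<le> linear \<sigma> * n) (r, m) 0"
  unfolding prog_def
proof (rule wp_Sq, rule wp_mono[OF wp_build[OF r m]])
  fix st t
  assume b: "fst st vn = n \<and> fst st vd = D \<and> (\<exists>ad cnt. inv W (snd st) (fst st vfr) ad cnt) \<and>
    t \<le> build_time \<sigma> * (2 * n + 2)"
  then obtain ad cnt where "inv W (snd st) (fst st vfr) ad cnt" by blast
  then interpret b: built \<sigma> s "snd st" "fst st vfr" ad cnt by unfold_locales
  have "wp bnd (children \<sigma>;; bfs \<sigma>;; dp \<sigma>;; emit \<sigma>) (\<lambda>st t'. \<exists>ys \<pi>. result st ys \<and>
    encodes_orderings \<sigma> s ys \<pi> \<and> optimal_orderings \<sigma> s \<pi> \<and>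
    t' \<le> t + (b.children_time + b.bfs_time + b.dp_time + b.emit_time) * (cnt + 1)) (fst st, snd st) t"
    using b by (intro b.wp_tree) auto
  thus "wp bnd (children \<sigma>;; bfs \<sigma>;; dp \<sigma>;; emit \<sigma>) (\<lambda>st t. \<exists>ys \<pi>. result st ys \<and>
    encodes_orderings \<sigma> s ys \<pi> \<and> optimal_orderings \<sigma> s \<pi> \<and> t \<le> linear \<sigma> * n) st t"
    unfolding prod.collapse
  proof (rule wp_mono)
    fix st' t'
    assume *: "\<exists>ys \<pi>. result st' ys \<and> encodes_orderings \<sigma> s ys \<pi> \<and> optimal_orderings \<sigma> s \<pi> \<and>
      t' \<le> t + (b.children_time + b.bfs_time + b.dp_time + b.emit_time) * (cnt + 1)"
    \<comment> \<open>Since \<open>n\<close> is positive, \<open>2 * n + 2 \<le> 4 * n\<close> and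
      \<open>cnt + 1 \<le> 4 * n + 3 \<le> 7 * n\<close>; this is the origin of the factors 4 and 7
      in \<open>linear\<close>.\<close>
    have "build_time \<sigma> * (2 * n + 2) \<le> build_time \<sigma> * (4 * n)" using n_pos by (intro mult_le_mono2) linarith
    moreover have "(b.children_time + b.bfs_time + b.dp_time + b.emit_time) * (cnt + 1) \<le>
        (b.children_time + b.bfs_time + b.dp_time + b.emit_time) * (7 * n)"
      using b.cnt(1) n_pos by (intro mult_le_mono2) linarith
    moreover have "build_time \<sigma> * (4 * n) + (b.children_time + b.bfs_time + b.dp_time + b.emit_time) *
        (7 * n) = linear \<sigma> * n"
      by (simp add: linear_def algebra_simps)
    ultimately have "t + (b.children_time + b.bfs_time + b.dp_time + b.emit_time) * (cnt + 1) \<le>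
        linear \<sigma> * n" using b by linarith
    thus "\<exists>ys \<pi>. result st' ys \<and> encodes_orderings \<sigma> s ys \<pi> \<and> optimal_orderings \<sigma> s \<pi> \<and> t' \<le> linear \<sigma> * n"
      using * order_trans by blast
  qed
qed

theorem theorem14:
  fixes \<sigma> :: nat
  shows "\<exists>P c k. \<forall>s w.
    primitive s \<and> set s \<subseteq> {..<\<sigma>} \<and> (length s + 1) ^ k \<le> 2 ^ w \<longrightarrow>
    (\<exists>ys \<pi>. ram_computes w P s (c * length s) ys \<and>
      encodes_orderings \<sigma> s ys \<pi> \<and> optimal_orderings \<sigma> s \<pi>)"
proof -
  define K where "K = max 1 (maxC (prog \<sigma>))"
  \<comment> \<open>All words stay below \<open>bnd + K * d\<close>, which is at most
    \<open>A * (n + 1)\<close>, and \<open>A < 2 ^ A \<le> (n + 1) ^ A\<close> as \<open>n\<close>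
    is positive; so the exponent \<open>A + 1\<close> is enough.\<close>
  define A where "A = 8 * rec_size \<sigma> + K * linear \<sigma>"
  have "\<exists>ys \<pi>. ram_computes w (compC 0 (prog \<sigma>)) s (linear \<sigma> * length s) ys \<and>
      encodes_orderings \<sigma> s ys \<pi> \<and> optimal_orderings \<sigma> s \<pi>"
    if s: "primitive s" "set s \<subseteq> {..<\<sigma>}" and w: "(length s + 1) ^ (A + 1) \<le> 2 ^ w" for s w
  proof -
    interpret input \<sigma> s using s by unfold_locales
    let ?st = "init_state s"
    have m: "mem ?st 0 = n" "\<And>i. i < n \<Longrightarrow> mem ?st (Suc i) = s ! i" "\<And>b. n < b \<Longrightarrow> mem ?st b = 0"
      by (simp_all add: init_state_def)
    obtain d st' ys \<pi> where run: "bs bnd (prog \<sigma>) (\<lambda>_. 0, mem ?st) d st'" "d \<le> linear \<sigma> * n"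
      and res: "result st' ys" "encodes_orderings \<sigma> s ys \<pi>" "optimal_orderings \<sigma> s \<pi>"
      using wp_prog[of "\<lambda>_. 0" "mem ?st", OF _ m] unfolding wp_def by fastforce
    have "K * d \<le> K * (linear \<sigma> * n)" using run(2) by (rule mult_le_mono2)
    also have "\<dots> \<le> K * linear \<sigma> * (n + 1)" by simp
    finally have "bnd + K * d \<le> A * (n + 1)" unfolding bnd_def A_def add_mult_distrib by (rule add_left_mono)
    also have "\<dots> < (A + 1) * (n + 1)" by simp
    also have "A + 1 \<le> 2 ^ A" using less_exp[of A] by linarith
    hence "(A + 1) * (n + 1) \<le> 2 ^ A * (n + 1)" by (rule mult_le_mono1)
    also have "\<dots> \<le> (n + 1) ^ A * (n + 1)" using n_pos by (intro mult_le_mono1 power_mono) linarith+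
    also have "\<dots> \<le> 2 ^ w" using w by (simp add: mult.commute)
    finally have small: "bnd + K * d < 2 ^ w" .
    have "mem ?st b \<le> bnd" for b
    proof -
      consider "b = 0" | i where "b = Suc i" "i < n" | "n < b"
        by (cases b) (auto, metis not_less_eq linorder_neqE_nat)
      thus ?thesis
      proof cases
        case 1
        thus ?thesis using m(1) n_le_bnd by simp
      next
        case (2 i)
        have "s ! i < \<sigma>" using s(2) nth_mem[OF 2(2)] by auto
        also have "\<sigma> \<le> 8 * rec_size \<sigma> * 1" by (simp add: rec_size_def)
        also have "\<dots> \<le> bnd" unfolding bnd_def by (intro mult_le_mono2) simp
        finally show ?thesis using m(2) 2 by simp
      qed (use m(3) in simp)
    qed
    hence below: "below bnd (\<lambda>_. 0, mem ?st)" by (simp add: below_def)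
    have "\<exists>rs. (step w (compC 0 (prog \<sigma>)) ^^ d) ?st = rs \<and> pc rs = 0 + lenC (prog \<sigma>) \<and> rel rs st' \<and>
        below (bnd + K * d) st'"
      by (rule compC_correct[OF run(1) _ _ _ below order_refl _ _ small])
        (simp_all add: code_at_def rel_def K_def, simp_all add: init_state_def)
    then obtain rs where rs: "(step w (compC 0 (prog \<sigma>)) ^^ d) ?st = rs" "pc rs = lenC (prog \<sigma>)" "rel rs st'"
      by auto
    have reg0: "reg rs 0 = fst st' 0" using rs(3) unfolding rel_def by (metis mult_0_right)
    have mem: "mem rs = snd st'" using rs(3) unfolding rel_def by blast
    have "output_list rs = ys"
    proof (rule nth_equalityI)
      show "length (output_list rs) = length ys"
        using res(1) unfolding result_def output_list_def Let_def reg0 mem by (simp del: upt_Suc)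
      fix i assume "i < length (output_list rs)"
      hence i: "i < length ys"
        using res(1) unfolding result_def output_list_def Let_def reg0 mem by (simp del: upt_Suc)
      thus "output_list rs ! i = ys ! i"
        using res(1) unfolding result_def output_list_def Let_def reg0 mem by (simp del: upt_Suc)
    qed
    hence "ram_computes w (compC 0 (prog \<sigma>)) s (linear \<sigma> * n) ys"
      unfolding ram_computes_def Let_def
      using rs(1,2) run(2) by (intro exI[of _ d]) (simp add: halted_def)
    thus ?thesis using res(2,3) by blast
  qed
  thus ?thesis by blast
qed

end
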